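(* Let $n,d\ge 1$ and $N=2n+1$. The assignment $$v\mapsto q,\qquad C\mapsto q^{N},\qquad \mathbb K_i\mapsto \hat{\mathbb K}_i,\qquad \mathbf\Theta_i(z)\mapsto \hat\Theta_i(z),\qquad \mathbf B_i(z)\mapsto \hat B_i(z)\qquad (1\le i\le 2n)$$ (the last two meaning coefficientwise in $z$) extends to a representation of the affine iquantum group $\widetilde{\mathbf U}^\imath$ of type $\mathrm{AIII}_{2n}^{(\tau)}$ on $\mathbf P\otimes_{\mathbb C[q,q^{-1}]}\mathbb C(q)$.
   Context: **Combinatorial notation.** $n,d\ge1$, $N=2n+1$, $\tau i=N-i$ for $1\le i\le 2n$, and $r'=2d+1-r$ for $1\le r\le 2d$. $\Lambda^\imath_{N,d}=\{\mathbf v=(v_1,\dots,v_N)\in\mathbb N^N: v_i=v_{N+1-i},\ \sum_i v_i=2d\}$; $\mathbf e_i$ is the $i$-th standard basis vector. For $\mathbf v\in\Lambda^\imath_{N,d}$ put $\bar v_i=v_1+\dots+v_i$, $[\mathbf v]_i=\{\bar v_{i-1}+1,\dots,\bar v_i\}$, $[\mathbf v]=([\mathbf v]_1,\dots,[\mathbf v]_N)$. $\mathbf R=\mathbb C[x_1^{\pm1},\dots,x_d^{\pm1}]$, with $x_{r'}:=x_r^{-1}$, so that $x_1,\dots,x_{2d}$ are defined. $W_{\mathfrak c}=\mathbb Z_2^d\rtimes\mathfrak S_d$ is the group of permutations $w$ of $\{1,\dots,2d\}$ with $w(r')=w(r)'$; it acts on $\mathbf R$ by $x_r\mapsto x_{w(r)}$.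 $W_{[\mathbf v]}\subset W_{\mathfrak c}$ is the subgroup preserving each block $[\mathbf v]_i$, and $\mathbf R^{[\mathbf v]}=\mathbf R^{W_{[\mathbf v]}}$. $\mathbf P=\bigoplus_{\mathbf v\in\Lambda^\imath_{N,d}}\mathbf R^{[\mathbf v]}[q,q^{-1}]$. If $I=(I_1,\dots,I_N)$ is a set partition of $\{1,\dots,2d\}$ with ($r\in I_s\iff r'\in I_{N+1-s}$) and $|I_k|=u_k$ for some $\mathbf u\in\Lambda^\imath_{N,d}$, then for $f\in\mathbf R^{[\mathbf u]}[q,q^{-1}]$, $f(x_I)$ denotes the image of $f$ under $x_m\mapsto x_{\sigma(m)}$ for any $\sigma\in W_{\mathfrak c}$ with $\sigma([\mathbf u]_k)=I_k$ for all $k$ (independent of the choice of $\sigma$). For $j\in I_s$, $1\le s\le 2n$, $\tau_j^+I$ is obtained from $I$ by moving $j$ from $I_s$ to $I_{s+1}$ and $j'$ from $I_{N+1-s}$ to $I_{N-s}$. $\theta_1(z)=\frac{qz-1}{z-q}$, $\Phi_S(z)=\prod_{t\in S}\theta_1(z/x_t)$ for $S\subset\{1,\dots,2d\}$, $\delta(z)=\sum_{k\in\mathbb Z}z^k$. **Operators on $\mathbf P$** ($1\le i\le 2n$). - $\hat{\mathbb K}_i$ acts on $\mathbf R^{[\mathbf v]}[q,q^{-1}]$ by the scalar $q^{-v_i+v_{i+1}+\delta_{i,n}}$. - $\hat\Theta_i(z)=1+(q-q^{-1})\sum_{r\ge1}\hat\Theta_{i,r}z^r$ acts on $\mathbf R^{[\mathbf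 v]}[q,q^{-1}]$ by multiplication by the expansion at $z=0$ of $$q^{v_{i+1}-v_i}\,\Phi_{[\mathbf v]_i}(q^{1-i}z^{-1})\,\Phi_{[\mathbf v]_{i+1}}(q^{-1-i}z^{-1})^{-1}\Big(\tfrac{1-q^{2n}z^2}{1-q^{2n+2}z^2}\Big)^{\delta_{i,n+1}}.$$ - For $r\in\mathbb Z$, $\hat B_{i,r}$ is the operator whose $\mathbf R^{[\mathbf v]}[q,q^{-1}]$-component only depends on the component $f\in\mathbf R^{[\mathbf v']}[q,q^{-1}]$ with $\mathbf v'=\mathbf v-\mathbf e_i+\mathbf e_{i+1}+\mathbf e_{\tau i}-\mathbf e_{\tau i+1}$ (it is zero if $\mathbf v'\notin\Lambda^\imath_{N,d}$), and is $$(\hat B_{i,r}f)(x_{[\mathbf v]})=\sum_{j\in[\mathbf v]_i}x_j^r\,\Phi_{[\mathbf v]_i\setminus\{j\}}(qx_j)\,f(x_{\tau_j^+[\mathbf v]}).$$ - $\hat B_i(z)=\sum_{r\in\mathbb Z}q^{ri}\hat B_{i,r}z^r$. **The algebra $\widetilde{\mathbf U}^\imath$** (Drinfeld new presentation). For $1\le i,j\le 2n$ let $c_{ij}=2$ if $i=j$, $-1$ if $|i-j|=1$, $0$ otherwise. $\widetilde{\mathbf U}^\imath$ is the $\mathbb C(v)$-algebra generated by $B_{i,l},\Theta_{i,m},\mathbb K_i^{\pm1},C^{\pm1}$ ($1\le i\le 2n$, $l\in\mathbb Z$, $m>0$). Put $\mathbf B_i(z)=\sum_{k\in\mathbb Z}B_{i,k}z^k$,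 $\mathbf\Theta_i(z)=1+\sum_{k\ge1}(v-v^{-1})\Theta_{i,k}z^k$, $\mathbf\Delta(z)=\sum_{k\in\mathbb Z}C^kz^k$, $[2]=v+v^{-1}$, $\mathrm{Sym}_{w_1,w_2}g(w_1,w_2)=g(w_1,w_2)+g(w_2,w_1)$, and $$\mathbb S_{i,j}(w_1,w_2|z)=\mathrm{Sym}_{w_1,w_2}\big(\mathbf B_i(w_1)\mathbf B_i(w_2)\mathbf B_j(z)-[2]\mathbf B_i(w_1)\mathbf B_j(z)\mathbf B_i(w_2)+\mathbf B_j(z)\mathbf B_i(w_1)\mathbf B_i(w_2)\big).$$ The defining relations are ($\mathbb K_i^{\pm1}$, $C^{\pm1}$ mutually inverse, and): 1. $C$ central, $[\mathbb K_i,\mathbb K_j]=[\mathbb K_i,\mathbf\Theta_j(w)]=0$, $\mathbb K_i\mathbf B_j(z)=v^{c_{\tau i,j}-c_{ij}}\mathbf B_j(z)\mathbb K_i$; 2. $[\mathbf\Theta_i(z),\mathbf\Theta_j(w)]=0$; 3. $\mathbf B_j(w)\mathbf\Theta_i(z)=\frac{(1-v^{c_{ij}}zw^{-1})(1-v^{-c_{\tau i,j}}zwC)}{(1-v^{-c_{ij}}zw^{-1})(1-v^{c_{\tau i,j}}zwC)}\mathbf\Theta_i(z)\mathbf B_j(w)$; 4. $[\mathbf B_i(z),\mathbf B_{\tau i}(w)]=\frac{\mathbf\Delta(zw)}{v-v^{-1}}\big(\mathbb K_{\tau i}\mathbf\Theta_i(z)-\mathbb K_i\mathbf\Theta_{\tau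 i}(w)\big)$ if $c_{i,\tau i}=0$; 5. $(v^{c_{ij}}z-w)\mathbf B_i(z)\mathbf B_j(w)+(v^{c_{ij}}w-z)\mathbf B_j(w)\mathbf B_i(z)=0$ if $j\ne\tau i$; 6. $(v^{-1}z-w)\mathbf B_i(z)\mathbf B_{\tau i}(w)+(v^{-1}w-z)\mathbf B_{\tau i}(w)\mathbf B_i(z)=\frac{\mathbf\Delta(zw)}{1-v^2}\big((z-vw)\mathbb K_i\mathbf\Theta_{\tau i}(w)+(w-vz)\mathbb K_{\tau i}\mathbf\Theta_i(z)\big)$ if $c_{i,\tau i}=-1$; 7. $\mathbf B_i(w)\mathbf B_j(z)=\mathbf B_j(z)\mathbf B_i(w)$ if $c_{ij}=0$, $\tau i\ne j$; 8. $\mathbb S_{i,j}(w_1,w_2|z)=0$ if $c_{ij}=-1$, $j\ne\tau i\ne i$; 9. if $c_{i,\tau i}=-1$: $$\begin{aligned}(v-v^{-1})\mathbb S_{i,\tau i}(w_1,w_2|z)=&-v^{-1}[2]\,\mathrm{Sym}_{w_1,w_2}\mathbf\Delta(w_2z)\tfrac{1-vw_2^{-1}z}{1-v^{-2}w_1w_2^{-1}}\mathbf B_i(w_1)\mathbf\Theta_{\tau i}(z)\mathbb K_i\\&+[2]\,\mathrm{Sym}_{w_1,w_2}\mathbf\Delta(w_2z)\tfrac{1-vw_2^{-1}z}{1-v^{2}w_1w_2^{-1}}\mathbf\Theta_{\tau i}(z)\mathbb K_i\mathbf B_i(w_1)\\&+v[2]\,\mathrm{Sym}_{w_1,w_2}\mathbf\Delta(w_2z)\tfrac{w_1^{-1}z-vw_1^{-1}w_2}{1-v^2w_1^{-1}w_2}\mathbf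 B_i(w_1)\mathbf\Theta_i(w_2)\mathbb K_{\tau i}\\&+v^{-2}[2]\,\mathrm{Sym}_{w_1,w_2}\mathbf\Delta(w_2z)\tfrac{vw_1^{-1}w_2-zw_1^{-1}}{1-v^{-2}w_1^{-1}w_2}\mathbf\Theta_i(w_2)\mathbb K_{\tau i}\mathbf B_i(w_1).\end{aligned}$$ Fractions are expanded as geometric series in the displayed monomials $zw^{-1}$, $zwC$, $w_1w_2^{-1}$, $w_1^{-1}w_2$ of the denominators. *)

theory Defs
  imports
    "HOL-Library.Poly_Mapping"
    "HOL-Library.Product_Plus"
    "HOL-Library.Function_Algebras"
    "HOL-Library.FuncSet"
    "HOL-Computational_Algebra.Computational_Algebra"
    "HOL-Combinatorics.Permutations"
    "HOL-Algebra.QuotRing"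
begin

section \<open>Scalars and formal distributions\<close>

text \<open>
  One type serves as \<open>\<complex>(v)\<close> and as \<open>\<complex>(q)\<close>; its generator \<open>qv\<close> is \<open>v\<close> when the algebra is
  described and \<open>q\<close> when its action is described, so \<open>v \<mapsto> q\<close> is the identity of this type.
\<close>

type_synonym Cq = "complex poly fract"

definition qv :: Cq where
  "qv = to_fract [:0, 1:]"

text \<open>
  Formal distributions in three commuting variables: a series is its family of coefficients,
  indexed by exponent vectors. A Laurent monomial is written as its exponent vector, additively:
  \<open>zz - ww\<close> stands for \<open>z w\<inverse>\<close>. Relations in two variables \<open>z, w\<close> use \<open>zz\<close> and \<open>ww = w1\<close>.
\<close>

type_synonym expo = "int \<times> int \<times> int"
type_synonym 'a fdist = "expo \<Rightarrow> 'a"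

definition zz :: expo where "zz = (1, 0, 0)"
definition w1 :: expo where "w1 = (0, 1, 0)"
definition w2 :: expo where "w2 = (0, 0, 1)"
abbreviation ww :: expo where "ww \<equiv> w1"

definition expo_scale :: "int \<Rightarrow> expo \<Rightarrow> expo" where
  "expo_scale k = (\<lambda>(a, b, c). (k * a, k * b, k * c))"

definition mon :: "'a::zero \<Rightarrow> expo \<Rightarrow> 'a fdist" where
  "mon c u = (\<lambda>e. if e = u then c else 0)"

abbreviation cst :: "'a::zero \<Rightarrow> 'a fdist" where
  "cst c \<equiv> mon c 0"

text \<open>\<open>ser f u\<close> is \<open>\<Sum>k\<in>\<int>. f k u\<^sup>k\<close> for a nontrivial monomial \<open>u\<close>.\<close>

definition ser :: "(int \<Rightarrow> 'a::comm_monoid_add) \<Rightarrow> expo \<Rightarrow> 'a fdist" where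
  "ser f u = (\<lambda>e. Sum_any (\<lambda>k. if expo_scale k u = e then f k else 0))"

text \<open>The expansion of \<open>1 / (1 - c u)\<close> as a geometric series in the monomial \<open>u\<close>.\<close>

definition geom :: "'a::semiring_1 \<Rightarrow> expo \<Rightarrow> 'a fdist" where
  "geom c u = ser (\<lambda>k. if 0 \<le> k then c ^ nat k else 0) u"

text \<open>
  The product of formal distributions. Every coefficient of every product formed below, bracketed
  to the left, is a sum with only finitely many nonzero terms. Addition and subtraction of
  distributions are the pointwise ones.
\<close>

definition fd_mult :: "'a::semiring_0 fdist \<Rightarrow> 'a fdist \<Rightarrow> 'a fdist" (infixl \<open>\<star>\<close> 70) where
  "f \<star> g = (\<lambda>e. Sum_any (\<lambda>a. f a * g (e - a)))"

definition Sym :: "(expo \<Rightarrow> expo \<Rightarrow> 'a::plus fdist) \<Rightarrow> 'a fdist" where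
  "Sym g = g w1 w2 + g w2 w1"


section \<open>The free algebra\<close>

datatype 'g fword = Word (letters: "'g list")

instantiation fword :: (type) monoid_add
begin

definition zero_fword :: "'a fword" where
  "0 = Word []"

definition plus_fword :: "'a fword \<Rightarrow> 'a fword \<Rightarrow> 'a fword" where
  "u + w = Word (letters u @ letters w)"

instance
  by standard (simp_all add: zero_fword_def plus_fword_def)

end

datatype gen =
    GB nat int
  | GTheta nat nat
  | GK nat
  | GKinv nat
  | GC
  | GCinv

text \<open>The monoid algebra of the free monoid on the generators.\<close>

type_synonym falg = "gen fword \<Rightarrow>\<^sub>0 Cq"

definition idx :: "nat \<Rightarrow> nat set" where
  "idx n = {1..2 * n}"

definition gens :: "nat \<Rightarrow> gen set" where
  "gens n = {GB i l | i l. i \<in> idx n} \<union> {GTheta i m | i m. i \<in> idx n \<and> m > 0}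
     \<union> {GK i | i. i \<in> idx n} \<union> {GKinv i | i. i \<in> idx n} \<union> {GC, GCinv}"

definition free_algebra :: "nat \<Rightarrow> falg ring" where
  "free_algebra n =
     \<lparr>carrier = {f. \<forall>w \<in> Poly_Mapping.keys f. set (letters w) \<subseteq> gens n},
      mult = (*), one = 1, zero = 0, add = (+)\<rparr>"

definition gn :: "gen \<Rightarrow> falg" where
  "gn g = Poly_Mapping.single (Word [g]) 1"

definition sc :: "Cq \<Rightarrow> falg" where
  "sc c = Poly_Mapping.single 0 c"


section \<open>The algebra by generators and relations\<close>

definition tau :: "nat \<Rightarrow> nat \<Rightarrow> nat" where
  "tau n i = 2 * n + 1 - i"

definition cartan :: "nat \<Rightarrow> nat \<Rightarrow> int" where
  "cartan i j = (if i = j then 2 else if i = j + 1 \<or> j = i + 1 then -1 else 0)"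

definition vp :: "int \<Rightarrow> falg" where
  "vp k = sc (qv powi k)"

definition qtwo :: Cq where
  "qtwo = qv + inverse qv"

definition Cpow :: "int \<Rightarrow> falg" where
  "Cpow k = (if 0 \<le> k then gn GC ^ nat k else gn GCinv ^ nat (- k))"

text \<open>The coefficient of \<open>z\<^sup>k\<close> in \<open>\<Theta>\<^sub>i(z) = 1 + \<Sum>k\<ge>1. (v - v\<inverse>) \<Theta>\<^sub>i\<^sub>,\<^sub>k z\<^sup>k\<close>.\<close>

definition Theta_coeff :: "nat \<Rightarrow> int \<Rightarrow> falg" where
  "Theta_coeff i k =
     (if k < 0 then 0 else if k = 0 then 1 else sc (qv - inverse qv) * gn (GTheta i (nat k)))"

definition Bs :: "nat \<Rightarrow> expo \<Rightarrow> falg fdist" where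
  "Bs i u = ser (\<lambda>k. gn (GB i k)) u"

definition Ths :: "nat \<Rightarrow> expo \<Rightarrow> falg fdist" where
  "Ths i u = ser (Theta_coeff i) u"

definition Deltas :: "expo \<Rightarrow> falg fdist" where
  "Deltas u = ser Cpow u"

abbreviation Ks :: "nat \<Rightarrow> falg fdist" where
  "Ks i \<equiv> cst (gn (GK i))"

definition Serre :: "nat \<Rightarrow> nat \<Rightarrow> falg fdist" where
  "Serre i j = Sym (\<lambda>a b. Bs i a \<star> Bs i b \<star> Bs j zz
     - cst (sc qtwo) \<star> Bs i a \<star> Bs j zz \<star> Bs i b
     + Bs j zz \<star> Bs i a \<star> Bs i b)"

text \<open>
  The elements \<open>lhs - rhs\<close> of the free algebra, one for each coefficient \<open>e\<close> of each defining
  relation.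
\<close>

inductive_set relators :: "nat \<Rightarrow> falg set" for n :: nat where
  K_inv_right: "i \<in> idx n \<Longrightarrow> gn (GK i) * gn (GKinv i) - 1 \<in> relators n"
| K_inv_left: "i \<in> idx n \<Longrightarrow> gn (GKinv i) * gn (GK i) - 1 \<in> relators n"
| C_inv_right: "gn GC * gn GCinv - 1 \<in> relators n"
| C_inv_left: "gn GCinv * gn GC - 1 \<in> relators n"
| C_central: "g \<in> gens n \<Longrightarrow> gn GC * gn g - gn g * gn GC \<in> relators n"
| K_K: "\<lbrakk>i \<in> idx n; j \<in> idx n\<rbrakk> \<Longrightarrow> gn (GK i) * gn (GK j) - gn (GK j) * gn (GK i) \<in> relators n"
| K_Theta: "\<lbrakk>i \<in> idx n; j \<in> idx n\<rbrakk> \<Longrightarrow> (Ks i \<star> Ths j ww - Ths j ww \<star> Ks i) e \<in> relators n"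
| K_B: "\<lbrakk>i \<in> idx n; j \<in> idx n\<rbrakk> \<Longrightarrow>
    (Ks i \<star> Bs j zz
     - cst (vp (cartan (tau n i) j - cartan i j)) \<star> Bs j zz \<star> Ks i) e \<in> relators n"
| Theta_Theta: "\<lbrakk>i \<in> idx n; j \<in> idx n\<rbrakk> \<Longrightarrow>
    (Ths i zz \<star> Ths j ww - Ths j ww \<star> Ths i zz) e \<in> relators n"
| B_Theta: "\<lbrakk>i \<in> idx n; j \<in> idx n\<rbrakk> \<Longrightarrow>
    (Bs j ww \<star> Ths i zz
     - (cst 1 - mon (vp (cartan i j)) (zz - ww))
       \<star> (cst 1 - mon (vp (- cartan (tau n i) j) * gn GC) (zz + ww))
       \<star> geom (vp (- cartan i j)) (zz - ww)
       \<star> geom (vp (cartan (tau n i) j) * gn GC) (zz + ww)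
       \<star> Ths i zz \<star> Bs j ww) e \<in> relators n"
| B_B_tau0: "\<lbrakk>i \<in> idx n; cartan i (tau n i) = 0\<rbrakk> \<Longrightarrow>
    (Bs i zz \<star> Bs (tau n i) ww - Bs (tau n i) ww \<star> Bs i zz
     - cst (sc (1 / (qv - inverse qv))) \<star> Deltas (zz + ww)
       \<star> (Ks (tau n i) \<star> Ths i zz - Ks i \<star> Ths (tau n i) ww)) e \<in> relators n"
| B_B: "\<lbrakk>i \<in> idx n; j \<in> idx n; j \<noteq> tau n i\<rbrakk> \<Longrightarrow>
    ((mon (vp (cartan i j)) zz - mon 1 ww) \<star> Bs i zz \<star> Bs j ww
     + (mon (vp (cartan i j)) ww - mon 1 zz) \<star> Bs j ww \<star> Bs i zz) e \<in> relators n"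
| B_B_tau1: "\<lbrakk>i \<in> idx n; cartan i (tau n i) = -1\<rbrakk> \<Longrightarrow>
    ((mon (vp (-1)) zz - mon 1 ww) \<star> Bs i zz \<star> Bs (tau n i) ww
     + (mon (vp (-1)) ww - mon 1 zz) \<star> Bs (tau n i) ww \<star> Bs i zz
     - cst (sc (1 / (1 - qv ^ 2))) \<star> Deltas (zz + ww)
       \<star> ((mon 1 zz - mon (vp 1) ww) \<star> Ks i \<star> Ths (tau n i) ww
          + (mon 1 ww - mon (vp 1) zz) \<star> Ks (tau n i) \<star> Ths i zz)) e \<in> relators n"
| B_B_comm: "\<lbrakk>i \<in> idx n; j \<in> idx n; cartan i j = 0; tau n i \<noteq> j\<rbrakk> \<Longrightarrow>
    (Bs i ww \<star> Bs j zz - Bs j zz \<star> Bs i ww) e \<in> relators n"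
| Serre_ordinary: "\<lbrakk>i \<in> idx n; j \<in> idx n; cartan i j = -1; j \<noteq> tau n i; tau n i \<noteq> i\<rbrakk> \<Longrightarrow>
    Serre i j e \<in> relators n"
| Serre_tau: "\<lbrakk>i \<in> idx n; cartan i (tau n i) = -1\<rbrakk> \<Longrightarrow>
    (cst (sc (qv - inverse qv)) \<star> Serre i (tau n i)
     - (cst (sc (- inverse qv * qtwo)) \<star> Sym (\<lambda>a b. Deltas (b + zz)
          \<star> (cst 1 - mon (vp 1) (zz - b)) \<star> geom (vp (-2)) (a - b)
          \<star> Bs i a \<star> Ths (tau n i) zz \<star> Ks i)
        + cst (sc qtwo) \<star> Sym (\<lambda>a b. Deltas (b + zz)
          \<star> (cst 1 - mon (vp 1) (zz - b)) \<star> geom (vp 2) (a - b)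
          \<star> Ths (tau n i) zz \<star> Ks i \<star> Bs i a)
        + cst (sc (qv * qtwo)) \<star> Sym (\<lambda>a b. Deltas (b + zz)
          \<star> (mon 1 (zz - a) - mon (vp 1) (b - a)) \<star> geom (vp 2) (b - a)
          \<star> Bs i a \<star> Ths i b \<star> Ks (tau n i))
        + cst (sc (qv powi (-2) * qtwo)) \<star> Sym (\<lambda>a b. Deltas (b + zz)
          \<star> (mon (vp 1) (b - a) - mon 1 (zz - a)) \<star> geom (vp (-2)) (b - a)
          \<star> Ths i b \<star> Ks (tau n i) \<star> Bs i a))) e \<in> relators n"

definition Ui :: "nat \<Rightarrow> falg set ring" where
  "Ui n = free_algebra n Quot (Idl\<^bsub>free_algebra n\<^esub> (relators n))"

definition Ui_class :: "nat \<Rightarrow> falg \<Rightarrow> falg set" where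
  "Ui_class n a = (Idl\<^bsub>free_algebra n\<^esub> (relators n)) +>\<^bsub>free_algebra n\<^esub> a"


section \<open>Representations\<close>

definition end_ring :: "('k \<Rightarrow> 'm \<Rightarrow> 'm) \<Rightarrow> 'm set \<Rightarrow> ('m::ab_group_add \<Rightarrow> 'm) ring" where
  "end_ring smul M =
     \<lparr>carrier = {T \<in> M \<rightarrow>\<^sub>E M. (\<forall>x\<in>M. \<forall>y\<in>M. T (x + y) = T x + T y)
                              \<and> (\<forall>c. \<forall>x\<in>M. T (smul c x) = smul c (T x))},
      mult = compose M, one = (\<lambda>x\<in>M. x), zero = (\<lambda>x\<in>M. 0),
      add = (\<lambda>S T. \<lambda>x\<in>M. S x + T x)\<rparr>"

text \<open>
  A homomorphism of \<open>\<complex>(q)\<close>-algebras from \<open>Ui n\<close> to the endomorphisms of the space \<open>M\<close>.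
\<close>

definition is_representation ::
  "nat \<Rightarrow> (Cq \<Rightarrow> 'm \<Rightarrow> 'm) \<Rightarrow> 'm set \<Rightarrow> (falg set \<Rightarrow> 'm::ab_group_add \<Rightarrow> 'm) \<Rightarrow> bool" where
  "is_representation n smul M \<rho> \<longleftrightarrow>
     \<rho> \<in> ring_hom (Ui n) (end_ring smul M) \<and>
     (\<forall>c. \<rho> (Ui_class n (sc c)) = (\<lambda>x\<in>M. smul c x))"


section \<open>Laurent polynomials and the group of signed permutations\<close>

text \<open>
  Laurent polynomials in \<open>x\<^sub>1, x\<^sub>2, \<dots>\<close> over \<open>\<complex>(q)\<close>: finitely supported functions on exponent
  vectors. All formulas are evaluated in the field of fractions \<open>rfun\<close>.
\<close>

type_synonym laurent = "(nat \<Rightarrow>\<^sub>0 int) \<Rightarrow>\<^sub>0 Cq"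
type_synonym rfun = "laurent fract"

definition coeffF :: "Cq \<Rightarrow> rfun" where
  "coeffF c = to_fract (Poly_Mapping.single 0 c)"

definition bar :: "nat \<Rightarrow> nat \<Rightarrow> nat" where
  "bar d r = 2 * d + 1 - r"

text \<open>The exponent vector of \<open>x\<^sub>r\<^sup>k\<close>, where \<open>x\<^sub>r = (x\<^bsub>bar r\<^esub>)\<inverse>\<close> for \<open>d < r \<le> 2d\<close>.\<close>

definition xexp :: "nat \<Rightarrow> nat \<Rightarrow> int \<Rightarrow> (nat \<Rightarrow>\<^sub>0 int)" where
  "xexp d r k = (if r \<le> d then Poly_Mapping.single r k else Poly_Mapping.single (bar d r) (- k))"

definition xvar :: "nat \<Rightarrow> nat \<Rightarrow> rfun" where
  "xvar d r = to_fract (Poly_Mapping.single (xexp d r 1) 1)"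

definition Wc :: "nat \<Rightarrow> (nat \<Rightarrow> nat) set" where
  "Wc d = {w. w permutes {1..2 * d} \<and> (\<forall>r \<in> {1..2 * d}. w (bar d r) = bar d (w r))}"

text \<open>The substitution \<open>x\<^sub>r \<mapsto> x\<^bsub>w r\<^esub>\<close>.\<close>

definition W_act :: "nat \<Rightarrow> (nat \<Rightarrow> nat) \<Rightarrow> laurent \<Rightarrow> laurent" where
  "W_act d w f = (\<Sum>a \<in> Poly_Mapping.keys f.
     Poly_Mapping.single (\<Sum>r = 1..d. xexp d (w r) (Poly_Mapping.lookup a r)) (Poly_Mapping.lookup f a))"

definition Lam :: "nat \<Rightarrow> nat \<Rightarrow> (nat \<Rightarrow> nat) set" where
  "Lam N d = {v. (\<forall>i. i \<notin> {1..N} \<longrightarrow> v i = 0) \<and> (\<forall>i \<in> {1..N}. v i = v (N + 1 - i))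
                \<and> (\<Sum>i = 1..N. v i) = 2 * d}"

definition blk :: "(nat \<Rightarrow> nat) \<Rightarrow> nat \<Rightarrow> nat set" where
  "blk v i = {(\<Sum>k = 1..i - 1. v k) + 1 .. (\<Sum>k = 1..i. v k)}"

definition Wblk :: "nat \<Rightarrow> nat \<Rightarrow> (nat \<Rightarrow> nat) \<Rightarrow> (nat \<Rightarrow> nat) set" where
  "Wblk N d v = {w \<in> Wc d. \<forall>i \<in> {1..N}. w ` blk v i = blk v i}"


section \<open>The polynomial representation space\<close>

text \<open>\<open>\<complex>[q, q\<inverse>]\<close> inside \<open>\<complex>(q)\<close>, and \<open>\<R>\<^bsup>[v]\<^esup>[q, q\<inverse>]\<close> for the invariants under \<open>Wblk N d v\<close>.\<close>

definition Claurent :: "Cq set" where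
  "Claurent = {c. \<exists>p (k::nat). c = to_fract p / qv ^ k}"

definition Rinv :: "nat \<Rightarrow> nat \<Rightarrow> (nat \<Rightarrow> nat) \<Rightarrow> laurent set" where
  "Rinv N d v = {f. (\<forall>a \<in> Poly_Mapping.keys f. Poly_Mapping.keys a \<subseteq> {1..d})
                  \<and> (\<forall>a. Poly_Mapping.lookup f a \<in> Claurent)
                  \<and> (\<forall>w \<in> Wblk N d v. W_act d w f = f)}"

text \<open>
  An element of the direct sum is the family of its components, zero off the finite set
  \<open>Lam N d\<close>.
\<close>

type_synonym pvec = "(nat \<Rightarrow> nat) \<Rightarrow> rfun"

definition Pint :: "nat \<Rightarrow> nat \<Rightarrow> pvec set" where
  "Pint N d = {m. \<forall>v. if v \<in> Lam N d then m v \<in> to_fract ` Rinv N d v else m v = 0}"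

definition pscale :: "Cq \<Rightarrow> pvec \<Rightarrow> pvec" where
  "pscale c m = (\<lambda>v. coeffF c * m v)"

text \<open>
  As \<open>Pint N d\<close> is torsion free, its extension of scalars to \<open>\<complex>(q)\<close> is its localisation at the
  nonzero elements of \<open>\<complex>[q]\<close>.
\<close>

definition PC :: "nat \<Rightarrow> nat \<Rightarrow> pvec set" where
  "PC N d = {m. \<exists>s::complex poly. s \<noteq> 0 \<and> pscale (to_fract s) m \<in> Pint N d}"


section \<open>The operators\<close>

definition theta1 :: "'a::field \<Rightarrow> 'a \<Rightarrow> 'a" where
  "theta1 q z = (q * z - 1) / (z - q)"

definition Phi :: "'a::field \<Rightarrow> (nat \<Rightarrow> 'a) \<Rightarrow> nat set \<Rightarrow> 'a \<Rightarrow> 'a" where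
  "Phi q x S z = (\<Prod>t\<in>S. theta1 q (z / x t))"

abbreviation qF :: rfun where
  "qF \<equiv> coeffF qv"

definition K_hat :: "nat \<Rightarrow> nat \<Rightarrow> pvec \<Rightarrow> pvec" where
  "K_hat n i m = (\<lambda>v. qF powi (- int (v i) + int (v (i + 1)) + (if i = n then 1 else 0)) * m v)"

text \<open>
  The expansion at \<open>z = 0\<close> of a rational function of \<open>z\<close> is its image in the field of formal
  Laurent series, so the formula is evaluated there, with \<open>z = fls_X\<close>.
\<close>

definition Theta_hat_series :: "nat \<Rightarrow> nat \<Rightarrow> nat \<Rightarrow> (nat \<Rightarrow> nat) \<Rightarrow> rfun fls" where
  "Theta_hat_series n d i v =
     (let q = fls_const qF; x = (\<lambda>t. fls_const (xvar d t)); z = fls_X in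
      q powi (int (v (i + 1)) - int (v i))
      * Phi q x (blk v i) (q powi (1 - int i) * inverse z)
      * inverse (Phi q x (blk v (i + 1)) (q powi (- 1 - int i) * inverse z))
      * (if i = n + 1 then (1 - q ^ (2 * n) * z ^ 2) / (1 - q ^ (2 * n + 2) * z ^ 2) else 1))"

text \<open>The coefficient of \<open>z\<^sup>k\<close> in the multiplication operator defined by this series.\<close>

definition Theta_hat_coeff :: "nat \<Rightarrow> nat \<Rightarrow> nat \<Rightarrow> int \<Rightarrow> pvec \<Rightarrow> pvec" where
  "Theta_hat_coeff n d i k m = (\<lambda>v. fls_nth (Theta_hat_series n d i v) k * m v)"

text \<open>
  \<open>f(x\<^sub>I)\<close>, for \<open>f\<close> in the image of the Laurent polynomials in the field of fractions.
\<close>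

definition at_part :: "nat \<Rightarrow> nat \<Rightarrow> (nat \<Rightarrow> nat set) \<Rightarrow> rfun \<Rightarrow> rfun" where
  "at_part N d I f =
     (let u = (\<lambda>k. if k \<in> {1..N} then card (I k) else 0);
          \<sigma> = (SOME \<sigma>. \<sigma> \<in> Wc d \<and> (\<forall>k \<in> {1..N}. \<sigma> ` blk u k = I k))
      in to_fract (W_act d \<sigma> (the_inv to_fract f)))"

definition tau_plus :: "nat \<Rightarrow> nat \<Rightarrow> nat \<Rightarrow> nat \<Rightarrow> (nat \<Rightarrow> nat set) \<Rightarrow> (nat \<Rightarrow> nat set)" where
  "tau_plus N d s j I = (\<lambda>k.
     (I k - (if k = s then {j} else {}) - (if k = N + 1 - s then {bar d j} else {}))
     \<union> (if k = s + 1 then {j} else {}) \<union> (if k = N - s then {bar d j} else {}))"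

text \<open>
  \<open>v - e\<^sub>i + e\<^bsub>i+1\<^esub> + e\<^bsub>\<tau>i\<^esub> - e\<^bsub>\<tau>i+1\<^esub>\<close>, whose entries may be negative.
\<close>

definition shift :: "nat \<Rightarrow> nat \<Rightarrow> (nat \<Rightarrow> nat) \<Rightarrow> nat \<Rightarrow> int" where
  "shift n i v = (\<lambda>k. int (v k) - of_bool (k = i) + of_bool (k = i + 1)
     + of_bool (k = tau n i) - of_bool (k = tau n i + 1))"

definition B_hat :: "nat \<Rightarrow> nat \<Rightarrow> nat \<Rightarrow> int \<Rightarrow> pvec \<Rightarrow> pvec" where
  "B_hat n d i r m = (\<lambda>v.
     (let N = 2 * n + 1; v' = (\<lambda>k. nat (shift n i v k)) in
      if v \<in> Lam N d \<and> (\<forall>k. 0 \<le> shift n i v k) \<and> v' \<in> Lam N d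
      then \<Sum>j \<in> blk v i. xvar d j powi r
             * Phi qF (xvar d) (blk v i - {j}) (qF * xvar d j)
             * at_part N d (tau_plus N d i j (blk v)) (m v')
      else 0))"

text \<open>The coefficient of \<open>z\<^sup>r\<close> in \<open>\<Sum>r\<in>\<int>. q\<^bsup>r i\<^esup> B_hat n d i r z\<^sup>r\<close>.\<close>

definition B_hat_coeff :: "nat \<Rightarrow> nat \<Rightarrow> nat \<Rightarrow> int \<Rightarrow> pvec \<Rightarrow> pvec" where
  "B_hat_coeff n d i r m = pscale (qv powi (r * int i)) (B_hat n d i r m)"

end

theory Submission
  imports Defs
begin

text \<open>
  Evaluating a vector at all set partitions turns it into a family of Laurent polynomials that is
  indexed by the colourings \<open>c\<close> of \<open>{1, \<dots>, 2d}\<close> with \<open>c r' = N + 1 - c r\<close> and is equivariant under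
  \<open>Wc d\<close>. On such families \<open>B\<^sub>i\<close> moves one index \<open>a\<close> from colour \<open>i\<close> to \<open>i + 1\<close> (and \<open>a'\<close> back), with a
  weight that is a product of the functions \<open>g a t = (q x\<^sub>a - q\<inverse> x\<^sub>t) / (x\<^sub>a - x\<^sub>t)\<close>, so a coefficient of a
  relation is a sum over tuples of moved indices.

  Tuples without mutually inverse moves cancel one by one, because \<open>g a b + g b a = q + q\<inverse>\<close>. A pair of
  mutually inverse moves \<open>s\<close>, \<open>s'\<close> leaves a scalar, which is the residue at the pole belonging to \<open>s\<close> of
  the rational function expanded by \<open>\<Theta>\<close>; summing over \<open>s\<close>, the partial fraction expansion gives the difference of its
  expansions at \<open>0\<close> and \<open>\<infinity>\<close>, which is the right hand side.

  The weights have poles along \<open>x\<^sub>a = x\<^sub>t\<close> for indices \<open>a\<close>, \<open>t\<close> of equal colour only. The reflection exchanging \<open>a\<close> and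
  \<open>t\<close> preserves the colouring, hence fixes the value of \<open>B\<^sub>i F\<close> there by equivariance, while it negates
  \<open>x\<^sub>a - x\<^sub>t\<close>; so the poles cancel and \<open>B\<^sub>i F\<close> is again a family of Laurent polynomials.
\<close>

section \<open>Partial fractions\<close>

text \<open>With y = q^i x_a the power q^(ri) in \<open>B_hat_coeff\<close> is absorbed and B_i(z)
  becomes a weighted sum of delta functions of y z. The parameters of mirror moves multiply to q^N,
  which is why C acts by q^N: the expansion at infinity belonging to node i is the expansion at 0
  belonging to node N - i. The obstacle is the middle colour n + 1, its own mirror. There a and a'
  share a block, so the weight acquires the factor \<open>g a (br a)\<close> with poles at x_a = 1
  and x_a = -1, and the correction (1 - q^(2n) z^2) / (1 - q^(2n+2) z^2) in Theta_(n+1) has to match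
  it. In the Serre relation of the nodes n and n + 1 a further move of an index a accompanies the
  mirror pair; the rational function then also has poles belonging to a and a', and numerator
  factors 1 - q^i z and 1 + q^i z in their place. Divisibility of Laurent polynomials is tested by
  evaluations: if a substitution that alters one variable only sends f to 0, then f is a multiple of
  the displacement of that variable. The difference x_a - 1 / x_a has two zeros, 1 and -1, and takes
  two evaluations.\<close>

definition pf_res :: "'i set \<Rightarrow> ('i \<Rightarrow> 'a::field) \<Rightarrow> ('i \<Rightarrow> 'a) \<Rightarrow> 'i \<Rightarrow> 'a" where
  "pf_res S \<alpha> \<beta> s = (1 - \<alpha> s / \<beta> s) * (\<Prod>t\<in>S - {s}. (1 - \<alpha> t / \<beta> s) / (1 - \<beta> t / \<beta> s))"

lemma pf_res_insert:
  assumes "finite S" "s \<in> S" "u \<notin> S"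
  shows "pf_res (insert u S) \<alpha> \<beta> s = pf_res S \<alpha> \<beta> s * ((1 - \<alpha> u / \<beta> s) / (1 - \<beta> u / \<beta> s))"
proof -
  have "insert u S - {s} = insert u (S - {s})" using assms by auto
  then show ?thesis using assms by (simp add: pf_res_def mult_ac)
qed

text \<open>\<open>pf_res S \<alpha> \<beta> s\<close> is the coefficient of the simple fraction
  with pole 1 / \<beta> s, and the constant is the value at infinity. The coefficient at a new pole
  is the old product evaluated there; for this reason the induction keeps the point z
  arbitrary.\<close>

lemma partial_fractions:
  fixes \<alpha> \<beta> :: "'i \<Rightarrow> 'a::field"
  assumes "finite S" "inj_on \<beta> S" "\<And>s. s \<in> S \<Longrightarrow> \<beta> s \<noteq> 0" "\<And>s. s \<in> S \<Longrightarrow> 1 - \<beta> s * z \<noteq> 0"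
  shows "(\<Prod>s\<in>S. (1 - \<alpha> s * z) / (1 - \<beta> s * z))
       = (\<Prod>s\<in>S. \<alpha> s / \<beta> s) + (\<Sum>s\<in>S. pf_res S \<alpha> \<beta> s / (1 - \<beta> s * z))"
  using assms
proof (induction S arbitrary: z rule: finite_induct)
  case empty
  then show ?case by simp
next
  case (insert u S)
  have bu: "\<beta> u \<noteq> 0" and nz: "1 - \<beta> u * z \<noteq> 0" using insert.prems by auto
  have ne: "\<beta> s \<noteq> \<beta> u" if "s \<in> S" for s using insert.prems(1) insert.hyps that by (auto simp: inj_on_def)
  have IH: "(\<Prod>s\<in>S. (1 - \<alpha> s * y) / (1 - \<beta> s * y))
       = (\<Prod>s\<in>S. \<alpha> s / \<beta> s) + (\<Sum>s\<in>S. pf_res S \<alpha> \<beta> s / (1 - \<beta> s * y))"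
    if "\<And>s. s \<in> S \<Longrightarrow> 1 - \<beta> s * y \<noteq> 0" for y
    using insert.IH[of y] insert.prems that by (auto simp: inj_on_def)
  have IHu: "(\<Prod>s\<in>S. (1 - \<alpha> s / \<beta> u) / (1 - \<beta> s / \<beta> u))
       = (\<Prod>s\<in>S. \<alpha> s / \<beta> s) + (\<Sum>s\<in>S. pf_res S \<alpha> \<beta> s / (1 - \<beta> s / \<beta> u))"
  proof -
    have "1 - \<beta> s * (1 / \<beta> u) \<noteq> 0" if "s \<in> S" for s
      using ne[OF that] bu by simp
    from IH[OF this] show ?thesis by simp
  qed
  have ru: "pf_res (insert u S) \<alpha> \<beta> u = (1 - \<alpha> u / \<beta> u) *
      ((\<Prod>s\<in>S. \<alpha> s / \<beta> s) + (\<Sum>s\<in>S. pf_res S \<alpha> \<beta> s / (1 - \<beta> s / \<beta> u)))"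
  proof -
    have "insert u S - {u} = S" using insert.hyps by auto
    then have "pf_res (insert u S) \<alpha> \<beta> u = (1 - \<alpha> u / \<beta> u) * (\<Prod>s\<in>S. (1 - \<alpha> s / \<beta> u) / (1 - \<beta> s / \<beta> u))"
      by (simp only: pf_res_def)
    then show ?thesis by (simp only: IHu)
  qed
  have split: "(1 - \<alpha> u * z) / (1 - \<beta> u * z) = \<alpha> u / \<beta> u + (1 - \<alpha> u / \<beta> u) / (1 - \<beta> u * z)"
    using bu nz by (simp add: field_simps)
  \<comment> \<open>A product of two simple fractions splits over its two poles. The part at s
    updates the coefficient of s; the parts at u, summed over s, complete the coefficient of
    u.\<close>
  have tm: "pf_res S \<alpha> \<beta> s / (1 - \<beta> s * z) * ((1 - \<alpha> u * z) / (1 - \<beta> u * z))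
     = pf_res (insert u S) \<alpha> \<beta> s / (1 - \<beta> s * z)
       + (1 - \<alpha> u / \<beta> u) * (pf_res S \<alpha> \<beta> s / (1 - \<beta> s / \<beta> u)) / (1 - \<beta> u * z)" if s: "s \<in> S" for s
  proof -
    have z: "1 - \<beta> s * z \<noteq> 0" "\<beta> s \<noteq> 0" "\<beta> s \<noteq> \<beta> u" using insert.prems ne s by auto
    have d: "\<beta> u - \<beta> s \<noteq> 0" "\<beta> s - \<beta> u \<noteq> 0" using z by auto
    have e1: "(1 - \<alpha> u / \<beta> s) / (1 - \<beta> u / \<beta> s) = (\<beta> s - \<alpha> u) / (\<beta> s - \<beta> u)"
      and e2: "1 / (1 - \<beta> s / \<beta> u) = \<beta> u / (\<beta> u - \<beta> s)"
      using z d bu by (simp_all add: divide_simps)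
    have "(1 - \<alpha> u * z) / ((1 - \<beta> s * z) * (1 - \<beta> u * z))
      = (\<beta> s - \<alpha> u) / (\<beta> s - \<beta> u) / (1 - \<beta> s * z) + (1 - \<alpha> u / \<beta> u) * (\<beta> u / (\<beta> u - \<beta> s)) / (1 - \<beta> u * z)"
      using z d bu nz by (simp add: divide_simps) (simp add: algebra_simps)
    then have "pf_res S \<alpha> \<beta> s * ((1 - \<alpha> u * z) / ((1 - \<beta> s * z) * (1 - \<beta> u * z))) = pf_res S \<alpha> \<beta> s *
      ((\<beta> s - \<alpha> u) / (\<beta> s - \<beta> u) / (1 - \<beta> s * z) + (1 - \<alpha> u / \<beta> u) * (\<beta> u / (\<beta> u - \<beta> s)) / (1 - \<beta> u * z))"
      by simp
    then show ?thesis
      unfolding pf_res_insert[OF insert.hyps(1) s insert.hyps(2)] e1 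
      by (simp add: e2[symmetric] distrib_left mult_ac)
  qed
  have "(\<Prod>s\<in>insert u S. (1 - \<alpha> s * z) / (1 - \<beta> s * z))
     = ((\<Prod>s\<in>S. \<alpha> s / \<beta> s) + (\<Sum>s\<in>S. pf_res S \<alpha> \<beta> s / (1 - \<beta> s * z))) * ((1 - \<alpha> u * z) / (1 - \<beta> u * z))"
    using insert.hyps IH[of z] insert.prems by (simp add: mult_ac)
  also have "\<dots> = (\<Prod>s\<in>S. \<alpha> s / \<beta> s) * (\<alpha> u / \<beta> u + (1 - \<alpha> u / \<beta> u) / (1 - \<beta> u * z))
     + (\<Sum>s\<in>S. pf_res S \<alpha> \<beta> s / (1 - \<beta> s * z) * ((1 - \<alpha> u * z) / (1 - \<beta> u * z)))"
    by (simp only: split[symmetric] distrib_right sum_distrib_right)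
  also have "(\<Sum>s\<in>S. pf_res S \<alpha> \<beta> s / (1 - \<beta> s * z) * ((1 - \<alpha> u * z) / (1 - \<beta> u * z)))
     = (\<Sum>s\<in>S. pf_res (insert u S) \<alpha> \<beta> s / (1 - \<beta> s * z))
       + (1 - \<alpha> u / \<beta> u) * (\<Sum>s\<in>S. pf_res S \<alpha> \<beta> s / (1 - \<beta> s / \<beta> u)) / (1 - \<beta> u * z)"
    by (subst sum.cong[OF refl tm]) (simp_all only: sum.distrib sum_distrib_left sum_divide_distrib)
  finally show ?case
    using insert.hyps by (simp add: ru distrib_left distrib_right add_divide_distrib mult_ac)
qed

section \<open>Power series expansions of products of linear fractions\<close>

definition linfrac :: "'a::field \<Rightarrow> 'a \<Rightarrow> 'a fps" where
  "linfrac a b = (1 - fps_const a * fps_X) * inverse (1 - fps_const b * fps_X)"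

lemma one_minus_X_mult_inverse:
  "(1 - fps_const (b::'a::field) * fps_X) * inverse (1 - fps_const b * fps_X) = 1"
  by (rule inverse_mult_eq_1') simp

lemma linfrac_mult_denom [simp]: "linfrac a b * (1 - fps_const b * fps_X) = 1 - fps_const (a::'a::field) * fps_X"
  by (simp add: linfrac_def mult.assoc mult.commute[of "inverse _"] one_minus_X_mult_inverse)

lemma linfrac_nth_0 [simp]: "linfrac a b $ 0 = 1"
  by (simp add: linfrac_def)

lemma inverse_one_minus_X_nth: "inverse (1 - fps_const (b::'a::field) * fps_X) $ k = b ^ k"
proof -
  have "inverse (1 - fps_const b * fps_X) = Abs_fps (\<lambda>k. b ^ k)"
  proof (rule fps_inverse_unique)
    show "(1 - fps_const b * fps_X) * Abs_fps (\<lambda>k. b ^ k) = 1"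
      by (rule fps_ext) (auto simp: left_diff_distrib mult.assoc power_eq_if)
  qed
  then show ?thesis by simp
qed

lemma linfrac_nth: "linfrac a b $ k = b ^ k - (if k = 0 then 0 else (a::'a::field) * b ^ (k - 1))"
  by (simp add: linfrac_def left_diff_distrib mult.assoc inverse_one_minus_X_nth)

text \<open>The induction of \<open>partial_fractions\<close> is repeated for power series. The
  coefficient at the new pole is a value of the old product at a point, which a formal series does
  not have, so it is supplied by the version over the field.\<close>

lemma partial_fractions_fps:
  fixes \<alpha> \<beta> :: "'i \<Rightarrow> 'a::field"
  assumes "finite S" "inj_on \<beta> S" "\<And>s. s \<in> S \<Longrightarrow> \<beta> s \<noteq> 0"
  shows "(\<Prod>s\<in>S. linfrac (\<alpha> s) (\<beta> s))
       = fps_const (\<Prod>s\<in>S. \<alpha> s / \<beta> s)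
         + (\<Sum>s\<in>S. fps_const (pf_res S \<alpha> \<beta> s) * inverse (1 - fps_const (\<beta> s) * fps_X))"
  using assms
proof (induction S rule: finite_induct)
  case empty
  then show ?case by simp
next
  case (insert u S)
  let ?D = "\<lambda>s. inverse (1 - fps_const (\<beta> s) * fps_X)"
  have bu: "\<beta> u \<noteq> 0" using insert.prems by auto
  have ne: "\<beta> s \<noteq> \<beta> u" if "s \<in> S" for s using insert.prems(1) insert.hyps that by (auto simp: inj_on_def)
  have IH: "(\<Prod>s\<in>S. linfrac (\<alpha> s) (\<beta> s))
       = fps_const (\<Prod>s\<in>S. \<alpha> s / \<beta> s) + (\<Sum>s\<in>S. fps_const (pf_res S \<alpha> \<beta> s) * ?D s)"
    using insert by (auto simp: inj_on_def)
  have IHu: "(\<Prod>s\<in>S. (1 - \<alpha> s / \<beta> u) / (1 - \<beta> s / \<beta> u))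
       = (\<Prod>s\<in>S. \<alpha> s / \<beta> s) + (\<Sum>s\<in>S. pf_res S \<alpha> \<beta> s / (1 - \<beta> s / \<beta> u))"
  proof -
    have "1 - \<beta> s * (1 / \<beta> u) \<noteq> 0" if "s \<in> S" for s
      using ne[OF that] bu by simp
    from partial_fractions[OF insert.hyps(1) _ _ this] insert.prems show ?thesis
      by (simp add: inj_on_def)
  qed
  have ru: "pf_res (insert u S) \<alpha> \<beta> u = (1 - \<alpha> u / \<beta> u) *
      ((\<Prod>s\<in>S. \<alpha> s / \<beta> s) + (\<Sum>s\<in>S. pf_res S \<alpha> \<beta> s / (1 - \<beta> s / \<beta> u)))"
  proof -
    have "insert u S - {u} = S" using insert.hyps by auto
    then have "pf_res (insert u S) \<alpha> \<beta> u = (1 - \<alpha> u / \<beta> u) * (\<Prod>s\<in>S. (1 - \<alpha> s / \<beta> u) / (1 - \<beta> s / \<beta> u))"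
      by (simp only: pf_res_def)
    then show ?thesis by (simp only: IHu)
  qed
  have split: "linfrac (\<alpha> u) (\<beta> u) = fps_const (\<alpha> u / \<beta> u) + fps_const (1 - \<alpha> u / \<beta> u) * ?D u"
  proof (rule fps_ext)
    fix k show "linfrac (\<alpha> u) (\<beta> u) $ k = (fps_const (\<alpha> u / \<beta> u) + fps_const (1 - \<alpha> u / \<beta> u) * ?D u) $ k"
      using bu by (simp add: linfrac_nth inverse_one_minus_X_nth left_diff_distrib)
        (simp add: power_eq_if divide_simps)
  qed
  have tm: "fps_const (pf_res S \<alpha> \<beta> s) * ?D s * linfrac (\<alpha> u) (\<beta> u)
     = fps_const (pf_res (insert u S) \<alpha> \<beta> s) * ?D s
       + fps_const ((1 - \<alpha> u / \<beta> u) * (pf_res S \<alpha> \<beta> s / (1 - \<beta> s / \<beta> u))) * ?D u" if s: "s \<in> S" for s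
  proof -
    have z: "\<beta> s \<noteq> 0" "\<beta> s \<noteq> \<beta> u" using insert.prems ne s by auto
    have d: "\<beta> u - \<beta> s \<noteq> 0" "\<beta> s - \<beta> u \<noteq> 0" using z by auto
    let ?a = "(1 - \<alpha> u / \<beta> s) / (1 - \<beta> u / \<beta> s)" and ?b = "(1 - \<alpha> u / \<beta> u) / (1 - \<beta> s / \<beta> u)"
    have num: "1 - fps_const (\<alpha> u) * fps_X = fps_const ?a * (1 - fps_const (\<beta> u) * fps_X)
       + fps_const ?b * (1 - fps_const (\<beta> s) * fps_X)"
    proof (rule fps_ext)
      fix k 
      show "(1 - fps_const (\<alpha> u) * fps_X) $ k = (fps_const ?a * (1 - fps_const (\<beta> u) * fps_X)
       + fps_const ?b * (1 - fps_const (\<beta> s) * fps_X)) $ k"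
      using z d bu by (auto simp: divide_simps) (simp_all add: algebra_simps)
    qed
    have "?D s * linfrac (\<alpha> u) (\<beta> u) = fps_const ?a * ?D s * ((1 - fps_const (\<beta> u) * fps_X) * ?D u)
        + fps_const ?b * ?D u * ((1 - fps_const (\<beta> s) * fps_X) * ?D s)"
      unfolding linfrac_def num by (simp only: distrib_left distrib_right mult_ac)
    then have "?D s * linfrac (\<alpha> u) (\<beta> u) = fps_const ?a * ?D s + fps_const ?b * ?D u"
      by (simp only: one_minus_X_mult_inverse mult_1_right)
    then have "fps_const (pf_res S \<alpha> \<beta> s) * (?D s * linfrac (\<alpha> u) (\<beta> u))
       = fps_const (pf_res S \<alpha> \<beta> s) * (fps_const ?a * ?D s + fps_const ?b * ?D u)" by simp
    moreover have "fps_const (pf_res S \<alpha> \<beta> s * ?a) = fps_const (pf_res S \<alpha> \<beta> s) * fps_const ?a"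
      "fps_const ((1 - \<alpha> u / \<beta> u) * (pf_res S \<alpha> \<beta> s / (1 - \<beta> s / \<beta> u))) = fps_const (pf_res S \<alpha> \<beta> s) * fps_const ?b"
      by (simp_all add: mult_ac)
    ultimately show ?thesis
      unfolding pf_res_insert[OF insert.hyps(1) s insert.hyps(2)]
      by (simp only: distrib_left mult.assoc)
  qed
  have cs: "fps_const (sum f S) = (\<Sum>s\<in>S. fps_const (f s))" for f :: "'i \<Rightarrow> 'a"
    by (rule fps_ext) (simp add: fps_sum_nth)
  have "(\<Prod>s\<in>insert u S. linfrac (\<alpha> s) (\<beta> s))
     = (fps_const (\<Prod>s\<in>S. \<alpha> s / \<beta> s) + (\<Sum>s\<in>S. fps_const (pf_res S \<alpha> \<beta> s) * ?D s)) * linfrac (\<alpha> u) (\<beta> u)"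
    using insert.hyps IH insert.prems by (simp add: mult_ac)
  also have "\<dots> = fps_const (\<Prod>s\<in>S. \<alpha> s / \<beta> s) * (fps_const (\<alpha> u / \<beta> u) + fps_const (1 - \<alpha> u / \<beta> u) * ?D u)
     + (\<Sum>s\<in>S. fps_const (pf_res S \<alpha> \<beta> s) * ?D s * linfrac (\<alpha> u) (\<beta> u))"
    by (simp only: split[symmetric] distrib_right sum_distrib_right)
  also have "(\<Sum>s\<in>S. fps_const (pf_res S \<alpha> \<beta> s) * ?D s * linfrac (\<alpha> u) (\<beta> u))
     = (\<Sum>s\<in>S. fps_const (pf_res (insert u S) \<alpha> \<beta> s) * ?D s)
       + fps_const ((1 - \<alpha> u / \<beta> u) * (\<Sum>s\<in>S. pf_res S \<alpha> \<beta> s / (1 - \<beta> s / \<beta> u))) * ?D u"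
    by (subst sum.cong[OF refl tm]) (simp_all only: sum.distrib sum_distrib_left sum_distrib_right cs)
  finally have fin: "(\<Prod>s\<in>insert u S. linfrac (\<alpha> s) (\<beta> s)) = fps_const (\<Prod>s\<in>S. \<alpha> s / \<beta> s) * fps_const (\<alpha> u / \<beta> u)
     + (fps_const (\<Prod>s\<in>S. \<alpha> s / \<beta> s) * fps_const (1 - \<alpha> u / \<beta> u)
        + fps_const ((1 - \<alpha> u / \<beta> u) * (\<Sum>s\<in>S. pf_res S \<alpha> \<beta> s / (1 - \<beta> s / \<beta> u)))) * ?D u
     + (\<Sum>s\<in>S. fps_const (pf_res (insert u S) \<alpha> \<beta> s) * ?D s)"
    by (simp only: distrib_left distrib_right mult.assoc add_ac)
  have e: "fps_const (\<Prod>s\<in>S. \<alpha> s / \<beta> s) * fps_const (1 - \<alpha> u / \<beta> u)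
        + fps_const ((1 - \<alpha> u / \<beta> u) * (\<Sum>s\<in>S. pf_res S \<alpha> \<beta> s / (1 - \<beta> s / \<beta> u)))
      = fps_const (pf_res (insert u S) \<alpha> \<beta> u)"
    by (simp add: ru distrib_left mult_ac)
  show ?case
    unfolding fin e using insert.hyps by (simp add: mult_ac add_ac)
qed

text \<open>Indexing by all integers allows the expansions at 0 and at infinity to be subtracted
  coefficient by coefficient.\<close>

definition zcoeff :: "'a::zero fps \<Rightarrow> int \<Rightarrow> 'a" where
  "zcoeff f k = (if 0 \<le> k then f $ nat k else 0)"

text \<open>The two expansions of 1 / (1 - \<beta> z) differ by the delta series, the sum of
  \<beta>^k z^k over all integers k. Hence each simple fraction contributes its coefficient times
  \<beta>^k in every degree, while the constant of the partial fraction expansion cancels. The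
  expansion at infinity is written with the inverse parameters, the value at infinity standing in
  front.\<close>

lemma expansion_difference:
  fixes \<alpha> \<beta> :: "'i \<Rightarrow> 'a::field"
  assumes "finite S" "inj_on \<beta> S" "\<And>s. s \<in> S \<Longrightarrow> \<beta> s \<noteq> 0" "\<And>s. s \<in> S \<Longrightarrow> \<alpha> s \<noteq> 0"
  shows "zcoeff (\<Prod>s\<in>S. linfrac (\<alpha> s) (\<beta> s)) k
       - (\<Prod>s\<in>S. \<alpha> s / \<beta> s) * zcoeff (\<Prod>s\<in>S. linfrac (1 / \<alpha> s) (1 / \<beta> s)) (- k)
     = (\<Sum>s\<in>S. pf_res S \<alpha> \<beta> s * \<beta> s powi k)"
proof -
  let ?a = "\<lambda>s. 1 / \<alpha> s" and ?b = "\<lambda>s. 1 / \<beta> s"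
  let ?p = "\<Prod>s\<in>S. \<alpha> s / \<beta> s"
  have pp: "?p * (\<Prod>s\<in>S. ?a s / ?b s) = 1"
    using assms(3,4) by (simp add: prod.distrib[symmetric])
  \<comment> \<open>Inverting the parameters is the substitution z -> 1 / z, under which the
    coefficient at a pole changes its sign.\<close>
  have res: "?p * pf_res S ?a ?b s = - pf_res S \<alpha> \<beta> s" if s: "s \<in> S" for s
  proof -
    have "\<alpha> t / \<beta> t * ((1 - ?a t / ?b s) / (1 - ?b t / ?b s)) = (1 - \<alpha> t / \<beta> s) / (1 - \<beta> t / \<beta> s)"
      if t: "t \<in> S - {s}" for t
    proof -
      have "\<beta> t \<noteq> \<beta> s" "\<beta> t \<noteq> 0" "\<beta> s \<noteq> 0" "\<alpha> t \<noteq> 0"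
        using assms s t by (auto simp: inj_on_def)
      then have "1 - ?a t / ?b s = (\<alpha> t - \<beta> s) / \<alpha> t" "1 - ?b t / ?b s = (\<beta> t - \<beta> s) / \<beta> t"
        "1 - \<alpha> t / \<beta> s = (\<beta> s - \<alpha> t) / \<beta> s" "1 - \<beta> t / \<beta> s = (\<beta> s - \<beta> t) / \<beta> s"
        by (simp_all add: diff_divide_distrib)
      moreover have "(\<alpha> t - \<beta> s) / (\<beta> t - \<beta> s) = (\<beta> s - \<alpha> t) / (\<beta> s - \<beta> t)"
        by (metis minus_diff_eq minus_divide_divide)
      ultimately show ?thesis using \<open>\<alpha> t \<noteq> 0\<close> \<open>\<beta> s \<noteq> 0\<close> \<open>\<beta> t \<noteq> 0\<close> by simp
    qed
    then have "(\<Prod>t\<in>S - {s}. \<alpha> t / \<beta> t) * (\<Prod>t\<in>S - {s}. (1 - ?a t / ?b s) / (1 - ?b t / ?b s))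
       = (\<Prod>t\<in>S - {s}. (1 - \<alpha> t / \<beta> s) / (1 - \<beta> t / \<beta> s))"
      by (simp add: prod.distrib[symmetric])
    moreover have "?p = \<alpha> s / \<beta> s * (\<Prod>t\<in>S - {s}. \<alpha> t / \<beta> t)"
      by (rule prod.remove) (use assms s in auto)
    moreover have "\<alpha> s / \<beta> s * (1 - ?a s / ?b s) = - (1 - \<alpha> s / \<beta> s)"
      using assms(3,4) s by (simp add: field_simps)
    moreover have "A * p * (B * r) = (A * B) * (p * r)" for A B p r :: 'a by (simp add: mult_ac)
    ultimately have "?p * pf_res S ?a ?b s = - (1 - \<alpha> s / \<beta> s) * (\<Prod>t\<in>S - {s}. (1 - \<alpha> t / \<beta> s) / (1 - \<beta> t / \<beta> s))"
      unfolding pf_res_def by (simp only:)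
    then show ?thesis unfolding pf_res_def by (simp only: mult_minus_left)
  qed
  have P0: "(\<Prod>s\<in>S. linfrac (\<alpha> s) (\<beta> s)) $ m
      = (if m = 0 then ?p else 0) + (\<Sum>s\<in>S. pf_res S \<alpha> \<beta> s * \<beta> s ^ m)" for m
    by (subst partial_fractions_fps) (use assms in \<open>simp_all add: fps_sum_nth inverse_one_minus_X_nth\<close>)
  have inj: "inj_on ?b S" using assms(2) by (simp add: inj_on_def)
  have "(\<Prod>s\<in>S. linfrac (?a s) (?b s)) $ m
      = (if m = 0 then (\<Prod>s\<in>S. ?a s / ?b s) else 0) + (\<Sum>s\<in>S. pf_res S ?a ?b s * ?b s ^ m)" for m
    by (subst partial_fractions_fps) (use assms inj in \<open>simp_all add: fps_sum_nth inverse_one_minus_X_nth\<close>)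
  then have "?p * (\<Prod>s\<in>S. linfrac (?a s) (?b s)) $ m
      = (if m = 0 then 1 else 0) + (\<Sum>s\<in>S. ?p * pf_res S ?a ?b s * ?b s ^ m)" for m
    using pp by (simp add: distrib_left sum_distrib_left mult.assoc)
  then have Pinf: "?p * (\<Prod>s\<in>S. linfrac (?a s) (?b s)) $ m
      = (if m = 0 then 1 else 0) - (\<Sum>s\<in>S. pf_res S \<alpha> \<beta> s * (1 / \<beta> s) ^ m)" for m
    by (simp add: res sum_negf)
  \<comment> \<open>The value at z = 0, where every linear fraction is 1. It settles the degree k =
    0, to which both expansions contribute.\<close>
  have P00: "1 = ?p + (\<Sum>s\<in>S. pf_res S \<alpha> \<beta> s)"
  proof -
    have "(\<Prod>s\<in>S. linfrac (\<alpha> s) (\<beta> s)) $ 0 = 1"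
      using assms(1) by (induction S rule: finite_induct) auto
    then show ?thesis using P0[of 0] by simp
  qed
  consider "k < 0" | "k = 0" | "k > 0" by linarith
  then show ?thesis
  proof cases
    case 1
    then show ?thesis using Pinf[of "nat (-k)"] by (simp add: zcoeff_def power_int_def field_simps)
  next
    case 2
    then show ?thesis using Pinf[of 0] P0[of 0] P00 by (simp add: zcoeff_def)
  next
    case 3
    then show ?thesis using P0[of "nat k"] by (simp add: zcoeff_def power_int_def)
  qed
qed

section \<open>Products of formal distributions\<close>

lemma Sum_any_reindex:
  fixes h :: "'a \<Rightarrow> 'c::comm_monoid_add"
  assumes "inj j" "\<And>a. h a \<noteq> 0 \<Longrightarrow> a \<in> range j"
  shows "Sum_any h = Sum_any (\<lambda>k. h (j k))"
proof -
  have e: "{a. h a \<noteq> 0} = j ` {k. h (j k) \<noteq> 0}" using assms(2) by auto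
  have i: "inj_on j A" for A using assms(1) by (rule inj_on_subset) simp
  show ?thesis
    unfolding Sum_any.expand_set e finite_image_iff[OF i] by (simp add: sum.reindex[OF i])
qed

lemma expo_scale_inj: "u \<noteq> 0 \<Longrightarrow> expo_scale k u = expo_scale l u \<longleftrightarrow> k = l"
  by (cases u) (auto simp: expo_scale_def zero_prod_def)

lemma ser_scale: "u \<noteq> 0 \<Longrightarrow> ser f u (expo_scale k u) = f k"
  by (simp add: ser_def expo_scale_inj)

lemma ser_outside: "(\<And>k. e \<noteq> expo_scale k u) \<Longrightarrow> ser f u e = 0"
proof -
  assume "\<And>k. e \<noteq> expo_scale k u"
  then have "(expo_scale k u = e) = False" for k by metis
  then show ?thesis by (simp add: ser_def)
qed

lemma ser_mult:
  assumes "u \<noteq> 0"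
  shows "(ser f u \<star> g) e = Sum_any (\<lambda>k. f k * g (e - expo_scale k u))"
proof -
  have "(ser f u \<star> g) e = Sum_any (\<lambda>k. ser f u (expo_scale k u) * g (e - expo_scale k u))"
    unfolding fd_mult_def
  proof (rule Sum_any_reindex)
    show "inj (\<lambda>k. expo_scale k u)" using assms by (auto simp: inj_def expo_scale_inj)
    fix a assume "ser f u a * g (e - a) \<noteq> 0"
    then obtain k where "a = expo_scale k u" by (metis mult_zero_left ser_outside)
    then show "a \<in> range (\<lambda>k. expo_scale k u)" by auto
  qed
  then show ?thesis by (simp add: ser_scale assms)
qed

lemma mult_ser:
  assumes "u \<noteq> 0"
  shows "(g \<star> ser f u) e = Sum_any (\<lambda>k. g (e - expo_scale k u) * f k)"
proof -
  have "(g \<star> ser f u) e = Sum_any (\<lambda>k. g (e - expo_scale k u) * ser f u (e - (e - expo_scale k u)))"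
    unfolding fd_mult_def
  proof (rule Sum_any_reindex)
    show "inj (\<lambda>k. e - expo_scale k u)" using assms by (auto simp: inj_def expo_scale_inj)
    fix a assume "g a * ser f u (e - a) \<noteq> 0"
    then obtain k where "e - a = expo_scale k u" by (metis mult_zero_right ser_outside)
    then have "a = e - expo_scale k u" by (simp add: algebra_simps)
    then show "a \<in> range (\<lambda>k. e - expo_scale k u)" by auto
  qed
  then show ?thesis by (simp add: ser_scale assms)
qed

lemma Sum_any_two: "u \<noteq> w \<Longrightarrow> (\<And>a. a \<noteq> u \<Longrightarrow> a \<noteq> w \<Longrightarrow> h a = 0) \<Longrightarrow> Sum_any h = h u + h w"
  by (subst Sum_any.expand_superset[of "{u, w}"]) auto

lemma Sum_any_one: "(\<And>a. a \<noteq> u \<Longrightarrow> h a = 0) \<Longrightarrow> Sum_any h = h u"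
  by (subst Sum_any.expand_superset[of "{u}"]) auto

lemma mon_mult: "(mon c u \<star> g) e = c * g (e - u)"
  unfolding fd_mult_def by (subst Sum_any_one[of u]) (auto simp: mon_def)

lemma mult_mon: "(g \<star> mon c u) e = g (e - u) * c"
  unfolding fd_mult_def by (subst Sum_any_one[of "e - u"]) (auto simp: mon_def algebra_simps)

lemma mon_diff_mult:
  fixes g :: "'a::ring fdist"
  assumes "u \<noteq> w"
  shows "((mon c u - mon c' w) \<star> g) e = c * g (e - u) - c' * g (e - w)"
  unfolding fd_mult_def by (subst Sum_any_two[of u w]) (use assms in \<open>auto simp: mon_def\<close>)

lemma mult_mon_diff:
  fixes g :: "'a::ring fdist"
  assumes "u \<noteq> w"
  shows "(g \<star> (mon c u - mon c' w)) e = g (e - u) * c - g (e - w) * c'"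
  unfolding fd_mult_def
  by (subst Sum_any_two[of "e - u" "e - w"]) (use assms in \<open>auto simp: mon_def algebra_simps\<close>)

lemma expo_simps:
  "expo_scale k zz = (k, 0, 0)" "expo_scale k w1 = (0, k, 0)" "expo_scale k w2 = (0, 0, k)"
  "zz \<noteq> 0" "w1 \<noteq> 0" "w2 \<noteq> 0" "zz \<noteq> w1" "w1 \<noteq> zz"
  "(a, b, c) - (a', b', c') = (a - a', b - b', c - (c' :: int) :: int)" for a b c a' b' c' :: int
  by (auto simp: expo_scale_def zz_def w1_def w2_def zero_prod_def)

lemma ser_zz: "ser f zz (a, b, c) = (if b = 0 \<and> c = 0 then f a else 0)"
proof (cases "b = 0 \<and> c = 0")
  case True
  then show ?thesis using ser_scale[of zz f a] by (simp add: expo_simps)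
qed (use ser_outside[of "(a, b, c)" zz f] in \<open>auto simp: expo_simps\<close>)

lemma ser_w1: "ser f w1 (a, b, c) = (if a = 0 \<and> c = 0 then f b else 0)"
proof (cases "a = 0 \<and> c = 0")
  case True
  then show ?thesis using ser_scale[of w1 f b] by (simp add: expo_simps)
qed (use ser_outside[of "(a, b, c)" w1 f] in \<open>auto simp: expo_simps\<close>)

lemma mult_ser_zz: "(\<And>a b c. a \<noteq> 0 \<Longrightarrow> g (a, b, c) = 0) \<Longrightarrow> (g \<star> ser f zz) (a, b, c) = g (0, b, c) * f a"
  by (simp add: mult_ser expo_simps) (subst Sum_any_one[of a]; simp)

lemma mult_ser_w1: "(\<And>a b c. b \<noteq> 0 \<Longrightarrow> g (a, b, c) = 0) \<Longrightarrow> (g \<star> ser f w1) (a, b, c) = g (a, 0, c) * f b"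
  by (simp add: mult_ser expo_simps) (subst Sum_any_one[of b]; simp)

lemma mult_ser_w2: "(\<And>a b c. c \<noteq> 0 \<Longrightarrow> g (a, b, c) = 0) \<Longrightarrow> (g \<star> ser f w2) (a, b, c) = g (a, b, 0) * f c"
  by (simp add: mult_ser expo_simps) (subst Sum_any_one[of c]; simp)

lemma ser_zz_w1: "(ser f zz \<star> ser g w1) (a, b, c) = (if c = 0 then f a * g b else 0)"
  by (subst mult_ser_w1) (auto simp: ser_zz)

lemma ser_w1_zz: "(ser g w1 \<star> ser f zz) (a, b, c) = (if c = 0 then g b * f a else 0)"
  by (subst mult_ser_zz) (auto simp: ser_w1)

lemma ser_w1_w2_zz: "(ser f w1 \<star> ser g w2 \<star> ser h zz) (a, b, c) = f b * g c * h a"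
proof -
  have 1: "(ser f w1 \<star> ser g w2) (a, b, c) = (if a = 0 then f b * g c else 0)" for a b c
    by (subst mult_ser_w2) (auto simp: ser_w1)
  show ?thesis by (subst mult_ser_zz) (auto simp: 1)
qed

lemma ser_w1_zz_w2: "(cst t \<star> ser f w1 \<star> ser h zz \<star> ser g w2) (a, b, c) = t * f b * h a * g c"
proof -
  have 0: "(cst t \<star> ser f w1) (a, b, c) = (if a = 0 \<and> c = 0 then t * f b else 0)" for a b c
    by (simp add: mon_mult ser_w1)
  have 1: "(cst t \<star> ser f w1 \<star> ser h zz) (a, b, c) = (if c = 0 then t * f b * h a else 0)" for a b c
    by (subst mult_ser_zz) (auto simp: 0)
  show ?thesis by (subst mult_ser_w2) (auto simp: 1)
qed

lemma ser_zz_w1_w2: "(ser h zz \<star> ser f w1 \<star> ser g w2) (a, b, c) = h a * f b * g c"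
  by (subst mult_ser_w2) (auto simp: ser_zz_w1)

section \<open>Coefficients of the relations in two variables\<close>

lemma quadratic_zz_w1:
  fixes f g :: "int \<Rightarrow> 'a::ring_1"
  shows "((mon u zz - mon 1 w1) \<star> ser f zz \<star> ser g w1) (a, b, c)
    = (if c = 0 then u * f (a - 1) * g b - f a * g (b - 1) else 0)"
proof -
  have 1: "((mon u zz - mon 1 w1) \<star> ser f zz) (a, b, c)
      = (if c = 0 \<and> b = 0 then u * f (a - 1) else 0) - (if c = 0 \<and> b = 1 then f a else 0)" for a b c
    unfolding mon_diff_mult[OF expo_simps(7)] unfolding zz_def w1_def expo_simps(9) ser_zz[unfolded zz_def] by auto
  show ?thesis
    unfolding mult_ser[OF expo_simps(5)] expo_simps
    by (subst Sum_any_two[of b "b - 1"]; simp add: 1)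
qed

lemma quadratic_w1_zz:
  fixes f g :: "int \<Rightarrow> 'a::ring_1"
  shows "((mon u w1 - mon 1 zz) \<star> ser g w1 \<star> ser f zz) (a, b, c)
    = (if c = 0 then u * g (b - 1) * f a - g b * f (a - 1) else 0)"
proof -
  have 1: "((mon u w1 - mon 1 zz) \<star> ser g w1) (a, b, c)
      = (if c = 0 \<and> a = 0 then u * g (b - 1) else 0) - (if c = 0 \<and> a = 1 then g b else 0)" for a b c
    unfolding mon_diff_mult[OF expo_simps(8)] unfolding zz_def w1_def expo_simps(9) ser_w1[unfolded w1_def] by auto
  show ?thesis
    unfolding mult_ser[OF expo_simps(4)] expo_simps
    by (subst Sum_any_two[of a "a - 1"]; simp add: 1)
qed

lemma diag_nz: "zz + w1 \<noteq> 0" "w2 + zz \<noteq> 0" "expo_scale k (zz + w1) = (k, k, 0)" "expo_scale k (w2 + zz) = (k, 0, k)"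
  by (auto simp: expo_scale_def zz_def w1_def w2_def zero_prod_def)

lemma cst_ser_mult:
  assumes "u \<noteq> 0"
  shows "(cst s \<star> ser D u \<star> g) e = Sum_any (\<lambda>k. s * D k * g (e - expo_scale k u))"
proof -
  have "cst s \<star> ser D u = ser (\<lambda>k. s * D k) u"
  proof
    fix e show "(cst s \<star> ser D u) e = ser (\<lambda>k. s * D k) u e"
    proof (cases "\<exists>k. e = expo_scale k u")
      case True
      then show ?thesis using assms by (auto simp: mon_mult ser_scale)
    next
      case False
      then show ?thesis using ser_outside[of e u D] ser_outside[of e u "\<lambda>k. s * D k"] by (auto simp: mon_mult)
    qed
  qed
  then show ?thesis using assms by (simp add: ser_mult)
qed

text \<open>The power j of the delta series must be b to meet a series in z alone and a to meet a
  series in w alone. For a = b both conditions select the same j, which is why that case is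
  separate.\<close>

lemma commutator_rhs:
  fixes f g D :: "int \<Rightarrow> 'a::ring_1"
  shows "(cst s \<star> ser D (zz + w1) \<star> (cst k \<star> ser f zz - cst k' \<star> ser g w1)) (a, b, c)
    = (if c = 0 then s * D b * (k * f (a - b)) - s * D a * (k' * g (b - a)) else 0)"
proof -
  have 1: "(cst k \<star> ser f zz) (a, b, c) = (if b = 0 \<and> c = 0 then k * f a else 0)"
    "(cst k' \<star> ser g w1) (a, b, c) = (if a = 0 \<and> c = 0 then k' * g b else 0)" for a b c
    by (simp_all add: mon_mult ser_zz ser_w1)
  have 2: "(cst s \<star> ser D (zz + w1) \<star> (cst k \<star> ser f zz - cst k' \<star> ser g w1)) (a, b, c)
    = Sum_any (\<lambda>j. s * D j * ((if b - j = 0 \<and> c = 0 then k * f (a - j) else 0) - (if a - j = 0 \<and> c = 0 then k' * g (b - j) else 0)))"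
    by (simp add: cst_ser_mult diag_nz expo_simps 1)
  show ?thesis
  proof (cases "a = b")
    case True
    then show ?thesis unfolding 2 by (subst Sum_any_one[of b]) (simp_all add: algebra_simps)
  next
    case False
    then show ?thesis unfolding 2 by (subst Sum_any_two[of b a]) simp_all
  qed
qed

text \<open>Each linear factor shifts one exponent by 1. The delta series therefore meets the series
  in w with its powers a - 1 and a, and the series in z with its powers b - 1 and b. These index
  sets may overlap, so the two sums are separated before they are evaluated.\<close>

lemma middle_rhs:
  fixes f g D :: "int \<Rightarrow> 'a::ring_1"
  shows "(cst s \<star> ser D (zz + w1) \<star> ((mon 1 zz - mon v w1) \<star> cst k \<star> ser g w1 + (mon 1 w1 - mon v zz) \<star> cst k' \<star> ser f zz)) (a, b, c)
    = (if c = 0 then s * D (a - 1) * (k * g (b - a + 1)) - s * D a * (v * k * g (b - a - 1))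
         + s * D (b - 1) * (k' * f (a - b + 1)) - s * D b * (v * k' * f (a - b - 1)) else 0)"
proof -
  let ?h1 = "(mon 1 zz - mon v w1) \<star> cst k \<star> ser g w1" and ?h2 = "(mon 1 w1 - mon v zz) \<star> cst k' \<star> ser f zz"
  have 1: "((mon 1 zz - mon v w1) \<star> cst k) (a, b, c)
     = (if a = 1 \<and> b = 0 \<and> c = 0 then k else 0) - (if a = 0 \<and> b = 1 \<and> c = 0 then v * k else 0)" for a b c
    unfolding mult_mon by (auto simp: zz_def w1_def mon_def zero_prod_def)
  have 2: "((mon 1 w1 - mon v zz) \<star> cst k') (a, b, c)
     = (if a = 0 \<and> b = 1 \<and> c = 0 then k' else 0) - (if a = 1 \<and> b = 0 \<and> c = 0 then v * k' else 0)" for a b c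
    unfolding mult_mon by (auto simp: zz_def w1_def mon_def zero_prod_def)
  have h1: "?h1 (a, b, c) = (if a = 1 \<and> c = 0 then k * g b else 0) - (if a = 0 \<and> c = 0 then v * k * g (b - 1) else 0)" for a b c
    unfolding mult_ser[OF expo_simps(5)] expo_simps
    by (subst Sum_any_two[of b "b - 1"]; simp add: 1)
  have h2: "?h2 (a, b, c) = (if b = 1 \<and> c = 0 then k' * f a else 0) - (if b = 0 \<and> c = 0 then v * k' * f (a - 1) else 0)" for a b c
    unfolding mult_ser[OF expo_simps(4)] expo_simps
    by (subst Sum_any_two[of a "a - 1"]; simp add: 2)
  let ?A = "{a - 1, a}" and ?B = "{b - 1, b}"
  have "(cst s \<star> ser D (zz + w1) \<star> (?h1 + ?h2)) (a, b, c) = Sum_any (\<lambda>j. s * D j * ?h1 (a - j, b - j, c) + s * D j * ?h2 (a - j, b - j, c))"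
    by (simp add: cst_ser_mult diag_nz expo_simps distrib_left)
  also have "\<dots> = (\<Sum>j\<in>?A \<union> ?B. s * D j * ?h1 (a - j, b - j, c) + s * D j * ?h2 (a - j, b - j, c))"
    by (rule Sum_any.expand_superset) (auto simp: h1 h2)
  also have "\<dots> = (\<Sum>j\<in>?A. s * D j * ?h1 (a - j, b - j, c)) + (\<Sum>j\<in>?B. s * D j * ?h2 (a - j, b - j, c))"
    unfolding sum.distrib by (intro arg_cong2[where f="(+)"] sum.mono_neutral_right) (auto simp: h1 h2)
  finally have X: "(cst s \<star> ser D (zz + w1) \<star> (?h1 + ?h2)) (a, b, c)
    = (\<Sum>j\<in>?A. s * D j * ?h1 (a - j, b - j, c)) + (\<Sum>j\<in>?B. s * D j * ?h2 (a - j, b - j, c))" .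
  show ?thesis unfolding X by (cases "c = 0") (simp_all add: h1 h2 algebra_simps)
qed

section \<open>The exchange of \<open>w1\<close> and \<open>w2\<close>\<close>

definition fswap :: "'a fdist \<Rightarrow> 'a fdist" where
  "fswap f = (\<lambda>(a, b, c). f (a, c, b))"

definition eswap :: "expo \<Rightarrow> expo" where
  "eswap = (\<lambda>(a, b, c). (a, c, b))"

lemma fswap_alt: "fswap f e = f (eswap e)"
  by (cases e) (simp add: fswap_def eswap_def)

lemma eswap_simps [simp]: "eswap (eswap e) = e" "eswap (e + e') = eswap e + eswap e'" "eswap (e - e') = eswap e - eswap e'"
  "eswap w1 = w2" "eswap w2 = w1" "eswap zz = zz" "eswap 0 = 0"
  by (cases e; cases e'; simp add: eswap_def zz_def w1_def w2_def zero_prod_def)+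

lemma eswap_scale: "expo_scale k (eswap u) = eswap (expo_scale k u)"
  by (cases u) (simp add: eswap_def expo_scale_def)

lemma ser_fswap: "ser f (eswap u) = fswap (ser f u)"
  by (rule ext) (auto simp: ser_def fswap_alt eswap_scale, metis eswap_simps(1))

lemma mon_fswap: "mon c (eswap u) = fswap (mon c u)"
  by (rule ext) (auto simp: mon_def fswap_alt)

text \<open>The exchange is compatible with products, so the second half of each \<open>Sym\<close>
  is obtained from the first by exchanging the exponents of \<open>w1\<close> and \<open>w2\<close>;
  only one order has to be computed.\<close>

lemma fd_mult_fswap: "fswap f \<star> fswap g = fswap (f \<star> g)"
proof
  fix e
  have "Sum_any (\<lambda>a. f (eswap a) * g (eswap (e - a))) = Sum_any (\<lambda>a. f a * g (eswap e - a))"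
  proof (rule Sum_any.reindex_cong[symmetric])
    show "bij eswap" by (rule o_bij[of eswap]) (auto simp: fun_eq_iff)
  qed (simp add: comp_def)
  then show "(fswap f \<star> fswap g) e = fswap (f \<star> g) e"
    by (simp add: fd_mult_def fswap_alt)
qed

lemma fswap_add: "fswap f + fswap g = fswap (f + g :: 'a::plus fdist)"
  by (rule ext) (simp add: fswap_alt)

lemma fswap_diff: "fswap f - fswap g = fswap (f - g :: 'a::minus fdist)"
  by (rule ext) (simp add: fswap_alt)

text \<open>The index l is bounded above by the geometric series and below by the vanishing of T in
  negative degrees; counting by m = L - l gives a finite sum. The common bound M lets the two parts,
  which have different upper limits, be merged.\<close>

lemma Sum_any_descending:
  fixes X X' T :: "_ \<Rightarrow> 'a::ring"
  assumes T: "\<And>k. k < 0 \<Longrightarrow> T k = 0" and M: "nat L \<le> M" "nat L' \<le> M"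
  shows "Sum_any (\<lambda>l. ((if l \<le> L then X (nat (L - l)) else 0) - (if l \<le> L' then X' (nat (L' - l)) else 0)) * T l)
    = (\<Sum>m\<le>M. X m * T (L - int m) - X' m * T (L' - int m))"
proof -
  let ?A = "{0..int M}"
  have S: "(\<Sum>l\<in>?A. (if l \<le> K then Y (nat (K - l)) else 0) * T l) = (\<Sum>m\<le>M. Y m * T (K - int m))"
    if K: "nat K \<le> M" for K and Y :: "nat \<Rightarrow> 'a"
  proof -
    have "(\<Sum>l\<in>?A. (if l \<le> K then Y (nat (K - l)) else 0) * T l) = (\<Sum>l\<in>{0..K}. Y (nat (K - l)) * T l)"
      using K by (intro sum.mono_neutral_cong_right) auto
    also have "\<dots> = (\<Sum>m\<in>{m. int m \<le> K}. Y m * T (K - int m))"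
      by (rule sum.reindex_bij_witness[where j="\<lambda>l. nat (K - l)" and i="\<lambda>m. K - int m"]) auto
    also have "\<dots> = (\<Sum>m\<le>M. Y m * T (K - int m))"
      using K T by (intro sum.mono_neutral_left) auto
    finally show ?thesis .
  qed
  have "Sum_any (\<lambda>l. ((if l \<le> L then X (nat (L - l)) else 0) - (if l \<le> L' then X' (nat (L' - l)) else 0)) * T l)
    = (\<Sum>l\<in>?A. ((if l \<le> L then X (nat (L - l)) else 0) - (if l \<le> L' then X' (nat (L' - l)) else 0)) * T l)"
  proof (rule Sum_any.expand_superset)
    show "{l. ((if l \<le> L then X (nat (L - l)) else 0) - (if l \<le> L' then X' (nat (L' - l)) else 0)) * T l \<noteq> 0} \<subseteq> ?A"
    proof
      fix l assume "l \<in> {l. ((if l \<le> L then X (nat (L - l)) else 0) - (if l \<le> L' then X' (nat (L' - l)) else 0)) * T l \<noteq> 0}"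
      then have n: "((if l \<le> L then X (nat (L - l)) else 0) - (if l \<le> L' then X' (nat (L' - l)) else 0)) * T l \<noteq> 0" by simp
      have "0 \<le> l" using n T[of l] by (cases "l < 0") auto
      moreover have "l \<le> L \<or> l \<le> L'" using n by (auto split: if_splits)
      ultimately show "l \<in> ?A" using M by auto
    qed
  qed simp
  also have "\<dots> = (\<Sum>m\<le>M. X m * T (L - int m)) - (\<Sum>m\<le>M. X' m * T (L' - int m))"
    unfolding left_diff_distrib sum_subtractf S[OF M(1)] S[OF M(2)] ..
  finally show ?thesis by (simp add: sum_subtractf)
qed

text \<open>B is infinite in both directions, so finiteness rests on X alone, through the bound
  M.\<close>

lemma Sum_any_shifted:
  fixes X B :: "_ \<Rightarrow> 'a::ring"
  assumes "\<And>m. M < m \<Longrightarrow> X m = 0"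
  shows "Sum_any (\<lambda>k. (if k \<le> p then X (nat (p - k)) else 0) * B k) = (\<Sum>m\<le>M. X m * B (p - int m))"
    and "Sum_any (\<lambda>k. (if p \<le> k then X (nat (k - p)) else 0) * B k) = (\<Sum>m\<le>M. X m * B (p + int m))"
proof -
  have "Sum_any (\<lambda>k. (if k \<le> p then X (nat (p - k)) else 0) * B k) = (\<Sum>k\<in>{p - int M..p}. X (nat (p - k)) * B k)"
  proof (subst Sum_any.expand_superset[of "{p - int M..p}"])
    show "{a. (if a \<le> p then X (nat (p - a)) else 0) * B a \<noteq> 0} \<subseteq> {p - int M..p}"
    proof
      fix a assume "a \<in> {a. (if a \<le> p then X (nat (p - a)) else 0) * B a \<noteq> 0}"
      then have "a \<le> p" "X (nat (p - a)) \<noteq> 0" by (auto split: if_splits)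
      then show "a \<in> {p - int M..p}" using assms[of "nat (p - a)"] by (cases "M < nat (p - a)") auto
    qed
  qed (auto intro: sum.cong)
  also have "\<dots> = (\<Sum>m\<le>M. X m * B (p - int m))"
    by (rule sum.reindex_bij_witness[where j="\<lambda>k. nat (p - k)" and i="\<lambda>m. p - int m"]) auto
  finally show "Sum_any (\<lambda>k. (if k \<le> p then X (nat (p - k)) else 0) * B k) = (\<Sum>m\<le>M. X m * B (p - int m))" .
  have "Sum_any (\<lambda>k. (if p \<le> k then X (nat (k - p)) else 0) * B k) = (\<Sum>k\<in>{p..p + int M}. X (nat (k - p)) * B k)"
  proof (subst Sum_any.expand_superset[of "{p..p + int M}"])
    show "{a. (if p \<le> a then X (nat (a - p)) else 0) * B a \<noteq> 0} \<subseteq> {p..p + int M}"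
    proof
      fix a assume "a \<in> {a. (if p \<le> a then X (nat (a - p)) else 0) * B a \<noteq> 0}"
      then have "p \<le> a" "X (nat (a - p)) \<noteq> 0" by (auto split: if_splits)
      then show "a \<in> {p..p + int M}" using assms[of "nat (a - p)"] by (cases "M < nat (a - p)") auto
    qed
  qed (auto intro: sum.cong)
  also have "\<dots> = (\<Sum>m\<le>M. X m * B (p + int m))"
    by (rule sum.reindex_bij_witness[where j="\<lambda>k. nat (k - p)" and i="\<lambda>m. p + int m"]) auto
  finally show "Sum_any (\<lambda>k. (if p \<le> k then X (nat (k - p)) else 0) * B k) = (\<Sum>m\<le>M. X m * B (p + int m))" .
qed

section \<open>The four correction terms of the Serre relation for the middle nodes\<close>

lemma ser_diag: "ser D (w2 + zz) (a, b, c) = (if b = 0 \<and> a = c then D a else 0)"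
proof (cases "b = 0 \<and> a = c")
  case True
  then show ?thesis using ser_scale[of "w2 + zz" D a] by (simp add: diag_nz)
qed (use ser_outside[of "(a, b, c)" "w2 + zz" D] in \<open>auto simp: diag_nz\<close>)

lemma ratio_expo:
  "expo_scale k (w1 - w2) = (0, k, - k)" "expo_scale k (w2 - w1) = (0, - k, k)" "w1 - w2 \<noteq> 0" "w2 - w1 \<noteq> 0"
  "0 \<noteq> zz - w2" "zz - w1 \<noteq> w2 - w1" "w2 - w1 \<noteq> zz - w1"
  "zz - w2 = (1, 0, -1)" "zz - w1 = (1, -1, 0)" "w2 - w1 = (0, -1, 1)" "(0 :: expo) = (0, 0, 0)"
  by (auto simp: expo_scale_def zz_def w1_def w2_def zero_prod_def)

text \<open>The geometric factor raises \<open>w1\<close> and lowers \<open>w2\<close> by the same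
  amount, so its power is the exponent b of \<open>w1\<close>. The other two factors leave for a - c
  - b only the values 0 and 2.\<close>

lemma kernel_down:
  fixes D :: "int \<Rightarrow> 'a::ring_1"
  shows "(ser D (w2 + zz) \<star> (cst 1 - mon v (zz - w2)) \<star> geom \<gamma> (w1 - w2)) (a, b, c)
    = (if 0 \<le> b then ((if a = c + b then D a else 0) - (if a = c + b + 2 then D (a - 1) * v else 0)) * \<gamma> ^ nat b else 0)"
proof -
  have 1: "(ser D (w2 + zz) \<star> (cst 1 - mon v (zz - w2))) (a, b, c)
    = (if b = 0 then (if a = c then D a else 0) - (if a = c + 2 then D (a - 1) * v else 0) else 0)" for a b c
    unfolding mult_mon_diff[OF ratio_expo(5)] unfolding ratio_expo(8,11) expo_simps(9) ser_diag by auto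
  show ?thesis unfolding geom_def mult_ser[OF ratio_expo(3)] ratio_expo(1) expo_simps(9) 1
    by (subst Sum_any_one[of b]) auto
qed

text \<open>Both monomials of the numerator lower \<open>w1\<close> once before the geometric factor
  lowers it further, so the power of the latter is - 1 - b.\<close>

lemma kernel_up:
  fixes D :: "int \<Rightarrow> 'a::ring_1"
  shows "(ser D (w2 + zz) \<star> (mon u (zz - w1) - mon v (w2 - w1)) \<star> geom \<gamma> (w2 - w1)) (a, b, c)
    = (if b \<le> -1 then ((if a = c + b + 2 then D (a - 1) * u else 0) - (if a = c + b then D a * v else 0)) * \<gamma> ^ nat (- 1 - b) else 0)"
proof -
  have 1: "(ser D (w2 + zz) \<star> (mon u (zz - w1) - mon v (w2 - w1))) (a, b, c)
    = (if b = -1 then (if a = c + 1 then D (a - 1) * u else 0) - (if a = c - 1 then D a * v else 0) else 0)" for a b c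
    unfolding mult_mon_diff[OF ratio_expo(6)] unfolding ratio_expo(9,10) expo_simps(9) ser_diag by auto
  show ?thesis unfolding geom_def mult_ser[OF ratio_expo(4)] ratio_expo(2) expo_simps(9) 1
    by (subst Sum_any_one[of "-1 - b"]) auto
qed

lemma kernel_up':
  fixes D :: "int \<Rightarrow> 'a::ring_1"
  shows "(ser D (w2 + zz) \<star> (mon v (w2 - w1) - mon u (zz - w1)) \<star> geom \<gamma> (w2 - w1)) (a, b, c)
    = (if b \<le> -1 then ((if a = c + b then D a * v else 0) - (if a = c + b + 2 then D (a - 1) * u else 0)) * \<gamma> ^ nat (- 1 - b) else 0)"
proof -
  have 1: "(ser D (w2 + zz) \<star> (mon v (w2 - w1) - mon u (zz - w1))) (a, b, c)
    = (if b = -1 then (if a = c - 1 then D a * v else 0) - (if a = c + 1 then D (a - 1) * u else 0) else 0)" for a b c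
    unfolding mult_mon_diff[OF ratio_expo(7)] unfolding ratio_expo(9,10) expo_simps(9) ser_diag by auto
  show ?thesis unfolding geom_def mult_ser[OF ratio_expo(4)] ratio_expo(2) expo_simps(9) 1
    by (subst Sum_any_one[of "-1 - b"]) auto
qed

text \<open>The four terms place B, Theta and K in different orders and the products are bracketed
  to the left, so each order is summed separately. In all of them the vanishing of T in negative
  degrees cuts the geometric series off, and any large enough M may serve as the limit.\<close>

lemma serre_term1:
  fixes D B T :: "int \<Rightarrow> 'a::ring_1"
  assumes "\<And>k. k < 0 \<Longrightarrow> T k = 0" and "nat (z - s) \<le> M"
  shows "(ser D (w2 + zz) \<star> (cst 1 - mon v (zz - w2)) \<star> geom \<gamma> (w1 - w2) \<star> ser B w1 \<star> ser T zz \<star> cst K) (z, p, s)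
    = (\<Sum>m\<le>M. D (s + int m) * \<gamma> ^ m * B (p - int m) * T (z - s - int m)
        - D (s + int m + 1) * v * \<gamma> ^ m * B (p - int m) * T (z - s - 2 - int m)) * K"
proof -
  let ?X = "\<lambda>m. D (s + int m) * \<gamma> ^ m * B (p - int m)" and ?X' = "\<lambda>m. D (s + int m + 1) * v * \<gamma> ^ m * B (p - int m)"
  have 3: "(ser D (w2 + zz) \<star> (cst 1 - mon v (zz - w2)) \<star> geom \<gamma> (w1 - w2) \<star> ser B w1) (a, p, s)
    = (if s \<le> a then ?X (nat (a - s)) else 0) - (if s \<le> a - 2 then ?X' (nat (a - 2 - s)) else 0)" for a
    unfolding mult_ser[OF expo_simps(5)] expo_simps kernel_down
    by (subst Sum_any_two[of "p - (a - s)" "p - (a - 2 - s)"]) (auto simp: algebra_simps)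
  have "(ser D (w2 + zz) \<star> (cst 1 - mon v (zz - w2)) \<star> geom \<gamma> (w1 - w2) \<star> ser B w1 \<star> ser T zz) (z, p, s)
    = Sum_any (\<lambda>l. ((if l \<le> z - s then ?X (nat (z - s - l)) else 0) - (if l \<le> z - s - 2 then ?X' (nat (z - s - 2 - l)) else 0)) * T l)"
    unfolding mult_ser[OF expo_simps(4)] expo_simps diff_zero 3
    by (intro Sum_any.cong) (simp add: algebra_simps)
  also have "\<dots> = (\<Sum>m\<le>M. ?X m * T (z - s - int m) - ?X' m * T (z - s - 2 - int m))"
    by (rule Sum_any_descending) (use assms in auto)
  finally show ?thesis by (simp add: mult_mon)
qed

lemma serre_term2:
  fixes D B T :: "int \<Rightarrow> 'a::ring_1"
  assumes "\<And>k. k < 0 \<Longrightarrow> T k = 0" and "nat (z - s) \<le> M"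
  shows "(ser D (w2 + zz) \<star> (cst 1 - mon v (zz - w2)) \<star> geom \<gamma> (w1 - w2) \<star> ser T zz \<star> cst K \<star> ser B w1) (z, p, s)
    = (\<Sum>m\<le>M. (D (s + int m) * \<gamma> ^ m * T (z - s - int m)
        - D (s + int m + 1) * v * \<gamma> ^ m * T (z - s - 2 - int m)) * K * B (p - int m))"
proof -
  let ?X = "\<lambda>m. (D (s + int m) * \<gamma> ^ m * T (z - s - int m) - D (s + int m + 1) * v * \<gamma> ^ m * T (z - s - 2 - int m)) * K"
  have 3: "(ser D (w2 + zz) \<star> (cst 1 - mon v (zz - w2)) \<star> geom \<gamma> (w1 - w2) \<star> ser T zz) (z, b, s)
    = (if 0 \<le> b then D (s + b) * \<gamma> ^ nat b * T (z - s - b) - D (s + b + 1) * v * \<gamma> ^ nat b * T (z - s - 2 - b) else 0)" for b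
    unfolding mult_ser[OF expo_simps(4)] expo_simps kernel_down
    by (subst Sum_any_two[of "z - s - b" "z - s - 2 - b"]) (auto simp: algebra_simps)
  have "(ser D (w2 + zz) \<star> (cst 1 - mon v (zz - w2)) \<star> geom \<gamma> (w1 - w2) \<star> ser T zz \<star> cst K \<star> ser B w1) (z, p, s)
    = Sum_any (\<lambda>k. (if k \<le> p then ?X (nat (p - k)) else 0) * B k)"
    unfolding mult_ser[OF expo_simps(5)] expo_simps mult_mon diff_zero 3
    by (intro Sum_any.cong) auto
  also have "\<dots> = (\<Sum>m\<le>M. ?X m * B (p - int m))"
    by (rule Sum_any_shifted(1)) (use assms in auto)
  finally show ?thesis .
qed

lemma serre_term3:
  fixes D B T :: "int \<Rightarrow> 'a::ring_1"
  assumes "\<And>k. k < 0 \<Longrightarrow> T k = 0" and "nat (s - z + 1) \<le> M"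
  shows "(ser D (w2 + zz) \<star> (mon u (zz - w1) - mon v (w2 - w1)) \<star> geom \<gamma> (w2 - w1) \<star> ser B w1 \<star> ser T w2 \<star> cst K) (z, p, s)
    = (\<Sum>m\<le>M. D (z - 1) * u * \<gamma> ^ m * B (p + 1 + int m) * T (s - z + 1 - int m)
        - D z * v * \<gamma> ^ m * B (p + 1 + int m) * T (s - z - 1 - int m)) * K"
proof -
  let ?X = "\<lambda>m. D (z - 1) * u * \<gamma> ^ m * B (p + 1 + int m)" and ?X' = "\<lambda>m. D z * v * \<gamma> ^ m * B (p + 1 + int m)"
  have 3: "(ser D (w2 + zz) \<star> (mon u (zz - w1) - mon v (w2 - w1)) \<star> geom \<gamma> (w2 - w1) \<star> ser B w1) (z, p, c)
    = (if 0 \<le> c - z + 1 then ?X (nat (c - z + 1)) else 0) - (if 0 \<le> c - z - 1 then ?X' (nat (c - z - 1)) else 0)" for c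
    unfolding mult_ser[OF expo_simps(5)] expo_simps kernel_up
    by (subst Sum_any_two[of "p + 1 + (c - z + 1)" "p + 1 + (c - z - 1)"]) (auto simp: algebra_simps)
  have "(ser D (w2 + zz) \<star> (mon u (zz - w1) - mon v (w2 - w1)) \<star> geom \<gamma> (w2 - w1) \<star> ser B w1 \<star> ser T w2) (z, p, s)
    = Sum_any (\<lambda>l. ((if l \<le> s - z + 1 then ?X (nat (s - z + 1 - l)) else 0) - (if l \<le> s - z - 1 then ?X' (nat (s - z - 1 - l)) else 0)) * T l)"
    unfolding mult_ser[OF expo_simps(6)] expo_simps diff_zero 3
    by (intro Sum_any.cong) (simp add: algebra_simps)
  also have "\<dots> = (\<Sum>m\<le>M. ?X m * T (s - z + 1 - int m) - ?X' m * T (s - z - 1 - int m))"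
    by (rule Sum_any_descending) (use assms in auto)
  finally show ?thesis by (simp add: mult_mon)
qed

lemma serre_term4:
  fixes D B T :: "int \<Rightarrow> 'a::ring_1"
  assumes "\<And>k. k < 0 \<Longrightarrow> T k = 0" and "nat (s - z + 1) \<le> M"
  shows "(ser D (w2 + zz) \<star> (mon v (w2 - w1) - mon u (zz - w1)) \<star> geom \<gamma> (w2 - w1) \<star> ser T w2 \<star> cst K \<star> ser B w1) (z, p, s)
    = (\<Sum>m\<le>M. (D z * v * \<gamma> ^ m * T (s - z - 1 - int m)
        - D (z - 1) * u * \<gamma> ^ m * T (s - z + 1 - int m)) * K * B (p + 1 + int m))"
proof -
  let ?X = "\<lambda>m. (D z * v * \<gamma> ^ m * T (s - z - 1 - int m) - D (z - 1) * u * \<gamma> ^ m * T (s - z + 1 - int m)) * K"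
  have 3: "(ser D (w2 + zz) \<star> (mon v (w2 - w1) - mon u (zz - w1)) \<star> geom \<gamma> (w2 - w1) \<star> ser T w2) (z, b, s)
    = (if b \<le> -1 then D z * v * \<gamma> ^ nat (- 1 - b) * T (s - z + b) - D (z - 1) * u * \<gamma> ^ nat (- 1 - b) * T (s - z + b + 2) else 0)" for b
    unfolding mult_ser[OF expo_simps(6)] expo_simps kernel_up'
    by (subst Sum_any_two[of "s - z + b" "s - z + b + 2"]) (auto simp: algebra_simps)
  have "(ser D (w2 + zz) \<star> (mon v (w2 - w1) - mon u (zz - w1)) \<star> geom \<gamma> (w2 - w1) \<star> ser T w2 \<star> cst K \<star> ser B w1) (z, p, s)
    = Sum_any (\<lambda>k. (if p + 1 \<le> k then ?X (nat (k - (p + 1))) else 0) * B k)"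
    unfolding mult_ser[OF expo_simps(5)] expo_simps mult_mon diff_zero 3
    by (intro Sum_any.cong) (auto simp: algebra_simps)
  also have "\<dots> = (\<Sum>m\<le>M. ?X m * B (p + 1 + int m))"
    by (rule Sum_any_shifted(2)) (use assms in auto)
  finally show ?thesis .
qed

section \<open>Representations by operators on families of functions\<close>

lemma coeffF_simps: "coeffF (a + b) = coeffF a + coeffF b" "coeffF (a * b) = coeffF a * coeffF b"
  "coeffF 0 = 0" "coeffF 1 = 1" "coeffF (- a) = - coeffF a" "coeffF (a - b) = coeffF a - coeffF b"
  by (simp_all add: coeffF_def single_add mult_single single_uminus single_diff flip: to_fract_add to_fract_mult to_fract_uminus to_fract_diff)

lemma coeffF_eq_0_iff: "coeffF a = 0 \<longleftrightarrow> a = 0"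
proof -
  have "Poly_Mapping.single (0 :: nat \<Rightarrow>\<^sub>0 int) a = 0 \<longleftrightarrow> a = 0"
    by (metis lookup_single_eq lookup_zero single_zero)
  then show ?thesis by (simp add: coeffF_def)
qed

lemma coeffF_inverse: "coeffF (inverse a) = inverse (coeffF a)"
proof (cases "a = 0")
  case False
  then have "coeffF a * coeffF (inverse a) = 1" by (simp add: coeffF_simps flip: coeffF_simps(2))
  then show ?thesis by (metis inverse_unique)
qed (simp add: coeffF_simps)

lemma coeffF_power: "coeffF (a ^ k) = coeffF a ^ k"
  by (induction k) (simp_all add: coeffF_simps)

lemma coeffF_power_int: "coeffF (a powi k) = coeffF a powi k"
  by (simp add: power_int_def coeffF_power coeffF_inverse)

definition fscale :: "Cq \<Rightarrow> ('b \<Rightarrow> rfun) \<Rightarrow> 'b \<Rightarrow> rfun" where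
  "fscale c F = (\<lambda>v. coeffF c * F v)"

definition fcarrier :: "nat \<Rightarrow> falg set" where
  "fcarrier n = {f. \<forall>w \<in> Poly_Mapping.keys f. set (letters w) \<subseteq> gens n}"

lemma fcarrier_add: "f \<in> fcarrier n \<Longrightarrow> g \<in> fcarrier n \<Longrightarrow> f + g \<in> fcarrier n"
  using Poly_Mapping.keys_add[of f g] by (auto simp: fcarrier_def)

lemma fcarrier_uminus: "f \<in> fcarrier n \<Longrightarrow> - f \<in> fcarrier n"
  by (auto simp: fcarrier_def in_keys_iff)

lemma fcarrier_diff: "f \<in> fcarrier n \<Longrightarrow> g \<in> fcarrier n \<Longrightarrow> f - g \<in> fcarrier n"
  using fcarrier_add[of f n "- g"] fcarrier_uminus[of g n] by simp

lemma fcarrier_mult: "f \<in> fcarrier n \<Longrightarrow> g \<in> fcarrier n \<Longrightarrow> f * g \<in> fcarrier n"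
  using Poly_Mapping.keys_mult[of f g] by (fastforce simp: fcarrier_def plus_fword_def)

lemma fcarrier_zero: "0 \<in> fcarrier n"
  by (simp add: fcarrier_def)

lemma fcarrier_single: "set (letters w) \<subseteq> gens n \<Longrightarrow> Poly_Mapping.single w c \<in> fcarrier n"
  by (auto simp: fcarrier_def)

lemma fcarrier_sc: "sc c \<in> fcarrier n"
  unfolding sc_def by (rule fcarrier_single) (simp add: zero_fword_def)

lemma fcarrier_one: "1 \<in> fcarrier n"
  using fcarrier_sc[of 1] by (simp add: sc_def)

lemma fcarrier_gn: "g \<in> gens n \<Longrightarrow> gn g \<in> fcarrier n"
  unfolding gn_def by (rule fcarrier_single) simp

lemma fcarrier_power: "f \<in> fcarrier n \<Longrightarrow> f ^ k \<in> fcarrier n"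
  by (induction k) (auto intro: fcarrier_one fcarrier_mult)

lemma fcarrier_Sum_any: "(\<And>a. h a \<in> fcarrier n) \<Longrightarrow> Sum_any h \<in> fcarrier n"
proof -
  assume h: "\<And>a. h a \<in> fcarrier n"
  have "sum h A \<in> fcarrier n" for A
    by (induction A rule: infinite_finite_induct) (auto intro: fcarrier_zero fcarrier_add h)
  then show ?thesis by (simp add: Sum_any.expand_set)
qed

lemma free_algebra_simps [simp]:
  "carrier (free_algebra n) = fcarrier n" "mult (free_algebra n) = (*)" "one (free_algebra n) = 1"
  "zero (free_algebra n) = 0" "add (free_algebra n) = (+)"
  by (simp_all add: free_algebra_def fcarrier_def)

lemma ring_free_algebra: "ring (free_algebra n)"
proof (rule ringI)
  show "abelian_group (free_algebra n)"
    by (rule abelian_groupI) (auto intro: fcarrier_add fcarrier_zero simp: add.assoc add.commute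
        intro!: bexI[of _ "- _"] fcarrier_uminus)
  show "Group.monoid (free_algebra n)"
    by (rule monoidI) (auto intro: fcarrier_mult fcarrier_one simp: mult.assoc)
qed (auto simp: distrib_left distrib_right)

definition fdc :: "nat \<Rightarrow> falg fdist \<Rightarrow> bool" where
  "fdc n f \<longleftrightarrow> (\<forall>e. f e \<in> fcarrier n)"

lemma fdc_add: "fdc n f \<Longrightarrow> fdc n g \<Longrightarrow> fdc n (f + g)"
  by (simp add: fdc_def fcarrier_add)

lemma fdc_diff: "fdc n f \<Longrightarrow> fdc n g \<Longrightarrow> fdc n (f - g)"
  by (simp add: fdc_def fcarrier_diff)

lemma fdc_addD: "fdc n f \<Longrightarrow> fdc n g \<Longrightarrow> (f + g) e \<in> fcarrier n"
  using fdc_add[of n f g] unfolding fdc_def[of n "f + g"] by blast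

lemma fdc_diffD: "fdc n f \<Longrightarrow> fdc n g \<Longrightarrow> (f - g) e \<in> fcarrier n"
  using fdc_diff[of n f g] unfolding fdc_def[of n "f - g"] by blast

lemma fdc_mult: "fdc n f \<Longrightarrow> fdc n g \<Longrightarrow> fdc n (f \<star> g)"
  unfolding fdc_def fd_mult_def by (auto intro!: fcarrier_Sum_any fcarrier_mult)

lemma fdc_mon: "c \<in> fcarrier n \<Longrightarrow> fdc n (mon c u)"
  by (simp add: fdc_def mon_def fcarrier_zero)

lemma fdc_ser: "(\<And>k. f k \<in> fcarrier n) \<Longrightarrow> fdc n (ser f u)"
  unfolding fdc_def ser_def by (auto intro!: fcarrier_Sum_any fcarrier_zero)

lemma fdc_geom: "c \<in> fcarrier n \<Longrightarrow> fdc n (geom c u)"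
  unfolding geom_def by (rule fdc_ser) (auto intro: fcarrier_power fcarrier_zero)

lemma gens_mem: "i \<in> idx n \<Longrightarrow> GB i l \<in> gens n" "i \<in> idx n \<Longrightarrow> 0 < m \<Longrightarrow> GTheta i m \<in> gens n"
  "i \<in> idx n \<Longrightarrow> GK i \<in> gens n" "i \<in> idx n \<Longrightarrow> GKinv i \<in> gens n" "GC \<in> gens n" "GCinv \<in> gens n"
  by (auto simp: gens_def)

lemma tau_idx: "i \<in> idx n \<Longrightarrow> tau n i \<in> idx n"
  by (auto simp: idx_def tau_def)

lemma fcarrier_Theta: "i \<in> idx n \<Longrightarrow> Theta_coeff i k \<in> fcarrier n"
  by (auto simp: Theta_coeff_def intro!: fcarrier_zero fcarrier_one fcarrier_mult fcarrier_sc fcarrier_gn gens_mem)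

lemma fcarrier_Cpow: "Cpow k \<in> fcarrier n"
  by (auto simp: Cpow_def intro!: fcarrier_power fcarrier_gn gens_mem)

lemmas fdc_intros = fdc_add fdc_diff fdc_mult fdc_mon fdc_ser fdc_geom fcarrier_sc fcarrier_one fcarrier_mult
  fcarrier_gn gens_mem tau_idx fcarrier_Theta fcarrier_Cpow

lemma relators_carrier: "relators n \<subseteq> fcarrier n"
proof
  fix r assume "r \<in> relators n"
  then show "r \<in> fcarrier n"
    by cases (simp only: Bs_def Ths_def Deltas_def vp_def Serre_def Sym_def;
        intro fdc_addD fdc_diffD fcarrier_diff fdc_intros; assumption)+
qed

section \<open>Operators for the generators, extended to the free algebra\<close>

locale op_family =
  fixes G :: "gen \<Rightarrow> ('b \<Rightarrow> rfun) \<Rightarrow> 'b \<Rightarrow> rfun"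
  assumes G_add: "G g (\<lambda>v. F v + F' v) = (\<lambda>v. G g F v + G g F' v)"
    and G_scale: "G g (fscale c F) = fscale c (G g F)"
begin

text \<open>The last letter acts first, so that concatenation of words becomes composition of
  operators.\<close>

definition wact :: "gen fword \<Rightarrow> ('b \<Rightarrow> rfun) \<Rightarrow> 'b \<Rightarrow> rfun" where
  "wact w F = foldr G (letters w) F"

definition Ev :: "falg \<Rightarrow> ('b \<Rightarrow> rfun) \<Rightarrow> 'b \<Rightarrow> rfun" where
  "Ev f F = (\<lambda>v. \<Sum>w\<in>Poly_Mapping.keys f. coeffF (Poly_Mapping.lookup f w) * wact w F v)"

lemma wact_plus: "wact (u + w) F = wact u (wact w F)"
  by (simp add: wact_def plus_fword_def)

lemma wact_zero: "wact 0 F = F"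
  by (simp add: wact_def zero_fword_def)

lemma wact_add: "wact w (\<lambda>v. F v + F' v) = (\<lambda>v. wact w F v + wact w F' v)"
proof -
  have "foldr G l (\<lambda>v. F v + F' v) = (\<lambda>v. foldr G l F v + foldr G l F' v)" for l
    by (induction l) (simp_all add: G_add)
  then show ?thesis by (simp add: wact_def)
qed

lemma wact_scale: "wact w (fscale c F) = fscale c (wact w F)"
proof -
  have "foldr G l (fscale c F) = fscale c (foldr G l F)" for l
    by (induction l) (simp_all add: G_scale)
  then show ?thesis by (simp add: wact_def)
qed

lemma Ev_superset:
  assumes "finite S" "Poly_Mapping.keys f \<subseteq> S"
  shows "Ev f F v = (\<Sum>w\<in>S. coeffF (Poly_Mapping.lookup f w) * wact w F v)"
  unfolding Ev_def using assms
  by (intro sum.mono_neutral_left) (auto simp: in_keys_iff coeffF_simps)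

lemma Ev_add: "Ev (f + g) F v = Ev f F v + Ev g F v"
proof -
  let ?S = "Poly_Mapping.keys f \<union> Poly_Mapping.keys g"
  have "Ev (f + g) F v = (\<Sum>w\<in>?S. coeffF (Poly_Mapping.lookup (f + g) w) * wact w F v)"
    by (rule Ev_superset) (use Poly_Mapping.keys_add[of f g] in auto)
  then show ?thesis
    using Ev_superset[of ?S f F v] Ev_superset[of ?S g F v]
    by (simp add: lookup_add coeffF_simps distrib_right sum.distrib)
qed

lemma Ev_zero: "Ev 0 F v = 0"
  by (simp add: Ev_def)

lemma Ev_uminus: "Ev (- f) F v = - Ev f F v"
  using Ev_add[of f "- f" F v] by (simp add: Ev_zero add_eq_0_iff)

lemma Ev_diff: "Ev (f - g) F v = Ev f F v - Ev g F v"
  using Ev_add[of f "- g" F v] by (simp add: Ev_uminus)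

lemma Ev_sum: "Ev (sum f A) F v = (\<Sum>a\<in>A. Ev (f a) F v)"
  by (induction A rule: infinite_finite_induct) (simp_all add: Ev_zero Ev_add)

lemma Ev_single: "Ev (Poly_Mapping.single w c) F v = coeffF c * wact w F v"
  by (subst Ev_superset[of "{w}"]) auto

lemma Ev_gn: "Ev (gn g) F = G g F"
  by (rule ext) (simp add: gn_def Ev_single coeffF_simps wact_def)

lemma Ev_sc: "Ev (sc c) F v = coeffF c * F v"
  by (simp add: sc_def Ev_single wact_zero)

lemma Ev_one: "Ev 1 F = F"
  using Ev_sc[of 1] by (auto simp: sc_def coeffF_simps)

lemma Ev_add_right: "Ev f (\<lambda>v. F v + F' v) v = Ev f F v + Ev f F' v"
  by (simp add: Ev_def wact_add distrib_left sum.distrib)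

lemma Ev_scale_right: "Ev f (fscale c F) = fscale c (Ev f F)"
  by (rule ext) (simp add: Ev_def wact_scale, simp add: fscale_def sum_distrib_left mult_ac)

lemma Ev_zero_right: "Ev f (\<lambda>v. 0) v = 0"
  using Ev_scale_right[of f 0 "\<lambda>v. 0"] by (simp add: fscale_def coeffF_simps fun_eq_iff)

lemma Ev_sum_right: "Ev f (\<lambda>v. \<Sum>a\<in>A. F a v) v = (\<Sum>a\<in>A. Ev f (F a) v)"
proof (induction A arbitrary: v rule: infinite_finite_induct)
  case (insert a A)
  then show ?case using Ev_add_right[of f "F a" "\<lambda>v. \<Sum>a\<in>A. F a v" v] by simp
qed (simp_all add: Ev_zero_right)

lemma falg_expand: "(f :: falg) = (\<Sum>w\<in>Poly_Mapping.keys f. Poly_Mapping.single w (Poly_Mapping.lookup f w))"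
  by (rule poly_mapping_eqI) (auto simp: lookup_sum lookup_single when_def in_keys_iff)

lemma Ev_mult: "Ev (f * g) F = Ev f (Ev g F)"
proof
  fix v
  have s: "Ev (Poly_Mapping.single u a * g) F v = coeffF a * wact u (Ev g F) v" for u a
  proof -
    have "Poly_Mapping.single u a * g = (\<Sum>w\<in>Poly_Mapping.keys g. Poly_Mapping.single u a * Poly_Mapping.single w (Poly_Mapping.lookup g w))"
      by (subst falg_expand[of g]) (rule sum_distrib_left)
    also have "\<dots> = (\<Sum>w\<in>Poly_Mapping.keys g. Poly_Mapping.single (u + w) (a * Poly_Mapping.lookup g w))"
      by (simp add: mult_single)
    finally have "Ev (Poly_Mapping.single u a * g) F v
      = (\<Sum>w\<in>Poly_Mapping.keys g. coeffF a * (coeffF (Poly_Mapping.lookup g w) * wact u (wact w F) v))"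
      by (simp add: Ev_sum Ev_single wact_plus coeffF_simps mult.assoc)
    also have "\<dots> = coeffF a * (\<Sum>w\<in>Poly_Mapping.keys g. wact u (fscale (Poly_Mapping.lookup g w) (wact w F)) v)"
      unfolding wact_scale by (simp add: fscale_def sum_distrib_left)
    also have "(\<Sum>w\<in>Poly_Mapping.keys g. wact u (fscale (Poly_Mapping.lookup g w) (wact w F)) v) = wact u (Ev g F) v"
      using Ev_sum_right[of "Poly_Mapping.single u 1" "\<lambda>w. fscale (Poly_Mapping.lookup g w) (wact w F)" "Poly_Mapping.keys g" v]
      by (simp add: Ev_single coeffF_simps Ev_def fscale_def)
    finally show ?thesis .
  qed
  have "f * g = (\<Sum>u\<in>Poly_Mapping.keys f. Poly_Mapping.single u (Poly_Mapping.lookup f u) * g)"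
    by (subst falg_expand[of f]) (rule sum_distrib_right)
  then show "Ev (f * g) F v = Ev f (Ev g F) v"
    by (simp add: Ev_sum s) (simp add: Ev_def[of f])
qed

end

text \<open>Relations are checked on families of functions, whereas the module consists of vectors.
  E and D are mutually inverse identifications of M with the space Q of admissible families; the
  operators are defined on all families, but the relators have to annihilate Q only.\<close>

locale transported_rep = op_family G for G :: "gen \<Rightarrow> ('b \<Rightarrow> rfun) \<Rightarrow> 'b \<Rightarrow> rfun" +
  fixes n :: nat and Q :: "('b \<Rightarrow> rfun) set" and M :: "pvec set"
    and E :: "pvec \<Rightarrow> 'b \<Rightarrow> rfun" and D :: "('b \<Rightarrow> rfun) \<Rightarrow> pvec"
  assumes Q_add: "F \<in> Q \<Longrightarrow> F' \<in> Q \<Longrightarrow> (\<lambda>v. F v + F' v) \<in> Q"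
    and Q_scale: "F \<in> Q \<Longrightarrow> fscale c F \<in> Q"
    and Q_zero: "(\<lambda>v. 0) \<in> Q"
    and Q_G: "g \<in> gens n \<Longrightarrow> F \<in> Q \<Longrightarrow> G g F \<in> Q"
    and E_mem: "m \<in> M \<Longrightarrow> E m \<in> Q" and D_mem: "F \<in> Q \<Longrightarrow> D F \<in> M"
    and DE: "m \<in> M \<Longrightarrow> D (E m) = m" and ED: "F \<in> Q \<Longrightarrow> E (D F) = F"
    and D_add: "D (\<lambda>v. F v + F' v) = D F + D F'" and D_scale: "D (fscale c F) = pscale c (D F)"
    and relators: "r \<in> relators n \<Longrightarrow> F \<in> Q \<Longrightarrow> Ev r F = (\<lambda>v. 0)"
begin

lemma Ev_Q: "f \<in> fcarrier n \<Longrightarrow> F \<in> Q \<Longrightarrow> Ev f F \<in> Q"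
proof -
  assume f: "f \<in> fcarrier n" and F: "F \<in> Q"
  have w: "wact w F \<in> Q" if "w \<in> Poly_Mapping.keys f" for w
  proof -
    have "set l \<subseteq> gens n \<Longrightarrow> foldr G l F \<in> Q" for l
      by (induction l) (auto simp: F Q_G)
    then show ?thesis using f that by (auto simp: fcarrier_def wact_def)
  qed
  have "(\<lambda>v. \<Sum>w\<in>A. fscale (Poly_Mapping.lookup f w) (wact w F) v) \<in> Q" if "A \<subseteq> Poly_Mapping.keys f" for A
    using that
  proof (induction A rule: infinite_finite_induct)
    case (insert w A)
    then show ?case using Q_add[OF Q_scale[OF w]] by simp
  qed (simp_all add: Q_zero)
  from this[OF order_refl] show "Ev f F \<in> Q" by (simp add: Ev_def fscale_def)
qed

text \<open>Linearity of E on M is inherited from that of its inverse D, and so is the closure of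
  M.\<close>

lemma E_add: "m \<in> M \<Longrightarrow> m' \<in> M \<Longrightarrow> E (m + m') = (\<lambda>v. E m v + E m' v)"
  and M_add: "m \<in> M \<Longrightarrow> m' \<in> M \<Longrightarrow> m + m' \<in> M"
proof -
  assume m: "m \<in> M" "m' \<in> M"
  have F: "(\<lambda>v. E m v + E m' v) \<in> Q" using m E_mem Q_add by blast
  have D: "D (\<lambda>v. E m v + E m' v) = m + m'" by (simp add: D_add DE m)
  show "E (m + m') = (\<lambda>v. E m v + E m' v)" using ED[OF F] D by simp
  show "m + m' \<in> M" using D_mem[OF F] D by simp
qed

lemma E_scale: "m \<in> M \<Longrightarrow> E (pscale c m) = fscale c (E m)"
  and M_scale: "m \<in> M \<Longrightarrow> pscale c m \<in> M"
proof -
  assume m: "m \<in> M"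
  have F: "fscale c (E m) \<in> Q" using m E_mem Q_scale by blast
  have D: "D (fscale c (E m)) = pscale c m" by (simp add: D_scale DE m)
  show "E (pscale c m) = fscale c (E m)" using ED[OF F] D by simp
  show "pscale c m \<in> M" using D_mem[OF F] D by simp
qed

definition rho0 :: "falg \<Rightarrow> pvec \<Rightarrow> pvec" where
  "rho0 f = (\<lambda>m\<in>M. D (Ev f (E m)))"

definition ker :: "falg set" where
  "ker = {f \<in> fcarrier n. \<forall>F\<in>Q. Ev f F = (\<lambda>v. 0)}"

text \<open>A left multiple annihilates Q because operators send 0 to 0, a right multiple because Q
  is stable under the action.\<close>

lemma ker_ideal: "ideal ker (free_algebra n)"
proof (rule idealI)
  show "ring (free_algebra n)" by (rule ring_free_algebra)
  interpret ring "free_algebra n" by (rule ring_free_algebra)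
  show "subgroup ker (add_monoid (free_algebra n))"
  proof (rule subgroup.intro)
    fix a assume a: "a \<in> ker"
    have "inv\<^bsub>add_monoid (free_algebra n)\<^esub> a = - a"
      unfolding a_inv_def[symmetric] using a add.inv_equality[of "- a" a] fcarrier_uminus by (simp add: ker_def)
    moreover have "- a \<in> ker" using a by (simp add: ker_def fcarrier_uminus Ev_uminus fun_eq_iff)
    ultimately show "inv\<^bsub>add_monoid (free_algebra n)\<^esub> a \<in> ker" by (simp only:)
  qed (auto simp: ker_def fcarrier_add fcarrier_zero Ev_add Ev_zero fun_eq_iff)
next
  fix a f assume "a \<in> ker" "f \<in> carrier (free_algebra n)"
  moreover have "Ev f (\<lambda>v. 0) = (\<lambda>v. 0)" for f by (rule ext) (rule Ev_zero_right)
  ultimately show "f \<otimes>\<^bsub>free_algebra n\<^esub> a \<in> ker" "a \<otimes>\<^bsub>free_algebra n\<^esub> f \<in> ker"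
    by (auto simp: ker_def fcarrier_mult Ev_mult Ev_Q)
qed

definition rel_ideal :: "falg set" where
  "rel_ideal = Idl\<^bsub>free_algebra n\<^esub> (relators n)"

lemma rel_ideal_ideal: "ideal rel_ideal (free_algebra n)"
  unfolding rel_ideal_def using relators_carrier
  by (intro ring.genideal_ideal ring_free_algebra) simp

lemma rel_ideal_ker: "rel_ideal \<subseteq> ker"
  unfolding rel_ideal_def using relators_carrier relators
  by (intro ring.genideal_minimal ring_free_algebra ker_ideal) (auto simp: ker_def)

lemma coset_eq: "a +>\<^bsub>free_algebra n\<^esub> b = {h + b | h. h \<in> a}"
  by (auto simp: a_r_coset_def r_coset_def)

lemma class_eq: "Ui_class n a = {h + a | h. h \<in> rel_ideal}"
  by (simp add: Ui_class_def rel_ideal_def coset_eq)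

lemma class_mem: "a \<in> Ui_class n a"
proof -
  have "0 \<in> rel_ideal"
    using additive_subgroup.zero_closed[OF ideal.axioms(1)[OF rel_ideal_ideal]] by simp
  then show ?thesis unfolding class_eq by force
qed

lemma class_ker: "b \<in> Ui_class n a \<Longrightarrow> F \<in> Q \<Longrightarrow> Ev b F = Ev a F"
  using rel_ideal_ker by (auto simp: class_eq ker_def Ev_add fun_eq_iff)

text \<open>By \<open>class_ker\<close> all representatives of a coset act alike on Q, so the choice
  only serves to obtain a function on cosets.\<close>

definition rho :: "falg set \<Rightarrow> pvec \<Rightarrow> pvec" where
  "rho X = rho0 (SOME a. a \<in> X)"

lemma rho_class: "rho (Ui_class n a) = rho0 a"
proof -
  have "(SOME b. b \<in> Ui_class n a) \<in> Ui_class n a" by (rule someI) (rule class_mem)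
  from class_ker[OF this] show ?thesis
    unfolding rho_def rho0_def by (intro restrict_ext) (simp add: E_mem)
qed

lemma rho0_mult: "f \<in> fcarrier n \<Longrightarrow> g \<in> fcarrier n \<Longrightarrow> rho0 (f * g) = compose M (rho0 f) (rho0 g)"
  by (auto simp: rho0_def compose_def fun_eq_iff Ev_mult ED Ev_Q E_mem D_mem)

lemma rho0_add: "rho0 (f + g) = (\<lambda>x\<in>M. rho0 f x + rho0 g x)"
  by (auto simp: rho0_def fun_eq_iff Ev_add[abs_def] simp flip: D_add)

lemma rho0_carrier: "f \<in> fcarrier n \<Longrightarrow> rho0 f \<in> carrier (end_ring pscale M)"
proof -
  assume f: "f \<in> fcarrier n"
  have a: "D (Ev f (E (x + y))) = D (Ev f (E x)) + D (Ev f (E y))" if "x \<in> M" "y \<in> M" for x y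
    using that by (simp add: E_add Ev_add_right[abs_def] flip: D_add)
  have s: "D (Ev f (E (pscale c x))) = pscale c (D (Ev f (E x)))" if "x \<in> M" for x c
    using that by (simp add: E_scale Ev_scale_right D_scale)
  show ?thesis
    using f by (auto simp: end_ring_def rho0_def D_mem Ev_Q E_mem M_add M_scale a s)
qed

lemma rep: "is_representation n pscale M rho"
proof -
  interpret I: ideal rel_ideal "free_algebra n" by (rule rel_ideal_ideal)
  have U: "Ui n = free_algebra n Quot rel_ideal" by (simp add: Ui_def rel_ideal_def)
  have cl: "rel_ideal +>\<^bsub>free_algebra n\<^esub> a = Ui_class n a" for a by (simp add: Ui_class_def rel_ideal_def)
  have car: "\<exists>a\<in>fcarrier n. X = Ui_class n a" if "X \<in> carrier (Ui n)" for X
    using that by (auto simp: U FactRing_def A_RCOSETS_def' cl)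
  have mul: "Ui_class n a \<otimes>\<^bsub>Ui n\<^esub> Ui_class n b = Ui_class n (a * b)" if "a \<in> fcarrier n" "b \<in> fcarrier n" for a b
    using I.rcoset_mult_add[of a b] that by (simp add: U FactRing_def cl)
  have add: "Ui_class n a \<oplus>\<^bsub>Ui n\<^esub> Ui_class n b = Ui_class n (a + b)" if "a \<in> fcarrier n" "b \<in> fcarrier n" for a b
    using I.a_rcos_sum[of a b] that by (simp add: U FactRing_def cl)
  have one: "\<one>\<^bsub>Ui n\<^esub> = Ui_class n 1" by (simp add: U FactRing_def cl)
  have "rho \<in> ring_hom (Ui n) (end_ring pscale M)"
  proof (rule ring_hom_memI)
    fix X assume "X \<in> carrier (Ui n)"
    then show "rho X \<in> carrier (end_ring pscale M)" using car rho_class rho0_carrier by metis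
  next
    fix X Y assume "X \<in> carrier (Ui n)" "Y \<in> carrier (Ui n)"
    then obtain a b where ab: "a \<in> fcarrier n" "b \<in> fcarrier n" "X = Ui_class n a" "Y = Ui_class n b" using car by metis
    show "rho (X \<otimes>\<^bsub>Ui n\<^esub> Y) = rho X \<otimes>\<^bsub>end_ring pscale M\<^esub> rho Y"
      using ab by (simp add: mul rho_class rho0_mult) (simp add: end_ring_def)
    show "rho (X \<oplus>\<^bsub>Ui n\<^esub> Y) = rho X \<oplus>\<^bsub>end_ring pscale M\<^esub> rho Y"
      using ab by (simp add: add rho_class rho0_add) (simp add: end_ring_def)
  next
    have "rho0 1 = (\<lambda>x\<in>M. x)" by (auto simp: rho0_def Ev_one DE)
    then show "rho \<one>\<^bsub>Ui n\<^esub> = \<one>\<^bsub>end_ring pscale M\<^esub>" by (simp add: one rho_class end_ring_def)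
  qed
  moreover have "rho (Ui_class n (sc c)) = (\<lambda>x\<in>M. pscale c x)" for c
  proof -
    have "Ev (sc c) F = fscale c F" for F by (rule ext) (simp add: Ev_sc fscale_def)
    then show ?thesis by (auto simp: rho_class rho0_def D_scale DE)
  qed
  ultimately show ?thesis by (simp add: is_representation_def)
qed

end

section \<open>Colourings and moves\<close>

lemma bar_bar [simp]: "r \<in> {1..2 * d} \<Longrightarrow> bar d (bar d r) = r"
  by (auto simp: bar_def)

lemma bar_mem [simp]: "r \<in> {1..2 * d} \<Longrightarrow> bar d r \<in> {1..2 * d}"
  by (auto simp: bar_def)

lemma bar_neq: "r \<in> {1..2 * d} \<Longrightarrow> bar d r \<noteq> r"
  by (auto simp: bar_def; presburger)

definition cmat :: "int \<Rightarrow> int \<Rightarrow> int" where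
  "cmat i k = (if i = k then 2 else if i = k + 1 \<or> k = i + 1 then -1 else 0)"

text \<open>The combinatorics takes place over any field with parameters x that are distinct, invert
  under \<open>bar\<close>, and never have ratio q^2. The last condition makes every
  \<open>g a b\<close> with a distinct from b invertible, so factors may be removed from the weights
  by division.\<close>

locale colouring =
  fixes n d :: nat and q :: "'a::field" and x :: "nat \<Rightarrow> 'a"
  assumes n1: "1 \<le> n" and q0: "q \<noteq> 0" and q2: "q ^ 2 \<noteq> 1"
    and x0: "\<And>r. r \<in> {1..2 * d} \<Longrightarrow> x r \<noteq> 0"
    and x_bar: "\<And>r. r \<in> {1..2 * d} \<Longrightarrow> x (bar d r) = inverse (x r)"
    and x_inj: "inj_on x {1..2 * d}"
    and qx: "\<And>a b. a \<in> {1..2 * d} \<Longrightarrow> b \<in> {1..2 * d} \<Longrightarrow> q ^ 2 * x a \<noteq> x b"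
begin

definition R :: "nat set" where "R = {1..2 * d}"
abbreviation N :: int where "N \<equiv> 2 * int n + 1"
abbreviation br :: "nat \<Rightarrow> nat" where "br \<equiv> bar d"

lemma finite_R [simp]: "finite R"
  by (simp add: R_def)

lemma br_br [simp]: "r \<in> R \<Longrightarrow> br (br r) = r"
  by (simp add: R_def)

lemma br_mem [simp]: "r \<in> R \<Longrightarrow> br r \<in> R"
  unfolding R_def by (rule bar_mem)

lemma br_neq [simp]: "r \<in> R \<Longrightarrow> br r \<noteq> r" "r \<in> R \<Longrightarrow> r \<noteq> br r"
  using bar_neq[of r d] by (auto simp: R_def)

lemma br_eq_iff: "r \<in> R \<Longrightarrow> s \<in> R \<Longrightarrow> br r = br s \<longleftrightarrow> r = s"
  by (metis br_br)

lemma neq_br_sym: "b \<noteq> br a \<Longrightarrow> a \<in> R \<Longrightarrow> b \<in> R \<Longrightarrow> a \<noteq> br b"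
  by auto

lemma x_nz: "r \<in> R \<Longrightarrow> x r \<noteq> 0"
  using x0 by (simp add: R_def)

lemma x_inj_R: "inj_on x R"
  using x_inj by (simp only: R_def)

lemma x_br: "r \<in> R \<Longrightarrow> x (br r) = inverse (x r)"
  using x_bar by (simp add: R_def)

text \<open>A colouring \<open>c\<close> encodes the set partition with blocks \<open>I\<^sub>k = {r. c r = k}\<close>.\<close>

definition Col :: "(nat \<Rightarrow> int) set" where
  "Col = {c. (\<forall>r\<in>R. 1 \<le> c r \<and> c r \<le> N \<and> c (br r) = N + 1 - c r) \<and> (\<forall>r. r \<notin> R \<longrightarrow> c r = 0)}"

text \<open>The operation \<open>\<tau>\<^sub>a\<^sup>+\<close>. Colours are arbitrary integers, so that moves commute and are invertible without side
  conditions; the weight \<open>wt\<close> below vanishes when a move would leave \<open>Col\<close>.\<close>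

definition mv :: "(nat \<Rightarrow> int) \<Rightarrow> nat \<Rightarrow> nat \<Rightarrow> int" where
  "mv c a = (\<lambda>r. c r + (if r = a then 1 else 0) - (if r = br a then 1 else 0))"

text \<open>For distinct indices this is \<open>theta1 q (q * x a / x b)\<close> with denominators
  cleared.\<close>

definition g :: "nat \<Rightarrow> nat \<Rightarrow> 'a" where
  "g a b = (q * x a - inverse q * x b) / (x a - x b)"

text \<open>The mirror index is left out: it shares the colour of a only in the middle block n + 1,
  where it enters through \<open>mid\<close>. In this way moving a does not affect
  \<open>pg c k a\<close> or \<open>pg c k (br a)\<close>.\<close>

definition pg :: "(nat \<Rightarrow> int) \<Rightarrow> int \<Rightarrow> nat \<Rightarrow> 'a" where
  "pg c k a = (\<Prod>t\<in>{t \<in> R. t \<noteq> a \<and> t \<noteq> br a \<and> c t = k}. g a t)"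

definition mid :: "int \<Rightarrow> nat \<Rightarrow> 'a" where
  "mid k a = (if k = int n + 1 then g a (br a) else 1)"

text \<open>The coefficient with which \<open>a\<close> is moved from colour \<open>k\<close> to colour \<open>k + 1\<close>.\<close>

definition wt :: "int \<Rightarrow> nat \<Rightarrow> (nat \<Rightarrow> int) \<Rightarrow> 'a" where
  "wt k a c = (if c a = k then pg c k a * mid k a else 0)"

text \<open>The factor by which \<open>pg c k a\<close> changes when b goes from colour i to i + 1
  and its mirror from N + 1 - i to N - i: an arrival at colour k multiplies by a value of
  \<open>g\<close>, a departure divides by one.\<close>

definition eps :: "int \<Rightarrow> int \<Rightarrow> nat \<Rightarrow> nat \<Rightarrow> 'a" where
  "eps i k b a = (if k = i + 1 then g a b else if k = i then inverse (g a b) else 1)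
     * (if k = N - i then g a (br b) else if k = N + 1 - i then inverse (g a (br b)) else 1)"

definition symc :: "(nat \<Rightarrow> int) \<Rightarrow> bool" where
  "symc c \<longleftrightarrow> (\<forall>r\<in>R. c (br r) = N + 1 - c r)"

lemma symcD: "symc c \<Longrightarrow> r \<in> R \<Longrightarrow> c (br r) = N + 1 - c r"
  by (simp add: symc_def)

lemma symc_Col: "c \<in> Col \<Longrightarrow> symc c"
  by (simp add: symc_def Col_def)

lemma mv_same: "a \<in> R \<Longrightarrow> mv c a a = c a + 1"
  by (simp add: mv_def)

lemma mv_br: "a \<in> R \<Longrightarrow> mv c a (br a) = c (br a) - 1"
  by (simp add: mv_def)

lemma mv_other: "t \<noteq> a \<Longrightarrow> t \<noteq> br a \<Longrightarrow> mv c a t = c t"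
  by (simp add: mv_def)

lemma symc_mv: "symc c \<Longrightarrow> a \<in> R \<Longrightarrow> symc (mv c a)"
  unfolding symc_def mv_def by (auto simp: br_eq_iff)

lemma mv_commute: "mv (mv c a) b = mv (mv c b) a"
  by (rule ext) (simp add: mv_def)

lemma mv_mv_br: "a \<in> R \<Longrightarrow> mv (mv c a) (br a) = c"
  by (rule ext) (simp add: mv_def)

lemma mv_Col: "c \<in> Col \<Longrightarrow> a \<in> R \<Longrightarrow> c a = i \<Longrightarrow> 1 \<le> i \<Longrightarrow> i \<le> 2 * int n \<Longrightarrow> mv c a \<in> Col"
proof -
  assume a: "c \<in> Col" "a \<in> R" "c a = i" "1 \<le> i" "i \<le> 2 * int n"
  have "symc (mv c a)" using a symc_mv symc_Col by blast
  moreover have "1 \<le> mv c a r \<and> mv c a r \<le> N" if r: "r \<in> R" for r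
  proof -
    have b: "1 \<le> c r" "c r \<le> N" "c (br a) = N + 1 - c a" using a r by (simp_all add: Col_def)
    consider "r = a" | "r = br a" | "r \<noteq> a" "r \<noteq> br a" by blast
    then show ?thesis using a b by cases (simp_all add: mv_same mv_br mv_other)
  qed
  moreover have "mv c a r = 0" if r: "r \<notin> R" for r
  proof -
    have "r \<noteq> a" "r \<noteq> br a" using a r by auto
    then show ?thesis using a r by (simp add: mv_other Col_def)
  qed
  ultimately show ?thesis by (simp add: Col_def symc_def)
qed

lemma xneq: "a \<in> R \<Longrightarrow> b \<in> R \<Longrightarrow> a \<noteq> b \<Longrightarrow> x a - x b \<noteq> 0"
  using inj_on_eq_iff[OF x_inj_R] by simp

lemma g_nz: "a \<in> R \<Longrightarrow> b \<in> R \<Longrightarrow> a \<noteq> b \<Longrightarrow> g a b \<noteq> 0"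
proof -
  assume a: "a \<in> R" "b \<in> R" "a \<noteq> b"
  have "q * (q * x a - inverse q * x b) = q\<^sup>2 * x a - x b"
    using q0 by (simp add: algebra_simps power2_eq_square)
  then show ?thesis using a xneq[OF a] qx[of a b] by (auto simp: g_def R_def)
qed

lemma g_add: "a \<in> R \<Longrightarrow> b \<in> R \<Longrightarrow> a \<noteq> b \<Longrightarrow> g a b + g b a = q + inverse q"
proof -
  assume a: "a \<in> R" "b \<in> R" "a \<noteq> b"
  have "g b a = (inverse q * x a - q * x b) / (x a - x b)"
    unfolding g_def by (metis minus_diff_eq minus_divide_divide)
  then have "g a b + g b a = ((q * x a - inverse q * x b) + (inverse q * x a - q * x b)) / (x a - x b)"
    by (simp only: g_def add_divide_distrib)
  also have "(q * x a - inverse q * x b) + (inverse q * x a - q * x b) = (q + inverse q) * (x a - x b)"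
    by (simp add: algebra_simps)
  finally show ?thesis using xneq[OF a] by simp
qed

text \<open>Clearing denominators turns both sides into (q x_a x_b - 1/q) / (x_a x_b - 1), which is
  symmetric in a and b.\<close>

lemma g_br_right: "a \<in> R \<Longrightarrow> b \<in> R \<Longrightarrow> a \<noteq> br b \<Longrightarrow> g a (br b) = g b (br a)"
proof -
  assume a: "a \<in> R" "b \<in> R" "a \<noteq> br b"
  then have "b \<noteq> br a" by auto
  then have nz: "x a - inverse (x b) \<noteq> 0" "x b - inverse (x a) \<noteq> 0" "x a \<noteq> 0" "x b \<noteq> 0"
    using a xneq[of a "br b"] xneq[of b "br a"] x_nz by (auto simp: x_br)
  have e1: "x a - inverse (x b) = (x a * x b - 1) / x b" "x b - inverse (x a) = (x a * x b - 1) / x a"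
    using nz by (simp_all add: field_simps)
  have "q * x a - inverse q * inverse (x b) = (q * x a * x b - inverse q) / x b"
    "q * x b - inverse q * inverse (x a) = (q * x a * x b - inverse q) / x a"
    using nz by (simp_all add: field_simps)
  then show ?thesis using a nz by (simp add: g_def x_br e1)
qed

lemma g_br_br: "a \<in> R \<Longrightarrow> b \<in> R \<Longrightarrow> a \<noteq> b \<Longrightarrow> g (br a) (br b) = g b a"
  using g_br_right[of "br a" b] by (simp add: br_eq_iff)

lemma pg_mv_same [simp]: "a \<in> R \<Longrightarrow> pg (mv c a) k a = pg c k a"
  unfolding pg_def by (rule prod.cong) (auto simp: mv_other)

lemma pg_mv_br [simp]: "a \<in> R \<Longrightarrow> pg (mv c a) k (br a) = pg c k (br a)"
  unfolding pg_def by (rule prod.cong) (auto simp: mv_other)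

lemma pg_mv_br' [simp]: "a \<in> R \<Longrightarrow> pg (mv c (br a)) k a = pg c k a"
  using pg_mv_br[of "br a"] by simp

lemma pg_alt: "pg c k a = (\<Prod>t\<in>R - {a, br a}. if c t = k then g a t else 1)"
  unfolding pg_def
  by (subst prod.inter_filter[symmetric]) (auto intro: prod.cong)

lemma pg_split:
  assumes "a \<in> R" "b \<in> R" "a \<noteq> b" "a \<noteq> br b"
  shows "pg c k a = (if c b = k then g a b else 1) * (if c (br b) = k then g a (br b) else 1)
     * (\<Prod>t\<in>R - {a, br a} - {b, br b}. if c t = k then g a t else 1)"
proof -
  have s: "{b, br b} \<subseteq> R - {a, br a}" using assms by (auto simp: br_eq_iff)
  show ?thesis
    unfolding pg_alt using br_neq[of b] assms
    by (subst prod.subset_diff[OF s]) (auto simp: mult_ac)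
qed

lemma pg_mv_other:
  assumes "symc c" "a \<in> R" "b \<in> R" "a \<noteq> b" "a \<noteq> br b"
  shows "pg (mv c b) k a = pg c k a * eps (c b) k b a"
proof -
  have e: "(\<Prod>t\<in>R - {a, br a} - {b, br b}. if mv c b t = k then g a t else 1)
      = (\<Prod>t\<in>R - {a, br a} - {b, br b}. if c t = k then g a t else 1)"
    by (rule prod.cong) (auto simp: mv_other)
  have g: "g a b \<noteq> 0" "g a (br b) \<noteq> 0" using g_nz[of a b] g_nz[of a "br b"] assms by auto
  have gg: "g a b * (g a (br b) * (inverse (g a b) * inverse (g a (br b)))) = 1" using g by (simp add: field_simps)
  have c: "c (br b) = N + 1 - c b" using assms symcD by blast
  show ?thesis
    unfolding pg_split[OF assms(2-5), of "mv c b"] pg_split[OF assms(2-5), of c] e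
    using g by (auto simp: mv_same mv_br assms c eps_def gg)
qed

definition yv :: "int \<Rightarrow> nat \<Rightarrow> 'a" where
  "yv i a = q powi i * x a"

lemma yv_nz: "a \<in> R \<Longrightarrow> yv i a \<noteq> 0"
  using q0 x_nz by (simp add: yv_def)

text \<open>The factor q^(i k) of the generating series is part of the power of \<open>yv\<close>.
  The guard keeps every image supported on \<open>Col\<close>.\<close>

definition Bop :: "int \<Rightarrow> int \<Rightarrow> ((nat \<Rightarrow> int) \<Rightarrow> 'a) \<Rightarrow> (nat \<Rightarrow> int) \<Rightarrow> 'a" where
  "Bop i k F c = (if c \<in> Col then \<Sum>a\<in>R. yv i a powi k * wt i a c * F (mv c a) else 0)"

definition wt2 where "wt2 i a k b c = wt i a c * wt k b (mv c a)"
definition wt3 where "wt3 i a k b l e c = wt i a c * wt k b (mv c a) * wt l e (mv (mv c a) b)"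

abbreviation ok :: "int \<Rightarrow> bool" where "ok i \<equiv> 1 \<le> i \<and> i \<le> 2 * int n"

lemma wt_Bop:
  assumes "c \<in> Col" "ok i" "a \<in> R"
  shows "wt i a c * Bop k l F (mv c a) = wt i a c * (\<Sum>b\<in>R. yv k b powi l * wt k b (mv c a) * F (mv (mv c a) b))"
  using mv_Col[of c a i] assms by (cases "c a = i") (auto simp: Bop_def wt_def)

lemma Bop_Bop:
  assumes "c \<in> Col" "ok i"
  shows "Bop i r (Bop k s F) c
    = (\<Sum>a\<in>R. \<Sum>b\<in>R. yv i a powi r * yv k b powi s * wt2 i a k b c * F (mv (mv c a) b))"
proof -
  have "Bop i r (Bop k s F) c = (\<Sum>a\<in>R. yv i a powi r * (wt i a c * Bop k s F (mv c a)))"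
    using assms by (simp add: Bop_def[of i] mult.assoc)
  also have "\<dots> = (\<Sum>a\<in>R. \<Sum>b\<in>R. yv i a powi r * yv k b powi s * wt2 i a k b c * F (mv (mv c a) b))"
    by (rule sum.cong[OF refl], subst wt_Bop[OF assms]) (simp_all add: sum_distrib_left wt2_def mult_ac)
  finally show ?thesis .
qed

lemma Bop_Bop_Bop:
  assumes "c \<in> Col" "ok i" "ok k"
  shows "Bop i r (Bop k s (Bop l t F)) c
    = (\<Sum>a\<in>R. \<Sum>b\<in>R. \<Sum>e\<in>R. yv i a powi r * yv k b powi s * yv l e powi t
         * wt3 i a k b l e c * F (mv (mv (mv c a) b) e))"
proof -
  have "Bop i r (Bop k s (Bop l t F)) c
      = (\<Sum>a\<in>R. \<Sum>b\<in>R. yv i a powi r * yv k b powi s * (wt2 i a k b c * Bop l t F (mv (mv c a) b)))"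
    using assms by (simp add: Bop_Bop mult.assoc)
  also have "\<dots> = (\<Sum>a\<in>R. \<Sum>b\<in>R. \<Sum>e\<in>R. yv i a powi r * yv k b powi s * yv l e powi t
         * wt3 i a k b l e c * F (mv (mv (mv c a) b) e))"
  proof (intro sum.cong refl)
    fix a b assume ab: "a \<in> R" "b \<in> R"
    have "wt2 i a k b c * Bop l t F (mv (mv c a) b)
        = wt2 i a k b c * (\<Sum>e\<in>R. yv l e powi t * wt l e (mv (mv c a) b) * F (mv (mv (mv c a) b) e))"
    proof (cases "c a = i")
      case True
      then have "mv c a \<in> Col" using mv_Col assms ab by blast
      then show ?thesis using wt_Bop[of "mv c a" k b l t F] assms ab by (simp add: wt2_def mult.assoc)
    qed (simp add: wt2_def wt_def)
    then show "yv i a powi r * yv k b powi s * (wt2 i a k b c * Bop l t F (mv (mv c a) b)) =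
       (\<Sum>e\<in>R. yv i a powi r * yv k b powi s * yv l e powi t * wt3 i a k b l e c * F (mv (mv (mv c a) b) e))"
      by (simp add: sum_distrib_left wt2_def wt3_def mult_ac)
  qed
  finally show ?thesis .
qed

section \<open>Pairs of moves and the quadratic relations\<close>

lemma wt2_gen:
  assumes "symc c" "a \<in> R" "b \<in> R" "b \<noteq> a" "b \<noteq> br a"
  shows "wt2 i a k b c = wt i a c * wt k b c * eps i k a b"
  using assms by (auto simp: wt2_def wt_def mv_other pg_mv_other)

lemma exchange_adjacent:
  assumes "a \<noteq> 0" "b \<noteq> 0" "Q \<noteq> 0" "b - a \<noteq> (0::'a)"
  shows "(inverse q / (Q * a) - 1 / (Q * q * b)) * ((q * b - inverse q * a) / (b - a))
      + (inverse q / (Q * q * b) - 1 / (Q * a)) = 0"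
proof -
  have e: "inverse q / (Q * a) - 1 / (Q * q * b) = (b - a) / (Q * q * a * b)"
    "inverse q / (Q * q * b) - 1 / (Q * a) = - (q * b - inverse q * a) / (Q * q * a * b)"
    using assms q0 by (simp_all add: field_simps)
  have "(b - a) / D * (A / (b - a)) + (- A) / D = 0" for A D
    using assms(4) by simp
  then show ?thesis by (simp only: e)
qed

lemma exchange_equal:
  assumes "a \<noteq> 0" "b \<noteq> 0" "Q \<noteq> 0" "b - a \<noteq> (0::'a)"
    "q * a - inverse q * b \<noteq> 0" "q * b - inverse q * a \<noteq> 0"
  shows "(q powi 2 / (Q * a) - 1 / (Q * b)) * ((b - a) / (q * b - inverse q * a))
      + (q powi 2 / (Q * b) - 1 / (Q * a)) * ((a - b) / (q * a - inverse q * b)) = 0"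
proof -
  have e: "q powi 2 / (Q * a) - 1 / (Q * b) = (q / (Q * a * b)) * (q * b - inverse q * a)"
    "q powi 2 / (Q * b) - 1 / (Q * a) = (q / (Q * a * b)) * (q * a - inverse q * b)"
    using assms(1-3) q0 by (simp_all add: field_simps power2_eq_square)
  have "(K * B) * ((b - a) / B) + (K * A) * ((a - b) / A) = 0" if "A \<noteq> 0" "B \<noteq> 0" for K A B :: 'a
  proof -
    have "(K * B) * ((b - a) / B) = K * (b - a)" "(K * A) * ((a - b) / A) = K * (a - b)"
      using that by simp_all
    then show ?thesis by (simp only:) (simp add: algebra_simps)
  qed
  then show ?thesis using assms(5,6) unfolding e by blast
qed

text \<open>The factors due to the mirror colours are equal in the two orders by
  \<open>g_br_right\<close> and split off as h. What remains is the exchange identity of type A for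
  \<open>g\<close>.\<close>

lemma eps_cases_cmat:
  assumes "a \<in> R" "b \<in> R" "b \<noteq> a" "b \<noteq> br a"
  shows "(q powi cmat i k / yv i a - 1 / yv k b) * eps i k a b + (q powi cmat i k / yv k b - 1 / yv i a) * eps k i b a = 0"
proof -
  have ab: "a \<noteq> br b" "b \<noteq> a" using assms by auto
  have gs: "g b (br a) = g a (br b)" using g_br_right[of b a] assms by auto
  define h where "h = (if k = N - i then g a (br b) else if k = N + 1 - i then inverse (g a (br b)) else 1)"
  have e1: "eps i k a b = (if k = i + 1 then g b a else if k = i then inverse (g b a) else 1) * h"
    using assms gs by (auto simp: eps_def h_def)
  have e2: "eps k i b a = (if i = k + 1 then g a b else if k = i then inverse (g a b) else 1) * h"
    using assms gs by (auto simp: eps_def h_def)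
  have nz: "x a \<noteq> 0" "x b \<noteq> 0" "q \<noteq> 0" "x a - x b \<noteq> 0" "x b - x a \<noteq> 0" "q powi k \<noteq> 0"
    "q * x a - inverse q * x b \<noteq> 0" "q * x b - inverse q * x a \<noteq> 0"
    using x_nz assms q0 xneq[of a b] xneq[of b a] g_nz[of a b] g_nz[of b a] by (auto simp: g_def)
  have ig: "inverse (g a b) = (x a - x b) / (q * x a - inverse q * x b)"
     "inverse (g b a) = (x b - x a) / (q * x b - inverse q * x a)" by (simp_all add: g_def)
  consider "k = i + 1" | "k = i" | "i = k + 1" | "k \<noteq> i" "k \<noteq> i + 1" "i \<noteq> k + 1" by blast
  then have "(q powi cmat i k / yv i a - 1 / yv k b) * (if k = i + 1 then g b a else if k = i then inverse (g b a) else 1) + (q powi cmat i k / yv k b - 1 / yv i a) * (if i = k + 1 then g a b else if k = i then inverse (g a b) else 1) = 0"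
  proof cases
    case 1
    then show ?thesis using exchange_adjacent[of "x a" "x b" "q powi i"] nz
      by (simp add: cmat_def yv_def g_def power_int_add q0 power_int_minus)
  next
    case 2
    then show ?thesis using exchange_equal[of "x a" "x b" "q powi i"] nz
      by (simp add: cmat_def yv_def ig)
  next
    case 3
    then show ?thesis using exchange_adjacent[of "x b" "x a" "q powi k"] nz
      by (subst add.commute) (simp add: cmat_def yv_def g_def power_int_add q0 power_int_minus)
  next
    case 4
    then show ?thesis by (simp add: cmat_def)
  qed
  then show ?thesis unfolding e1 e2 by (simp add: mult.assoc[symmetric] distrib_right[symmetric])
qed

text \<open>For b = a the moves are consecutive steps of one index, which requires adjacent nodes,
  and the coefficient vanishes because \<open>yv\<close> gains a factor q with each colour. For b =
  \<open>br a\<close> the second move would start from colour N - i or N - k, which the hypothesis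
  on k excludes.\<close>

lemma wt2_quadratic:
  assumes "symc c" "a \<in> R" "b \<in> R" "b \<noteq> br a \<or> k \<noteq> N - i"
  shows "(q powi cmat i k / yv i a - 1 / yv k b) * wt2 i a k b c
       + (q powi cmat i k / yv k b - 1 / yv i a) * wt2 k b i a c = 0"
proof -
  consider "b = a" | "b = br a" | "b \<noteq> a" "b \<noteq> br a" by blast
  then show ?thesis
  proof cases
    case 1
    then show ?thesis using assms q0 x_nz
      by (auto simp: wt2_def wt_def mv_same cmat_def yv_def power_int_add field_simps)
  next
    case 2
    have "c (br a) = N + 1 - c a" using assms symcD by blast
    then show ?thesis using assms 2 mv_br[of "br a" c]
      by (auto simp: wt2_def wt_def mv_br)
  next
    case 3
    then have "wt2 k b i a c = wt i a c * wt k b c * eps k i b a"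
      using wt2_gen[of c b a k i] neq_br_sym[of b a] assms by (auto simp: mult_ac)
    then have "(q powi cmat i k / yv i a - 1 / yv k b) * wt2 i a k b c
       + (q powi cmat i k / yv k b - 1 / yv i a) * wt2 k b i a c = wt i a c * wt k b c * 
       ((q powi cmat i k / yv i a - 1 / yv k b) * eps i k a b + (q powi cmat i k / yv k b - 1 / yv i a) * eps k i b a)"
      using wt2_gen[OF assms(1-3) 3] by (simp add: algebra_simps)
    then show ?thesis using eps_cases_cmat[OF assms(2,3) 3] by simp
  qed
qed

text \<open>Once the summations of the second composite are exchanged, every pair of indices already
  contributes 0.\<close>

lemma quadratic_relation:
  assumes "c \<in> Col" "ok i" "ok k" "k \<noteq> N - i"
  shows "q powi cmat i k * Bop i (r - 1) (Bop k s F) c - Bop i r (Bop k (s - 1) F) c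
     + q powi cmat i k * Bop k (s - 1) (Bop i r F) c - Bop k s (Bop i (r - 1) F) c = 0"
proof -
  let ?v = "q powi cmat i k"
  have B1: "Bop i r' (Bop k s' F) c = (\<Sum>a\<in>R. \<Sum>b\<in>R. yv i a powi r' * yv k b powi s' * wt2 i a k b c * F (mv (mv c a) b))"
    for r' s' using assms by (simp add: Bop_Bop)
  have B2: "Bop k s' (Bop i r' F) c = (\<Sum>a\<in>R. \<Sum>b\<in>R. yv i a powi r' * yv k b powi s' * wt2 k b i a c * F (mv (mv c a) b))"
    for r' s' using assms by (simp add: Bop_Bop) (subst sum.swap, simp add: mult_ac mv_commute)
  have pw: "?v * (yv i a powi (r - 1) * yv k b powi s * wt2 i a k b c * f)
     - yv i a powi r * yv k b powi (s - 1) * wt2 i a k b c * f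
     + ?v * (yv i a powi r * yv k b powi (s - 1) * wt2 k b i a c * f)
     - yv i a powi (r - 1) * yv k b powi s * wt2 k b i a c * f = 0" if "a \<in> R" "b \<in> R" for a b f
  proof -
    have "yv i a powi (r - 1) = yv i a powi r / yv i a" "yv k b powi (s - 1) = yv k b powi s / yv k b"
      using yv_nz that by (simp_all add: power_int_diff)
    then have "?v * (yv i a powi (r - 1) * yv k b powi s * wt2 i a k b c * f)
     - yv i a powi r * yv k b powi (s - 1) * wt2 i a k b c * f
     + ?v * (yv i a powi r * yv k b powi (s - 1) * wt2 k b i a c * f)
     - yv i a powi (r - 1) * yv k b powi s * wt2 k b i a c * f
     = yv i a powi r * yv k b powi s * f * ((?v / yv i a - 1 / yv k b) * wt2 i a k b c
       + (?v / yv k b - 1 / yv i a) * wt2 k b i a c)"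
      by (simp add: algebra_simps)
    then show ?thesis using wt2_quadratic[of c a b k i] assms that symc_Col by simp
  qed
  show ?thesis
    unfolding B1 B2 sum_distrib_left sum_subtractf[symmetric] sum.distrib[symmetric]
    by (intro sum.neutral ballI pw)
qed

lemma wt2_commute:
  assumes s: "symc c" and ab: "a \<in> R" "b \<in> R" "b \<noteq> br a \<or> k \<noteq> N - i" "cmat i k = 0"
  shows "wt2 i a k b c = wt2 k b i a c"
proof -
  have k: "k \<noteq> i" "k \<noteq> i + 1" "i \<noteq> k + 1" using assms by (auto simp: cmat_def split: if_splits)
  consider "b = a" | "b = br a" | "b \<noteq> a" "b \<noteq> br a" by blast
  then show ?thesis
  proof cases
    case 1
    then show ?thesis using k ab by (auto simp: wt2_def wt_def mv_same)
  next
    case 2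
    have "c (br a) = N + 1 - c a" using s ab symcD by blast
    then show ?thesis using ab 2 mv_br[of "br a" c]
      by (auto simp: wt2_def wt_def mv_br)
  next
    case 3
    then have "eps i k a b = eps k i b a"
      using k g_br_right[of b a] ab by (auto simp: eps_def)
    then show ?thesis using wt2_gen[OF s ab(1,2) 3, of i k] wt2_gen[OF s ab(2,1), of k i] neq_br_sym[OF 3(2) ab(1,2)] 3 by auto
  qed
qed

lemma commute_relation:
  assumes "c \<in> Col" "ok i" "ok k" "k \<noteq> N - i" "cmat i k = 0"
  shows "Bop i r (Bop k s F) c = Bop k s (Bop i r F) c"
proof -
  have pw: "wt2 i a k b c = wt2 k b i a c" if "a \<in> R" "b \<in> R" for a b
    using assms that symc_Col wt2_commute by blast
  show ?thesis using assms
    by (simp add: Bop_Bop) (subst sum.swap, simp add: pw mult_ac mv_commute)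
qed

end

section \<open>The Serre relation\<close>

context colouring
begin

abbreviation two :: 'a where "two \<equiv> q + inverse q"

text \<open>The six orders in which a and b make a step at node i and e makes one at node k. All of
  them end in the same colouring, so this Serre combination of weights is the coefficient of a
  single value of F.\<close>

definition S6 :: "int \<Rightarrow> nat \<Rightarrow> nat \<Rightarrow> int \<Rightarrow> nat \<Rightarrow> (nat \<Rightarrow> int) \<Rightarrow> 'a" where
  "S6 i a b k e c = wt3 i a i b k e c + wt3 i b i a k e c
     - two * (wt3 i a k e i b c + wt3 i b k e i a c)
     + wt3 k e i a i b c + wt3 k e i b i a c"

lemma S6_commute: "S6 i a b k e c = S6 i b a k e c"
  by (simp add: S6_def add_ac)

lemma wt3_gen:
  assumes "symc c" "a \<in> R" "b \<in> R" "e \<in> R" "b \<noteq> a" "b \<noteq> br a" "e \<noteq> a" "e \<noteq> br a" "e \<noteq> b" "e \<noteq> br b"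
  shows "wt3 i a k b l e c = wt i a c * wt k b c * wt l e c * (eps i k a b * eps i l a e * eps k l b e)"
proof -
  have "wt3 i a k b l e c = wt i a c * wt2 k b l e (mv c a)" by (simp add: wt3_def wt2_def)
  also have "wt2 k b l e (mv c a) = wt k b (mv c a) * wt l e (mv c a) * eps k l b e"
    by (rule wt2_gen[OF symc_mv]) (use assms in auto)
  also have "wt i a c * (wt k b (mv c a) * wt l e (mv c a) * eps k l b e) = wt2 i a k b c * wt l e (mv c a) * eps k l b e"
    by (simp add: wt2_def mult_ac)
  also have "wt2 i a k b c = wt i a c * wt k b c * eps i k a b"
    by (rule wt2_gen) (use assms in auto)
  also have "wt i a c * wt k b c * eps i k a b * wt l e (mv c a) * eps k l b e = wt k b c * (eps i k a b * (wt2 i a l e c * eps k l b e))"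
    by (simp add: wt2_def mult_ac)
  also have "wt2 i a l e c = wt i a c * wt l e c * eps i l a e"
    by (rule wt2_gen) (use assms in auto)
  finally show ?thesis by (simp add: mult_ac)
qed

text \<open>With denominators cleared, the two sides differ by a multiple of q p - 1.\<close>

lemma three_term:
  assumes "q * p = 1" "a - b \<noteq> 0" "e - a \<noteq> 0" "e - b \<noteq> (0::'a)"
  shows "(q * e - p * a) / (e - a) * ((q * e - p * b) / (e - b)) + 1
     = (q * a - p * b) / (a - b) * ((q * e - p * a) / (e - a))
       - (q * b - p * a) / (a - b) * ((q * e - p * b) / (e - b))"
proof -
  have "((q * e - p * a) * (q * e - p * b) + (e - a) * (e - b)) * (a - b)
     - ((q * a - p * b) * (q * e - p * a) * (e - b) - (q * b - p * a) * (q * e - p * b) * (e - a))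
     = (q * p - 1) * ((a * a - b * b) * e + (e * e + a * b) * (b - a))"
    by (simp add: algebra_simps)
  then have "((q * e - p * a) * (q * e - p * b) + (e - a) * (e - b)) * (a - b)
     = (q * a - p * b) * (q * e - p * a) * (e - b) - (q * b - p * a) * (q * e - p * b) * (e - a)"
    using assms(1) by simp
  then show ?thesis using assms(2-4) by (simp add: divide_simps)
qed

lemma g_flip: "g b a = - ((q * x b - inverse q * x a) / (x a - x b))"
  unfolding g_def by (metis minus_diff_eq minus_divide_right)

lemma three_term_left:
  assumes "a \<in> R" "b \<in> R" "e \<in> R" "a \<noteq> b" "e \<noteq> a" "e \<noteq> b"
  shows "g e a * g e b + 1 = g a b * g e a + g b a * g e b"
  using three_term[of "inverse q" "x a" "x b" "x e"] q0 xneq assms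
  by (simp add: g_flip[of b a]) (simp add: g_def)

text \<open>Replacing each value \<open>g s t\<close> by \<open>two - g t s\<close> carries the
  identity of \<open>three_term_left\<close> into this one.\<close>

lemma three_term_right:
  assumes "a \<in> R" "b \<in> R" "e \<in> R" "a \<noteq> b" "e \<noteq> a" "e \<noteq> b"
  shows "g a e * g b e + 1 = g a b * g b e + g b a * g a e"
proof -
  have e: "g a e = two - g e a" "g b e = two - g e b" "g b a = two - g a b"
    using g_add[of a e] g_add[of b e] g_add[of a b] assms by (simp_all add: algebra_simps)
  show ?thesis using three_term_left[OF assms] by (simp add: e algebra_simps)
qed

lemma two_eq: "a \<in> R \<Longrightarrow> b \<in> R \<Longrightarrow> a \<noteq> b \<Longrightarrow> two = g a b + g b a"
  by (simp add: g_add)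

text \<open>N is odd, so i = N - i never occurs. A mirror factor arises for i = n + 1 only, and
  \<open>g_br_right\<close> makes it the same in both orders; it becomes h.\<close>

lemma eps_same:
  assumes "a \<in> R" "b \<in> R" "b \<noteq> a" "b \<noteq> br a"
  obtains h where "eps i i a b = inverse (g b a) * h" "eps i i b a = inverse (g a b) * h"
proof
  show "eps i i a b = inverse (g b a) * (if i = N + 1 - i then inverse (g b (br a)) else 1)"
    by (simp add: eps_def) presburger
  show "eps i i b a = inverse (g a b) * (if i = N + 1 - i then inverse (g b (br a)) else 1)"
    using g_br_right[of b a] assms by (simp add: eps_def) presburger
qed

lemma eps_up:
  assumes "a \<in> R" "b \<in> R" "b \<noteq> a" "b \<noteq> br a"
  shows "eps i (i + 1) a b = g b a * (if i = int n then g b (br a) else 1)"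
    and "eps (i + 1) i b a = (if i = int n then g b (br a) else 1)"
  using g_br_right[of b a] assms by (auto simp: eps_def)

text \<open>After multiplication by u w the left side is t times the difference of the two sides of
  the three-term identity.\<close>

lemma serre_alg:
  assumes "A * B + 1 = u * A + w * B" "u + w = t" "u \<noteq> 0" "w \<noteq> (0::'a)"
  shows "inverse w * (A * B) + inverse u * (A * B) - t * (inverse w * A + inverse u * B) + inverse w + inverse u = 0"
proof -
  have "inverse w * (A * B) + inverse u * (A * B) - t * (inverse w * A + inverse u * B) + inverse w + inverse u
     = inverse w * inverse u * (t * (A * B + 1) - t * (u * A + w * B))"
    using assms(3,4) assms(2)[symmetric] by (simp add: field_simps)
  then show ?thesis by (simp add: assms(1))
qed

text \<open>The initial weights are common to the six orders, and so are the mirror factors h, Ma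
  and Mb. Without them the sum is the expression of \<open>serre_alg\<close>, with the three-term
  identity on the left or on the right according to whether k is above or below i.\<close>

lemma S6_generic:
  assumes "symc c" "a \<in> R" "b \<in> R" "e \<in> R" "b \<noteq> a" "b \<noteq> br a" "e \<noteq> a" "e \<noteq> br a" "e \<noteq> b" "e \<noteq> br b"
    and "k = i + 1 \<or> i = k + 1"
  shows "S6 i a b k e c = 0"
proof -
  have ne: "a \<noteq> b" "a \<noteq> br b" "a \<noteq> e" "a \<noteq> br e" "b \<noteq> e" "b \<noteq> br e" using assms by auto
  obtain h where h: "eps i i a b = inverse (g b a) * h" "eps i i b a = inverse (g a b) * h"
    using eps_same[of a b i] assms by metis
  have nz: "g a b \<noteq> 0" "g b a \<noteq> 0" using g_nz assms ne by auto
  define X where "X = wt i a c * wt i b c * wt k e c"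
  have w: "wt3 i a i b k e c = X * (eps i i a b * eps i k a e * eps i k b e)"
    "wt3 i b i a k e c = X * (eps i i b a * eps i k b e * eps i k a e)"
    "wt3 i a k e i b c = X * (eps i k a e * eps i i a b * eps k i e b)"
    "wt3 i b k e i a c = X * (eps i k b e * eps i i b a * eps k i e a)"
    "wt3 k e i a i b c = X * (eps k i e a * eps k i e b * eps i i a b)"
    "wt3 k e i b i a c = X * (eps k i e b * eps k i e a * eps i i b a)"
    unfolding X_def
    by (subst wt3_gen[OF assms(1)]; (rule assms ne)?; simp only: mult_ac)+
  have comb: "X * p1 + X * p2 - t * (X * p3 + X * p4) + X * p5 + X * p6 = X * (p1 + p2 - t * (p3 + p4) + p5 + p6)"
    for p1 p2 p3 p4 p5 p6 t by (simp add: algebra_simps)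
  have S: "S6 i a b k e c = X *
    (eps i i a b * eps i k a e * eps i k b e + eps i i b a * eps i k b e * eps i k a e
     - two * (eps i k a e * eps i i a b * eps k i e b + eps i k b e * eps i i b a * eps k i e a)
     + eps k i e a * eps k i e b * eps i i a b + eps k i e b * eps k i e a * eps i i b a)"
    unfolding S6_def w by (rule comb)
  have comb2: "v * h * (A * M) * (B * L) + u * h * (B * L) * (A * M) - t * (A * M * (v * h) * L + B * L * (u * h) * M)
      + M * L * (v * h) + L * M * (u * h) = h * M * L * (v * (A * B) + u * (A * B) - t * (v * A + u * B) + v + u)"
    for v u h A B M L t :: 'a by (simp add: algebra_simps)
  have comb3: "v * h * M * L + u * h * L * M - t * (M * (v * h) * (B * L) + L * (u * h) * (A * M))
      + A * M * (B * L) * (v * h) + B * L * (A * M) * (u * h)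
      = h * M * L * (u * (B * A) + v * (B * A) - t * (u * A + v * B) + u + v)"
    for v u h A B M L t :: 'a by (simp add: algebra_simps)
  from assms(11) show ?thesis
  proof
    assume k: "k = i + 1"
    define Ma Mb where "Ma = (if i = int n then g e (br a) else 1)" and "Mb = (if i = int n then g e (br b) else 1)"
    have E: "eps i k a e = g e a * Ma" "eps i k b e = g e b * Mb" "eps k i e a = Ma" "eps k i e b = Mb"
      using eps_up[of a e i] eps_up[of b e i] assms k by (simp_all add: Ma_def Mb_def)
    have "S6 i a b k e c = X * (h * Ma * Mb *
      (inverse (g b a) * (g e a * g e b) + inverse (g a b) * (g e a * g e b)
        - two * (inverse (g b a) * g e a + inverse (g a b) * g e b) + inverse (g b a) + inverse (g a b)))"
      unfolding S E h by (simp only: comb2)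
    then show ?thesis
      using serre_alg[OF three_term_left[OF assms(2-4)] g_add nz] assms ne by simp
  next
    assume k: "i = k + 1"
    define Ma Mb where "Ma = (if k = int n then g a (br e) else 1)" and "Mb = (if k = int n then g b (br e) else 1)"
    have E: "eps k i e a = g a e * Ma" "eps k i e b = g b e * Mb" "eps i k a e = Ma" "eps i k b e = Mb"
      using eps_up[of e a k] eps_up[of e b k] assms k ne by (simp_all add: Ma_def Mb_def)
    have "S6 i a b k e c = X * (h * Ma * Mb *
      (inverse (g a b) * (g b e * g a e) + inverse (g b a) * (g b e * g a e)
        - two * (inverse (g a b) * g a e + inverse (g b a) * g b e) + inverse (g a b) + inverse (g b a)))"
      unfolding S E h by (simp only: comb3)
    moreover have "g a e * g b e + 1 = g b a * g a e + g a b * g b e"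
      using three_term_right[OF assms(2-4)] assms ne by (simp add: add.commute)
    ultimately show ?thesis
      using serre_alg[of "g a e" "g b e" "g b a" "g a b" two] g_add[of b a] nz assms ne by (simp add: mult.commute)
  qed
qed

text \<open>The index a makes two steps, the one at the lower node first, which leaves three orders.
  They cancel because \<open>two\<close> is \<open>g a b + g b a\<close>.\<close>

lemma S6_string:
  assumes c: "symc c" and ab: "a \<in> R" "b \<in> R" "b \<noteq> a" "b \<noteq> br a"
    and k: "k = i + 1 \<or> i = k + 1"
  shows "S6 i a b k a c = 0"
proof -
  have ne: "a \<noteq> b" "a \<noteq> br b" using ab by auto
  obtain h where h: "eps i i a b = inverse (g b a) * h" "eps i i b a = inverse (g a b) * h"
    using eps_same[of a b i] ab by metis
  have nz: "g a b \<noteq> 0" "g b a \<noteq> 0" using g_nz ab ne by auto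
  have s: "symc (mv c a)" "symc (mv c b)" using symc_mv c ab by auto
  note sim = wt3_def wt_def mv_same mv_other pg_mv_other ab ne c s symc_mv
  from k show ?thesis
  proof
    assume k: "k = i + 1"
    define M where "M = (if i = int n then g b (br a) else 1)"
    have M: "g a (br b) = g b (br a)" using g_br_right[of a b] ab ne by simp
    have E: "eps i k b a = g a b * M" "eps k i a b = M"
      using eps_up[of b a i] eps_up[of a b i] ab k ne M by (simp_all add: M_def)
    let ?X = "wt i a c * wt i b c * (pg c k a * mid k a)"
    have "wt3 i a i b k a c = ?X * (eps i i a b * eps i k b a)"
      "wt3 i b i a k a c = ?X * (eps i i b a * eps i k b a)"
      "wt3 i a k a i b c = ?X * (eps i i a b * eps k i a b)"
      "wt3 i b k a i a c = 0" "wt3 k a i a i b c = 0" "wt3 k a i b i a c = 0"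
      using k by (auto simp: sim)
    then have "S6 i a b k a c = ?X * h * M * (inverse (g b a) * g a b + inverse (g a b) * g a b - two * inverse (g b a))"
      unfolding S6_def by (simp add: h E) (simp add: algebra_simps)
    also have "inverse (g b a) * g a b + inverse (g a b) * g a b - two * inverse (g b a) = 0"
      unfolding two_eq[OF ab(1,2) ne(1)] using nz by (simp add: field_simps)
    finally show ?thesis by simp
  next
    assume k: "i = k + 1"
    define M where "M = (if k = int n then g b (br a) else 1)"
    have M: "g a (br b) = g b (br a)" using g_br_right[of a b] ab ne by simp
    have E: "eps k i a b = g b a * M" "eps i k b a = M"
      using eps_up[of b a k] eps_up[of a b k] ab k ne M by (simp_all add: M_def)
    let ?X = "wt k a c * wt i b c * (pg c i a * mid i a)"
    have "wt3 k a i a i b c = ?X * (eps k i a b * eps i i a b)"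
      "wt3 k a i b i a c = ?X * (eps k i a b * eps i i b a)"
      "wt3 i b k a i a c = ?X * (eps i k b a * eps i i b a)"
      "wt3 i a k a i b c = 0" "wt3 i a i b k a c = 0" "wt3 i b i a k a c = 0"
      using k by (auto simp: sim)
    then have "S6 i a b k a c = ?X * h * M * (inverse (g b a) * g b a + inverse (g a b) * g b a - two * inverse (g a b))"
      unfolding S6_def by (simp add: h E) (simp add: algebra_simps)
    also have "inverse (g b a) * g b a + inverse (g a b) * g b a - two * inverse (g a b) = 0"
      unfolding two_eq[OF ab(1,2) ne(1)] using nz by (simp add: field_simps)
    finally show ?thesis by simp
  qed
qed

lemma wt3_zeroI: "(c a = i \<Longrightarrow> mv c a b = k \<Longrightarrow> mv (mv c a) b e = l \<Longrightarrow> False) \<Longrightarrow> wt3 i a k b l e c = 0"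
  by (auto simp: wt3_def wt_def)

text \<open>No order is possible: an index that has left colour i upwards does not return to it, and
  once one of a, \<open>br a\<close> has stepped from colour i the other has colour N - i, which is
  not i because N is odd.\<close>

lemma S6_degenerate:
  assumes c: "symc c" and "a \<in> R" "b \<in> R" "e \<in> R" "b = a \<or> b = br a" "e \<noteq> br a" "e \<noteq> br b"
    and k: "k = i + 1 \<or> i = k + 1"
  shows "S6 i a b k e c = 0"
proof -
  have bra: "c (br a) = N + 1 - c a" using c assms symcD by blast
  have br: "mv c' a (br a) = c' (br a) - 1" "mv c' (br a) a = c' a - 1" "mv c' a a = c' a + 1"
    "mv c' (br a) (br a) = c' (br a) + 1" for c'
    using assms(2) mv_br[of a] mv_br[of "br a"] mv_same[of "br a"] by (simp_all add: mv_same)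
  have oth: "mv c' a e = c' e" "mv c' (br a) e = c' e" "mv c' e a = c' a" "mv c' e (br a) = c' (br a)" if "e \<noteq> a" for c'
    using that assms mv_other[of e a c'] mv_other[of e "br a" c'] mv_other[of a e c'] mv_other[of "br a" e c'] neq_br_sym[of e a]
    by (auto simp: br_eq_iff)
  have "wt3 i a i b k e c = 0 \<and> wt3 i b i a k e c = 0 \<and> wt3 i a k e i b c = 0 \<and>
    wt3 i b k e i a c = 0 \<and> wt3 k e i a i b c = 0 \<and> wt3 k e i b i a c = 0"
  proof (cases "e = a")
    case True
    with assms have "b = a" by auto
    show ?thesis unfolding True \<open>b = a\<close>
      by (intro conjI; rule wt3_zeroI; simp only: br; use bra k in presburger)
  next
    case False
    note oth = oth[OF False]
    from assms(5) show ?thesis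
    proof
      assume b: "b = a"
      show ?thesis unfolding b
        by (intro conjI; rule wt3_zeroI; simp only: br oth; use bra k in presburger)
    next
      assume b: "b = br a"
      show ?thesis unfolding b
        by (intro conjI; rule wt3_zeroI; simp only: br oth bra; use bra k in presburger)
    qed
  qed
  then show ?thesis by (simp add: S6_def)
qed

lemma S6_zero:
  assumes "symc c" "a \<in> R" "b \<in> R" "e \<in> R" "e \<noteq> br a" "e \<noteq> br b" "k = i + 1 \<or> i = k + 1"
  shows "S6 i a b k e c = 0"
proof -
  consider "b = a \<or> b = br a" | "b \<noteq> a" "b \<noteq> br a" "e = a" | "b \<noteq> a" "b \<noteq> br a" "e = b"
    | "b \<noteq> a" "b \<noteq> br a" "e \<noteq> a" "e \<noteq> b" by blast
  then show ?thesis
  proof cases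
    case 1
    then show ?thesis using S6_degenerate assms by blast
  next
    case 2
    then show ?thesis using S6_string assms by blast
  next
    case 3
    then show ?thesis using S6_string[of c b a k i] neq_br_sym[of b a] assms by (auto simp: S6_commute[of i a])
  next
    case 4
    then show ?thesis using S6_generic assms by blast
  qed
qed

text \<open>After the first step of the mirror pair the other member has colour N - i or N - k. A
  step at node k, respectively i, from there would require k = N - i.\<close>

lemma S6_mirror_zero:
  assumes c: "symc c" and ab: "a \<in> R" "b \<in> R" and "k = i + 1 \<or> i = k + 1" "k \<noteq> N - i"
  shows "S6 i a b k (br a) c = 0"
proof -
  have bra: "c (br a) = N + 1 - c a" using c assms symcD by blast
  have br: "mv c' a (br a) = c' (br a) - 1" "mv c' (br a) a = c' a - 1" "mv c' a a = c' a + 1"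
    "mv c' (br a) (br a) = c' (br a) + 1" for c'
    using ab mv_br[of a] mv_br[of "br a"] mv_same[of "br a"] by (simp_all add: mv_same)
  have oth: "mv c' a b = c' b" "mv c' (br a) b = c' b" "mv c' b a = c' a" "mv c' b (br a) = c' (br a)"
    if "b \<noteq> a" "b \<noteq> br a" for c'
    using that ab mv_other[of b a c'] mv_other[of b "br a" c'] mv_other[of a b c'] mv_other[of "br a" b c'] neq_br_sym[of b a]
    by (auto simp: br_eq_iff)
  have "wt3 i a i b k (br a) c = 0 \<and> wt3 i b i a k (br a) c = 0 \<and> wt3 i a k (br a) i b c = 0 \<and>
    wt3 i b k (br a) i a c = 0 \<and> wt3 k (br a) i a i b c = 0 \<and> wt3 k (br a) i b i a c = 0"
  proof -
    consider "b = a" | "b = br a" | "b \<noteq> a" "b \<noteq> br a" by blast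
    then show ?thesis
    proof cases
      case 1
      show ?thesis unfolding 1
        by (intro conjI; rule wt3_zeroI; simp only: br bra; use assms(4,5) bra in presburger)
    next
      case 2
      show ?thesis unfolding 2
        by (intro conjI; rule wt3_zeroI; simp only: br bra; use assms(4,5) bra in presburger)
    next
      case 3
      show ?thesis
        by (intro conjI; rule wt3_zeroI; simp only: br oth[OF 3] bra; use assms(4,5) bra in presburger)
    qed
  qed
  then show ?thesis by (simp add: S6_def)
qed

definition serre_coeff :: "int \<Rightarrow> int \<Rightarrow> int \<Rightarrow> int \<Rightarrow> int \<Rightarrow> ((nat \<Rightarrow> int) \<Rightarrow> 'a) \<Rightarrow> (nat \<Rightarrow> int) \<Rightarrow> 'a" where
  "serre_coeff i k r s t F c =
     Bop i r (Bop i s (Bop k t F)) c - two * Bop i r (Bop k t (Bop i s F)) c + Bop k t (Bop i r (Bop i s F)) c"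

text \<open>Each of the six composites is renamed so that a and b always carry the exponents r and s
  and e carries t; then the sums can be compared term by term.\<close>

lemma serre_coeff_sum:
  assumes "c \<in> Col" "ok i" "ok k"
  shows "serre_coeff i k r s t F c + serre_coeff i k s r t F c
    = (\<Sum>a\<in>R. \<Sum>b\<in>R. \<Sum>e\<in>R. yv i a powi r * yv i b powi s * yv k e powi t
         * S6 i a b k e c * F (mv (mv (mv c a) b) e))"
proof -
  let ?m = "\<lambda>a b e. yv i a powi r * yv i b powi s * yv k e powi t" and ?F = "\<lambda>a b e. F (mv (mv (mv c a) b) e)"
  have FC: "F (mv (mv (mv c a) e) b) = ?F a b e" "F (mv (mv (mv c e) a) b) = ?F a b e"
    "?F b a e = ?F a b e" "F (mv (mv (mv c b) e) a) = ?F a b e" "F (mv (mv (mv c e) b) a) = ?F a b e" for a b e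
    by (metis mv_commute)+
  have swap23: "(\<Sum>a\<in>R. \<Sum>e\<in>R. \<Sum>b\<in>R. h a e b) = (\<Sum>a\<in>R. \<Sum>b\<in>R. \<Sum>e\<in>R. h a e b)" for h :: "nat \<Rightarrow> nat \<Rightarrow> nat \<Rightarrow> 'a"
    by (rule sum.cong[OF refl sum.swap])
  have swap12: "(\<Sum>a\<in>R. \<Sum>b\<in>R. \<Sum>e\<in>R. h b a e) = (\<Sum>a\<in>R. \<Sum>b\<in>R. \<Sum>e\<in>R. h a b e)" for h :: "nat \<Rightarrow> nat \<Rightarrow> nat \<Rightarrow> 'a"
    by (rule sum.swap)
  have 1: "Bop i r (Bop i s (Bop k t F)) c = (\<Sum>a\<in>R. \<Sum>b\<in>R. \<Sum>e\<in>R. ?m a b e * wt3 i a i b k e c * ?F a b e)"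
    using assms by (simp add: Bop_Bop_Bop)
  have 2: "Bop i s (Bop i r (Bop k t F)) c = (\<Sum>a\<in>R. \<Sum>b\<in>R. \<Sum>e\<in>R. ?m a b e * wt3 i b i a k e c * ?F a b e)"
    unfolding Bop_Bop_Bop[OF assms(1,2,2)] by (subst swap12[symmetric], intro sum.cong refl) (simp add: FC mult_ac)
  have 3: "Bop i r (Bop k t (Bop i s F)) c = (\<Sum>a\<in>R. \<Sum>b\<in>R. \<Sum>e\<in>R. ?m a b e * wt3 i a k e i b c * ?F a b e)"
    unfolding Bop_Bop_Bop[OF assms(1,2,3)] by (subst swap23, intro sum.cong refl) (simp add: FC mult_ac)
  have 4: "Bop i s (Bop k t (Bop i r F)) c = (\<Sum>a\<in>R. \<Sum>b\<in>R. \<Sum>e\<in>R. ?m a b e * wt3 i b k e i a c * ?F a b e)"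
    unfolding Bop_Bop_Bop[OF assms(1,2,3)] by (subst swap23, subst swap12[symmetric], intro sum.cong refl) (simp add: FC mult_ac)
  have 5: "Bop k t (Bop i r (Bop i s F)) c = (\<Sum>a\<in>R. \<Sum>b\<in>R. \<Sum>e\<in>R. ?m a b e * wt3 k e i a i b c * ?F a b e)"
    unfolding Bop_Bop_Bop[OF assms(1,3,2)] by (subst swap12[symmetric], subst swap23, intro sum.cong refl) (simp add: FC mult_ac)
  have 6: "Bop k t (Bop i s (Bop i r F)) c = (\<Sum>a\<in>R. \<Sum>b\<in>R. \<Sum>e\<in>R. ?m a b e * wt3 k e i b i a c * ?F a b e)"
    unfolding Bop_Bop_Bop[OF assms(1,3,2)] by (subst swap12[symmetric], subst swap23, subst swap12[symmetric], intro sum.cong refl) (simp add: FC mult_ac)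
  show ?thesis
    unfolding serre_coeff_def 1 2 3 4 5 6 sum_distrib_left sum.distrib[symmetric] sum_subtractf[symmetric]
    by (intro sum.cong refl) (simp add: S6_def algebra_simps)
qed

lemma serre_relation:
  assumes "c \<in> Col" "ok i" "ok k" "k = i + 1 \<or> i = k + 1" "k \<noteq> N - i"
  shows "serre_coeff i k r s t F c + serre_coeff i k s r t F c = 0"
proof -
  have s: "symc c" using assms symc_Col by blast
  have "S6 i a b k e c = 0" if "a \<in> R" "b \<in> R" "e \<in> R" for a b e
    using S6_zero[OF s that _ _ assms(4)] S6_mirror_zero[OF s that(1,2) assms(4,5)]
      S6_mirror_zero[OF s that(2,1) assms(4,5)] S6_commute[of i a b] by metis
  then show ?thesis unfolding serre_coeff_sum[OF assms(1-3)] by simp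
qed

end

section \<open>Commutators of opposite nodes\<close>

lemma linfrac_scale_nth: "finite S \<Longrightarrow> (\<Prod>s\<in>S. linfrac (C * a s) (C * b s)) $ m
    = (C::'a::field) ^ m * (\<Prod>s\<in>S. linfrac (a s) (b s)) $ m"
proof (induction S arbitrary: m rule: finite_induct)
  case (insert u S)
  have 1: "linfrac (C * a u) (C * b u) $ k = C ^ k * linfrac (a u) (b u) $ k" for k
    by (cases k) (simp_all add: linfrac_nth power_mult_distrib right_diff_distrib mult_ac)
  have 2: "C ^ k * y * (C ^ (m - k) * z) = C ^ m * (y * z)" if "k \<le> m" for k y z
  proof -
    have "C ^ k * y * (C ^ (m - k) * z) = C ^ (k + (m - k)) * (y * z)"
      by (simp only: power_add mult_ac)
    then show ?thesis using that by simp
  qed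
  show ?case
    using insert(1,2) by (simp add: fps_mult_nth insert(3) 1 2 sum_distrib_left)
qed simp

lemma linfrac_trans: "linfrac u w * linfrac w z = linfrac u (z::'a::field)"
proof -
  have "linfrac u w * linfrac w z = linfrac u z * ((1 - fps_const w * fps_X) * inverse (1 - fps_const w * fps_X))"
    unfolding linfrac_def by (simp only: mult_ac)
  then show ?thesis by (simp only: one_minus_X_mult_inverse mult_1_right)
qed

lemma linfrac_trans': "linfrac w z * linfrac u w = linfrac u (z::'a::field)"
  by (simp add: linfrac_trans mult.commute)

lemma linfrac_self: "linfrac u u = (1 :: 'a::field fps)"
  by (simp add: linfrac_def one_minus_X_mult_inverse)

lemma prod_inverse: "(\<Prod>t\<in>A. inverse (f t :: 'a::field)) = inverse (prod f A)"
  using prod_inversef[of f A] by (simp add: comp_def)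

context colouring
begin

abbreviation cC :: 'a where "cC \<equiv> q powi N"

lemma prod_split_pair:
  "a \<in> R \<Longrightarrow> prod h R = h a * (h (br a) * prod h (R - {a, br a}))"
proof -
  assume a: "a \<in> R"
  have "R - {a} - {br a} = R - {a, br a}" by auto
  then show ?thesis using a prod.remove[of R a h] prod.remove[of "R - {a}" "br a" h] by simp
qed

lemma prod_br: "prod h R = (\<Prod>t\<in>R. h (br t))"
  by (rule prod.reindex_bij_witness[where i=br and j=br]) auto

lemma prod_R_mv:
  assumes "a \<in> R"
  shows "(\<Prod>t\<in>R. h t (mv c a t)) = h a (c a + 1) * (h (br a) (c (br a) - 1) * (\<Prod>t\<in>R - {a, br a}. h t (c t)))"
  using assms by (subst prod_split_pair[OF assms]) (auto simp: mv_same mv_br mv_other intro!: arg_cong2[where f="(*)"] prod.cong)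

section \<open>Eigenvalues of K and Theta and their change under a move\<close>

definition kap :: "int \<Rightarrow> int \<Rightarrow> 'a" where
  "kap i k = (if k = i then q else if k = i + 1 then inverse q else 1)"

text \<open>A power of q whose exponent is the number of indices of colour i minus that of colour i
  + 1. As a product over indices it changes under a move only in the factors at a and
  \<open>br a\<close>, and it can be distributed over the factors of a residue.\<close>

definition kk :: "int \<Rightarrow> (nat \<Rightarrow> int) \<Rightarrow> 'a" where
  "kk i c = (\<Prod>t\<in>R. kap i (c t))"

definition Kf :: "int \<Rightarrow> (nat \<Rightarrow> int) \<Rightarrow> 'a" where
  "Kf i c = inverse (kk i c) * (if i = int n then q else 1)"

lemma kap_nz: "kap i k \<noteq> 0" using q0 by (simp add: kap_def)

lemma kk_nz: "kk i c \<noteq> 0" using kap_nz by (simp add: kk_def)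

lemma Kf_nz: "Kf i c \<noteq> 0" using kk_nz q0 by (simp add: Kf_def)

lemma kk_dual: "symc c \<Longrightarrow> kk (N - i) c = inverse (kk i c)"
proof -
  assume c: "symc c"
  have "kk (N - i) c = (\<Prod>t\<in>R. kap (N - i) (c (br t)))" unfolding kk_def by (rule prod_br)
  also have "\<dots> = (\<Prod>t\<in>R. inverse (kap i (c t)))"
    using c by (intro prod.cong) (auto simp: symcD kap_def)
  finally show ?thesis by (simp add: kk_def prod_inverse)
qed

lemma kap_step: "kap i (j + 1) = kap i j * q powi (- cmat i j)"
  using q0 by (auto simp: kap_def cmat_def power2_eq_square power_int_minus)

lemma cmat_dual: "cmat (N - i) j = cmat i (N - j)"
  by (auto simp: cmat_def)

lemma kk_mv:
  assumes "symc c" "a \<in> R"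
  shows "kk i (mv c a) = kk i c * q powi (cmat (N - i) (c a) - cmat i (c a))"
proof -
  define j where "j = N - c a"
  have b: "c (br a) = j + 1" using assms symcD[of c a] by (simp add: j_def)
  have 1: "kap i (c (br a) - 1) = kap i (c (br a)) * q powi (cmat (N - i) (c a))"
    unfolding b kap_step cmat_dual j_def[symmetric] using q0 by (simp add: power_int_minus)
  have "kk i (mv c a) = kap i (c a + 1) * (kap i (c (br a) - 1) * (\<Prod>t\<in>R - {a, br a}. kap i (c t)))"
    unfolding kk_def by (rule prod_R_mv[OF assms(2), of "\<lambda>t. kap i"])
  also have "\<dots> = kk i c * (q powi (- cmat i (c a)) * q powi (cmat (N - i) (c a)))"
    unfolding kk_def prod_split_pair[OF assms(2)] 1 kap_step by (simp only: mult_ac)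
  also have "q powi (- cmat i (c a)) * q powi (cmat (N - i) (c a)) = q powi (cmat (N - i) (c a) - cmat i (c a))"
    using q0 by (simp add: power_int_add[symmetric])
  finally show ?thesis .
qed

lemma Kf_mv:
  assumes "symc c" "a \<in> R"
  shows "Kf i c = q powi (cmat (N - i) (c a) - cmat i (c a)) * Kf i (mv c a)"
  using q0 by (simp add: Kf_def kk_mv[OF assms])

text \<open>The contribution of one index of colour k to Theta_i, normalised to constant term 1. The
  powers of q removed from \<open>Phi\<close> by this normalisation cancel the prefactor of
  \<open>Theta_hat_series\<close>.\<close>

definition phi :: "int \<Rightarrow> int \<Rightarrow> 'a \<Rightarrow> 'a fps" where
  "phi i k y = (if k = i then linfrac (y / q ^ 2) y else if k = i + 1 then linfrac (q ^ 2 * y) y else 1)"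

definition pth :: "int \<Rightarrow> (nat \<Rightarrow> int) \<Rightarrow> 'a fps" where
  "pth i c = (\<Prod>t\<in>R. phi i (c t) (yv i t))"

definition ext :: "int \<Rightarrow> 'a fps" where
  "ext i = (if i = int n + 1 then (1 - fps_const (q ^ (2 * n)) * fps_X ^ 2)
      * inverse (1 - fps_const (q ^ (2 * n + 2)) * fps_X ^ 2) else 1)"

definition th :: "int \<Rightarrow> (nat \<Rightarrow> int) \<Rightarrow> 'a fps" where
  "th i c = pth i c * ext i"

text \<open>The structure function relating B and Theta already shows on a single index, as the
  quotient of its contributions in adjacent colours. Both transitions at node i and the trivial ones
  have this form with the exponent \<open>cmat i j\<close>.\<close>

lemma phi_step:
  "phi i (j + 1) (q powi i * z) = linfrac (q powi (cmat i j) * (q powi j * z)) (q powi (- cmat i j) * (q powi j * z))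
     * phi i j (q powi i * z)"
proof -
  consider "j = i" | "i = j + 1" | "j = i + 1" | "j \<noteq> i" "i \<noteq> j + 1" "j \<noteq> i + 1" by blast
  then show ?thesis
  proof cases
    case 1
    then show ?thesis using q0 by (simp add: phi_def cmat_def power_int_minus field_simps linfrac_trans linfrac_trans')
  next
    case 2
    then have "i = 1 + j" by simp
    then show ?thesis using q0 by (simp add: phi_def cmat_def power_int_add power_int_minus field_simps power2_eq_square)
  next
    case 3
    then show ?thesis using q0 
      by (simp add: phi_def cmat_def power_int_add power_int_minus linfrac_self linfrac_trans linfrac_trans' field_simps power2_eq_square)
  next
    case 4
    then show ?thesis by (simp add: phi_def cmat_def linfrac_self)
  qed
qed

text \<open>The first fraction comes from a, which rises, the second from \<open>br a\<close>, which
  falls. For the latter \<open>phi_step\<close> is applied at the colour N - j that it reaches, and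
  inverted.\<close>

lemma pth_mv:
  assumes "symc c" "a \<in> R"
  defines "j \<equiv> c a" and "y \<equiv> yv (c a) a"
  shows "pth i (mv c a) = linfrac (q powi cmat i j * y) (q powi (- cmat i j) * y)
     * linfrac (q powi (- cmat (N - i) j) * (cC / y)) (q powi (cmat (N - i) j) * (cC / y)) * pth i c"
proof -
  have b: "c (br a) = (N - j) + 1" using assms(1,2) symcD[of c a] by (simp add: j_def)
  have inv: "linfrac u w * (linfrac w u * z) = z" for u w :: 'a and z
    by (simp add: linfrac_trans linfrac_self flip: mult.assoc)
  have y': "q powi (N - j) * x (br a) = cC / y"
    using assms(2) q0 x_nz by (simp add: y_def yv_def x_br power_int_diff j_def field_simps)
  have 1: "phi i (j + 1) (yv i a) = linfrac (q powi cmat i j * y) (q powi (- cmat i j) * y) * phi i j (yv i a)"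
    unfolding yv_def y_def j_def by (rule phi_step)
  have 2: "phi i (c (br a)) (yv i (br a)) = linfrac (q powi cmat (N - i) j * (cC / y)) (q powi (- cmat (N - i) j) * (cC / y))
      * phi i (N - j) (yv i (br a))"
    unfolding b yv_def phi_step y' cmat_dual ..
  have 3: "phi i (N - j) (yv i (br a)) = linfrac (q powi (- cmat (N - i) j) * (cC / y)) (q powi (cmat (N - i) j) * (cC / y))
      * phi i (c (br a)) (yv i (br a))"
    unfolding 2 by (simp add: inv)
  have "pth i (mv c a) = phi i (c a + 1) (yv i a) * (phi i (c (br a) - 1) (yv i (br a)) * (\<Prod>t\<in>R - {a, br a}. phi i (c t) (yv i t)))"
    unfolding pth_def by (rule prod_R_mv[OF assms(2), of "\<lambda>t k. phi i k (yv i t)"])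
  also have "c (br a) - 1 = N - j" using b by simp
  finally have "pth i (mv c a) = phi i (j + 1) (yv i a) * (phi i (N - j) (yv i (br a)) * (\<Prod>t\<in>R - {a, br a}. phi i (c t) (yv i t)))"
    by (simp add: j_def)
  then show ?thesis
    unfolding 1 3 by (simp only: pth_def prod_split_pair[OF assms(2)] j_def mult_ac)
qed

section \<open>Weights of mirror pairs as residues\<close>

definition Qp :: "(nat \<Rightarrow> int) \<Rightarrow> int \<Rightarrow> nat \<Rightarrow> 'a" where
  "Qp c k t = pg c k t * pg c (N - k) (br t)"

definition gam :: "(nat \<Rightarrow> int) \<Rightarrow> int \<Rightarrow> nat \<Rightarrow> nat \<Rightarrow> 'a" where
  "gam c i t u = (if c u = i then g t u else if c u = i + 1 then g u t else 1)"

text \<open>Reindexing the factor of \<open>br t\<close> by \<open>br\<close> turns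
  \<open>g (br t) (br u)\<close> into \<open>g u t\<close> and colour N - i into i + 1, so both
  factors become products over the same indices u.\<close>

lemma Qp_eq:
  assumes "symc c" "t \<in> R"
  shows "Qp c i t = (\<Prod>u\<in>R - {t, br t}. gam c i t u)"
proof -
  have "pg c (N - i) (br t) = (\<Prod>u\<in>R - {t, br t}. if c (br u) = N - i then g (br t) (br u) else 1)"
    unfolding pg_alt by (rule prod.reindex_bij_witness[where i=br and j=br]) (use assms in \<open>auto simp: br_eq_iff\<close>)
  also have "\<dots> = (\<Prod>u\<in>R - {t, br t}. if c u = i + 1 then g u t else 1)"
    using assms by (intro prod.cong) (auto simp: symcD g_br_br)
  finally show ?thesis
    unfolding Qp_def by (simp add: pg_alt prod.distrib[symmetric]) (rule prod.cong, auto simp: gam_def)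
qed

definition alf :: "int \<Rightarrow> (nat \<Rightarrow> int) \<Rightarrow> nat \<Rightarrow> 'a" where
  "alf i c t = (if c t = i then yv i t / q ^ 2 else q ^ 2 * yv i t)"

definition rs :: "int \<Rightarrow> (nat \<Rightarrow> int) \<Rightarrow> nat \<Rightarrow> 'a" where
  "rs i c t = (if c t = i then 1 else if c t = i + 1 then -1 else 0) * (q - inverse q) * (Qp c i t * gam c i t (br t))"

text \<open>The power of q balances the fraction: q (1 - X / q^2) / (1 - X) with X = x_u / x_t is
  \<open>g t u\<close>, and similarly for colour i + 1. Distributing \<open>kk\<close> over the
  indices thus turns a residue into a product of values of \<open>g\<close>.\<close>

lemma kap_ratio:
  assumes "t \<in> R" "u \<in> R" "u \<noteq> t" "c u = i \<or> c u = i + 1"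
  shows "kap i (c u) * ((1 - alf i c u / yv i t) / (1 - yv i u / yv i t)) = gam c i t u"
proof -
  have nz: "x t \<noteq> 0" "q \<noteq> 0" "q powi i \<noteq> 0" using x_nz assms q0 by auto
  have d: "x t - x u \<noteq> 0" "x u - x t \<noteq> 0" using xneq[of t u] xneq[of u t] assms by auto
  have b: "1 - yv i u / yv i t = (x t - x u) / x t" using nz by (simp add: yv_def field_simps)
  have can: "q * ((inverse q / x t * A) / (B / x t)) = A / B" "inverse q * ((- (q / x t) * A) / (B / x t)) = - (A / B)" for A B
    using nz by (simp_all add: field_simps)
  show ?thesis
  proof (cases "c u = i")
    case True
    then have e: "1 - alf i c u / yv i t = (inverse q / x t) * (q * x t - inverse q * x u)"
      using nz by (simp add: alf_def yv_def field_simps power2_eq_square)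
    show ?thesis unfolding b e using True by (simp only: kap_def gam_def g_def simp_thms if_True can)
  next
    case False
    then have cu: "c u = i + 1" "i + 1 \<noteq> i" using assms by auto
    have e: "1 - alf i c u / yv i t = - (q / x t) * (q * x u - inverse q * x t)"
      using nz False by (simp add: alf_def yv_def field_simps power2_eq_square)
    have "g u t = - ((q * x u - inverse q * x t) / (x t - x u))" by (rule g_flip)
    then show ?thesis unfolding b e using cu by (simp only: kap_def gam_def simp_thms if_True if_False can)
  qed
qed

lemma pth_alt: "pth i c = (\<Prod>t\<in>{t\<in>R. c t = i \<or> c t = i + 1}. linfrac (alf i c t) (yv i t))"
  unfolding pth_def by (subst prod.inter_filter) (auto simp: phi_def alf_def intro!: prod.cong)

lemma alf_nz: "t \<in> R \<Longrightarrow> alf i c t \<noteq> 0"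
  using q0 yv_nz by (simp add: alf_def)

lemma yv_inj: "inj_on (yv i) R"
  using q0 x_inj_R by (auto simp: inj_on_def yv_def)

lemma yv_dual: "t \<in> R \<Longrightarrow> yv (N - i) (br t) = cC / yv i t"
  using q0 x_nz by (simp add: yv_def x_br power_int_diff field_simps)

text \<open>Because \<open>yv (N - i) (br t)\<close> is \<open>cC / yv i t\<close>, the series of
  the mirror node is, up to the value at infinity, the expansion at infinity of that of node i, with
  the variable rescaled by \<open>cC\<close>.\<close>

lemma pth_dual_nth:
  assumes "symc c"
  shows "pth (N - i) c $ m = cC ^ m * (\<Prod>t\<in>{t\<in>R. c t = i \<or> c t = i + 1}. linfrac (1 / alf i c t) (1 / yv i t)) $ m"
proof -
  have "pth (N - i) c = (\<Prod>t\<in>R. phi (N - i) (c (br t)) (yv (N - i) (br t)))"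
    unfolding pth_def by (rule prod_br)
  also have "\<dots> = (\<Prod>t\<in>R. if c t = i \<or> c t = i + 1 then linfrac (cC * (1 / alf i c t)) (cC * (1 / yv i t)) else 1)"
  proof (intro prod.cong refl)
    fix t assume t: "t \<in> R"
    have c: "c (br t) = N + 1 - c t" using assms t symcD by blast
    have y: "q ^ 2 * (cC / yv i t) = cC * (1 / (yv i t / q ^ 2))" "cC / yv i t / q ^ 2 = cC * (1 / (q ^ 2 * yv i t))"
      using q0 yv_nz[OF t] by (simp_all add: field_simps)
    show "phi (N - i) (c (br t)) (yv (N - i) (br t))
      = (if c t = i \<or> c t = i + 1 then linfrac (cC * (1 / alf i c t)) (cC * (1 / yv i t)) else 1)"
      unfolding yv_dual[OF t] phi_def alf_def c y by auto
  qed
  also have "\<dots> = (\<Prod>t\<in>{t\<in>R. c t = i \<or> c t = i + 1}. linfrac (cC * (1 / alf i c t)) (cC * (1 / yv i t)))"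
    by (subst prod.inter_filter) auto
  finally have P: "pth (N - i) c = (\<Prod>t\<in>{t\<in>R. c t = i \<or> c t = i + 1}. linfrac (cC * (1 / alf i c t)) (cC * (1 / yv i t)))" .
  show ?thesis unfolding P by (rule linfrac_scale_nth) simp
qed

lemma kk_pf_res:
  assumes "symc c" "t \<in> R" "c t = i \<or> c t = i + 1"
  shows "kk i c * pf_res {t\<in>R. c t = i \<or> c t = i + 1} (alf i c) (yv i) t = rs i c t"
proof -
  let ?S = "{t\<in>R. c t = i \<or> c t = i + 1}" and ?r = "\<lambda>u. (1 - alf i c u / yv i t) / (1 - yv i u / yv i t)"
  have "(\<Prod>u\<in>?S - {t}. ?r u) = (\<Prod>u\<in>R - {t}. if c u = i \<or> c u = i + 1 then ?r u else 1)"
    by (subst prod.inter_filter[symmetric]) (auto intro!: prod.cong)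
  moreover have "kk i c = kap i (c t) * (\<Prod>u\<in>R - {t}. kap i (c u))"
    unfolding kk_def using assms(2) by (simp add: prod.remove)
  ultimately have "kk i c * pf_res ?S (alf i c) (yv i) t = kap i (c t) * (1 - alf i c t / yv i t)
     * (\<Prod>u\<in>R - {t}. kap i (c u) * (if c u = i \<or> c u = i + 1 then ?r u else 1))"
    unfolding pf_res_def by (simp add: prod.distrib mult_ac)
  also have "(\<Prod>u\<in>R - {t}. kap i (c u) * (if c u = i \<or> c u = i + 1 then ?r u else 1)) = (\<Prod>u\<in>R - {t}. gam c i t u)"
  proof (intro prod.cong refl)
    fix u assume u: "u \<in> R - {t}"
    show "kap i (c u) * (if c u = i \<or> c u = i + 1 then ?r u else 1) = gam c i t u"
    proof (cases "c u = i \<or> c u = i + 1")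
      case True
      then show ?thesis using kap_ratio[OF assms(2), of u c i] u by auto
    qed (simp add: kap_def gam_def)
  qed
  also have "\<dots> = gam c i t (br t) * Qp c i t"
    unfolding Qp_eq[OF assms(1,2)] using assms(2) prod.remove[of "R - {t}" "br t" "gam c i t"]
    by (simp add: Diff_insert2[symmetric] insert_commute)
  also have "kap i (c t) * (1 - alf i c t / yv i t) = (if c t = i then 1 else if c t = i + 1 then -1 else 0) * (q - inverse q)"
    using assms q0 yv_nz[OF assms(2)] by (auto simp: kap_def alf_def field_simps power2_eq_square)
  finally show ?thesis by (simp add: rs_def mult_ac)
qed

text \<open>This is \<open>expansion_difference\<close> multiplied by \<open>kk i c\<close>. The
  value at infinity is the inverse square of \<open>kk i c\<close>, so the two expansions receive
  the factors \<open>kk i c\<close> and its inverse, just as the two terms on the right of the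
  relations for mirror nodes carry the eigenvalues of K at the mirror and at the node.\<close>

lemma expansion_difference_pth:
  assumes c: "symc c"
  shows "kk i c * zcoeff (pth i c) m - inverse (kk i c) * cC powi m * zcoeff (pth (N - i) c) (- m)
     = (\<Sum>t\<in>R. rs i c t * yv i t powi m)"
proof -
  let ?S = "{t\<in>R. c t = i \<or> c t = i + 1}"
  let ?D = "\<Prod>t\<in>?S. linfrac (1 / alf i c t) (1 / yv i t)"
  have p: "(\<Prod>t\<in>?S. alf i c t / yv i t) = inverse (kk i c) * inverse (kk i c)"
  proof -
    have "(\<Prod>t\<in>?S. alf i c t / yv i t) = (\<Prod>t\<in>R. inverse (kap i (c t)) * inverse (kap i (c t)))"
      using q0 yv_nz by (subst prod.inter_filter) (auto simp: kap_def alf_def field_simps power2_eq_square intro!: prod.cong)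
    then show ?thesis by (simp add: prod.distrib kk_def prod_inverse)
  qed
  have d: "zcoeff ?D (- m) = cC powi m * zcoeff (pth (N - i) c) (- m)"
  proof (cases "m \<le> 0")
    case True
    then obtain k where m: "m = - int k" by (metis nonpos_int_cases)
    have "cC ^ k \<noteq> 0" using q0 by simp
    then show ?thesis unfolding m zcoeff_def pth_dual_nth[OF c]
      by (simp add: power_int_minus del: power_not_zero power_eq_0_iff)
  qed (simp add: zcoeff_def)
  have "zcoeff (pth i c) m - inverse (kk i c) * inverse (kk i c) * zcoeff ?D (- m)
      = (\<Sum>t\<in>?S. pf_res ?S (alf i c) (yv i) t * yv i t powi m)"
    unfolding pth_alt p[symmetric]
    by (rule expansion_difference) (auto intro: inj_on_subset[OF yv_inj] simp: yv_nz alf_nz)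
  then have "kk i c * zcoeff (pth i c) m - inverse (kk i c) * zcoeff ?D (- m)
      = (\<Sum>t\<in>?S. kk i c * pf_res ?S (alf i c) (yv i) t * yv i t powi m)"
  proof -
    assume E: "zcoeff (pth i c) m - inverse (kk i c) * inverse (kk i c) * zcoeff ?D (- m) = (\<Sum>t\<in>?S. pf_res ?S (alf i c) (yv i) t * yv i t powi m)"
    have "kk i c * (z - inverse (kk i c) * inverse (kk i c) * w) = kk i c * z - inverse (kk i c) * w" for z w
      using kk_nz[of i c] by (simp add: right_diff_distrib)
    from this[of "zcoeff (pth i c) m" "zcoeff ?D (- m)"] show ?thesis
      unfolding E by (simp only: sum_distrib_left mult.assoc)
  qed
  also have "\<dots> = (\<Sum>t\<in>?S. rs i c t * yv i t powi m)"
    by (intro sum.cong refl) (simp add: kk_pf_res[OF c])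
  also have "\<dots> = (\<Sum>t\<in>R. rs i c t * yv i t powi m)"
    by (rule sum.mono_neutral_left) (auto simp: rs_def)
  finally show ?thesis unfolding d by (simp add: mult.assoc)
qed

text \<open>Off the mirror pairs everything cancels by hypothesis. The pair a, \<open>br a\<close>
  leads back to c, and as \<open>yv k (br a)\<close> is \<open>cC / yv i a\<close> its two powers
  combine into one power of \<open>yv i a\<close>.\<close>

lemma two_step_mirror:
  assumes "c \<in> Col" "ok i"
  defines "k \<equiv> N - i"
  assumes off: "\<And>a b. a \<in> R \<Longrightarrow> b \<in> R \<Longrightarrow> b \<noteq> br a \<Longrightarrow> A a b * wt2 i a k b c + B a b * wt2 k b i a c = 0"
  shows "(\<Sum>a\<in>R. \<Sum>b\<in>R. yv i a powi r * yv k b powi s * (A a b * wt2 i a k b c + B a b * wt2 k b i a c) * F (mv (mv c a) b))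
    = (\<Sum>a\<in>R. cC powi s * yv i a powi (r - s) * (A a (br a) * wt2 i a k (br a) c + B a (br a) * wt2 k (br a) i a c)) * F c"
proof -
  have "(\<Sum>b\<in>R. yv i a powi r * yv k b powi s * (A a b * wt2 i a k b c + B a b * wt2 k b i a c) * F (mv (mv c a) b))
    = cC powi s * yv i a powi (r - s) * (A a (br a) * wt2 i a k (br a) c + B a (br a) * wt2 k (br a) i a c) * F c"
    if a: "a \<in> R" for a
  proof -
    have "(\<Sum>b\<in>R. yv i a powi r * yv k b powi s * (A a b * wt2 i a k b c + B a b * wt2 k b i a c) * F (mv (mv c a) b))
      = (\<Sum>b\<in>{br a}. yv i a powi r * yv k b powi s * (A a b * wt2 i a k b c + B a b * wt2 k b i a c) * F (mv (mv c a) b))"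
      by (rule sum.mono_neutral_right) (use a off in auto)
    also have "yv i a powi r * yv k (br a) powi s = cC powi s * yv i a powi (r - s)"
      unfolding k_def yv_dual[OF a] using yv_nz[OF a, of i] by (simp add: power_int_divide_distrib power_int_diff)
    ultimately show ?thesis using a by (simp add: mv_mv_br)
  qed
  then show ?thesis by (simp add: sum_distrib_right)
qed

text \<open>In the second order \<open>br a\<close> moves first, from colour N - i, so initially a
  has colour i + 1. In both orders the weights do not see the displacement of the partner, because
  \<open>pg\<close> omits it.\<close>

lemma wt2_mirror:
  assumes "symc c" "a \<in> R"
  shows "wt2 i a (N - i) (br a) c = (if c a = i then Qp c i a * mid i a * mid (N - i) (br a) else 0)"
    and "wt2 (N - i) (br a) i a c = (if c a = i + 1 then Qp c i a * mid i a * mid (N - i) (br a) else 0)"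
proof -
  have b: "c (br a) = N + 1 - c a" using assms symcD by blast
  have m: "mv c (br a) a = c a - 1" using mv_br[of "br a" c] assms by simp
  show "wt2 i a (N - i) (br a) c = (if c a = i then Qp c i a * mid i a * mid (N - i) (br a) else 0)"
    using assms by (simp add: wt2_def wt_def mv_br b Qp_def mult_ac)
  show "wt2 (N - i) (br a) i a c = (if c a = i + 1 then Qp c i a * mid i a * mid (N - i) (br a) else 0)"
    using assms by (simp add: wt2_def wt_def m b Qp_def mult_ac)
qed

text \<open>The mirror pairs leave the residues \<open>rs\<close>, whose sum is evaluated by
  \<open>expansion_difference_pth\<close>. Since i is neither n nor n + 1, the indices a and
  \<open>br a\<close> do not meet in one block: \<open>mid\<close>, \<open>ext\<close> and the
  factor of \<open>br a\<close> in the residue are 1.\<close>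

lemma commutator_relation:
  assumes c: "c \<in> Col" and i: "ok i" "cmat i (N - i) = 0"
  defines "k \<equiv> N - i"
  shows "Bop i r (Bop k s F) c - Bop k s (Bop i r F) c
     = 1 / (q - inverse q) * (cC powi s * Kf k c * zcoeff (th i c) (r - s)
         - cC powi r * Kf i c * zcoeff (th k c) (s - r)) * F c"
proof -
  have sc: "symc c" using c symc_Col by blast
  have k: "ok k" and n: "i \<noteq> int n" "i \<noteq> int n + 1" using i by (auto simp: k_def cmat_def split: if_splits)
  have qq: "q - inverse q \<noteq> 0" using q0 q2 by (auto simp: field_simps power2_eq_square)
  have "Bop i r (Bop k s F) c - Bop k s (Bop i r F) c
    = (\<Sum>a\<in>R. \<Sum>b\<in>R. yv i a powi r * yv k b powi s * (1 * wt2 i a k b c + (-1) * wt2 k b i a c) * F (mv (mv c a) b))"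
    unfolding Bop_Bop[OF c i(1)] Bop_Bop[OF c k]
    by (subst (2) sum.swap) (simp add: sum_subtractf[symmetric] algebra_simps mv_commute)
  also have "\<dots> = (\<Sum>a\<in>R. cC powi s * yv i a powi (r - s) * (1 * wt2 i a k (br a) c + (-1) * wt2 k (br a) i a c)) * F c"
    unfolding k_def by (rule two_step_mirror[OF c i(1)]) (use wt2_commute[OF sc] i in auto)
  also have "(\<Sum>a\<in>R. cC powi s * yv i a powi (r - s) * (1 * wt2 i a k (br a) c + (-1) * wt2 k (br a) i a c))
    = (\<Sum>a\<in>R. cC powi s / (q - inverse q) * (rs i c a * yv i a powi (r - s)))"
  proof (intro sum.cong refl)
    fix a assume a: "a \<in> R"
    have b: "c (br a) = N + 1 - c a" using sc a symcD by blast
    have "mid i a = 1" "mid k (br a) = 1" using n by (auto simp: mid_def k_def)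
    moreover have "gam c i a (br a) = 1" if "c a = i \<or> c a = i + 1"
      using that b n by (auto simp: gam_def)
    ultimately have "1 * wt2 i a k (br a) c + (-1) * wt2 k (br a) i a c = rs i c a / (q - inverse q)"
      unfolding k_def wt2_mirror[OF sc a] rs_def using qq by auto
    then show "cC powi s * yv i a powi (r - s) * (1 * wt2 i a k (br a) c + (-1) * wt2 k (br a) i a c)
      = cC powi s / (q - inverse q) * (rs i c a * yv i a powi (r - s))" by simp
  qed
  also have "\<dots> = cC powi s / (q - inverse q) * (kk i c * zcoeff (pth i c) (r - s)
     - inverse (kk i c) * cC powi (r - s) * zcoeff (pth (N - i) c) (- (r - s)))"
    by (simp only: sum_distrib_left[symmetric] expansion_difference_pth[OF sc])
  also have "\<dots> = 1 / (q - inverse q) * (cC powi s * Kf k c * zcoeff (th i c) (r - s)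
         - cC powi r * Kf i c * zcoeff (th k c) (s - r))"
  proof -
    have c1: "cC powi r = cC powi s * cC powi (r - s)" using q0 by (simp add: power_int_add[symmetric])
    have c2: "th i c = pth i c" "th k c = pth (N - i) c" "Kf i c = inverse (kk i c)" "Kf k c = kk i c"
      using n kk_dual[OF sc, of i] by (auto simp: th_def ext_def Kf_def k_def)
    have gen: "u / v * (e * z - e' * w * z') = 1 / v * (u * e * z - u * w * e' * z')" for u v e z e' w z' :: 'a
      by (simp add: algebra_simps diff_divide_distrib)
    show ?thesis unfolding c1 c2 minus_diff_eq by (rule gen)
  qed
  finally show ?thesis .
qed

text \<open>The denominator of \<open>ext\<close> is multiplied out. The relation for the middle
  nodes contains Theta_(n+1) in exactly this combination of two coefficients, since q^(2n+2) is q
  times \<open>cC\<close>; this accounts for the constants in the correction factor.\<close>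

lemma th_middle:
  "zcoeff (th (int n + 1) c) m - q ^ (2 * n + 2) * zcoeff (th (int n + 1) c) (m - 2)
    = zcoeff (pth (int n + 1) c) m - q ^ (2 * n) * zcoeff (pth (int n + 1) c) (m - 2)"
proof -
  let ?t = "th (int n + 1) c" and ?p = "pth (int n + 1) c"
  have "inverse (1 - fps_const (q ^ (2 * n + 2)) * fps_X ^ 2) * (1 - fps_const (q ^ (2 * n + 2)) * fps_X ^ 2 :: 'a fps) = 1"
    by (rule inverse_mult_eq_1) (simp add: power2_eq_square)
  then have e: "?t * (1 - fps_const (q ^ (2 * n + 2)) * fps_X ^ 2) = ?p * (1 - fps_const (q ^ (2 * n)) * fps_X ^ 2)"
    by (simp add: th_def ext_def mult.assoc)
  have sh: "zcoeff (f * (1 - fps_const u * fps_X ^ 2)) m = zcoeff f m - u * zcoeff f (m - 2)" for f :: "'a fps" and u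
  proof (cases "m < 0")
    case False
    then obtain k where m: "m = int k" by (metis not_less zero_le_imp_eq_int)
    have "(f * (1 - fps_const u * fps_X ^ 2)) = f - fps_const u * (f * fps_X ^ 2)"
      by (simp add: algebra_simps)
    then show ?thesis unfolding m zcoeff_def
      by (auto simp: fps_X_power_mult_right_nth nat_diff_distrib)
  qed (simp add: zcoeff_def)
  show ?thesis using arg_cong[OF e, of "\<lambda>f. zcoeff f m"] unfolding sh .
qed

text \<open>For a of colour n the middle block adds the factor \<open>g (br a) a\<close> to the
  weight, but the coefficient of the relation is a multiple of 1 / x_a - x_a and removes its pole.
  For a of colour n + 1 the same factor belongs to the residue. Both cases give the residue times
  the one linear expression y / C - q / y.\<close>

lemma middle_relation:
  assumes c: "c \<in> Col"
  defines "i \<equiv> int n" and "k \<equiv> int n + 1"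
  shows "inverse q * Bop i (r - 1) (Bop k s F) c - Bop i r (Bop k (s - 1) F) c
     + inverse q * Bop k (s - 1) (Bop i r F) c - Bop k s (Bop i (r - 1) F) c
     = 1 / (1 - q ^ 2) * (cC powi (r - 1) * Kf i c * zcoeff (th k c) (s - r + 1)
         - q * cC powi r * Kf i c * zcoeff (th k c) (s - 1 - r)
         + cC powi (s - 1) * Kf k c * zcoeff (th i c) (r - s + 1)
         - q * cC powi s * Kf k c * zcoeff (th i c) (r - 1 - s)) * F c"
proof -
  have sc: "symc c" using c symc_Col by blast
  have ok: "ok i" "ok k" "k = N - i" "N - i = k" using n1 by (auto simp: i_def k_def)
  let ?A = "\<lambda>a b. inverse q / yv i a - 1 / yv k b" and ?B = "\<lambda>a b. inverse q / yv k b - 1 / yv i a"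
  have qq: "1 - q ^ 2 \<noteq> 0" using q2 by simp
  have C0: "cC \<noteq> 0" using q0 by simp
  have B1: "Bop i r' (Bop k s' F) c = (\<Sum>a\<in>R. \<Sum>b\<in>R. yv i a powi r' * yv k b powi s' * wt2 i a k b c * F (mv (mv c a) b))"
    for r' s' by (rule Bop_Bop[OF c ok(1)])
  have B2: "Bop k s' (Bop i r' F) c = (\<Sum>a\<in>R. \<Sum>b\<in>R. yv i a powi r' * yv k b powi s' * wt2 k b i a c * F (mv (mv c a) b))"
    for r' s' unfolding Bop_Bop[OF c ok(2)] by (subst sum.swap, simp add: mult_ac mv_commute)
  have pw: "inverse q * (yv i a powi (r - 1) * yv k b powi s * w * f)
     - yv i a powi r * yv k b powi (s - 1) * w * f
     + inverse q * (yv i a powi r * yv k b powi (s - 1) * w' * f)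
     - yv i a powi (r - 1) * yv k b powi s * w' * f
     = yv i a powi r * yv k b powi s * (?A a b * w + ?B a b * w') * f" if "a \<in> R" "b \<in> R" for a b f w w'
  proof -
    have "yv i a powi (r - 1) = yv i a powi r / yv i a" "yv k b powi (s - 1) = yv k b powi s / yv k b"
      using yv_nz that by (simp_all add: power_int_diff)
    then show ?thesis by (simp add: algebra_simps)
  qed
  have "inverse q * Bop i (r - 1) (Bop k s F) c - Bop i r (Bop k (s - 1) F) c
     + inverse q * Bop k (s - 1) (Bop i r F) c - Bop k s (Bop i (r - 1) F) c
    = (\<Sum>a\<in>R. \<Sum>b\<in>R. yv i a powi r * yv k b powi s * (?A a b * wt2 i a k b c + ?B a b * wt2 k b i a c) * F (mv (mv c a) b))"
    unfolding B1 B2 sum_distrib_left sum_subtractf[symmetric] sum.distrib[symmetric]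
    by (intro sum.cong refl pw)
  also have "\<dots> = (\<Sum>a\<in>R. cC powi s * yv i a powi (r - s) * (?A a (br a) * wt2 i a k (br a) c + ?B a (br a) * wt2 k (br a) i a c)) * F c"
    unfolding ok(3)
  proof (rule two_step_mirror[OF c ok(1)])
    fix a b assume ab: "a \<in> R" "b \<in> R" "b \<noteq> br a"
    have "cmat i (N - i) = -1" by (simp add: cmat_def i_def)
    then show "(inverse q / yv i a - 1 / yv (N - i) b) * wt2 i a (N - i) b c + (inverse q / yv (N - i) b - 1 / yv i a) * wt2 (N - i) b i a c = 0"
      using wt2_quadratic[OF sc ab(1,2), of "N - i" i] ab(3) by (simp add: power_int_minus)
  qed
  also have "(\<Sum>a\<in>R. cC powi s * yv i a powi (r - s) * (?A a (br a) * wt2 i a k (br a) c + ?B a (br a) * wt2 k (br a) i a c))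
    = (\<Sum>a\<in>R. cC powi s * yv i a powi (r - s) * (1 / (1 - q ^ 2) * rs i c a * (yv i a / cC - q / yv i a)))"
  proof (intro sum.cong refl)
    fix a assume a: "a \<in> R"
    have b: "c (br a) = N + 1 - c a" using sc a symcD by blast
    have yk: "yv k (br a) = cC / yv i a" unfolding ok(3) by (rule yv_dual[OF a])
    define y where "y = yv i a"
    have y0: "y \<noteq> 0" using yv_nz a by (simp add: y_def)
    have md: "mid i a = 1" "mid k (br a) = g (br a) a" using a by (auto simp: mid_def i_def k_def)
    have w: "wt2 i a k (br a) c = (if c a = i then Qp c i a * g (br a) a else 0)"
      "wt2 k (br a) i a c = (if c a = i + 1 then Qp c i a * g (br a) a else 0)"
      using wt2_mirror[OF sc a, of i] md unfolding ok(4) by simp_all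
    have qq': "1 / (1 - q ^ 2) * (q - inverse q) = - inverse q"
      using qq q0 by (simp add: field_simps power2_eq_square)
    have "?A a (br a) * wt2 i a k (br a) c + ?B a (br a) * wt2 k (br a) i a c
        = 1 / (1 - q ^ 2) * rs i c a * (yv i a / cC - q / yv i a)"
    proof -
      consider "c a = i" | "c a = i + 1" | "c a \<noteq> i" "c a \<noteq> i + 1" by blast
      then show ?thesis
      proof cases
        case 1
        have gm: "gam c i a (br a) = 1" using 1 b by (simp add: gam_def i_def)
        have xa: "x a \<noteq> 0" "inverse (x a) - x a \<noteq> 0"
          using x_nz a xneq[of "br a" a] by (auto simp: x_br)
        have yy: "y = q powi i * x a" "cC = q * (q powi i * q powi i)"
        proof -
          have "N = 1 + (i + i)" by (simp add: i_def)
          then show "cC = q * (q powi i * q powi i)" using q0 by (simp only: power_int_add power_int_1_right simp_thms)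
        qed (simp add: y_def yv_def)
        have "(inverse q / y - y / cC) * g (br a) a = - inverse q * (y / cC - q / y)"
        proof -
          have "inverse q / y - y / cC = (inverse (x a) - x a) / (q * q powi i)"
            unfolding yy using xa q0 by (simp add: field_simps)
          moreover have "- inverse q * (y / cC - q / y) = (q * inverse (x a) - inverse q * x a) / (q * q powi i)"
            unfolding yy using xa q0 by (simp add: field_simps)
          ultimately show ?thesis using xa a by (simp add: g_def x_br)
        qed
        then have "(inverse q / y - y / cC) * (Qp c i a * g (br a) a) = (1 / (1 - q ^ 2) * (q - inverse q)) * Qp c i a * (y / cC - q / y)"
          unfolding qq' by (drule_tac arg_cong[where f="\<lambda>z. z * Qp c i a"]) (simp only: mult_ac)
        then show ?thesis unfolding w yk rs_def gm using 1 by (simp add: y_def)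
      next
        case 2
        have gm: "gam c i a (br a) = g (br a) a" using 2 b by (simp add: gam_def i_def)
        have "(inverse q / (cC / y) - 1 / y) * X = (1 / (1 - q ^ 2) * (q - inverse q)) * - X * (y / cC - q / y)" for X
          unfolding qq' using y0 C0 q0 by (simp add: field_simps)
        from this[of "Qp c i a * g (br a) a"] show ?thesis
          unfolding w yk rs_def gm using 2 by (simp add: y_def del: minus_diff_eq)
      next
        case 3
        then show ?thesis unfolding w rs_def by simp
      qed
    qed
    then show "cC powi s * yv i a powi (r - s) * (?A a (br a) * wt2 i a k (br a) c + ?B a (br a) * wt2 k (br a) i a c)
      = cC powi s * yv i a powi (r - s) * (1 / (1 - q ^ 2) * rs i c a * (yv i a / cC - q / yv i a))" by simp
  qed
  \<comment> \<open>The factor y / C - q / y splits the sum into two power sums, of exponents r - s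
    + 1 and r - s - 1; \<open>expansion_difference_pth\<close> applies to each.\<close>
  also have "\<dots> = 1 / (1 - q ^ 2) * (cC powi (s - 1) * (\<Sum>a\<in>R. rs i c a * yv i a powi (r - s + 1))
      - q * cC powi s * (\<Sum>a\<in>R. rs i c a * yv i a powi (r - s - 1)))"
  proof -
    have "cC powi s * yv i a powi (r - s) * (1 / (1 - q ^ 2) * rs i c a * (yv i a / cC - q / yv i a))
      = 1 / (1 - q ^ 2) * (cC powi (s - 1) * (rs i c a * yv i a powi (r - s + 1)) - q * cC powi s * (rs i c a * yv i a powi (r - s - 1)))"
      if "a \<in> R" for a
    proof -
      have "cC powi (s - 1) = cC powi s / cC" "yv i a powi (r - s + 1) = yv i a powi (r - s) * yv i a"
        "yv i a powi (r - s - 1) = yv i a powi (r - s) / yv i a"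
        using C0 yv_nz[OF that] by (simp_all add: power_int_add power_int_diff)
      then show ?thesis by (simp only:) (simp add: algebra_simps)
    qed
    then show ?thesis unfolding sum_distrib_left sum_subtractf[symmetric] by (intro sum.cong refl)
  qed
  also have "\<dots> = 1 / (1 - q ^ 2) * (cC powi (r - 1) * Kf i c * zcoeff (th k c) (s - r + 1)
         - q * cC powi r * Kf i c * zcoeff (th k c) (s - 1 - r)
         + cC powi (s - 1) * Kf k c * zcoeff (th i c) (r - s + 1)
         - q * cC powi s * Kf k c * zcoeff (th i c) (r - 1 - s))"
  proof -
    note D = expansion_difference_pth[OF sc, of i, unfolded ok(4)]
    have K: "Kf i c = q * inverse (kk i c)" "Kf k c = kk i c" "th i c = pth i c"
      using kk_dual[OF sc, of i] unfolding ok(4) by (simp_all add: Kf_def th_def ext_def i_def k_def)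
    have qC: "q ^ (2 * n + 2) = q * cC" "q * q ^ (2 * n) = cC"
      using q0 by (simp_all add: power_int_add power_int_def nat_add_distrib nat_mult_distrib)
    have t1: "zcoeff (th k c) (s - r + 1) - q * cC * zcoeff (th k c) (s - 1 - r)
       = zcoeff (pth k c) (s - r + 1) - q ^ (2 * n) * zcoeff (pth k c) (s - r - 1)"
      using th_middle[of c "s - r + 1"] unfolding k_def[symmetric] qC(1) by (simp add: algebra_simps)
    have pC1: "cC powi r = cC powi (r - 1) * cC"
      using power_int_add_1[of cC "r - 1"] C0 by simp
    have "cC powi (r - s + 1) * cC powi (s - 1) = cC powi r" "cC powi (r - s - 1) * cC powi s = cC powi (r - 1)"
      using C0 by (simp_all add: power_int_add[symmetric] del: power_int_eq_0_iff)
    note pC = pC1 this[unfolded pC1]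
    have "cC powi (r - 1) * Kf i c * zcoeff (th k c) (s - r + 1)
         - q * cC powi r * Kf i c * zcoeff (th k c) (s - 1 - r)
       = q * (cC powi (r - 1) * inverse (kk i c) * zcoeff (pth k c) (s - r + 1))
         - cC powi (r - 1) * cC * inverse (kk i c) * zcoeff (pth k c) (s - r - 1)"
    proof -
      have "cC powi (r - 1) * Kf i c * zcoeff (th k c) (s - r + 1)
         - q * cC powi r * Kf i c * zcoeff (th k c) (s - 1 - r)
        = cC powi (r - 1) * q * inverse (kk i c) * (zcoeff (th k c) (s - r + 1) - q * cC * zcoeff (th k c) (s - 1 - r))"
        unfolding K pC(1) by (simp only: right_diff_distrib mult_ac)
      also have "\<dots> = cC powi (r - 1) * inverse (kk i c) * (q * zcoeff (pth k c) (s - r + 1) - (q * q ^ (2 * n)) * zcoeff (pth k c) (s - r - 1))"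
        unfolding t1 by (simp only: right_diff_distrib mult_ac)
      finally show ?thesis unfolding qC(2) by (simp only: right_diff_distrib mult_ac)
    qed
    moreover have "cC powi (s - 1) * (inverse (kk i c) * cC powi (r - s + 1) * Z) = cC powi (r - 1) * cC * inverse (kk i c) * Z"
      "q * cC powi s * (inverse (kk i c) * cC powi (r - s - 1) * Z) = q * (cC powi (r - 1) * inverse (kk i c) * Z)" for Z
    proof -
      have "A * (I * B * Z) = (B * A) * I * Z" "q * A * (I * B * Z) = q * ((B * A) * I * Z)" for A B I :: 'a
        by (simp_all only: mult_ac)
      then show "cC powi (s - 1) * (inverse (kk i c) * cC powi (r - s + 1) * Z) = cC powi (r - 1) * cC * inverse (kk i c) * Z"
        "q * cC powi s * (inverse (kk i c) * cC powi (r - s - 1) * Z) = q * (cC powi (r - 1) * inverse (kk i c) * Z)"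
        by (simp_all only: pC(2,3))
    qed
    moreover have "- (r - s + 1) = s - r - 1" "- (r - s - 1) = s - r + 1" "r - 1 - s = r - s - 1" by auto
    ultimately show ?thesis unfolding D[symmetric] K(2,3) by (simp only: right_diff_distrib) (simp add: algebra_simps)
  qed
  finally show ?thesis .
qed

end

section \<open>The Serre relation of the middle nodes\<close>

context colouring
begin

definition adj :: "int \<Rightarrow> int \<Rightarrow> bool" where
  "adj i k \<longleftrightarrow> (i = int n \<and> k = int n + 1) \<or> (i = int n + 1 \<and> k = int n)"

text \<open>What is left of \<open>S6 i a b k (br b) c\<close> after removing the weights of a and
  of the mirror pair, a factor \<open>two\<close> and a denominator. If \<open>br b\<close> has
  colour k + 1 then b moves before it, if it has colour k then b moves after it.\<close>

definition rho_num :: "int \<Rightarrow> int \<Rightarrow> nat \<Rightarrow> nat \<Rightarrow> (nat \<Rightarrow> int) \<Rightarrow> 'a" where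
  "rho_num i k a b c =
     (if c (br b) = k + 1 then (if i = int n then g (br b) a - g b a else 1 - g b a * g a (br b))
      else if c (br b) = k then (if i = int n then 1 - g (br b) a * g a b else g a (br b) - g a b) else 0)"

text \<open>The mirror pair restores its own colours, so its two moves come in a fixed order and
  only the position of the move of a varies. The three remaining orders are added using that
  \<open>two\<close> is \<open>g a b + g b a\<close>.\<close>

lemma S6_mirror_value:
  assumes s: "symc c" and A: "adj i k" and ab: "a \<in> R" "b \<in> R" "b \<noteq> a" "b \<noteq> br a"
  shows "S6 i a b k (br b) c = wt i a c * (Qp c k (br b) * mid i b * mid k (br b))
    * (two * rho_num i k a b c / (if i = int n then g b a else g b a * g a (br b)))"
proof (cases "c a = i")
  case False
  define t where "t = br b"
  have tR: "t \<in> R" "t \<noteq> a" "t \<noteq> br a" "br t = b" "t \<noteq> b" "a \<noteq> t" "br a \<noteq> t" "a \<noteq> br t"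
    using ab neq_br_sym[of b a] by (auto simp: t_def br_eq_iff)
  have ct: "c t = N + 1 - c b" using s ab symcD by (auto simp: t_def)
  have ne: "a \<noteq> b" "a \<noteq> br b" "br a \<noteq> b" using ab by auto
  have "mv c' a b = c' b" "mv c' a t = c' t" "mv c' b a = c' a" "mv c' t a = c' a" "mv c' b t = c' t - 1" "mv c' t b = c' b - 1" for c'
    using ab tR ne mv_br[of t c'] by (auto simp: mv_other mv_br t_def)
  then have "S6 i a b k t c = 0" using False by (simp add: S6_def wt3_def wt_def)
  then show ?thesis using False by (simp add: t_def wt_def)
next
  case ca: True
  define t where "t = br b"
  have tR: "t \<in> R" "t \<noteq> a" "t \<noteq> br a" "br t = b" "t \<noteq> b" "a \<noteq> t" "br a \<noteq> t" "a \<noteq> br t"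
    using ab neq_br_sym[of b a] by (auto simp: t_def br_eq_iff)
  have ct: "c t = N + 1 - c b" using s ab symcD by (auto simp: t_def)
  have ne: "a \<noteq> b" "a \<noteq> br b" "br a \<noteq> b" using ab by auto
  define u w h z where "u = g a b" and "w = g b a" and "h = g a t" and "z = g t a"
  have nz: "u \<noteq> 0" "w \<noteq> 0" "h \<noteq> 0" using g_nz ab tR ne by (auto simp: u_def w_def h_def)
  have uw: "two = u + w" unfolding u_def w_def by (rule two_eq[OF ab(1,2) ne(1)])
  have g1: "g t (br a) = u" using g_br_br[of b a] ab ne by (simp add: t_def u_def)
  have g2: "g b (br a) = h" using g_br_right[of b a] ab ne by (simp add: t_def h_def)
  have sv: "symc (mv c a)" "symc (mv c b)" "symc (mv c t)" using symc_mv s ab tR by auto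
  have m: "mv c' a a = c' a + 1" "mv c' a b = c' b" "mv c' a t = c' t" "mv c' b a = c' a" "mv c' t a = c' a" "mv c' b t = c' t - 1" "mv c' t b = c' b - 1"
    "mv c' b b = c' b + 1" "mv c' t t = c' t + 1" for c'
    using ab tR ne mv_br[of t c'] by (auto simp: mv_other mv_br mv_same t_def)
  have p: "pg (mv c' b) l t = pg c' l t" "pg (mv c' t) l b = pg c' l b" "pg (mv c' t) l t = pg c' l t" for c' l
    using ab tR by (auto simp: t_def)
  have pa: "pg (mv c' a) l t = pg c' l t * eps (c' a) l a t" "pg (mv c' a) l b = pg c' l b * eps (c' a) l a b" if "symc c'" for c' l
    using that ab tR ne by (simp_all add: pg_mv_other)
  have pb: "pg (mv c b) l a = pg c l a * eps (c b) l b a" "pg (mv c t) l a = pg c l a * eps (c t) l t a" for l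
    using s ab tR ne by (simp_all add: pg_mv_other)
  have mm: "mv (mv c b) t = c" "mv (mv c t) b = c" using mv_mv_br[of b c] mv_mv_br[of t c] ab tR by (simp_all add: t_def)
  have E: "eps i k a t = (if i = int n then z * u else u)"
    "eps i i a b = (if i = int n then inverse w else inverse w * inverse h)"
    "eps i i b a = (if i = int n then inverse u else inverse u * inverse h)"
    "eps k i t a = (if i = int n then u else h * u)"
    using A[unfolded adj_def] g1 g2
    by (elim disjE conjE; hypsubst; simp add: eps_def tR t_def[symmetric] u_def[symmetric] w_def[symmetric] h_def[symmetric] z_def[symmetric] mult.commute)+
  have Nk: "N - k = i" using A by (auto simp: adj_def)
  let ?X = "wt i a c * (pg c k t * mid k t) * (pg c i b * mid i b)"
  have X: "wt i a c * (Qp c k t * mid i b * mid k t) = ?X"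
    unfolding Qp_def Nk tR(4) by (simp only: mult_ac)
  consider "c t = k + 1" | "c t = k" | "c t \<noteq> k" "c t \<noteq> k + 1" by blast
  then have "S6 i a b k t c = ?X * (two * rho_num i k a b c / (if i = int n then w else w * h))"
  proof cases
    case 1
    have cb: "c b = i" "k \<noteq> k + 1" using 1 ct A by (auto simp: adj_def)
    note sim = wt3_def wt_def m p pa pb mm sv s ca 1 cb
    have "wt3 i a i b k t c = ?X * (eps i k a t * eps i i a b)"
      "wt3 i b i a k t c = ?X * (eps i k a t * eps i i b a)"
      "wt3 i a k t i b c = 0" "wt3 i b k t i a c = ?X" "wt3 k t i a i b c = 0" "wt3 k t i b i a c = 0"
      by (simp_all add: sim)
    then have "S6 i a b k t c = ?X * (eps i k a t * (eps i i a b + eps i i b a) - two)"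
      unfolding S6_def by (simp only:) (simp add: algebra_simps)
    also have "eps i k a t * (eps i i a b + eps i i b a) - two = two * rho_num i k a b c / (if i = int n then w else w * h)"
      unfolding E uw using nz 1 by (simp add: rho_num_def t_def[symmetric] u_def[symmetric] w_def[symmetric] h_def[symmetric] z_def[symmetric] field_simps)
    finally show ?thesis .
  next
    case 2
    have cb: "c b = i + 1" "i + 1 \<noteq> i" "k \<noteq> k + 1" using 2 ct A by (auto simp: adj_def)
    note sim = wt3_def wt_def m p pa pb mm sv s ca 2 cb
    have "wt3 i a i b k t c = 0" "wt3 i b i a k t c = 0"
      "wt3 i a k t i b c = ?X * (eps i k a t * eps i i a b)" "wt3 i b k t i a c = 0"
      "wt3 k t i a i b c = ?X * (eps k i t a * eps i i a b)" "wt3 k t i b i a c = ?X"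
      by (simp_all add: sim)
    then have "S6 i a b k t c = ?X * (- two * (eps i k a t * eps i i a b) + eps k i t a * eps i i a b + 1)"
      unfolding S6_def by (simp only:) (simp add: algebra_simps)
    also have "- two * (eps i k a t * eps i i a b) + eps k i t a * eps i i a b + 1
        = two * rho_num i k a b c / (if i = int n then w else w * h)"
      unfolding E uw using nz 2 by (simp add: rho_num_def t_def[symmetric] u_def[symmetric] w_def[symmetric] h_def[symmetric] z_def[symmetric] field_simps)
    finally show ?thesis .
  next
    case 3
    have "c b \<noteq> i" "c b \<noteq> i + 1" using 3 ct A by (auto simp: adj_def)
    then have "S6 i a b k t c = 0" using 3 ca by (simp add: S6_def wt3_def wt_def m)
    then show ?thesis using 3 by (simp add: rho_num_def t_def)
  qed
  then show ?thesis unfolding X[symmetric] by (simp add: t_def w_def h_def)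
qed

text \<open>The boundary cases, in which a itself belongs to the mirror pair. A single order
  survives, up to the exchange of equal indices, which is the source of the factor 2 in the last
  value.\<close>

lemma S6_diag_value:
  assumes s: "symc c" and A: "adj i k" and a: "a \<in> R"
  shows "S6 i a (br a) k a c = - two * (wt i a c * (Qp c k a * mid i (br a) * mid k a))"
    and "wt3 i a k (br a) i a c = wt i a c * (Qp c k (br a) * mid i a * mid k (br a))"
    and "S6 i a a k (br a) c = - two * (2 * wt3 i a k (br a) i a c)"
proof -
  define t where "t = br a"
  have tR: "t \<in> R" "br t = a" "t \<noteq> a" "a \<noteq> t" using a by (auto simp: t_def)
  have ct: "c t = N + 1 - c a" using s a symcD by (auto simp: t_def)
  have m: "mv c' a a = c' a + 1" "mv c' a t = c' t - 1" "mv c' t a = c' a - 1" "mv c' t t = c' t + 1" for c'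
    using a tR mv_br[of t c'] by (auto simp: mv_br mv_same t_def)
  have p: "pg (mv c' a) l t = pg c' l t" "pg (mv c' t) l a = pg c' l a" for c' l
    using a tR by (auto simp: t_def)
  have mm: "mv (mv c a) t = c" "mv (mv c t) a = c" using mv_mv_br[of a c] mv_mv_br[of t c] a tR by (simp_all add: t_def)
  have Nk: "N - k = i" using A by (auto simp: adj_def)
  have w3: "wt3 i a k t i a c = wt i a c * (Qp c k t * mid i a * mid k t)"
  proof (cases "c a = i")
    case True
    then show ?thesis using ct A by (auto simp: wt3_def wt_def m p mm Qp_def tR Nk adj_def)
  qed (simp add: wt3_def wt_def)
  then show "wt3 i a k (br a) i a c = wt i a c * (Qp c k (br a) * mid i a * mid k (br a))" by (simp add: t_def)
  have z: "wt3 i a i a k t c = 0" "wt3 k t i a i a c = 0"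
    by (simp_all add: wt3_def wt_def m)
  show "S6 i a a k (br a) c = - two * (2 * wt3 i a k (br a) i a c)"
    unfolding S6_def t_def[symmetric] by (simp add: z algebra_simps)
  show "S6 i a (br a) k a c = - two * (wt i a c * (Qp c k a * mid i (br a) * mid k a))"
    unfolding t_def[symmetric]
  \<comment> \<open>For i = n the index a makes its step at n and the one at n + 1 before its mirror
    moves; for i = n + 1 the mirror moves first and a makes both its steps afterwards.\<close>
  proof (cases "i = int n")
    case True
    then have k: "k = i + 1" using A by (auto simp: adj_def)
    have "wt3 i a i t k a c = 0" "wt3 i t i a k a c = 0" "wt3 i t k a i a c = 0" "wt3 k a i a i t c = 0" "wt3 k a i t i a c = 0"
      by (rule wt3_zeroI; simp only: m ct; use k True in presburger)+
    moreover have "wt3 i a k a i t c = wt i a c * (Qp c k a * mid i t * mid k a)"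
      using ct True k by (auto simp: wt3_def wt_def m p pg_mv_same a Qp_def tR Nk t_def[symmetric])
    ultimately show "S6 i a t k a c = - two * (wt i a c * (Qp c k a * mid i t * mid k a))"
      by (simp add: S6_def algebra_simps)
  next
    case False
    then have k: "i = int n + 1" "k = int n" using A by (auto simp: adj_def)
    have "wt3 i a i t k a c = 0" "wt3 i t i a k a c = 0" "wt3 i a k a i t c = 0" "wt3 k a i a i t c = 0" "wt3 k a i t i a c = 0"
      by (rule wt3_zeroI; simp only: m ct; use k in presburger)+
    moreover have "wt3 i t k a i a c = wt i a c * (Qp c k a * mid i t * mid k a)"
      using ct k by (auto simp: wt3_def wt_def m p mm a Qp_def tR Nk t_def[symmetric])
    ultimately show "S6 i a t k a c = - two * (wt i a c * (Qp c k a * mid i t * mid k a))"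
      by (simp add: S6_def algebra_simps)
  qed
qed

text \<open>The share of the pair a, b when triples are grouped by the mirror pair b,
  \<open>br b\<close>. For b = a either copy of a may be taken as the partner of e, and the value is
  half of \<open>S6\<close>.\<close>

definition rho :: "int \<Rightarrow> int \<Rightarrow> nat \<Rightarrow> nat \<Rightarrow> (nat \<Rightarrow> int) \<Rightarrow> 'a" where
  "rho i k a b c = (if b = a then - two * wt3 i a k (br a) i a c else S6 i a b k (br b) c)"

text \<open>Only e = \<open>br b\<close> and e = \<open>br a\<close> survive. The former is counted
  in the first sum and the latter in the second; for a = b they coincide and the single term is
  shared equally.\<close>

lemma serre_middle_sum:
  assumes "c \<in> Col" and A: "adj i k"
  shows "serre_coeff i k r s t F c + serre_coeff i k s r t F c
    = (\<Sum>a\<in>R. yv i a powi r * cC powi t * (\<Sum>b\<in>R. yv i b powi (s - t) * rho i k a b c) * F (mv c a))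
    + (\<Sum>a\<in>R. yv i a powi s * cC powi t * (\<Sum>b\<in>R. yv i b powi (r - t) * rho i k a b c) * F (mv c a))"
proof -
  have sc: "symc c" using assms symc_Col by blast
  have ok: "ok i" "ok k" "k = i + 1 \<or> i = k + 1" and kN: "k = N - i" using A n1 by (auto simp: adj_def)
  let ?X = "\<lambda>a b e. yv i a powi r * yv i b powi s * yv k e powi t * S6 i a b k e c * F (mv (mv (mv c a) b) e)"
  let ?L = "\<lambda>r s a b. yv i a powi r * cC powi t * (yv i b powi (s - t) * rho i k a b c) * F (mv c a)"
  have y: "yv i b powi s' * yv k (br b) powi t = cC powi t * yv i b powi (s' - t)" if "b \<in> R" for b s'
    unfolding kN yv_dual[OF that] using yv_nz[OF that, of i] by (simp add: power_int_divide_distrib power_int_diff)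
  have m1: "mv (mv (mv c a) b) (br b) = mv c a" "mv (mv (mv c a) b) (br a) = mv c b" if "a \<in> R" "b \<in> R" for a b
    using that mv_mv_br[of b "mv c a"] mv_mv_br[of a "mv c b"] by (simp_all add: mv_commute[of c b a])
  have e: "(\<Sum>e\<in>R. ?X a b e) = (if a = b then ?L r s a b + ?L s r a b
      else ?L r s a b + ?L s r b a)" if ab: "a \<in> R" "b \<in> R" for a b
  proof -
    have z: "?X a b e = 0" if "e \<in> R - {br a, br b}" for e
      using S6_zero[OF sc ab, of e k i] that ok by auto
    have "(\<Sum>e\<in>R. ?X a b e) = (\<Sum>e\<in>{br a, br b}. ?X a b e)"
      by (rule sum.mono_neutral_right) (use ab z in auto)
    also have "\<dots> = (if a = b then ?L r s a b + ?L s r a b else ?L r s a b + ?L s r b a)"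
    proof (cases "a = b")
      case True
      have "yv i b powi r * yv i b powi s * yv k (br b) powi t = yv i b powi r * (cC powi t * yv i b powi (s - t))"
        "yv i b powi r * (cC powi t * yv i b powi (s - t)) = yv i b powi s * (cC powi t * yv i b powi (r - t))"
        unfolding y[OF ab(2), symmetric] by (simp_all only: mult_ac)
      note M = this(1) this(1)[unfolded this(2)]
      have alg: "m * (- T * (2 * w)) * f = a * c * (p * (- T * w)) * f + b * c * (p' * (- T * w)) * f"
        if "m = a * (c * p)" "m = b * (c * p')" for m T w f a c p b p' :: 'a
      proof -
        have "a * c * (p * (- T * w)) * f = m * (- T * w) * f" by (simp only: that(1) mult_ac)
        moreover have "b * c * (p' * (- T * w)) * f = m * (- T * w) * f" by (simp only: that(2) mult_ac)
        ultimately show ?thesis by (simp only:) (simp add: algebra_simps)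
      qed
      have R: "rho i k b b c = - two * wt3 i b k (br b) i b c" by (simp add: rho_def)
      have "?X b b (br b) = ?L r s b b + ?L s r b b"
        unfolding S6_diag_value(3)[OF sc A ab(2)] R m1(1)[OF ab(2) ab(2)] by (rule alg[OF M])
      then show ?thesis unfolding True by simp
    next
      case False
      then have "br a \<noteq> br b" using ab br_eq_iff by blast
      have M1: "yv i a powi r * yv i b powi s * yv k (br b) powi t = yv i a powi r * (cC powi t * yv i b powi (s - t))"
        unfolding y[OF ab(2), symmetric] by (simp only: mult_ac)
      have M2: "yv i a powi r * yv i b powi s * yv k (br a) powi t = yv i b powi s * (cC powi t * yv i a powi (r - t))"
        unfolding y[OF ab(1), symmetric] by (simp only: mult_ac)
      have r: "rho i k a b c = S6 i a b k (br b) c" "rho i k b a c = S6 i a b k (br a) c"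
        using False S6_commute[of i a b k "br a"] by (auto simp: rho_def)
      have X: "?X a b (br b) = ?L r s a b" "?X a b (br a) = ?L s r b a"
        unfolding M1 M2 m1[OF ab] r by (simp_all only: mult.assoc)
      have "(\<Sum>e\<in>{br a, br b}. ?X a b e) = ?X a b (br a) + ?X a b (br b)"
        using \<open>br a \<noteq> br b\<close> by simp
      also have "\<dots> = ?L r s a b + ?L s r b a" unfolding X by (rule add.commute)
      finally show ?thesis unfolding if_not_P[OF False] .
    qed
    finally show ?thesis .
  qed
  have "serre_coeff i k r s t F c + serre_coeff i k s r t F c = (\<Sum>a\<in>R. \<Sum>b\<in>R. \<Sum>e\<in>R. ?X a b e)"
    by (rule serre_coeff_sum[OF assms(1) ok(1,2)])
  also have "\<dots> = (\<Sum>a\<in>R. \<Sum>b\<in>R. ?L r s a b + ?L s r b a)"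
    by (intro sum.cong refl) (auto simp: e)
  also have "\<dots> = (\<Sum>a\<in>R. \<Sum>b\<in>R. ?L r s a b) + (\<Sum>a\<in>R. \<Sum>b\<in>R. ?L s r a b)"
    unfolding sum.distrib by (subst (2) sum.swap) (rule refl)
  finally show ?thesis by (simp add: sum_distrib_left sum_distrib_right)
qed

end

section \<open>Residues of the rational function in the Serre relation for the middle nodes\<close>

context colouring
begin

text \<open>The poles: those of Theta_k, together with a and its mirror whatever their
  colours.\<close>

definition pset :: "int \<Rightarrow> nat \<Rightarrow> (nat \<Rightarrow> int) \<Rightarrow> nat set" where
  "pset k a c = {u\<in>R. c u = k \<or> c u = k + 1 \<or> u = a \<or> u = br a}"

text \<open>At a and \<open>br a\<close> the numerators of Theta_k, where present, are cancelled by
  the geometric series of the correction terms. In their place come the two linear factors into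
  which 1 - q C z^2 times \<open>ext k\<close> splits, with parameters q^(N-k) and its
  negative.\<close>

definition alf2 :: "int \<Rightarrow> nat \<Rightarrow> (nat \<Rightarrow> int) \<Rightarrow> nat \<Rightarrow> 'a" where
  "alf2 k a c u = (if u = a then q powi (N - k) else if u = br a then - (q powi (N - k)) else alf k c u)"

lemma prod_pset:
  assumes "a \<in> R"
  shows "prod h (pset k a c) = h a * (h (br a) * (\<Prod>u\<in>R - {a, br a}. if c u = k \<or> c u = k + 1 then h u else 1))"
proof -
  have 1: "pset k a c = insert a (insert (br a) {u\<in>R - {a, br a}. c u = k \<or> c u = k + 1})"
    using assms by (auto simp: pset_def)
  have "prod h {u\<in>R - {a, br a}. c u = k \<or> c u = k + 1} = (\<Prod>u\<in>R - {a, br a}. if c u = k \<or> c u = k + 1 then h u else 1)"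
    by (rule prod.inter_filter) simp
  then show ?thesis unfolding 1 using assms by simp
qed

text \<open>With p for 1 / q, each identity of numerators holds up to a multiple of q p - 1. The
  first and third expressions serve i = n, the second and fourth i = n + 1; within each pair they
  belong to the two colours that t can have, and they are opposite like the residues there.\<close>

lemma g_pair_num:
  assumes "a \<in> R" "t \<in> R" "t \<noteq> a" "t \<noteq> br a"
  shows "1 - g t a * g t (br a) = (1 - q ^ 2) * (x t ^ 2 - inverse q ^ 2) / ((x t - x a) * (x t - inverse (x a)))"
    and "1 - g a t * g (br a) t = (1 - inverse q ^ 2) * (x t ^ 2 - q ^ 2) / ((x t - x a) * (x t - inverse (x a)))"
    and "g t (br t) * (g t a - g (br t) a) = - ((1 - q ^ 2) * (x t ^ 2 - inverse q ^ 2) / ((x t - x a) * (x t - inverse (x a))))"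
    and "g (br t) t * (g a t - g a (br t)) = - ((1 - inverse q ^ 2) * (x t ^ 2 - q ^ 2) / ((x t - x a) * (x t - inverse (x a))))"
proof -
  define X A p where "X = x t" and "A = x a" and "p = inverse q"
  have nz: "X \<noteq> 0" "A \<noteq> 0" "X - A \<noteq> 0" "X * A - 1 \<noteq> 0" "X * X - 1 \<noteq> 0" "q * p = 1"
  proof -
    show "X \<noteq> 0" "A \<noteq> 0" "X - A \<noteq> 0" "q * p = 1"
      using assms x_nz xneq q0 by (auto simp: X_def A_def p_def)
    have "x t - x (br a) \<noteq> 0" "x t - x (br t) \<noteq> 0" using assms xneq by auto
    then show "X * A - 1 \<noteq> 0" "X * X - 1 \<noteq> 0"
      using \<open>X \<noteq> 0\<close> \<open>A \<noteq> 0\<close> assms by (auto simp: x_br X_def A_def field_simps)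
  qed
  have d: "X - inverse A = (X * A - 1) / A" "X - inverse X = (X * X - 1) / X" "inverse X - A = - ((X * A - 1) / X)"
    "inverse A - X = - ((X * A - 1) / A)" "A - inverse X = (X * A - 1) / X" "inverse X - X = - ((X * X - 1) / X)"
    "A - X = - (X - A)"
    using nz by (simp_all add: field_simps)
  have gs: "g t a = (q * X - p * A) / (X - A)" "g t (br a) = (q * X * A - p) / (X * A - 1)"
    "g a t = (p * X - q * A) / (X - A)" "g (br a) t = (p * X * A - q) / (X * A - 1)"
    "g t (br t) = (q * X * X - p) / (X * X - 1)" "g (br t) a = (p * X * A - q) / (X * A - 1)"
    "g (br t) t = (p * X * X - q) / (X * X - 1)" "g a (br t) = (q * X * A - p) / (X * A - 1)"
    unfolding g_def x_br[OF assms(1)] x_br[OF assms(2)] X_def[symmetric] A_def[symmetric] p_def[symmetric] d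
    using nz by (simp_all add: field_simps)
  have D: "(x t - x a) * (x t - inverse (x a)) = (X - A) * (X * A - 1) / A"
    unfolding X_def[symmetric] A_def[symmetric] d by simp
  have fin: "u / (X - A) * (w / (X * A - 1)) = u * w / ((X - A) * (X * A - 1))" for u w by simp
  have I1: "(X - A) * (X * A - 1) - (q * X - p * A) * (q * X * A - p) = (1 - q ^ 2) * (X ^ 2 - p ^ 2) * A"
  proof -
    have "(X - A) * (X * A - 1) - (q * X - p * A) * (q * X * A - p) - (1 - q ^ 2) * (X ^ 2 - p ^ 2) * A = (q * p - 1) * (X + X * A * A - (q * p + 1) * A)"
      by (simp add: algebra_simps power2_eq_square)
    then show ?thesis using nz(6) by simp
  qed
  have I2: "(X - A) * (X * A - 1) - (p * X - q * A) * (p * X * A - q) = (1 - p ^ 2) * (X ^ 2 - q ^ 2) * A"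
  proof -
    have "(X - A) * (X * A - 1) - (p * X - q * A) * (p * X * A - q) - (1 - p ^ 2) * (X ^ 2 - q ^ 2) * A = (q * p - 1) * (X + X * A * A - (q * p + 1) * A)"
      by (simp add: algebra_simps power2_eq_square)
    then show ?thesis using nz(6) by simp
  qed
  have I3: "(q * X * X - p) * ((q * X - p * A) * (X * A - 1) - (p * X * A - q) * (X - A)) = - ((1 - q ^ 2) * (X ^ 2 - p ^ 2) * A * (X * X - 1))"
  proof -
    have "(q * X * X - p) * ((q * X - p * A) * (X * A - 1) - (p * X * A - q) * (X - A)) - (- ((1 - q ^ 2) * (X ^ 2 - p ^ 2) * A * (X * X - 1))) = (q * p - 1) * ((q * p - X * X) * A * (X * X - 1))"
      by (simp add: algebra_simps power2_eq_square)
    then show ?thesis using nz(6) by (simp add: eq_neg_iff_add_eq_0)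
  qed
  have I4: "(p * X * X - q) * ((p * X - q * A) * (X * A - 1) - (q * X * A - p) * (X - A)) = - ((1 - p ^ 2) * (X ^ 2 - q ^ 2) * A * (X * X - 1))"
  proof -
    have "(p * X * X - q) * ((p * X - q * A) * (X * A - 1) - (q * X * A - p) * (X - A)) - (- ((1 - p ^ 2) * (X ^ 2 - q ^ 2) * A * (X * X - 1))) = (q * p - 1) * ((q * p - X * X) * A * (X * X - 1))"
      by (simp add: algebra_simps power2_eq_square)
    then show ?thesis using nz(6) by (simp add: eq_neg_iff_add_eq_0)
  qed
  have e: "u / ((X - A) * (X * A - 1) / A) = u * A / ((X - A) * (X * A - 1))" for u by simp
  have s1: "1 - u / (X - A) * (w / (X * A - 1)) = ((X - A) * (X * A - 1) - u * w) / ((X - A) * (X * A - 1))" for u w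
    using nz by (simp add: diff_divide_distrib)
  have s2: "z / (X * X - 1) * (u / (X - A) - w / (X * A - 1)) = z * (u * (X * A - 1) - w * (X - A)) / ((X - A) * (X * A - 1) * (X * X - 1))" for z u w
  proof -
    have "u / (X - A) - w / (X * A - 1) = (u * (X * A - 1) - w * (X - A)) / ((X - A) * (X * A - 1))"
      using nz by (simp add: diff_frac_eq)
    then show ?thesis by (simp add: mult.commute)
  qed
  have s3: "- (U * (X * X - 1)) / (V * (X * X - 1)) = - (U / V)" for U V using nz(5) by simp
  show "1 - g t a * g t (br a) = (1 - q ^ 2) * (x t ^ 2 - inverse q ^ 2) / ((x t - x a) * (x t - inverse (x a)))"
    unfolding D unfolding e gs s1 I1 X_def[symmetric] p_def[symmetric] ..
  show "1 - g a t * g (br a) t = (1 - inverse q ^ 2) * (x t ^ 2 - q ^ 2) / ((x t - x a) * (x t - inverse (x a)))"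
    unfolding D unfolding e gs s1 I2 X_def[symmetric] p_def[symmetric] ..
  show "g t (br t) * (g t a - g (br t) a) = - ((1 - q ^ 2) * (x t ^ 2 - inverse q ^ 2) / ((x t - x a) * (x t - inverse (x a))))"
    unfolding D unfolding e gs s2 I3 s3 X_def[symmetric] p_def[symmetric] ..
  show "g (br t) t * (g a t - g a (br t)) = - ((1 - inverse q ^ 2) * (x t ^ 2 - q ^ 2) / ((x t - x a) * (x t - inverse (x a))))"
    unfolding D unfolding e gs s2 I4 s3 X_def[symmetric] p_def[symmetric] ..
qed

text \<open>As in \<open>kk_pf_res\<close>, the eigenvalue is distributed over the indices and
  produces values of \<open>g\<close>. Only a and \<open>br a\<close> behave differently: their
  numerators 1 - u and 1 + u combine into the quadratic expression in x_t.\<close>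

lemma kk_pf_res_pset:
  assumes s: "symc c" and A: "adj i k" and a: "a \<in> R" and t: "t \<in> pset k a c" "t \<noteq> a" "t \<noteq> br a"
  shows "kk k c * pf_res (pset k a c) (alf2 k a c) (yv k) t = (if c t = k then 1 else -1) * (q - inverse q)
    * gam c k t (br t) * (\<Prod>u\<in>R - {a, br a} - {t, br t}. gam c k t u)
    * (kap k (c a) * kap k (c (br a)) * (x t ^ 2 - q powi (2 * (i - k))) / ((x t - x a) * (x t - inverse (x a))))"
proof -
  have tR: "t \<in> R" "br t \<in> R" "br t \<noteq> a" "br t \<noteq> br a" "c t = k \<or> c t = k + 1" "br t \<noteq> t"
    using t a by (auto simp: pset_def br_eq_iff)
  have Nk: "N - k = i" using A by (auto simp: adj_def)
  let ?r = "\<lambda>u. (1 - alf2 k a c u / yv k t) / (1 - yv k u / yv k t)"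
  have S: "pset k a c - {t} = insert a (insert (br a) {u\<in>R - {a, br a} - {t}. c u = k \<or> c u = k + 1})"
    using a t by (auto simp: pset_def)
  have f: "prod ?r {u\<in>R - {a, br a} - {t}. c u = k \<or> c u = k + 1} = (\<Prod>u\<in>R - {a, br a} - {t}. if c u = k \<or> c u = k + 1 then ?r u else 1)"
    by (rule prod.inter_filter) simp
  have p1: "(\<Prod>u\<in>pset k a c - {t}. ?r u) = ?r a * (?r (br a) * (\<Prod>u\<in>R - {a, br a} - {t}. if c u = k \<or> c u = k + 1 then ?r u else 1))"
    unfolding S f[symmetric] using a by simp
  have p2: "kk k c = kap k (c a) * (kap k (c (br a)) * (kap k (c t) * (\<Prod>u\<in>R - {a, br a} - {t}. kap k (c u))))"
    unfolding kk_def prod_split_pair[OF a] using prod.remove[of "R - {a, br a}" t "\<lambda>u. kap k (c u)"] tR t by simp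
  have p3: "(\<Prod>u\<in>R - {a, br a} - {t}. kap k (c u)) * (\<Prod>u\<in>R - {a, br a} - {t}. if c u = k \<or> c u = k + 1 then ?r u else 1)
      = (\<Prod>u\<in>R - {a, br a} - {t}. gam c k t u)"
    unfolding prod.distrib[symmetric]
  proof (intro prod.cong refl)
    fix u assume u: "u \<in> R - {a, br a} - {t}"
    show "kap k (c u) * (if c u = k \<or> c u = k + 1 then ?r u else 1) = gam c k t u"
    proof (cases "c u = k \<or> c u = k + 1")
      case True
      have "alf2 k a c u = alf k c u" using u by (simp add: alf2_def)
      then show ?thesis using kap_ratio[OF tR(1), of u c k] u True by auto
    qed (simp add: kap_def gam_def)
  qed
  have p4: "(\<Prod>u\<in>R - {a, br a} - {t}. gam c k t u) = gam c k t (br t) * (\<Prod>u\<in>R - {a, br a} - {t, br t}. gam c k t u)"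
  proof -
    have "R - {a, br a} - {t, br t} = R - {a, br a} - {t} - {br t}" by auto
    then show ?thesis using prod.remove[of "R - {a, br a} - {t}" "br t" "gam c k t"] tR by simp
  qed
  have p5: "kap k (c t) * (1 - alf2 k a c t / yv k t) = (if c t = k then 1 else -1) * (q - inverse q)"
    using tR t q0 yv_nz[OF tR(1)] by (auto simp: kap_def alf2_def alf_def field_simps power2_eq_square)
  have p6: "?r a * ?r (br a) = (x t ^ 2 - q powi (2 * (i - k))) / ((x t - x a) * (x t - inverse (x a)))"
  proof -
    define T u where "T = yv k t" and "u = q powi i / T"
    have nz: "x t \<noteq> 0" "q powi k \<noteq> 0" "x a \<noteq> 0" "q \<noteq> 0" using x_nz tR q0 a by auto
    have b: "1 - yv k a / yv k t = (x t - x a) / x t" "1 - yv k (br a) / yv k t = (x t - inverse (x a)) / x t"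
      using nz a by (simp_all add: yv_def x_br field_simps)
    have uu: "(1 - u) * (1 + u) = (x t ^ 2 - q powi (2 * (i - k))) / (x t * x t)"
    proof -
      have "q powi (2 * (i - k)) = (q powi i / q powi k) * (q powi i / q powi k)"
        using q0 by (simp add: power_int_diff[symmetric] power_int_add[symmetric])
      then show ?thesis using nz by (simp add: u_def T_def yv_def field_simps power2_eq_square)
    qed
    have al: "1 - alf2 k a c a / yv k t = 1 - u" "1 - alf2 k a c (br a) / yv k t = 1 + u"
      using a Nk by (simp_all add: alf2_def u_def T_def)
    have "(1 - u) / (P / X) * ((1 + u) / (Q / X)) = ((1 - u) * (1 + u)) * (X * X) / (P * Q)" for P Q X
      by simp
    then show ?thesis unfolding b al uu using nz by simp
  qed
  have "kk k c * pf_res (pset k a c) (alf2 k a c) (yv k) t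
    = (kap k (c t) * (1 - alf2 k a c t / yv k t)) * (kap k (c a) * kap k (c (br a)) * (?r a * ?r (br a)))
      * ((\<Prod>u\<in>R - {a, br a} - {t}. kap k (c u)) * (\<Prod>u\<in>R - {a, br a} - {t}. if c u = k \<or> c u = k + 1 then ?r u else 1))"
    unfolding pf_res_def p1 p2 by (simp only: mult_ac)
  then show ?thesis unfolding p3 p4 p5 p6 by (simp only: mult_ac times_divide_eq_right)
qed

text \<open>At its own pole the numerator parameter of t is q^i or its negative and that of
  \<open>br t\<close> is the opposite, so the product is the same quadratic expression for t = a and
  t = \<open>br a\<close>.\<close>

lemma kk_pf_res_self:
  assumes s: "symc c" and A: "adj i k" and a: "a \<in> R" and t: "t = a \<or> t = br a"
  shows "kk k c * pf_res (pset k a c) (alf2 k a c) (yv k) t = kap k (c t) * kap k (c (br t))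
    * ((x t ^ 2 - q powi (2 * (i - k))) / (x t ^ 2 - 1)) * Qp c k t"
proof -
  have tR: "t \<in> R" "br t \<noteq> t" "t \<noteq> br t" and P: "{a, br a} = {t, br t}" and S': "pset k a c = pset k t c"
    using t a by (auto simp: pset_def)
  have Nk: "N - k = i" using A by (auto simp: adj_def)
  let ?r = "\<lambda>u. (1 - alf2 k a c u / yv k t) / (1 - yv k u / yv k t)"
  have S: "pset k t c - {t} = insert (br t) {u\<in>R - {t, br t}. c u = k \<or> c u = k + 1}"
    using tR by (auto simp: pset_def)
  have f: "prod ?r {u\<in>R - {t, br t}. c u = k \<or> c u = k + 1} = (\<Prod>u\<in>R - {t, br t}. if c u = k \<or> c u = k + 1 then ?r u else 1)"
    by (rule prod.inter_filter) simp
  have p1: "(\<Prod>u\<in>pset k t c - {t}. ?r u) = ?r (br t) * (\<Prod>u\<in>R - {t, br t}. if c u = k \<or> c u = k + 1 then ?r u else 1)"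
    unfolding S f[symmetric] using tR by simp
  have p2: "kk k c = kap k (c t) * (kap k (c (br t)) * (\<Prod>u\<in>R - {t, br t}. kap k (c u)))"
    unfolding kk_def by (rule prod_split_pair[OF tR(1)])
  have p3: "(\<Prod>u\<in>R - {t, br t}. kap k (c u)) * (\<Prod>u\<in>R - {t, br t}. if c u = k \<or> c u = k + 1 then ?r u else 1) = Qp c k t"
    unfolding prod.distrib[symmetric] Qp_eq[OF s tR(1)]
  proof (intro prod.cong refl)
    fix u assume u: "u \<in> R - {t, br t}"
    show "kap k (c u) * (if c u = k \<or> c u = k + 1 then ?r u else 1) = gam c k t u"
    proof (cases "c u = k \<or> c u = k + 1")
      case True
      have "alf2 k a c u = alf k c u" using u P by (auto simp: alf2_def)
      then show ?thesis using kap_ratio[OF tR(1), of u c k] u True by auto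
    qed (simp add: kap_def gam_def)
  qed
  have p4: "(1 - alf2 k a c t / yv k t) * ?r (br t) = (x t ^ 2 - q powi (2 * (i - k))) / (x t ^ 2 - 1)"
  proof -
    define u where "u = q powi i / yv k t"
    have nz: "x t \<noteq> 0" "q powi k \<noteq> 0" "q \<noteq> 0" using x_nz tR q0 by auto
    have b: "1 - yv k (br t) / yv k t = (x t ^ 2 - 1) / (x t * x t)"
      using nz tR by (simp add: yv_def x_br field_simps power2_eq_square)
    have "(1 - u) * (1 + u) = (x t ^ 2 - q powi (2 * (i - k))) / (x t * x t)"
    proof -
      have "q powi (2 * (i - k)) = (q powi i / q powi k) * (q powi i / q powi k)"
        using q0 by (simp add: power_int_diff[symmetric] power_int_add[symmetric])
      then show ?thesis using nz by (simp add: u_def yv_def field_simps power2_eq_square)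
    qed
    moreover have "(1 - alf2 k a c t / yv k t) * (1 - alf2 k a c (br t) / yv k t) = (1 - u) * (1 + u)"
      using t a Nk by (auto simp: alf2_def u_def mult.commute)
    ultimately have "(1 - alf2 k a c t / yv k t) * (1 - alf2 k a c (br t) / yv k t) = (x t ^ 2 - q powi (2 * (i - k))) / (x t * x t)"
      by simp
    then show ?thesis unfolding b times_divide_eq_right using nz by simp
  qed
  have "kk k c * pf_res (pset k a c) (alf2 k a c) (yv k) t
    = kap k (c t) * kap k (c (br t)) * ((1 - alf2 k a c t / yv k t) * ?r (br t))
      * ((\<Prod>u\<in>R - {t, br t}. kap k (c u)) * (\<Prod>u\<in>R - {t, br t}. if c u = k \<or> c u = k + 1 then ?r u else 1))"
    unfolding pf_res_def S' p1 p2 by (simp only: mult_ac)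
  then show ?thesis unfolding p3 p4 .
qed

end

context colouring
begin

lemma qi2: "q powi (- 2) = inverse q ^ 2"
  by (simp add: power_int_minus power_inverse)

text \<open>The four combinations of node and colour are compared through \<open>g_pair_num\<close>.
  The values of \<open>kap\<close> at a and \<open>br a\<close>, and the extra q of
  \<open>Kf\<close> at node n, supply exactly the missing powers of q.\<close>

lemma rho_residue_generic:
  assumes s: "symc c" and A: "adj i k" and a: "a \<in> R" and ca: "c a = i" and t: "t \<in> pset k a c" "t \<noteq> a" "t \<noteq> br a"
  shows "mid i (br t) * mid k t * rho_num i k a (br t) c = (1 - q ^ 2) * (if i = int n then q else 1) *
     ((if c t = k then 1 else -1) * gam c k t (br t) *
      (kap k (c a) * kap k (c (br a)) * (x t ^ 2 - q powi (2 * (i - k))) / ((x t - x a) * (x t - inverse (x a)))))"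
proof -
  have tR: "t \<in> R" "br t \<in> R" "br (br t) = t" "c t = k \<or> c t = k + 1" "a \<noteq> t" "a \<noteq> br t"
    using t a by (auto simp: pset_def)
  have cb: "c (br a) = N + 1 - i" "c (br t) = N + 1 - c t" using s a tR ca symcD by blast+
  define Z where "Z = (x t - x a) * (x t - inverse (x a))"
  have g1: "g a (br t) = g t (br a)" by (rule g_br_right) (use a tR in auto)
  have g2: "g (br t) a = g (br a) t" using g_br_br[of t "br a"] a tR t by simp
  note G = g_pair_num[OF a tR(1) t(2,3), folded Z_def]
  have q1: "(1 - q ^ 2) * inverse q ^ 2 = - (1 - inverse q ^ 2)"
    using q0 by (simp add: left_diff_distrib power_mult_distrib[symmetric])
  have "mid i (br t) * mid k t * rho_num i k a (br t) c = (1 - q ^ 2) * (if i = int n then q else 1) *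
     ((if c t = k then 1 else -1) * gam c k t (br t) *
      (kap k (c a) * kap k (c (br a)) * (x t ^ 2 - q powi (2 * (i - k))) / Z))" (is ?main)
    using A unfolding adj_def
  proof (elim disjE conjE)
    assume i: "i = int n" and k: "k = int n + 1"
    have e: "q powi (2 * (i - k)) = inverse q ^ 2" unfolding i k using qi2 by simp
    have kp: "kap k (c a) * kap k (c (br a)) = inverse q" unfolding cb ca i k kap_def by simp
    have m: "mid i (br t) = 1" "mid k t = g t (br t)" unfolding i k mid_def by simp_all
    from tR(4) show ?main
    proof
      assume ct: "c t = k"
      have "gam c k t (br t) = g t (br t)" unfolding gam_def cb ct k by simp
      moreover have "rho_num i k a (br t) c = 1 - g t a * g t (br a)" unfolding rho_num_def tR(3) ct g1 using i by simp
      ultimately show ?main unfolding m e kp G(1) using ct i q0 by simp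
    next
      assume ct: "c t = k + 1"
      have "gam c k t (br t) = 1" unfolding gam_def cb ct k by simp
      moreover have "mid k t * rho_num i k a (br t) c = - ((1 - q ^ 2) * (x t ^ 2 - inverse q ^ 2) / Z)"
        unfolding rho_num_def tR(3) ct m G(3)[symmetric] using i by simp
      ultimately show ?main unfolding m(1) e kp using ct i q0 by simp
    qed
  next
    assume i: "i = int n + 1" and k: "k = int n"
    have e: "q powi (2 * (i - k)) = q ^ 2" unfolding i k by simp
    have kp: "kap k (c a) * kap k (c (br a)) = inverse q ^ 2" unfolding cb ca i k kap_def by (simp add: power2_eq_square)
    have m: "mid i (br t) = g (br t) t" "mid k t = 1" unfolding i k mid_def using tR by simp_all
    have al: "(1 - q ^ 2) * 1 * (u * (inverse q ^ 2 * w / Z)) = - ((1 - inverse q ^ 2) * w / Z) * u" for u w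
    proof -
      have "(1 - q ^ 2) * 1 * (u * (inverse q ^ 2 * w / Z)) = ((1 - q ^ 2) * inverse q ^ 2) * (u * (w / Z))"
        by (simp only: mult_1_right mult_1_left times_divide_eq_right times_divide_eq_left mult_ac)
      then show ?thesis unfolding q1
        by (simp add: mult_ac del: minus_diff_eq)
    qed
    have ni: "(if i = int n then q else 1) = 1" using i by simp
    from tR(4) show ?main
    proof
      assume ct: "c t = k"
      have gm: "gam c k t (br t) = 1" unfolding gam_def cb ct k by simp
      have rn: "rho_num i k a (br t) c = g a t - g a (br t)" unfolding rho_num_def tR(3) ct using i by simp
      show ?main unfolding m e kp gm rn ni al using ct G(4) by simp
    next
      assume ct: "c t = k + 1"
      have gm: "gam c k t (br t) = g (br t) t" unfolding gam_def cb ct k by simp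
      have "rho_num i k a (br t) c = 1 - g a t * g (br a) t" unfolding rho_num_def tR(3) ct g2 using i by (simp add: mult.commute)
      then have rn: "rho_num i k a (br t) c = (1 - inverse q ^ 2) * (x t ^ 2 - q ^ 2) / Z" unfolding G(2) .
      show ?main unfolding m e kp gm rn ni al using ct by simp
    qed
  qed
  then show ?thesis unfolding Z_def .
qed

lemma Kf_adj: "symc c \<Longrightarrow> adj i k \<Longrightarrow> Kf i c = kk k c * (if i = int n then q else 1)"
  using kk_dual[of c i] by (auto simp: Kf_def adj_def)

text \<open>The pole t corresponds to the mirror pair formed with b = \<open>br t\<close>. The
  boundary values of \<open>rho\<close> are the residues at the two additional poles a and
  \<open>br a\<close>; for t outside \<open>pset\<close> the numerator \<open>rho_num\<close> is
  0.\<close>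

lemma rho_residue:
  assumes s: "symc c" and A: "adj i k" and a: "a \<in> R" and ca: "c a = i" and t: "t \<in> R"
  shows "(q - inverse q) * rho i k a (br t) c = two * wt i a c * ((1 - q ^ 2) * Kf i c *
     (if t \<in> pset k a c then pf_res (pset k a c) (alf2 k a c) (yv k) t else 0))"
proof -
  have btR: "br t \<in> R" "br (br t) = t" using t by auto
  define \<delta> where "\<delta> = (if i = int n then q else 1)"
  have K: "Kf i c = kk k c * \<delta>" unfolding \<delta>_def by (rule Kf_adj[OF s A])
  consider "t = a \<or> t = br a" | "t \<noteq> a" "t \<noteq> br a" by blast
  then show ?thesis
  proof cases
    case 1
    have tp: "t \<in> pset k a c" using 1 a by (auto simp: pset_def)
    have r: "rho i k a (br t) c = - two * (wt i a c * (Qp c k t * mid i (br t) * mid k t))"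
      using 1
    proof
      assume "t = a"
      then show ?thesis using S6_diag_value(1)[OF s A a] a by (simp add: rho_def)
    next
      assume "t = br a"
      then show ?thesis using S6_diag_value(2)[OF s A a] a by (simp add: rho_def)
    qed
    have cb: "c (br a) = N + 1 - i" using s a ca symcD by blast
    have kp: "kap k (c t) * kap k (c (br t)) = kap k i * kap k (N + 1 - i)"
      using 1 a cb ca by (auto simp: mult.commute)
    have x2: "x t \<noteq> 0" "x t ^ 2 - 1 \<noteq> 0" using x_nz[OF t] xneq[of t "br t"] t
      by (auto simp: x_br field_simps power2_eq_square)
    have gt: "g t (br t) = (q * x t ^ 2 - inverse q) / (x t ^ 2 - 1)" "g (br t) t = (inverse q * x t ^ 2 - q) / (x t ^ 2 - 1)"
    proof -
      have d: "x t - inverse (x t) = (x t ^ 2 - 1) / x t" "inverse (x t) - x t = - ((x t ^ 2 - 1) / x t)"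
        using x2 by (simp_all add: field_simps power2_eq_square)
      have "q * x t - inverse q * inverse (x t) = (q * x t ^ 2 - inverse q) / x t"
        "q * inverse (x t) - inverse q * x t = - ((inverse q * x t ^ 2 - q) / x t)"
        using x2(1) by (simp_all add: field_simps power2_eq_square)
      then show "g t (br t) = (q * x t ^ 2 - inverse q) / (x t ^ 2 - 1)" "g (br t) t = (inverse q * x t ^ 2 - q) / (x t ^ 2 - 1)"
        unfolding g_def x_br[OF t] d using x2(1) by (simp_all del: minus_diff_eq)
    qed
    have "mid i (br t) * mid k t = q * \<delta> * (kap k i * kap k (N + 1 - i)) * ((x t ^ 2 - q powi (2 * (i - k))) / (x t ^ 2 - 1))"
      using A unfolding adj_def
    proof (elim disjE conjE)
      assume i: "i = int n" and k: "k = int n + 1"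
      have e: "q powi (2 * (i - k)) = inverse q ^ 2" unfolding i k using qi2 by simp
      have kp: "kap k i * kap k (N + 1 - i) = inverse q" unfolding i k kap_def by simp
      have m: "mid i (br t) = 1" "mid k t = g t (br t)" unfolding i k mid_def by simp_all
      have "q * q * inverse q * (x t ^ 2 - inverse q ^ 2) = q * x t ^ 2 - inverse q"
        using q0 by (simp add: field_simps power2_eq_square)
      then show ?thesis unfolding m kp e gt \<delta>_def using i by (simp only: times_divide_eq_right if_True simp_thms mult_1_left)
    next
      assume i: "i = int n + 1" and k: "k = int n"
      have e: "q powi (2 * (i - k)) = q ^ 2" unfolding i k by simp
      have kp: "kap k i * kap k (N + 1 - i) = inverse q * inverse q" unfolding i k kap_def by simp
      have m: "mid i (br t) = g (br t) t" "mid k t = 1" unfolding i k mid_def using t by simp_all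
      have ni: "(if i = int n then q else 1) = 1" using i by simp
      have "q * 1 * (inverse q * inverse q) * (x t ^ 2 - q ^ 2) = inverse q * x t ^ 2 - q"
        using q0 by (simp add: field_simps power2_eq_square)
      then show ?thesis unfolding m kp e gt \<delta>_def ni by (simp only: times_divide_eq_right mult_1_right)
    qed
    moreover have "(q - inverse q) * q = - (1 - q ^ 2)" using q0 by (simp add: left_diff_distrib power2_eq_square)
    moreover have "kk k c * pf_res (pset k a c) (alf2 k a c) (yv k) t = kap k i * kap k (N + 1 - i)
        * ((x t ^ 2 - q powi (2 * (i - k))) / (x t ^ 2 - 1)) * Qp c k t"
      using kk_pf_res_self[OF s A a 1] unfolding kp .
    moreover have "u * (- T * (w * (Q * M * M'))) = T * w * (Z * (K * \<delta>) * pf)"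
      if "M * M' = q * \<delta> * KK * X" "u * q = - Z" "K * pf = KK * X * Q" for u T w Q M M' Z K pf KK X :: 'a
    proof -
      have "u * (- T * (w * (Q * M * M'))) = - T * w * Q * u * (M * M')" by (simp add: mult_ac)
      also have "\<dots> = - T * w * \<delta> * (u * q) * (KK * X * Q)" unfolding that(1) by (simp add: mult_ac)
      also have "\<dots> = T * w * \<delta> * Z * (K * pf)" unfolding that(2,3) by (simp add: mult_ac)
      finally show ?thesis by (simp add: mult_ac)
    qed
    ultimately have "(q - inverse q) * (- two * (wt i a c * (Qp c k t * mid i (br t) * mid k t))) =
      two * wt i a c * ((1 - q ^ 2) * (kk k c * \<delta>) * pf_res (pset k a c) (alf2 k a c) (yv k) t)" by blast
    then show ?thesis unfolding r K using tp by simp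
  next
    case 2
    have ne: "br t \<noteq> a" "br t \<noteq> br a" "a \<noteq> t" using 2 t a by (auto simp: br_eq_iff)
    have r: "rho i k a (br t) c = wt i a c * (Qp c k t * mid i (br t) * mid k t)
      * (two * rho_num i k a (br t) c / (if i = int n then g (br t) a else g (br t) a * g a t))"
      unfolding rho_def using S6_mirror_value[OF s A a btR(1) ne(1,2)] ne btR(2) by simp
    show ?thesis
    proof (cases "t \<in> pset k a c")
      case False
      then have "rho_num i k a (br t) c = 0" using 2 t by (simp add: pset_def rho_num_def)
      then show ?thesis unfolding r using False by simp
    next
      case tp: True
      define Gm where "Gm = (if i = int n then g (br t) a else g (br t) a * g a t)"
      have nz: "Gm \<noteq> 0" using g_nz[of "br t" a] g_nz[of a t] a t btR ne by (simp add: Gm_def)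
      define P where "P = (\<Prod>u\<in>R - {a, br a} - {t, br t}. gam c k t u)"
      have cb: "c (br a) = N + 1 - i" using s a ca symcD by blast
      have g2: "g (br t) a = g (br a) t" using g_br_br[of t "br a"] a t 2 by simp
      have "Qp c k t = gam c k t a * (gam c k t (br a) * P)"
      proof -
        have "R - {t, br t} - {a} - {br a} = R - {a, br a} - {t, br t}" by auto
        then show ?thesis unfolding Qp_eq[OF s t] P_def
          using prod.remove[of "R - {t, br t}" a "gam c k t"] prod.remove[of "R - {t, br t} - {a}" "br a" "gam c k t"] a t 2 ne
          by simp
      qed
      moreover have "gam c k t a * gam c k t (br a) = Gm"
        using A unfolding gam_def ca cb Gm_def g2 by (auto simp: adj_def)
      ultimately have Q: "Qp c k t = Gm * P" by (simp add: mult.assoc[symmetric])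
      let ?Z = "kap k (c a) * kap k (c (br a)) * (x t ^ 2 - q powi (2 * (i - k))) / ((x t - x a) * (x t - inverse (x a)))"
      have num: "mid i (br t) * mid k t * rho_num i k a (br t) c = (1 - q ^ 2) * \<delta> * ((if c t = k then 1 else -1) * gam c k t (br t) * ?Z)"
        unfolding \<delta>_def by (rule rho_residue_generic[OF s A a ca tp 2])
      have pf: "kk k c * pf_res (pset k a c) (alf2 k a c) (yv k) t = (if c t = k then 1 else -1) * (q - inverse q) * gam c k t (br t) * P * ?Z"
        unfolding P_def by (rule kk_pf_res_pset[OF s A a tp 2])
      have "u * (w * (Gm * P * M * M') * (T * r / Gm)) = T * w * (Z * (K * \<delta>) * pf)"
        if "M * M' * r = Z * \<delta> * (S * G * X)" "K * pf = S * u * G * P * X" for u w M M' T r Z K pf S G X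
      proof -
        have "u * (w * (Gm * P * M * M') * (T * r / Gm)) = u * w * P * T * (M * M' * r)" using nz by simp
        also have "\<dots> = T * w * (Z * \<delta>) * (S * u * G * P * X)" unfolding that(1) by (simp only: mult_ac)
        also have "\<dots> = T * w * (Z * (K * \<delta>) * pf)" unfolding that(2)[symmetric] by (simp only: mult_ac)
        finally show ?thesis .
      qed
      from this[OF num pf] show ?thesis unfolding r Q K Gm_def[symmetric] using tp by simp
    qed
  qed
qed

section \<open>Expansions of the correction terms at 0 and at infinity\<close>

abbreviation lf :: "'a \<Rightarrow> 'a fps" where "lf u \<equiv> 1 - fps_const u * fps_X"
abbreviation iv :: "'a \<Rightarrow> 'a fps" where "iv u \<equiv> inverse (1 - fps_const u * fps_X)"

lemma lf_iv: "lf u * iv u = 1" by (rule one_minus_X_mult_inverse)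

text \<open>The constant \<open>q * cC\<close> is q^(2n+2). For k = n + 1 the factor cancels the
  denominator of \<open>ext\<close> and leaves 1 - q^(2n) z^2, for k = n it stays as it is; in both
  cases the constant is the square of q^i and the quadratic splits.\<close>

lemma ext_factor:
  assumes "adj i k"
  shows "(1 - fps_const (q * cC) * fps_X ^ 2) * ext k = lf (q powi i) * lf (- (q powi i))"
proof -
  have f: "lf u * lf (- u) = 1 - fps_const (u * u) * fps_X ^ 2" for u
    by (simp add: algebra_simps power2_eq_square fps_const_mult[symmetric] del: fps_const_mult)
  have qC: "q * cC = q ^ (2 * n + 2)"
    using q0 by (simp add: power_int_add power_int_def nat_add_distrib nat_mult_distrib)
  from assms show ?thesis unfolding f adj_def
  proof (elim disjE conjE)
    assume i: "i = int n" and k: "k = int n + 1"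
    have "q powi i * q powi i = q ^ (2 * n)" unfolding i by (simp add: power_int_def power_add[symmetric] mult_2)
    moreover have "inverse (1 - fps_const (q ^ (2 * n + 2)) * fps_X ^ 2) * (1 - fps_const (q ^ (2 * n + 2)) * fps_X ^ 2 :: 'a fps) = 1"
      by (rule inverse_mult_eq_1) (simp add: power2_eq_square)
    ultimately show "(1 - fps_const (q * cC) * fps_X ^ 2) * ext k = 1 - fps_const (q powi i * q powi i) * fps_X ^ 2"
      unfolding qC ext_def k by (simp add: mult.left_commute mult.commute)
  next
    assume i: "i = int n + 1" and k: "k = int n"
    have "q powi i = q ^ (n + 1)" unfolding i by (simp add: power_int_def nat_add_distrib)
    then have "q powi i * q powi i = q ^ (2 * n + 2)" by (simp add: power_add[symmetric] mult_2)
    then show "(1 - fps_const (q * cC) * fps_X ^ 2) * ext k = 1 - fps_const (q powi i * q powi i) * fps_X ^ 2"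
      unfolding qC ext_def k by simp
  qed
qed

text \<open>At \<open>br a\<close>, of colour k + 1, the second geometric series cancels the
  numerator of Theta_k. At a the first one cancels the numerator if i = n + 1 and creates a new pole
  if i = n.\<close>

lemma pset_expansion_0:
  assumes s: "symc c" and A: "adj i k" and a: "a \<in> R" and ca: "c a = i"
  shows "pth k c * (iv (q * yv i a) * iv (q ^ 2 * (cC / yv i a))) * (lf (q powi i) * lf (- (q powi i)))
     = (\<Prod>u\<in>pset k a c. linfrac (alf2 k a c u) (yv k u))"
proof -
  have cb: "c (br a) = N + 1 - i" using s a ca symcD by blast
  have kN: "k = N - i" "N - k = i" using A by (auto simp: adj_def)
  have yb: "yv k (br a) = cC / yv i a" unfolding kN(1) by (rule yv_dual[OF a])
  have rest: "(\<Prod>u\<in>R - {a, br a}. if c u = k \<or> c u = k + 1 then linfrac (alf2 k a c u) (yv k u) else 1)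
     = (\<Prod>u\<in>R - {a, br a}. phi k (c u) (yv k u))"
    by (rule prod.cong) (auto simp: alf2_def alf_def phi_def)
  have 1: "phi k (c a) (yv k a) * iv (q * yv i a) = iv (yv k a)"
    using A unfolding adj_def
  proof (elim disjE conjE)
    assume "i = int n" "k = int n + 1"
    then show ?thesis using q0 by (simp add: phi_def ca yv_def power_int_add mult_ac)
  next
    assume i: "i = int n + 1" "k = int n"
    have "q ^ 2 * yv k a = q * yv i a" using q0 i by (simp add: yv_def power_int_add power2_eq_square)
    then have "phi k (c a) (yv k a) = lf (q * yv i a) * iv (yv k a)" using i by (simp add: phi_def ca linfrac_def)
    then have "phi k (c a) (yv k a) * iv (q * yv i a) = iv (yv k a) * (lf (q * yv i a) * iv (q * yv i a))" by (simp only: mult_ac)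
    then show ?thesis by (simp only: lf_iv mult_1_right)
  qed
  have 2: "phi k (c (br a)) (yv k (br a)) * iv (q ^ 2 * (cC / yv i a)) = iv (yv k (br a))"
  proof -
    have "c (br a) = k + 1" using cb kN by simp
    then have "phi k (c (br a)) (yv k (br a)) = lf (q ^ 2 * (cC / yv i a)) * iv (yv k (br a))"
      by (simp add: phi_def linfrac_def yb)
    then have "phi k (c (br a)) (yv k (br a)) * iv (q ^ 2 * (cC / yv i a)) = iv (yv k (br a)) * (lf (q ^ 2 * (cC / yv i a)) * iv (q ^ 2 * (cC / yv i a)))" by (simp only: mult_ac)
    then show ?thesis by (simp only: lf_iv mult_1_right)
  qed
  have al: "alf2 k a c a = q powi i" "alf2 k a c (br a) = - (q powi i)" using a by (simp_all add: alf2_def kN(2))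
  have "pth k c * (iv (q * yv i a) * iv (q ^ 2 * (cC / yv i a))) * (lf (q powi i) * lf (- (q powi i)))
    = lf (q powi i) * (phi k (c a) (yv k a) * iv (q * yv i a)) * (lf (- (q powi i)) * (phi k (c (br a)) (yv k (br a)) * iv (q ^ 2 * (cC / yv i a)))
       * (\<Prod>u\<in>R - {a, br a}. phi k (c u) (yv k u)))"
    unfolding pth_def prod_split_pair[OF a] by (simp only: mult_ac)
  then show ?thesis unfolding 1 2 prod_pset[OF a] rest al unfolding linfrac_def by (simp only: mult_ac)
qed

text \<open>The counterpart at infinity: \<open>cC / yv k u\<close> is \<open>yv i (br u)\<close>,
  so after the exchange of every index with its mirror the rescaled expansion is built from Theta_i
  instead of Theta_k.\<close>

lemma pset_expansion_inf:
  assumes s: "symc c" and A: "adj i k" and a: "a \<in> R" and ca: "c a = i"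
  shows "pth i c * (iv (inverse q ^ 2 * yv i a) * iv (inverse q * (cC / yv i a))) * (lf (q powi k) * lf (- (q powi k)))
     = (\<Prod>u\<in>pset k a c. linfrac (cC * (1 / alf2 k a c u)) (cC * (1 / yv k u)))"
proof -
  have cb: "c (br a) = N + 1 - i" using s a ca symcD by blast
  have kN: "k = N - i" "N - k = i" using A by (auto simp: adj_def)
  have yb: "cC * (1 / yv k u) = yv i (br u)" if "u \<in> R" for u using yv_dual[OF that, of k] unfolding kN(2) by simp
  have ya: "cC * (1 / yv k (br a)) = yv i a" using yb[of "br a"] a by simp
  have rest: "(\<Prod>u\<in>R - {a, br a}. if c u = k \<or> c u = k + 1 then linfrac (cC * (1 / alf2 k a c u)) (cC * (1 / yv k u)) else 1)
     = (\<Prod>u\<in>R - {a, br a}. phi i (c u) (yv i u))"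
  proof -
    have "(\<Prod>u\<in>R - {a, br a}. phi i (c u) (yv i u)) = (\<Prod>u\<in>R - {a, br a}. phi i (c (br u)) (yv i (br u)))"
      by (rule prod.reindex_bij_witness[where i=br and j=br]) (use a in \<open>auto simp: br_eq_iff\<close>)
    also have "\<dots> = (\<Prod>u\<in>R - {a, br a}. if c u = k \<or> c u = k + 1 then linfrac (cC * (1 / alf2 k a c u)) (cC * (1 / yv k u)) else 1)"
    proof (intro prod.cong refl)
      fix u assume u: "u \<in> R - {a, br a}"
      have c: "c (br u) = N + 1 - c u" using s u symcD by blast
      have y: "q ^ 2 * (cC / yv k u) = cC * (1 / (yv k u / q ^ 2))" "cC / yv k u / q ^ 2 = cC * (1 / (q ^ 2 * yv k u))"
        using q0 yv_nz[of u k] u by (simp_all add: field_simps)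
      have yu: "yv i (br u) = cC / yv k u" using yb[of u] u by simp
      have al: "alf2 k a c u = alf k c u" using u by (simp add: alf2_def)
      show "phi i (c (br u)) (yv i (br u))
        = (if c u = k \<or> c u = k + 1 then linfrac (cC * (1 / alf2 k a c u)) (cC * (1 / yv k u)) else 1)"
        unfolding yu phi_def al alf_def c y using kN by auto
    qed
    finally show ?thesis by simp
  qed
  have 1: "phi i (c (br a)) (yv i (br a)) * iv (inverse q * (cC / yv i a)) = iv (yv i (br a))"
    using A unfolding adj_def
  proof (elim disjE conjE)
    assume i: "i = int n" "k = int n + 1"
    have "yv i (br a) = inverse q * (cC / yv i a)"
    proof -
      have "yv k a = q * yv i a" using q0 i by (simp add: yv_def power_int_add mult_ac)
      then show ?thesis using yb[OF a] q0 by (simp add: field_simps)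
    qed
    then show ?thesis using i by (simp add: phi_def cb)
  next
    assume i: "i = int n + 1" "k = int n"
    have "yv i (br a) / q ^ 2 = inverse q * (cC / yv i a)"
    proof -
      have "yv i a = q * yv k a" using q0 i by (simp add: yv_def power_int_add mult_ac)
      then show ?thesis using yb[OF a, symmetric] q0 yv_nz[OF a, of k] by (simp add: field_simps power2_eq_square)
    qed
    then have "phi i (c (br a)) (yv i (br a)) = lf (inverse q * (cC / yv i a)) * iv (yv i (br a))"
      using i by (simp add: phi_def cb linfrac_def)
    then have "phi i (c (br a)) (yv i (br a)) * iv (inverse q * (cC / yv i a)) = iv (yv i (br a)) * (lf (inverse q * (cC / yv i a)) * iv (inverse q * (cC / yv i a)))"
      by (simp only: mult_ac)
    then show ?thesis by (simp only: lf_iv mult_1_right)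
  qed
  have 2: "phi i (c a) (yv i a) * iv (inverse q ^ 2 * yv i a) = iv (yv i a)"
  proof -
    have "phi i (c a) (yv i a) = lf (inverse q ^ 2 * yv i a) * iv (yv i a)"
      using q0 by (simp add: phi_def linfrac_def ca field_simps)
    then have "phi i (c a) (yv i a) * iv (inverse q ^ 2 * yv i a) = iv (yv i a) * (lf (inverse q ^ 2 * yv i a) * iv (inverse q ^ 2 * yv i a))" by (simp only: mult_ac)
    then show ?thesis by (simp only: lf_iv mult_1_right)
  qed
  have "cC * (1 / (q powi i)) = q powi k" unfolding kN using q0 by (simp add: power_int_diff)
  then have al: "cC * (1 / alf2 k a c a) = q powi k" "cC * (1 / alf2 k a c (br a)) = - (q powi k)"
    using a by (simp_all add: alf2_def kN(2))
  have "pth i c * (iv (inverse q ^ 2 * yv i a) * iv (inverse q * (cC / yv i a))) * (lf (q powi k) * lf (- (q powi k)))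
    = lf (- (q powi k)) * (phi i (c a) (yv i a) * iv (inverse q ^ 2 * yv i a)) * (lf (q powi k) * (phi i (c (br a)) (yv i (br a)) * iv (inverse q * (cC / yv i a)))
       * (\<Prod>u\<in>R - {a, br a}. phi i (c u) (yv i u)))"
    unfolding pth_def prod_split_pair[OF a] by (simp only: mult_ac)
  then show ?thesis unfolding 1 2 prod_pset[OF a] rest al yb[OF a] ya unfolding linfrac_def by (simp only: mult_ac)
qed

text \<open>The product is the value of the rational function at infinity. Away from a and
  \<open>br a\<close> it is an inverse square of the eigenvalue, which exchanges the two K. The
  minus sign comes from the parameters q^i and - q^i; the power of q collects what remains at a and
  \<open>br a\<close> and the extra factor q of \<open>Kf\<close> at node n.\<close>

lemma prod_ratio_pset:
  assumes s: "symc c" and A: "adj i k" and a: "a \<in> R" and ca: "c a = i"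
  shows "(\<Prod>u\<in>pset k a c. alf2 k a c u / yv k u) * Kf i c = - (inverse q ^ 3 * Kf k c)"
proof -
  have cb: "c (br a) = N + 1 - i" using s a ca symcD by blast
  have kN: "N - k = i" "N - i = k" using A by (auto simp: adj_def)
  define \<delta> where "\<delta> = (if i = int n then 1 else inverse q ^ 2)"
  have inv_kap: "(if c u = k \<or> c u = k + 1 then alf2 k a c u / yv k u else 1) = inverse (kap k (c u)) * inverse (kap k (c u))"
    if u: "u \<in> R - {a, br a}" for u
  proof -
    have y: "yv k u \<noteq> 0" using yv_nz u by simp
    have al: "alf2 k a c u = alf k c u" using u by (simp add: alf2_def)
    show ?thesis unfolding al using y q0 by (simp add: alf_def kap_def power2_eq_square field_simps)
  qed
  have rest: "(\<Prod>u\<in>R - {a, br a}. if c u = k \<or> c u = k + 1 then alf2 k a c u / yv k u else 1)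
     = inverse (\<Prod>u\<in>R - {a, br a}. kap k (c u)) * inverse (\<Prod>u\<in>R - {a, br a}. kap k (c u))" (is "_ = inverse ?P * inverse ?P")
    by (subst prod.cong[OF refl inv_kap]) (simp_all add: prod.distrib prod_inverse)
  have kkP: "kk k c = kap k i * (kap k (N + 1 - i) * ?P)" unfolding kk_def prod_split_pair[OF a] ca cb ..
  have yy: "yv k a * yv k (br a) = q powi k * q powi k" using a x_nz by (simp add: yv_def x_br)
  have al: "alf2 k a c a = q powi i" "alf2 k a c (br a) = - (q powi i)" using a by (simp_all add: alf2_def kN)
  have "alf2 k a c a / yv k a * (alf2 k a c (br a) / yv k (br a)) = - (q powi i * q powi i) / (q powi k * q powi k)"
    unfolding al yy[symmetric] by simp
  then have 1: "(\<Prod>u\<in>pset k a c. alf2 k a c u / yv k u) = - (q powi i * q powi i) / (q powi k * q powi k) * (inverse ?P * inverse ?P)"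
    unfolding prod_pset[OF a] rest by (simp only: mult.assoc[symmetric])
  have P0: "?P \<noteq> 0" using kap_nz by simp
  have K: "Kf i c = kk k c * (if i = int n then q else 1)" by (rule Kf_adj[OF s A])
  have K': "Kf k c = inverse (kk k c) * (if i = int n then 1 else q)" using A by (auto simp: Kf_def adj_def)
  from A show ?thesis unfolding 1 K K' kkP adj_def
  proof (elim disjE conjE)
    assume i: "i = int n" "k = int n + 1"
    have "q powi k = q * q powi i" unfolding i using q0 by (simp add: power_int_add)
    moreover have "kap k i = 1" "kap k (N + 1 - i) = inverse q" unfolding i kap_def by simp_all
    moreover have "q powi i \<noteq> 0" using q0 by simp
    ultimately show "- (q powi i * q powi i) / (q powi k * q powi k) * (inverse ?P * inverse ?P) * (kap k i * (kap k (N + 1 - i) * ?P) * (if i = int n then q else 1)) = - (inverse q ^ 3 * (inverse (kap k i * (kap k (N + 1 - i) * ?P)) * (if i = int n then 1 else q)))"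
      using i q0 P0 by (simp add: field_simps power3_eq_cube)
  next
    assume i: "i = int n + 1" "k = int n"
    have e1: "q powi i = q * q powi k" unfolding i using q0 by (simp add: power_int_add)
    have e2: "kap k i = inverse q" "kap k (N + 1 - i) = inverse q" unfolding i kap_def by simp_all
    have e3: "(if i = int n then q else 1) = 1" "(if i = int n then 1 else q) = q" using i by simp_all
    have "q powi k \<noteq> 0" using q0 by simp
    then show "- (q powi i * q powi i) / (q powi k * q powi k) * (inverse ?P * inverse ?P) * (kap k i * (kap k (N + 1 - i) * ?P) * (if i = int n then q else 1)) = - (inverse q ^ 3 * (inverse (kap k i * (kap k (N + 1 - i) * ?P)) * (if i = int n then 1 else q)))"
      unfolding e1 e2 e3 using q0 P0 by (simp add: field_simps power3_eq_cube)
  qed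
qed

text \<open>On the support of Delta(w2 z) one has 1 / w2 = C z, which turns the factor 1 - v z / w2
  of the first two correction terms into 1 - q C z^2 and their geometric series into 1 / (1 - u z).
  The last two terms take the same form in w2.\<close>

definition sq :: "'a \<Rightarrow> 'a fps \<Rightarrow> 'a fps" where
  "sq u f = (1 - fps_const (q * cC) * fps_X ^ 2) * iv u * f"

lemma adj_cmat: "adj i k \<Longrightarrow> cmat i k = -1 \<and> cmat k i = -1 \<and> N - k = i \<and> N - i = k"
  by (auto simp: adj_def cmat_def)

lemma adj_commute: "adj i k \<longleftrightarrow> adj k i"
  by (auto simp: adj_def)

text \<open>By the known change of Theta_k and K_i under the move of a, both terms are linear
  multiples of one series, with the factors 1 - q y z and 1 - y z / q. Their coefficients are such
  that the parts linear in z cancel.\<close>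

lemma middle_series_0:
  assumes s: "symc c" and A: "adj i k" and a: "a \<in> R" and ca: "c a = i"
  defines "y \<equiv> yv i a"
  shows "fps_const (Kf i c) * sq (q ^ 2 * (cC / y)) (th k c)
     - fps_const (inverse q * Kf i (mv c a)) * sq (inverse q ^ 2 * (cC / y)) (th k (mv c a))
    = fps_const ((1 - q ^ 2) * Kf i c) * (\<Prod>u\<in>pset k a c. linfrac (alf2 k a c u) (yv k u))"
proof -
  note cm = adj_cmat[OF A]
  have alg: "u * (w * v) - u' * (w * v') = (u * v - u' * v') * w" for u w v u' v' :: "'a fps"
    by (simp add: algebra_simps)
  have cii: "cmat i i = 2" by (simp add: cmat_def)
  define W where "W = (\<Prod>u\<in>pset k a c. linfrac (alf2 k a c u) (yv k u))"
  have W: "pth k c * (iv (q * y) * iv (q ^ 2 * (cC / y))) * (lf (q powi i) * lf (- (q powi i))) = W"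
    unfolding W_def y_def by (rule pset_expansion_0[OF s A a ca])
  have p: "pth k (mv c a) = linfrac (inverse q * y) (q * y) * linfrac (inverse q ^ 2 * (cC / y)) (q ^ 2 * (cC / y)) * pth k c"
    using pth_mv[OF s a, of k] cm by (simp add: ca y_def cii power_int_minus power_inverse)
  have Kmv: "Kf i (mv c a) = q ^ 3 * Kf i c"
    using Kf_mv[OF s a, of i] cm q0 by (simp add: ca cii power_int_minus)
  have t: "th k c' = pth k c' * ext k" for c' by (simp add: th_def)
  have 1: "sq (q ^ 2 * (cC / y)) (th k c) = W * lf (q * y)"
  proof -
    have "sq (q ^ 2 * (cC / y)) (th k c) = ((1 - fps_const (q * cC) * fps_X ^ 2) * ext k) * (pth k c * iv (q ^ 2 * (cC / y))) * (lf (q * y) * iv (q * y))"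
      unfolding sq_def t lf_iv by (simp only: mult_ac mult_1_right mult_1_left)
    also have "\<dots> = W * lf (q * y)" unfolding ext_factor[OF A] W[symmetric] by (simp only: mult_ac)
    finally show ?thesis .
  qed
  have 2: "sq (inverse q ^ 2 * (cC / y)) (th k (mv c a)) = W * lf (inverse q * y)"
  proof -
    have "sq (inverse q ^ 2 * (cC / y)) (th k (mv c a)) = ((1 - fps_const (q * cC) * fps_X ^ 2) * ext k)
       * (pth k c * (iv (q * y) * iv (q ^ 2 * (cC / y)))) * lf (inverse q * y) * (lf (inverse q ^ 2 * (cC / y)) * iv (inverse q ^ 2 * (cC / y)))"
      unfolding sq_def t p linfrac_def by (simp only: mult_ac)
    also have "\<dots> = W * lf (inverse q * y)" unfolding ext_factor[OF A] W[symmetric] lf_iv by (simp only: mult_ac mult_1_right mult_1_left)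
    finally show ?thesis .
  qed
  have "fps_const (Kf i c) * (W * lf (q * y)) - fps_const (inverse q * Kf i (mv c a)) * (W * lf (inverse q * y))
     = (fps_const (Kf i c) * lf (q * y) - fps_const (inverse q * Kf i (mv c a)) * lf (inverse q * y)) * W"
    by (rule alg)
  also have "fps_const (Kf i c) * lf (q * y) - fps_const (inverse q * Kf i (mv c a)) * lf (inverse q * y) = fps_const ((1 - q ^ 2) * Kf i c)"
  proof -
    have cl: "fps_const u * lf w = fps_const u - fps_const (u * w) * fps_X" for u w
      by (simp add: right_diff_distrib flip: mult.assoc)
    have 3: "inverse q * (q ^ 3 * Kf i c) = q ^ 2 * Kf i c" "q ^ 2 * Kf i c * (inverse q * y) = Kf i c * (q * y)"
      using q0 by (simp_all add: power2_eq_square power3_eq_cube)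
    show ?thesis unfolding Kmv cl 3 by (simp add: left_diff_distrib)
  qed
  finally show ?thesis unfolding 1 2 W_def .
qed

text \<open>The same mechanism at infinity, except that here the constant parts cancel and the
  linear ones remain; hence the factor \<open>fps_X\<close> on the right.\<close>

lemma middle_series_inf:
  assumes s: "symc c" and A: "adj i k" and a: "a \<in> R" and ca: "c a = i"
  defines "y \<equiv> yv i a"
  shows "fps_const (q * Kf k (mv c a)) * sq (q ^ 2 * y) (th i (mv c a))
     - fps_const (inverse q ^ 2 * Kf k c) * sq (inverse q ^ 2 * y) (th i c)
    = fps_const (inverse q ^ 3 * (1 - q ^ 2) * (cC / y) * Kf k c)
      * ((\<Prod>u\<in>pset k a c. linfrac (cC * (1 / alf2 k a c u)) (cC * (1 / yv k u))) * fps_X)"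
proof -
  note cm = adj_cmat[OF A]
  have alg: "u * (w * v) - u' * (w * v') = (u * v - u' * v') * w" for u w v u' v' :: "'a fps"
    by (simp add: algebra_simps)
  have cii: "cmat i i = 2" by (simp add: cmat_def)
  define W where "W = (\<Prod>u\<in>pset k a c. linfrac (cC * (1 / alf2 k a c u)) (cC * (1 / yv k u)))"
  have W: "pth i c * (iv (inverse q ^ 2 * y) * iv (inverse q * (cC / y))) * (lf (q powi k) * lf (- (q powi k))) = W"
    unfolding W_def y_def by (rule pset_expansion_inf[OF s A a ca])
  have p: "pth i (mv c a) = linfrac (q ^ 2 * y) (inverse q ^ 2 * y) * linfrac (q * (cC / y)) (inverse q * (cC / y)) * pth i c"
    using pth_mv[OF s a, of i] cm by (simp add: ca y_def cii power_int_minus power_inverse)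
  have Kmv: "Kf k (mv c a) = inverse q ^ 3 * Kf k c"
  proof -
    have "Kf k c = q ^ 3 * Kf k (mv c a)" using Kf_mv[OF s a, of k] cm by (simp add: ca cii)
    then show ?thesis using q0 by (simp add: power_inverse)
  qed
  have A': "adj k i" using A adj_commute by blast
  have t: "th i c' = pth i c' * ext i" for c' by (simp add: th_def)
  have 1: "sq (inverse q ^ 2 * y) (th i c) = W * lf (inverse q * (cC / y))"
  proof -
    have "sq (inverse q ^ 2 * y) (th i c) = ((1 - fps_const (q * cC) * fps_X ^ 2) * ext i) * (pth i c * iv (inverse q ^ 2 * y)) * (lf (inverse q * (cC / y)) * iv (inverse q * (cC / y)))"
      unfolding sq_def t lf_iv by (simp only: mult_ac mult_1_right mult_1_left)
    also have "\<dots> = W * lf (inverse q * (cC / y))" unfolding ext_factor[OF A'] W[symmetric] by (simp only: mult_ac)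
    finally show ?thesis .
  qed
  have 2: "sq (q ^ 2 * y) (th i (mv c a)) = W * lf (q * (cC / y))"
  proof -
    have "sq (q ^ 2 * y) (th i (mv c a)) = ((1 - fps_const (q * cC) * fps_X ^ 2) * ext i)
       * (pth i c * (iv (inverse q ^ 2 * y) * iv (inverse q * (cC / y)))) * lf (q * (cC / y)) * (lf (q ^ 2 * y) * iv (q ^ 2 * y))"
      unfolding sq_def t p linfrac_def by (simp only: mult_ac)
    also have "\<dots> = W * lf (q * (cC / y))" unfolding ext_factor[OF A'] W[symmetric] lf_iv by (simp only: mult_ac mult_1_right mult_1_left)
    finally show ?thesis .
  qed
  have "fps_const (q * Kf k (mv c a)) * (W * lf (q * (cC / y))) - fps_const (inverse q ^ 2 * Kf k c) * (W * lf (inverse q * (cC / y)))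
     = (fps_const (q * Kf k (mv c a)) * lf (q * (cC / y)) - fps_const (inverse q ^ 2 * Kf k c) * lf (inverse q * (cC / y))) * W"
    by (rule alg)
  also have "fps_const (q * Kf k (mv c a)) * lf (q * (cC / y)) - fps_const (inverse q ^ 2 * Kf k c) * lf (inverse q * (cC / y))
     = fps_const (inverse q ^ 3 * (1 - q ^ 2) * (cC / y) * Kf k c) * fps_X"
  proof -
    define z where "z = cC / y"
    have K2: "q * Kf k (mv c a) = inverse q ^ 2 * Kf k c" unfolding Kmv using q0 by (simp add: power2_eq_square power3_eq_cube)
    have e: "inverse q ^ 3 * (1 - q ^ 2) * z * Kf k c = inverse q ^ 2 * Kf k c * (inverse q * z - q * z)"
      using q0 by (simp add: field_simps power2_eq_square power3_eq_cube)
    show ?thesis unfolding K2 z_def[symmetric] e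
      by (simp add: algebra_simps fps_const_mult[symmetric] fps_const_sub[symmetric] del: fps_const_mult fps_const_sub)
  qed
  finally show ?thesis unfolding 1 2 W_def by (simp only: mult_ac)
qed

text \<open>Both sides are the difference of the expansions at \<open>0\<close> and \<open>\<infinity>\<close> of one rational function.\<close>

lemma serre_middle_step:
  assumes s: "symc c" and A: "adj i k" and a: "a \<in> R" and ca: "c a = i"
  defines "y \<equiv> yv i a"
  shows "(q - inverse q) * (cC powi t * (\<Sum>b\<in>R. yv i b powi (r - t) * rho i k a b c)) = two * wt i a c *
    (cC powi r * (Kf i c * zcoeff (sq (q ^ 2 * (cC / y)) (th k c)) (t - r)
        - inverse q * Kf i (mv c a) * zcoeff (sq (inverse q ^ 2 * (cC / y)) (th k (mv c a))) (t - r))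
     + y * cC powi (t - 1) * (q * Kf k (mv c a) * zcoeff (sq (q ^ 2 * y) (th i (mv c a))) (r - t + 1)
        - inverse q ^ 2 * Kf k c * zcoeff (sq (inverse q ^ 2 * y) (th i c)) (r - t + 1)))"
proof -
  let ?S = "pset k a c" and ?al = "alf2 k a c" and ?be = "yv k"
  let ?W = "\<Prod>u\<in>?S. linfrac (?al u) (?be u)" and ?V = "\<Prod>u\<in>?S. linfrac (1 / ?al u) (1 / ?be u)"
  let ?V' = "\<Prod>u\<in>?S. linfrac (cC * (1 / ?al u)) (cC * (1 / ?be u))"
  have SR: "?S \<subseteq> R" "finite ?S" by (auto simp: pset_def)
  have y0: "y \<noteq> 0" and C0: "cC \<noteq> 0" using yv_nz[OF a] q0 by (simp_all add: y_def)
  have kN: "N - k = i" using A by (auto simp: adj_def)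
  have alg: "u * (b * K * (w - p * v)) = u * (b * K * w - b * (p * K) * v)" for u b K w p v :: 'a
    by (simp add: algebra_simps)
  have zc: "zcoeff (fps_const u * f) m = u * zcoeff f m" "zcoeff (f - h) m = zcoeff f m - zcoeff h m"
    for u and f h :: "'a fps" and m by (simp_all add: zcoeff_def)
  have zX: "zcoeff (f * fps_X) (m + 1) = zcoeff f m" for f :: "'a fps" and m
    by (auto simp: zcoeff_def nat_add_distrib)
  have E0: "Kf i c * zcoeff (sq (q ^ 2 * (cC / y)) (th k c)) m
        - inverse q * Kf i (mv c a) * zcoeff (sq (inverse q ^ 2 * (cC / y)) (th k (mv c a))) m
      = (1 - q ^ 2) * Kf i c * zcoeff ?W m" for m
    using arg_cong[OF middle_series_0[OF s A a ca], of "\<lambda>f. zcoeff f m"] unfolding zc y_def .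
  have Einf: "q * Kf k (mv c a) * zcoeff (sq (q ^ 2 * y) (th i (mv c a))) (m + 1)
        - inverse q ^ 2 * Kf k c * zcoeff (sq (inverse q ^ 2 * y) (th i c)) (m + 1)
      = inverse q ^ 3 * (1 - q ^ 2) * (cC / y) * Kf k c * zcoeff ?V' m" for m
    using arg_cong[OF middle_series_inf[OF s A a ca], of "\<lambda>f. zcoeff f (m + 1)"] unfolding zc zX y_def .
  \<comment> \<open>Rescaling all parameters by \<open>cC\<close> multiplies the coefficient of
    degree r - t by C^(r-t).\<close>
  have V': "cC powi t * zcoeff ?V' (r - t) = cC powi r * zcoeff ?V (r - t)"
  proof (cases "0 \<le> r - t")
    case True
    then obtain m where m: "r - t = int m" by (metis zero_le_imp_eq_int)
    have "r = t + int m" using m by simp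
    then have "cC powi r = cC powi t * cC ^ m" using C0 by (simp only: power_int_add power_int_of_nat simp_thms)
    then show ?thesis unfolding m zcoeff_def using linfrac_scale_nth[OF SR(2), of cC "\<lambda>u. 1 / ?al u" "\<lambda>u. 1 / ?be u" m]
      by (simp add: mult.assoc)
  qed (simp add: zcoeff_def)
  have PF: "zcoeff ?W (t - r) - (\<Prod>u\<in>?S. ?al u / ?be u) * zcoeff ?V (r - t) = (\<Sum>u\<in>?S. pf_res ?S ?al ?be u * ?be u powi (t - r))"
  proof -
    have "?al u \<noteq> 0" if "u \<in> ?S" for u using that SR alf_nz q0 by (auto simp: alf2_def)
    moreover have "?be u \<noteq> 0" if "u \<in> ?S" for u using that SR yv_nz by blast
    ultimately show ?thesis using expansion_difference[of ?S ?be ?al "t - r"] SR inj_on_subset[OF yv_inj SR(1)] by simp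
  qed
  have yb: "yv i (br u) = cC / yv k u" if "u \<in> R" for u using yv_dual[OF that, of k] unfolding kN .
  \<comment> \<open>The sum is reindexed by u = \<open>br b\<close>, because the pair formed with b
    belongs to the pole \<open>br b\<close>, and \<open>yv i (br u)\<close> is
    \<open>cC / yv k u\<close>.\<close>
  have "cC powi t * (\<Sum>b\<in>R. yv i b powi (r - t) * rho i k a b c) = cC powi t * (\<Sum>u\<in>R. yv i (br u) powi (r - t) * rho i k a (br u) c)"
    by (rule arg_cong[where f="(*) _"], rule sum.reindex_bij_witness[where i=br and j=br]) auto
  also have "\<dots> = cC powi r * (\<Sum>u\<in>R. yv k u powi (t - r) * rho i k a (br u) c)"
  proof -
    have "cC powi t * (yv i (br u) powi (r - t) * z) = cC powi r * (yv k u powi (t - r) * z)" if "u \<in> R" for u z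
      unfolding yb[OF that] using yv_nz[OF that, of k] C0 by (simp add: power_int_divide_distrib power_int_diff)
    then show ?thesis unfolding sum_distrib_left by (intro sum.cong refl)
  qed
  finally have "(q - inverse q) * (cC powi t * (\<Sum>b\<in>R. yv i b powi (r - t) * rho i k a b c))
      = cC powi r * (\<Sum>u\<in>R. yv k u powi (t - r) * ((q - inverse q) * rho i k a (br u) c))"
    by (simp only: sum_distrib_left mult_ac)
  also have "(\<Sum>u\<in>R. yv k u powi (t - r) * ((q - inverse q) * rho i k a (br u) c))
      = (\<Sum>u\<in>R. two * wt i a c * ((1 - q ^ 2) * Kf i c * (if u \<in> ?S then pf_res ?S ?al ?be u * ?be u powi (t - r) else 0)))"
    by (intro sum.cong refl) (simp add: rho_residue[OF s A a ca])
  also have "\<dots> = two * wt i a c * ((1 - q ^ 2) * Kf i c * (\<Sum>u\<in>?S. pf_res ?S ?al ?be u * ?be u powi (t - r)))"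
  proof -
    have "(\<Sum>u\<in>R. if u \<in> ?S then h u else 0) = sum h ?S" for h :: "nat \<Rightarrow> 'a"
      by (subst sum.inter_restrict[symmetric]) (use SR in \<open>auto simp: Int_absorb1 Int_commute\<close>)
    then show ?thesis by (simp only: sum_distrib_left[symmetric])
  qed
  also have "\<dots> = two * wt i a c * ((1 - q ^ 2) * Kf i c * zcoeff ?W (t - r)
     - (1 - q ^ 2) * ((\<Prod>u\<in>?S. ?al u / ?be u) * Kf i c) * zcoeff ?V (r - t))"
    unfolding PF[symmetric] by (rule alg)
  also have "cC powi r * (two * wt i a c * ((1 - q ^ 2) * Kf i c * zcoeff ?W (t - r)
     - (1 - q ^ 2) * ((\<Prod>u\<in>?S. ?al u / ?be u) * Kf i c) * zcoeff ?V (r - t)))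
     = two * wt i a c * (cC powi r * ((1 - q ^ 2) * Kf i c * zcoeff ?W (t - r))
       + inverse q ^ 3 * (1 - q ^ 2) * Kf k c * (cC powi r * zcoeff ?V (r - t)))"
    unfolding prod_ratio_pset[OF s A a ca] by (simp only: right_diff_distrib distrib_left mult_minus_right mult_minus_left diff_minus_eq_add mult_ac)
  also have "inverse q ^ 3 * (1 - q ^ 2) * Kf k c * (cC powi r * zcoeff ?V (r - t))
     = y * cC powi (t - 1) * (inverse q ^ 3 * (1 - q ^ 2) * (cC / y) * Kf k c * zcoeff ?V' (r - t))"
  proof -
    have "y * cC powi (t - 1) * (cC / y) = cC powi t" using y0 C0 power_int_add_1[of cC "t - 1"] by simp
    moreover have "y * P * (u * v * D * w * z) = u * v * w * ((y * P * D) * z)" for P u v D w z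
      by (simp only: mult_ac)
    ultimately show ?thesis unfolding V'[symmetric] by (simp only:)
  qed
  finally show ?thesis unfolding E0 Einf .
qed

end

section \<open>The relators as operators\<close>

locale rcol = colouring n d qF x for n d :: nat and x :: "nat \<Rightarrow> rfun"
begin

definition cop :: "gen \<Rightarrow> ((nat \<Rightarrow> int) \<Rightarrow> rfun) \<Rightarrow> (nat \<Rightarrow> int) \<Rightarrow> rfun" where
  "cop e F = (case e of
      GB i k \<Rightarrow> Bop (int i) k F
    | GTheta i m \<Rightarrow> (\<lambda>c. th (int i) c $ m / (qF - inverse qF) * F c)
    | GK i \<Rightarrow> (\<lambda>c. Kf (int i) c * F c)
    | GKinv i \<Rightarrow> (\<lambda>c. inverse (Kf (int i) c) * F c)
    | GC \<Rightarrow> (\<lambda>c. cC * F c)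
    | GCinv \<Rightarrow> (\<lambda>c. inverse cC * F c))"

lemma Bop_add: "Bop i k (\<lambda>v. F v + F' v) = (\<lambda>v. Bop i k F v + Bop i k F' v)"
  by (rule ext) (simp add: Bop_def distrib_left sum.distrib)

lemma Bop_mult: "Bop i k (\<lambda>v. u * F v) = (\<lambda>v. u * Bop i k F v)"
  by (rule ext) (simp add: Bop_def sum_distrib_left mult_ac)

sublocale op_family cop
proof
  show "cop h (\<lambda>v. F v + F' v) = (\<lambda>v. cop h F v + cop h F' v)" for h F F'
    by (cases h) (simp_all add: cop_def Bop_add distrib_left)
  show "cop h (fscale c F) = fscale c (cop h F)" for h c F
    by (cases h) (simp_all add: cop_def fscale_def Bop_mult mult_ac)
qed

lemma qq_nz: "qF - inverse qF \<noteq> 0"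
  using q0 q2 by (auto simp: field_simps power2_eq_square)

lemma linfrac_prod_nth_0: "finite S \<Longrightarrow> (\<Prod>s\<in>S. linfrac (f s) (h s)) $ 0 = (1 :: rfun)"
  by (induction S rule: finite_induct) auto

lemma th_nth_0: "th i c $ 0 = 1"
  by (simp add: th_def pth_alt linfrac_prod_nth_0 ext_def power2_eq_square)

lemma Ev_Theta: "Ev (Theta_coeff i k) F = (\<lambda>c. zcoeff (th (int i) c) k * F c)"
proof
  fix c
  consider "k < 0" | "k = 0" | "k > 0" by linarith
  then show "Ev (Theta_coeff i k) F c = zcoeff (th (int i) c) k * F c"
  proof cases
    case 3
    have "coeffF (qv - inverse qv) = qF - inverse qF" by (simp add: coeffF_simps coeffF_inverse)
    then show ?thesis using 3 qq_nz by (simp add: Theta_coeff_def zcoeff_def Ev_mult Ev_sc Ev_gn cop_def)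
  qed (simp_all add: Theta_coeff_def zcoeff_def Ev_zero Ev_one th_nth_0)
qed

lemma Ev_vp: "Ev (vp k) F = (\<lambda>c. qF powi k * F c)"
  by (rule ext) (simp add: vp_def Ev_sc coeffF_power_int)

lemma Ev_power_GC: "Ev (gn GC ^ k) F = (\<lambda>c. cC ^ k * F c)" "Ev (gn GCinv ^ k) F = (\<lambda>c. inverse cC ^ k * F c)"
  by (induction k) (simp_all add: Ev_one Ev_mult Ev_gn cop_def mult_ac)

lemma Ev_Cpow: "Ev (Cpow k) F = (\<lambda>c. cC powi k * F c)"
  by (simp add: Cpow_def Ev_power_GC power_int_def power_inverse)

lemma Ev_vp_power: "Ev (vp k ^ m) F = (\<lambda>c. (qF powi k) ^ m * F c)"
  by (induction m) (simp_all add: Ev_one Ev_mult Ev_vp mult_ac)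

lemma Ev_gens: "Ev (gn (GB i k)) F = Bop (int i) k F" "Ev (gn (GK i)) F = (\<lambda>c. Kf (int i) c * F c)"
  "Ev (gn (GKinv i)) F = (\<lambda>c. inverse (Kf (int i) c) * F c)"
  "Ev (gn GC) F = (\<lambda>c. cC * F c)" "Ev (gn GCinv) F = (\<lambda>c. inverse cC * F c)"
  by (simp_all add: Ev_gn cop_def)

lemma int_tau: "i \<in> idx n \<Longrightarrow> int (tau n i) = N - int i"
  by (auto simp: idx_def tau_def)

lemma cartan_cmat: "cartan i j = cmat (int i) (int j)"
  by (auto simp: cartan_def cmat_def)

lemma idx_ok: "i \<in> idx n \<Longrightarrow> ok (int i)"
  by (auto simp: idx_def)

lemma Ev_sc': "Ev (sc u) F = (\<lambda>c. coeffF u * F c)"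
  by (rule ext) (rule Ev_sc)

lemmas Ev_simps = Ev_mult Ev_add Ev_diff Ev_sum Ev_Theta Ev_vp Ev_vp_power Ev_Cpow Ev_gens Ev_sc' Ev_one Ev_zero

section \<open>Diagonal operators and the relation between B and Theta\<close>

definition sg :: "falg \<Rightarrow> (nat \<Rightarrow> int) \<Rightarrow> rfun" where
  "sg f c = Ev f (\<lambda>_. 1) c"

definition diagonal :: "falg \<Rightarrow> bool" where
  "diagonal f \<longleftrightarrow> (\<forall>F c. Ev f F c = sg f c * F c)"

lemma diagonalD: "diagonal f \<Longrightarrow> Ev f F c = sg f c * F c"
  by (simp add: diagonal_def)

lemma diagonalI: "(\<And>F c. Ev f F c = u c * F c) \<Longrightarrow> diagonal f" "(\<And>F c. Ev f F c = u c * F c) \<Longrightarrow> sg f c = u c"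
  by (simp_all add: diagonal_def sg_def)

lemma diagonal_mult: "diagonal f \<Longrightarrow> diagonal h \<Longrightarrow> diagonal (f * h)" "diagonal f \<Longrightarrow> diagonal h \<Longrightarrow> sg (f * h) c = sg f c * sg h c"
  by (rule diagonalI[of _ "\<lambda>c. sg f c * sg h c"], simp add: Ev_mult diagonalD mult.assoc)+

lemma diagonal_zero: "diagonal 0" "sg 0 c = 0"
  by (simp_all add: diagonal_def sg_def Ev_zero)

lemma diagonal_diff: "diagonal f \<Longrightarrow> diagonal h \<Longrightarrow> diagonal (f - h)" "sg (f - h) c = sg f c - sg h c"
  by (rule diagonalI[of _ "\<lambda>c. sg f c - sg h c"], simp add: Ev_diff diagonalD left_diff_distrib)
    (simp add: sg_def Ev_diff)

lemma diagonal_sum: "(\<And>a. a \<in> A \<Longrightarrow> diagonal (f a)) \<Longrightarrow> diagonal (sum f A)" "sg (sum f A) c = (\<Sum>a\<in>A. sg (f a) c)"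
  by (rule diagonalI[of _ "\<lambda>c. \<Sum>a\<in>A. sg (f a) c"], simp add: Ev_sum diagonalD sum_distrib_right)
    (simp add: sg_def Ev_sum)

text \<open>Distributions in \<open>z, w\<close> whose \<open>z\<^sup>a\<close>-coefficient involves only \<open>w\<^sup>b\<close> with \<open>\<bar>b\<bar> \<le> a\<close> form a ring,
  and substituting \<open>w = 1 / y\<close> maps it to power series in \<open>z\<close>.\<close>

definition cone :: "falg fdist \<Rightarrow> bool" where
  "cone P \<longleftrightarrow> (\<forall>a b t. P (a, b, t) \<noteq> 0 \<longrightarrow> t = 0 \<and> \<bar>b\<bar> \<le> a) \<and> (\<forall>e. diagonal (P e))"

definition at_w :: "(nat \<Rightarrow> int) \<Rightarrow> rfun \<Rightarrow> falg fdist \<Rightarrow> rfun fps" where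
  "at_w c y P = Abs_fps (\<lambda>a. \<Sum>b\<in>{- int a..int a}. sg (P (int a, b, 0)) c * y powi (- b))"

lemma coneD: "cone P \<Longrightarrow> t \<noteq> 0 \<or> \<not> \<bar>b\<bar> \<le> a \<Longrightarrow> P (a, b, t) = 0"
  by (auto simp: cone_def)

lemma cone_diag: "cone P \<Longrightarrow> diagonal (P e)"
  unfolding cone_def by blast

text \<open>The cone conditions on both factors confine the index of summation to a finite
  triangle.\<close>

lemma cone_mult_coeff:
  assumes "cone P" "cone P'"
  shows "(P \<star> P') (a, b, t) = (if t = 0 then \<Sum>a1\<in>{0..nat a}. \<Sum>b1\<in>{- int a1..int a1}. P (int a1, b1, 0) * P' (a - int a1, b - b1, 0) else 0)"
proof -
  let ?S = "(\<lambda>(a1, b1). (int a1, b1, 0::int)) ` (SIGMA a1:{0..nat a}. {- int a1..int a1})"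
  have "(P \<star> P') (a, b, t) = (\<Sum>e\<in>?S. P e * P' ((a, b, t) - e))"
    unfolding fd_mult_def
  proof (rule Sum_any.expand_superset)
    show "{e. P e * P' ((a, b, t) - e) \<noteq> 0} \<subseteq> ?S"
    proof
      fix e assume "e \<in> {e. P e * P' ((a, b, t) - e) \<noteq> 0}"
      moreover obtain a1 b1 t1 where e: "e = (a1, b1, t1)" by (cases e)
      ultimately have "P (a1, b1, t1) \<noteq> 0" "P' (a - a1, b - b1, t - t1) \<noteq> 0" by (auto simp: expo_simps)
      then have "t1 = 0" "\<bar>b1\<bar> \<le> a1" "\<bar>b - b1\<bar> \<le> a - a1" using assms coneD by blast+
      then show "e \<in> ?S" unfolding e by (intro image_eqI[where x="(nat a1, b1)"]) auto
    qed
  qed simp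
  also have "\<dots> = (\<Sum>(a1, b1)\<in>(SIGMA a1:{0..nat a}. {- int a1..int a1}). P (int a1, b1, 0) * P' (a - int a1, b - b1, t))"
    by (subst sum.reindex) (auto simp: inj_on_def expo_simps intro!: sum.cong)
  also have "\<dots> = (\<Sum>a1\<in>{0..nat a}. \<Sum>b1\<in>{- int a1..int a1}. P (int a1, b1, 0) * P' (a - int a1, b - b1, t))"
    by (rule sum.Sigma[symmetric]) auto
  finally show ?thesis using coneD[OF assms(2)] by simp
qed

lemma cone_mult:
  assumes "cone P" "cone P'"
  shows "cone (P \<star> P')"
  unfolding cone_def
proof (intro conjI allI impI)
  fix a b t assume n: "(P \<star> P') (a, b, t) \<noteq> 0"
  then show "t = 0" unfolding cone_mult_coeff[OF assms] by (auto split: if_splits)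
  show "\<bar>b\<bar> \<le> a"
  proof (rule ccontr)
    assume "\<not> \<bar>b\<bar> \<le> a"
    then have "P (int a1, b1, 0) * P' (a - int a1, b - b1, 0) = 0" for a1 b1
      using coneD[OF assms(1), of 0 b1 "int a1"] coneD[OF assms(2), of 0 "b - b1" "a - int a1"]
      by (cases "\<bar>b1\<bar> \<le> int a1") auto
    then show False using n unfolding cone_mult_coeff[OF assms] by (auto split: if_splits)
  qed
next
  fix e show "diagonal ((P \<star> P') e)"
    using cone_diag[OF assms(1)] cone_diag[OF assms(2)]
    by (cases e) (auto simp: cone_mult_coeff[OF assms] intro!: diagonal_zero diagonal_sum diagonal_mult)
qed

text \<open>In z this is the Cauchy product; in w, for fixed degrees in z, it is a finite
  convolution, whose range the cone condition allows to be shifted freely.\<close>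

lemma at_w_mult:
  assumes "cone P" "cone P'" "y \<noteq> 0"
  shows "at_w c y (P \<star> P') = at_w c y P * at_w c y P'"
proof (rule fps_ext)
  fix a
  let ?p = "\<lambda>a1 b1. sg (P (int a1, b1, 0)) c * y powi (- b1)" and ?p' = "\<lambda>a1 b1. sg (P' (int a1, b1, 0)) c * y powi (- b1)"
  have in1: "(\<Sum>b\<in>{- int a..int a}. ?p a1 b1 * (sg (P' (int a - int a1, b - b1, 0)) c * y powi (- (b - b1))))
    = ?p a1 b1 * (\<Sum>b2\<in>{- int (a - a1)..int (a - a1)}. ?p' (a - a1) b2)"
    if "a1 \<in> {0..a}" "b1 \<in> {- int a1..int a1}" for a1 b1
  proof -
    have "(\<Sum>b\<in>{- int a..int a}. sg (P' (int a - int a1, b - b1, 0)) c * y powi (- (b - b1)))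
      = (\<Sum>b\<in>{b1 - int (a - a1)..b1 + int (a - a1)}. sg (P' (int a - int a1, b - b1, 0)) c * y powi (- (b - b1)))"
      by (rule sum.mono_neutral_right)
        (use that coneD[OF assms(2)] in \<open>auto simp: diagonal_zero of_nat_diff\<close>)
    also have "\<dots> = (\<Sum>b2\<in>{- int (a - a1)..int (a - a1)}. ?p' (a - a1) b2)"
      by (rule sum.reindex_bij_witness[where j="\<lambda>b. b - b1" and i="\<lambda>b. b + b1"]) (use that in \<open>auto simp: of_nat_diff\<close>)
    finally show ?thesis by (simp only: sum_distrib_left[symmetric])
  qed
  have "at_w c y (P \<star> P') $ a = (\<Sum>b\<in>{- int a..int a}. (\<Sum>a1\<in>{0..a}. \<Sum>b1\<in>{- int a1..int a1}.
      sg (P (int a1, b1, 0)) c * sg (P' (int a - int a1, b - b1, 0)) c) * y powi (- b))"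
    by (simp add: at_w_def cone_mult_coeff[OF assms(1,2)] diagonal_sum diagonal_mult cone_diag assms)
  also have "\<dots> = (\<Sum>b\<in>{- int a..int a}. \<Sum>a1\<in>{0..a}. \<Sum>b1\<in>{- int a1..int a1}.
      ?p a1 b1 * (sg (P' (int a - int a1, b - b1, 0)) c * y powi (- (b - b1))))"
  proof -
    have "y powi (- b) = y powi (- b1) * y powi (- (b - b1))" for b b1
      using assms(3) by (simp add: power_int_add[symmetric])
    then have "u * w * y powi (- b) = u * y powi (- b1) * (w * y powi (- (b - b1)))" for u w b b1
      by (metis (no_types, lifting) mult.assoc mult.left_commute)
    then show ?thesis unfolding sum_distrib_right by (intro sum.cong refl)
  qed
  also have "\<dots> = (\<Sum>a1\<in>{0..a}. \<Sum>b1\<in>{- int a1..int a1}. \<Sum>b\<in>{- int a..int a}.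
      ?p a1 b1 * (sg (P' (int a - int a1, b - b1, 0)) c * y powi (- (b - b1))))"
    by (rule trans[OF sum.swap]) (rule sum.cong[OF refl], rule sum.swap)
  also have "\<dots> = (\<Sum>a1\<in>{0..a}. \<Sum>b1\<in>{- int a1..int a1}. ?p a1 b1 * (\<Sum>b2\<in>{- int (a - a1)..int (a - a1)}. ?p' (a - a1) b2))"
    by (intro sum.cong refl in1)
  also have "\<dots> = (at_w c y P * at_w c y P') $ a"
    by (simp add: fps_mult_nth at_w_def sum_distrib_right)
  finally show "at_w c y (P \<star> P') $ a = (at_w c y P * at_w c y P') $ a" .
qed

text \<open>On the summand that moves l, B_j(w) is the delta series in y w for y =
  \<open>yv j l\<close>. Multiplying it by a distribution in z and w amounts to substituting w = 1 /
  y.\<close>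

lemma cone_mult_B:
  assumes "cone P" "c \<in> Col" "0 \<le> a"
  shows "Ev ((P \<star> Bs j w1) (a, b, 0)) F c
    = (\<Sum>l\<in>R. yv (int j) l powi b * at_w c (yv (int j) l) P $ nat a * (wt (int j) l c * F (mv c l)))"
proof -
  have sup: "b - a \<le> k \<and> k \<le> b + a" if "P (a, b - k, 0) * h \<noteq> 0" for k h
    using that coneD[OF assms(1), of 0 "b - k" a] by (cases "\<bar>b - k\<bar> \<le> a") auto
  have "(P \<star> Bs j w1) (a, b, 0) = (\<Sum>b1\<in>{- a..a}. P (a, b1, 0) * gn (GB j (b - b1)))"
  proof -
    have "(P \<star> Bs j w1) (a, b, 0) = (\<Sum>k\<in>{b - a..b + a}. P (a, b - k, 0) * gn (GB j k))"
      unfolding Bs_def mult_ser[OF expo_simps(5)] expo_simps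
      by (subst Sum_any.expand_superset[of "{b - a..b + a}"]) (auto dest: sup)
    also have "\<dots> = (\<Sum>b1\<in>{- a..a}. P (a, b1, 0) * gn (GB j (b - b1)))"
      by (rule sum.reindex_bij_witness[where i="\<lambda>k. b - k" and j="\<lambda>k. b - k"]) auto
    finally show ?thesis .
  qed
  then have "Ev ((P \<star> Bs j w1) (a, b, 0)) F c = (\<Sum>b1\<in>{- a..a}. sg (P (a, b1, 0)) c * Bop (int j) (b - b1) F c)"
    by (simp add: Ev_sum Ev_mult Ev_gens diagonalD cone_diag[OF assms(1)])
  also have "\<dots> = (\<Sum>b1\<in>{- a..a}. \<Sum>l\<in>R. yv (int j) l powi b * (sg (P (a, b1, 0)) c * yv (int j) l powi (- b1)) * (wt (int j) l c * F (mv c l)))"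
  proof (intro sum.cong refl)
    fix b1
    have "yv (int j) l powi (b - b1) = yv (int j) l powi b * yv (int j) l powi (- b1)" if "l \<in> R" for l
      using yv_nz[OF that] by (simp add: power_int_add[symmetric])
    then show "sg (P (a, b1, 0)) c * Bop (int j) (b - b1) F c
      = (\<Sum>l\<in>R. yv (int j) l powi b * (sg (P (a, b1, 0)) c * yv (int j) l powi (- b1)) * (wt (int j) l c * F (mv c l)))"
      using assms(2) by (auto simp: Bop_def sum_distrib_left mult_ac intro!: sum.cong)
  qed
  also have "\<dots> = (\<Sum>l\<in>R. \<Sum>b1\<in>{- a..a}. yv (int j) l powi b * (sg (P (a, b1, 0)) c * yv (int j) l powi (- b1)) * (wt (int j) l c * F (mv c l)))"
    by (rule sum.swap)
  also have "\<dots> = (\<Sum>l\<in>R. yv (int j) l powi b * at_w c (yv (int j) l) P $ nat a * (wt (int j) l c * F (mv c l)))"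
    using assms(3) by (simp add: at_w_def sum_distrib_left sum_distrib_right)
  finally show ?thesis .
qed

lemma diagonal_basic: "diagonal (vp k)" "diagonal (gn GC)" "diagonal 1" "diagonal (Theta_coeff i m)"
  "sg (vp k) c = qF powi k" "sg (gn GC) c = cC" "sg 1 c = 1" "sg (Theta_coeff i m) c = zcoeff (th (int i) c) m"
  by (simp_all add: diagonal_def sg_def Ev_simps)

lemma diagonal_power: "diagonal f \<Longrightarrow> diagonal (f ^ k)" "diagonal f \<Longrightarrow> sg (f ^ k) c = sg f c ^ k"
proof -
  assume f: "diagonal f"
  have "diagonal (f ^ k) \<and> sg (f ^ k) c = sg f c ^ k"
    using f by (induction k) (simp_all add: diagonal_basic diagonal_mult)
  then show "diagonal (f ^ k)" "sg (f ^ k) c = sg f c ^ k" by auto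
qed

lemma expo_pm: "zz - w1 = (1, -1, 0)" "zz + w1 = (1, 1, 0)" "(0 :: expo) = (0, 0, 0)"
  by (simp_all add: zz_def w1_def zero_prod_def)

lemma cone_linear:
  assumes "diagonal f" "\<bar>s\<bar> = 1"
  shows "cone (cst 1 - mon f (1, s, 0))" and "at_w c y (cst 1 - mon f (1, s, 0)) = 1 - fps_const (sg f c * y powi (- s)) * fps_X"
proof -
  show "cone (cst 1 - mon f (1, s, 0))"
    using assms unfolding cone_def by (auto simp: mon_def expo_pm diagonal_basic diagonal_zero diagonal_diff split: if_splits intro!: diagonal_diff)
  have s: "s \<in> {- int 1..int 1}" using assms(2) by auto
  show "at_w c y (cst 1 - mon f (1, s, 0)) = 1 - fps_const (sg f c * y powi (- s)) * fps_X"
  proof (rule fps_ext)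
    fix a
    have "(\<Sum>b\<in>{- int a..int a}. sg ((cst 1 - mon f (1, s, 0)) (int a, b, 0)) c * y powi (- b))
       = (\<Sum>b\<in>{- int a..int a}. (if b = 0 then (if a = 0 then 1 else 0) else 0))
         - (\<Sum>b\<in>{- int a..int a}. (if b = s then (if a = 1 then sg f c * y powi (- s) else 0) else 0))"
      unfolding sum_subtractf[symmetric]
      by (rule sum.cong) (auto simp: mon_def expo_pm diagonal_basic diagonal_zero diagonal_diff)
    also have "\<dots> = (if a = 0 then 1 else 0) - (if a = 1 then sg f c * y powi (- s) else 0)"
      using s by (subst (1 2) sum.delta) auto
    finally show "at_w c y (cst 1 - mon f (1, s, 0)) $ a = (1 - fps_const (sg f c * y powi (- s)) * fps_X) $ a"
      by (simp add: at_w_def)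
  qed
qed

lemma ser_line: "\<bar>s\<bar> = 1 \<Longrightarrow> ser f (1, s, 0) (a, b, t) = (if t = 0 \<and> b = s * a then f a else 0)"
proof (cases "t = 0 \<and> b = s * a")
  case True
  then show ?thesis using ser_scale[of "(1, s, 0)" f a] by (auto simp: expo_scale_def zero_prod_def mult.commute)
qed (use ser_outside[of "(a, b, t)" "(1, s, 0)" f] in \<open>auto simp: expo_scale_def mult.commute\<close>)

lemma cone_geom:
  assumes "diagonal f" "\<bar>s\<bar> = 1" "y \<noteq> 0"
  shows "cone (geom f (1, s, 0))" and "at_w c y (geom f (1, s, 0)) = iv (sg f c * y powi (- s))"
proof -
  have sa: "\<bar>s * a\<bar> = \<bar>a\<bar>" for a using assms(2) by (simp add: abs_mult)
  show "cone (geom f (1, s, 0))"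
    using assms sa unfolding cone_def geom_def by (auto simp: ser_line diagonal_zero diagonal_power split: if_splits)
  show "at_w c y (geom f (1, s, 0)) = iv (sg f c * y powi (- s))"
  proof (rule fps_ext)
    fix a
    have "at_w c y (geom f (1, s, 0)) $ a = (\<Sum>b\<in>{- int a..int a}. if b = s * int a then sg f c ^ a * y powi (- (s * int a)) else 0)"
      unfolding at_w_def geom_def fps_nth_Abs_fps by (rule sum.cong) (auto simp: ser_line[OF assms(2)] diagonal_zero diagonal_power assms)
    also have "\<dots> = sg f c ^ a * y powi (- (s * int a))"
      using sa[of "int a"] by (subst sum.delta) auto
    also have "y powi (- (s * int a)) = (y powi (- s)) ^ a"
      by (simp add: power_int_mult[symmetric] flip: power_int_of_nat)
    finally show "at_w c y (geom f (1, s, 0)) $ a = iv (sg f c * y powi (- s)) $ a"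
      by (simp add: inverse_one_minus_X_nth power_mult_distrib)
  qed
qed

lemma Theta_coeff_neg: "k < 0 \<Longrightarrow> Theta_coeff i k = 0"
  by (simp add: Theta_coeff_def)

lemma cone_Theta: "cone (Ths i zz)" "at_w c y (Ths i zz) = th (int i) c"
proof -
  show "cone (Ths i zz)" unfolding cone_def Ths_def
    by (auto simp: ser_zz diagonal_zero diagonal_basic Theta_coeff_neg split: if_splits intro: ccontr)
  show "at_w c y (Ths i zz) = th (int i) c"
  proof (rule fps_ext)
    fix a
    have "at_w c y (Ths i zz) $ a = (\<Sum>b\<in>{- int a..int a}. if b = 0 then th (int i) c $ a else 0)"
      unfolding at_w_def Ths_def fps_nth_Abs_fps by (rule sum.cong) (auto simp: ser_zz diagonal_zero diagonal_basic zcoeff_def)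
    then show "at_w c y (Ths i zz) $ a = th (int i) c $ a" by (subst (asm) sum.delta) auto
  qed
qed

lemma th_mv:
  assumes "symc c" "a \<in> R"
  shows "th i (mv c a) = linfrac (qF powi cmat i (c a) * yv (c a) a) (qF powi (- cmat i (c a)) * yv (c a) a)
     * linfrac (qF powi (- cmat (N - i) (c a)) * (cC / yv (c a) a)) (qF powi (cmat (N - i) (c a)) * (cC / yv (c a) a)) * th i c"
  unfolding th_def pth_mv[OF assms] by (simp add: mult.assoc)

text \<open>By \<open>cone_mult_B\<close> the structure function is evaluated at w = 1 /
  \<open>yv j l\<close>. There it is the quotient of the eigenvalues of Theta_i after and before the
  move of l, by \<open>th_mv\<close>.\<close>

lemma relator_B_Theta:
  assumes ij: "i \<in> idx n" "j \<in> idx n" and c: "c \<in> Col"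
  shows "Ev ((Bs j ww \<star> Ths i zz
     - (cst 1 - mon (vp (cartan i j)) (zz - ww))
       \<star> (cst 1 - mon (vp (- cartan (tau n i) j) * gn GC) (zz + ww))
       \<star> geom (vp (- cartan i j)) (zz - ww)
       \<star> geom (vp (cartan (tau n i) j) * gn GC) (zz + ww)
       \<star> Ths i zz \<star> Bs j ww) (a, b, t)) F c = 0"
proof -
  let ?A = "cst 1 - mon (vp (cartan i j)) (zz - ww)" and ?B = "cst 1 - mon (vp (- cartan (tau n i) j) * gn GC) (zz + ww)"
  let ?C = "geom (vp (- cartan i j)) (zz - ww)" and ?D = "geom (vp (cartan (tau n i) j) * gn GC) (zz + ww)"
  let ?P = "?A \<star> ?B \<star> ?C \<star> ?D \<star> Ths i zz"
  have dg: "diagonal (vp k * gn GC)" "sg (vp k * gn GC) c' = qF powi k * cC" for k c'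
    by (simp_all add: diagonal_mult diagonal_basic)
  note cA = cone_linear[OF diagonal_basic(1), of "-1", folded expo_pm] cone_linear[OF dg(1), of 1, folded expo_pm]
  note cG = cone_geom[OF diagonal_basic(1), of "-1", folded expo_pm] cone_geom[OF dg(1), of 1, folded expo_pm]
  have one: "(1 :: rfun) \<noteq> 0" by simp
  have cones: "cone ?A" "cone ?B" "cone ?C" "cone ?D" "cone (Ths i zz)"
    using cA cG[where y=1] cone_Theta by simp_all
  then have cP: "cone (?A \<star> ?B)" "cone (?A \<star> ?B \<star> ?C)" "cone (?A \<star> ?B \<star> ?C \<star> ?D)" "cone ?P" by (auto intro: cone_mult)
  have at: "at_w c y ?P = linfrac (qF powi cartan i j * y) (qF powi (- cartan i j) * y)
     * linfrac (qF powi (- cartan (tau n i) j) * (cC / y)) (qF powi (cartan (tau n i) j) * (cC / y)) * th (int i) c"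
    if y: "y \<noteq> 0" for y
  proof -
    have shift_y: "qF powi k * cC * y powi (- 1) = qF powi k * (cC / y)" for k
      by (simp add: divide_inverse)
    have "at_w c y ?P = at_w c y ?A * at_w c y ?B * at_w c y ?C * at_w c y ?D * th (int i) c"
      using cones cP y by (simp add: at_w_mult cone_Theta)
    also have "at_w c y ?A = lf (qF powi cartan i j * y)" using cA by (simp add: diagonal_basic)
    also have "at_w c y ?B = lf (qF powi (- cartan (tau n i) j) * (cC / y))" by (subst cA(4)) (simp_all only: dg shift_y abs_one)
    also have "at_w c y ?C = iv (qF powi (- cartan i j) * y)" using cG[OF _ y] by (simp add: diagonal_basic)
    also have "at_w c y ?D = iv (qF powi (cartan (tau n i) j) * (cC / y))" by (subst cG(4)[OF _ y]) (simp_all only: dg shift_y abs_one)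
    finally show ?thesis unfolding linfrac_def by (simp only: mult_ac)
  qed
  have sc: "symc c" using c symc_Col by blast
  have L: "(Bs j w1 \<star> Ths i zz) (a, b, t) = (if t = 0 then gn (GB j b) * Theta_coeff i a else 0)"
    unfolding Bs_def Ths_def by (rule ser_w1_zz)
  show ?thesis
  proof (cases "t = 0 \<and> 0 \<le> a")
    case False
    have "?P (a, k, t) = 0" for k by (rule coneD[OF cP(4)]) (use False in auto)
    then have "(?P \<star> Bs j w1) (a, b, t) = 0"
      unfolding Bs_def mult_ser[OF expo_simps(5)] expo_simps by simp
    moreover have "(Bs j w1 \<star> Ths i zz) (a, b, t) = 0" using False by (auto simp: L Theta_coeff_def)
    ultimately show ?thesis by (simp add: Ev_zero)
  next
    case True
    then have t: "t = 0" and a: "0 \<le> a" by auto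
    have "Ev ((?P \<star> Bs j w1) (a, b, 0)) F c = (\<Sum>l\<in>R. yv (int j) l powi b * at_w c (yv (int j) l) ?P $ nat a * (wt (int j) l c * F (mv c l)))"
      by (rule cone_mult_B[OF cP(4) c a])
    also have "\<dots> = (\<Sum>l\<in>R. yv (int j) l powi b * wt (int j) l c * (zcoeff (th (int i) (mv c l)) a * F (mv c l)))"
    proof (intro sum.cong refl)
      fix l assume l: "l \<in> R"
      show "yv (int j) l powi b * at_w c (yv (int j) l) ?P $ nat a * (wt (int j) l c * F (mv c l))
        = yv (int j) l powi b * wt (int j) l c * (zcoeff (th (int i) (mv c l)) a * F (mv c l))"
      proof (cases "c l = int j")
        case cl: True
        have "at_w c (yv (int j) l) ?P = th (int i) (mv c l)"
          using at[OF yv_nz[OF l]] th_mv[OF sc l, of "int i"] ij by (simp add: cl cartan_cmat int_tau)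
        then show ?thesis using a by (simp add: zcoeff_def mult_ac)
      qed (simp add: wt_def)
    qed
    also have "\<dots> = Ev ((Bs j w1 \<star> Ths i zz) (a, b, 0)) F c"
      using c unfolding L[unfolded t] by (simp add: Ev_simps Bop_def mult.assoc)
    finally show ?thesis unfolding t by (simp add: Ev_diff)
  qed
qed

end

lemma Sym_coeff:
  assumes "g w2 w1 = fswap (g w1 w2)"
  shows "Sym g (z, p, s) = g w1 w2 (z, p, s) + g w1 w2 (z, s, p)"
  by (simp add: Sym_def assms fswap_def)

lemmas fswap_inward = fd_mult_fswap[symmetric] fswap_add[symmetric] fswap_diff[symmetric]
  ser_fswap[symmetric] mon_fswap[symmetric] eswap_simps

lemma Serre_coeff:
  fixes i j :: nat and p s z :: int
  defines "B \<equiv> \<lambda>k. gn (GB i k)" and "A \<equiv> \<lambda>k. gn (GB j k)"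
  shows "Serre i j (z, p, s) = (B p * B s * A z - sc qtwo * B p * A z * B s + A z * B p * B s)
     + (B s * B p * A z - sc qtwo * B s * A z * B p + A z * B s * B p)"
proof -
  let ?g = "\<lambda>a b. Bs i a \<star> Bs i b \<star> Bs j zz - cst (sc qtwo) \<star> Bs i a \<star> Bs j zz \<star> Bs i b + Bs j zz \<star> Bs i a \<star> Bs i b"
  have "?g w1 w2 (z, p, s) = B p * B s * A z - sc qtwo * B p * A z * B s + A z * B p * B s" for p s
    unfolding plus_fun_def fun_diff_def Bs_def ser_w1_w2_zz ser_w1_zz_w2 ser_zz_w1_w2 A_def B_def by (rule refl)
  moreover have "?g w2 w1 = fswap (?g w1 w2)"
    by (simp only: Bs_def fswap_inward)
  ultimately show ?thesis unfolding Serre_def by (subst Sym_coeff) simp_all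
qed

context rcol
begin

lemma relator_K_Theta:
  assumes "i \<in> idx n" "j \<in> idx n"
  shows "Ev ((Ks i \<star> Ths j ww - Ths j ww \<star> Ks i) e) F c = 0"
  by (cases e) (simp add: mon_mult mult_mon Ths_def ser_w1 Ev_simps)

lemma relator_K_B:
  assumes ij: "i \<in> idx n" "j \<in> idx n" and c: "c \<in> Col"
  shows "Ev ((Ks i \<star> Bs j zz - cst (vp (cartan (tau n i) j - cartan i j)) \<star> Bs j zz \<star> Ks i) e) F c = 0"
proof -
  obtain a b t where e: "e = (a, b, t)" by (cases e)
  let ?k = "cartan (tau n i) j - cartan i j"
  have "Kf (int i) c * Bop (int j) a F c = qF powi ?k * Bop (int j) a (\<lambda>c. Kf (int i) c * F c) c"
  proof -
    have "Kf (int i) c * (yv (int j) l powi a * wt (int j) l c * F (mv c l))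
      = qF powi ?k * (yv (int j) l powi a * wt (int j) l c * (Kf (int i) (mv c l) * F (mv c l)))" if l: "l \<in> R" for l
    proof (cases "c l = int j")
      case True
      have "Kf (int i) c = qF powi ?k * Kf (int i) (mv c l)"
        using Kf_mv[OF symc_Col[OF c] l, of "int i"] ij by (simp add: True cartan_cmat int_tau)
      then show ?thesis by (simp add: mult_ac)
    qed (simp add: wt_def)
    then have "(\<Sum>l\<in>R. Kf (int i) c * (yv (int j) l powi a * wt (int j) l c * F (mv c l)))
      = (\<Sum>l\<in>R. qF powi ?k * (yv (int j) l powi a * wt (int j) l c * (Kf (int i) (mv c l) * F (mv c l))))"
      by (rule sum.cong[OF refl])
    then show ?thesis using c by (simp add: Bop_def sum_distrib_left)
  qed
  then show ?thesis unfolding e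
    by (simp add: mon_mult mult_mon Bs_def ser_zz Ev_simps mult.assoc)
qed

lemma relator_Theta_Theta:
  "Ev ((Ths i zz \<star> Ths j ww - Ths j ww \<star> Ths i zz) e) F c = 0"
  by (cases e) (simp add: Ths_def ser_zz_w1 ser_w1_zz Ev_simps)

lemma coeffF_quotients:
  "coeffF (1 / (qv - inverse qv)) = 1 / (qF - inverse qF)" "coeffF (1 / (1 - qv ^ 2)) = 1 / (1 - qF ^ 2)"
  "coeffF qtwo = two" "coeffF (qv - inverse qv) = qF - inverse qF"
  by (simp_all add: qtwo_def coeffF_simps coeffF_inverse divide_inverse power2_eq_square)

lemma relator_B_B_tau0:
  assumes i: "i \<in> idx n" "cartan i (tau n i) = 0" and c: "c \<in> Col"
  shows "Ev ((Bs i zz \<star> Bs (tau n i) ww - Bs (tau n i) ww \<star> Bs i zz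
     - cst (sc (1 / (qv - inverse qv))) \<star> Deltas (zz + ww)
       \<star> (Ks (tau n i) \<star> Ths i zz - Ks i \<star> Ths (tau n i) ww)) e) F c = 0"
proof -
  obtain a b t where e: "e = (a, b, t)" by (cases e)
  have "cmat (int i) (N - int i) = 0" using i by (simp add: cartan_cmat int_tau)
  note rel = commutator_relation[OF c idx_ok[OF i(1)] this, of a b F]
  have alg: "Ev ((X - Y - Z) e) F c = Ev (X e) F c - Ev (Y e) F c - Ev (Z e) F c" for X Y Z
    by (simp add: Ev_simps)
  show ?thesis unfolding alg unfolding e Bs_def Ths_def Deltas_def commutator_rhs ser_zz_w1 ser_w1_zz
    using rel i by (simp add: Ev_simps coeffF_quotients int_tau algebra_simps)
qed

lemma relator_B_B:
  assumes ij: "i \<in> idx n" "j \<in> idx n" "j \<noteq> tau n i" and c: "c \<in> Col"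
  shows "Ev (((mon (vp (cartan i j)) zz - mon 1 ww) \<star> Bs i zz \<star> Bs j ww
     + (mon (vp (cartan i j)) ww - mon 1 zz) \<star> Bs j ww \<star> Bs i zz) e) F c = 0"
proof -
  obtain a b t where e: "e = (a, b, t)" by (cases e)
  have "int j \<noteq> N - int i" using ij by (auto simp: tau_def)
  note rel = quadratic_relation[OF c idx_ok[OF ij(1)] idx_ok[OF ij(2)] this, of a b F]
  show ?thesis unfolding e plus_fun_def Bs_def quadratic_zz_w1 quadratic_w1_zz
    using rel by (simp add: Ev_simps cartan_cmat algebra_simps)
qed

lemma relator_B_B_comm:
  assumes ij: "i \<in> idx n" "j \<in> idx n" "cartan i j = 0" "tau n i \<noteq> j" and c: "c \<in> Col"
  shows "Ev ((Bs i ww \<star> Bs j zz - Bs j zz \<star> Bs i ww) e) F c = 0"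
proof -
  obtain a b t where e: "e = (a, b, t)" by (cases e)
  have "int j \<noteq> N - int i" using ij by (auto simp: tau_def)
  note rel = commute_relation[OF c idx_ok[OF ij(1)] idx_ok[OF ij(2)] this, of b a F]
  show ?thesis unfolding e fun_diff_def Bs_def ser_zz_w1 ser_w1_zz
    using rel ij by (simp add: Ev_simps cartan_cmat)
qed

lemma relator_B_B_tau1:
  assumes i: "i \<in> idx n" "cartan i (tau n i) = -1" and c: "c \<in> Col"
  shows "Ev (((mon (vp (-1)) zz - mon 1 ww) \<star> Bs i zz \<star> Bs (tau n i) ww
     + (mon (vp (-1)) ww - mon 1 zz) \<star> Bs (tau n i) ww \<star> Bs i zz
     - cst (sc (1 / (1 - qv ^ 2))) \<star> Deltas (zz + ww)
       \<star> ((mon 1 zz - mon (vp 1) ww) \<star> Ks i \<star> Ths (tau n i) ww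
          + (mon 1 ww - mon (vp 1) zz) \<star> Ks (tau n i) \<star> Ths i zz)) e) F c = 0"
proof -
  obtain a b t where e: "e = (a, b, t)" by (cases e)
  have "cmat (int i) (N - int i) = -1" using i by (simp add: cartan_cmat int_tau)
  then consider (lo) "int i = int n" "int (tau n i) = int n + 1" | (hi) "int i = int n + 1" "int (tau n i) = int n"
    using i(2) int_tau[OF i(1)] unfolding cmat_def by (smt (verit))
  then have rel: "inverse qF * Bop (int i) (a - 1) (Bop (int (tau n i)) b F) c - Bop (int i) a (Bop (int (tau n i)) (b - 1) F) c
     + inverse qF * Bop (int (tau n i)) (b - 1) (Bop (int i) a F) c - Bop (int (tau n i)) b (Bop (int i) (a - 1) F) c
     = 1 / (1 - qF ^ 2) * (cC powi (a - 1) * Kf (int i) c * zcoeff (th (int (tau n i)) c) (b - a + 1)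
         - qF * cC powi a * Kf (int i) c * zcoeff (th (int (tau n i)) c) (b - 1 - a)
         + cC powi (b - 1) * Kf (int (tau n i)) c * zcoeff (th (int i) c) (a - b + 1)
         - qF * cC powi b * Kf (int (tau n i)) c * zcoeff (th (int i) c) (a - 1 - b)) * F c"
  proof cases
    case lo
    show ?thesis unfolding lo by (rule middle_relation[OF c])
  next
    \<comment> \<open>For i = n + 1 the relation is that for i = n with z and w exchanged.\<close>
    case hi
    have alg: "u1 - u2 + u3 - u4 = s * (v1 - v2 + v3 - v4) * f \<Longrightarrow> u3 - u4 + u1 - u2 = s * (v3 - v4 + v1 - v2) * f"
      for u1 u2 u3 u4 v1 v2 v3 v4 s f :: rfun by (simp add: algebra_simps)
    show ?thesis unfolding hi by (rule alg) (rule middle_relation[OF c])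
  qed
  have alg: "Ev ((X + Y - Z) e) F c = Ev (X e) F c + Ev (Y e) F c - Ev (Z e) F c" for X Y Z
    by (simp add: Ev_simps)
  show ?thesis unfolding alg unfolding e Bs_def Ths_def Deltas_def quadratic_zz_w1 quadratic_w1_zz middle_rhs
    using rel by (auto simp: Ev_simps coeffF_quotients algebra_simps power_int_minus)
qed

lemma Ev_Serre:
  "Ev (Serre i j (z, p, s)) F c = serre_coeff (int i) (int j) p s z F c + serre_coeff (int i) (int j) s p z F c"
  unfolding Serre_coeff serre_coeff_def by (simp add: Ev_simps coeffF_quotients)

lemma relator_Serre:
  assumes ij: "i \<in> idx n" "j \<in> idx n" "cartan i j = -1" "j \<noteq> tau n i" and c: "c \<in> Col"
  shows "Ev (Serre i j e) F c = 0"
proof -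
  obtain z p s where e: "e = (z, p, s)" by (cases e)
  have 1: "int j \<noteq> N - int i" using ij by (auto simp: tau_def)
  have 2: "int j = int i + 1 \<or> int i = int j + 1" using ij(3) by (auto simp: cartan_def split: if_splits)
  show ?thesis unfolding e Ev_Serre
    by (rule serre_relation[OF c idx_ok[OF ij(1)] idx_ok[OF ij(2)] 2 1])
qed

section \<open>The corrected Serre relation as a relator\<close>

lemma zcoeff_sq:
  assumes "nat L \<le> M"
  shows "zcoeff (sq u f) L = (\<Sum>m\<le>M. u ^ m * (zcoeff f (L - int m) - qF * cC * zcoeff f (L - 2 - int m)))"
proof -
  define h where "h = (1 - fps_const (qF * cC) * fps_X ^ 2) * f"
  have h: "zcoeff h k = zcoeff f k - qF * cC * zcoeff f (k - 2)" for k
  proof (cases "k < 2")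
    case True
    then show ?thesis by (auto simp: h_def zcoeff_def left_diff_distrib mult.assoc fps_X_power_mult_nth)
  next
    case False
    then have "nat (k - 2) = nat k - 2" "\<not> nat k < 2" by auto
    then show ?thesis using False by (auto simp: h_def zcoeff_def left_diff_distrib mult.assoc fps_X_power_mult_nth)
  qed
  have "zcoeff (iv u * h) L = (\<Sum>m\<le>M. u ^ m * zcoeff h (L - int m))"
  proof (cases "L < 0")
    case True
    then show ?thesis by (simp add: zcoeff_def)
  next
    case False
    have "zcoeff (iv u * h) L = (\<Sum>m\<in>{0..nat L}. u ^ m * h $ (nat L - m))"
      using False by (simp add: zcoeff_def fps_mult_nth inverse_one_minus_X_nth)
    also have "\<dots> = (\<Sum>m\<in>{0..nat L}. u ^ m * zcoeff h (L - int m))"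
      using False by (intro sum.cong) (auto simp: zcoeff_def nat_diff_distrib')
    also have "\<dots> = (\<Sum>m\<le>M. u ^ m * zcoeff h (L - int m))"
      using False assms by (intro sum.mono_neutral_left) (auto simp: zcoeff_def)
    finally show ?thesis .
  qed
  moreover have "L - int m - 2 = L - 2 - int m" for m by simp
  moreover have "sq u f = iv u * h" by (simp add: h_def sq_def mult_ac)
  ultimately show ?thesis unfolding h by (simp only:)
qed

lemma path_powers:
  assumes "a \<in> R"
  shows "yv i a powi (p - int m) = yv i a powi p * (1 / yv i a) ^ m" "yv i a powi (p + 1 + int m) = yv i a powi (p + 1) * yv i a ^ m"
    "cC powi (s + int m) = cC powi s * cC ^ m" "cC powi (s + int m + 1) = cC powi s * cC ^ m * cC" "cC powi s = cC powi (s - 1) * cC"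
proof -
  have y: "yv i a \<noteq> 0" by (rule yv_nz[OF assms])
  have C: "cC \<noteq> 0" using q0 by simp
  show "yv i a powi (p - int m) = yv i a powi p * (1 / yv i a) ^ m" "yv i a powi (p + 1 + int m) = yv i a powi (p + 1) * yv i a ^ m"
    using power_int_diff[of "yv i a" p "int m"] power_int_add[of "yv i a" "p + 1" "int m"] y by (simp_all add: power_divide)
  show "cC powi (s + int m) = cC powi s * cC ^ m" "cC powi (s + int m + 1) = cC powi s * cC ^ m * cC" "cC powi s = cC powi (s - 1) * cC"
    using power_int_add[of cC s "int m"] power_int_add[of cC "s + int m" 1] power_int_add[of cC "s - 1" 1] C
    by (simp_all del: power_int_mult)
qed

text \<open>For a move of a the m-th summand carries C^m, the m-th power of q^(-2) and y^(-m), a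
  geometric series that combines with Theta into a coefficient of \<open>sq\<close>. Here and in the
  third term Theta and K stand to the right of B and are evaluated at \<open>mv c a\<close>; in the
  second and fourth they stand to the left and are evaluated at c.\<close>

lemma path_term1:
  assumes c: "c \<in> Col" and M: "nat (z - s) \<le> M"
  shows "Ev ((\<Sum>m\<le>M. Cpow (s + int m) * vp (-2) ^ m * gn (GB i (p - int m)) * Theta_coeff k (z - s - int m)
        - Cpow (s + int m + 1) * vp 1 * vp (-2) ^ m * gn (GB i (p - int m)) * Theta_coeff k (z - s - 2 - int m)) * gn (GK i)) F c
    = (\<Sum>a\<in>R. yv (int i) a powi p * wt (int i) a c * (cC powi s * Kf (int i) (mv c a)
         * zcoeff (sq (inverse qF ^ 2 * (cC / yv (int i) a)) (th (int k) (mv c a))) (z - s)) * F (mv c a))"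
proof -
  have v: "qF powi (-2) = inverse qF ^ 2" by (simp add: power_int_minus power_inverse)
  have alg: "C * Cm * g * (yp * ym * w * (t1 * (K * f))) - C * Cm * C1 * (q1 * (g * (yp * ym * w * (t2 * (K * f)))))
    = yp * w * (C * K * (g * Cm * ym * (t1 - q1 * C1 * t2))) * f" for C Cm C1 g yp ym w t1 t2 K f q1 :: rfun
    by (simp add: algebra_simps)
  have "Ev ((\<Sum>m\<le>M. Cpow (s + int m) * vp (-2) ^ m * gn (GB i (p - int m)) * Theta_coeff k (z - s - int m)
        - Cpow (s + int m + 1) * vp 1 * vp (-2) ^ m * gn (GB i (p - int m)) * Theta_coeff k (z - s - 2 - int m)) * gn (GK i)) F c
    = (\<Sum>m\<le>M. \<Sum>a\<in>R. cC powi (s + int m) * (qF powi (-2)) ^ m * (yv (int i) a powi (p - int m) * wt (int i) a c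
          * (zcoeff (th (int k) (mv c a)) (z - s - int m) * (Kf (int i) (mv c a) * F (mv c a))))
        - cC powi (s + int m + 1) * (qF * ((qF powi (-2)) ^ m * (yv (int i) a powi (p - int m) * wt (int i) a c
          * (zcoeff (th (int k) (mv c a)) (z - s - 2 - int m) * (Kf (int i) (mv c a) * F (mv c a)))))))"
    using c by (simp add: Ev_simps Bop_def sum_distrib_left sum_subtractf mult.assoc)
  also have "\<dots> = (\<Sum>m\<le>M. \<Sum>a\<in>R. yv (int i) a powi p * wt (int i) a c * (cC powi s * Kf (int i) (mv c a)
      * ((inverse qF ^ 2 * (cC / yv (int i) a)) ^ m * (zcoeff (th (int k) (mv c a)) (z - s - int m)
          - qF * cC * zcoeff (th (int k) (mv c a)) (z - s - 2 - int m)))) * F (mv c a))"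
  proof (intro sum.cong refl)
    fix m a assume a: "a \<in> R"
    have e: "(inverse qF ^ 2 * (cC / yv (int i) a)) ^ m = (qF powi (-2)) ^ m * cC ^ m * (1 / yv (int i) a) ^ m"
      unfolding v by (simp add: power_mult_distrib[symmetric])
    show "cC powi (s + int m) * (qF powi (-2)) ^ m * (yv (int i) a powi (p - int m) * wt (int i) a c
          * (zcoeff (th (int k) (mv c a)) (z - s - int m) * (Kf (int i) (mv c a) * F (mv c a))))
        - cC powi (s + int m + 1) * (qF * ((qF powi (-2)) ^ m * (yv (int i) a powi (p - int m) * wt (int i) a c
          * (zcoeff (th (int k) (mv c a)) (z - s - 2 - int m) * (Kf (int i) (mv c a) * F (mv c a))))))
      = yv (int i) a powi p * wt (int i) a c * (cC powi s * Kf (int i) (mv c a)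
      * ((inverse qF ^ 2 * (cC / yv (int i) a)) ^ m * (zcoeff (th (int k) (mv c a)) (z - s - int m)
          - qF * cC * zcoeff (th (int k) (mv c a)) (z - s - 2 - int m)))) * F (mv c a)"
      unfolding path_powers(1)[OF a] path_powers(3,4)[OF a] e by (rule alg)
  qed
  also have "\<dots> = (\<Sum>a\<in>R. yv (int i) a powi p * wt (int i) a c * (cC powi s * Kf (int i) (mv c a)
         * zcoeff (sq (inverse qF ^ 2 * (cC / yv (int i) a)) (th (int k) (mv c a))) (z - s)) * F (mv c a))"
    unfolding zcoeff_sq[OF M] by (subst sum.swap) (simp only: sum_distrib_left sum_distrib_right)
  finally show ?thesis .
qed

lemma path_term2:
  assumes c: "c \<in> Col" and M: "nat (z - s) \<le> M"
  shows "Ev (\<Sum>m\<le>M. (Cpow (s + int m) * vp 2 ^ m * Theta_coeff k (z - s - int m)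
        - Cpow (s + int m + 1) * vp 1 * vp 2 ^ m * Theta_coeff k (z - s - 2 - int m)) * gn (GK i) * gn (GB i (p - int m))) F c
    = (\<Sum>a\<in>R. yv (int i) a powi p * wt (int i) a c * (cC powi s * Kf (int i) c
         * zcoeff (sq (qF ^ 2 * (cC / yv (int i) a)) (th (int k) c)) (z - s)) * F (mv c a))"
proof -
  have v: "qF powi 2 = qF ^ 2" by simp
  have alg: "C * Cm * g * (t1 * (K * (yp * ym * w * f))) - C * Cm * C1 * (q1 * (g * (t2 * (K * (yp * ym * w * f)))))
    = yp * w * (C * K * (g * Cm * ym * (t1 - q1 * C1 * t2))) * f" for C Cm C1 g yp ym w t1 t2 K f q1 :: rfun
    by (simp add: algebra_simps)
  have "Ev (\<Sum>m\<le>M. (Cpow (s + int m) * vp 2 ^ m * Theta_coeff k (z - s - int m)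
        - Cpow (s + int m + 1) * vp 1 * vp 2 ^ m * Theta_coeff k (z - s - 2 - int m)) * gn (GK i) * gn (GB i (p - int m))) F c
    = (\<Sum>m\<le>M. \<Sum>a\<in>R. cC powi (s + int m) * (qF powi 2) ^ m * (zcoeff (th (int k) c) (z - s - int m)
          * (Kf (int i) c * (yv (int i) a powi (p - int m) * wt (int i) a c * F (mv c a))))
        - cC powi (s + int m + 1) * (qF * ((qF powi 2) ^ m * (zcoeff (th (int k) c) (z - s - 2 - int m)
          * (Kf (int i) c * (yv (int i) a powi (p - int m) * wt (int i) a c * F (mv c a)))))))"
    using c by (simp add: Ev_simps Bop_def sum_distrib_left sum_subtractf mult.assoc)
  also have "\<dots> = (\<Sum>m\<le>M. \<Sum>a\<in>R. yv (int i) a powi p * wt (int i) a c * (cC powi s * Kf (int i) c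
      * ((qF ^ 2 * (cC / yv (int i) a)) ^ m * (zcoeff (th (int k) c) (z - s - int m)
          - qF * cC * zcoeff (th (int k) c) (z - s - 2 - int m)))) * F (mv c a))"
  proof (intro sum.cong refl)
    fix m a assume a: "a \<in> R"
    have e: "(qF ^ 2 * (cC / yv (int i) a)) ^ m = (qF powi 2) ^ m * cC ^ m * (1 / yv (int i) a) ^ m"
      unfolding v by (simp add: power_mult_distrib[symmetric])
    show "cC powi (s + int m) * (qF powi 2) ^ m * (zcoeff (th (int k) c) (z - s - int m)
          * (Kf (int i) c * (yv (int i) a powi (p - int m) * wt (int i) a c * F (mv c a))))
        - cC powi (s + int m + 1) * (qF * ((qF powi 2) ^ m * (zcoeff (th (int k) c) (z - s - 2 - int m)
          * (Kf (int i) c * (yv (int i) a powi (p - int m) * wt (int i) a c * F (mv c a))))))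
      = yv (int i) a powi p * wt (int i) a c * (cC powi s * Kf (int i) c
      * ((qF ^ 2 * (cC / yv (int i) a)) ^ m * (zcoeff (th (int k) c) (z - s - int m)
          - qF * cC * zcoeff (th (int k) c) (z - s - 2 - int m)))) * F (mv c a)"
      unfolding path_powers(1)[OF a] path_powers(3,4)[OF a] e by (rule alg)
  qed
  also have "\<dots> = (\<Sum>a\<in>R. yv (int i) a powi p * wt (int i) a c * (cC powi s * Kf (int i) c
         * zcoeff (sq (qF ^ 2 * (cC / yv (int i) a)) (th (int k) c)) (z - s)) * F (mv c a))"
    unfolding zcoeff_sq[OF M] by (subst sum.swap) (simp only: sum_distrib_left sum_distrib_right)
  finally show ?thesis .
qed

lemma path_term3:
  assumes c: "c \<in> Col" and M: "nat (s - z + 1) \<le> M"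
  shows "Ev ((\<Sum>m\<le>M. Cpow (z - 1) * 1 * vp 2 ^ m * gn (GB i (p + 1 + int m)) * Theta_coeff i (s - z + 1 - int m)
        - Cpow z * vp 1 * vp 2 ^ m * gn (GB i (p + 1 + int m)) * Theta_coeff i (s - z - 1 - int m)) * gn (GK k)) F c
    = (\<Sum>a\<in>R. yv (int i) a powi (p + 1) * wt (int i) a c * (cC powi (z - 1) * Kf (int k) (mv c a)
         * zcoeff (sq (qF ^ 2 * yv (int i) a) (th (int i) (mv c a))) (s - z + 1)) * F (mv c a))"
proof -
  have v: "qF powi 2 = qF ^ 2" by simp
  have sz: "s - z + 1 - 2 = s - z - 1" by simp
  have alg: "C * (g * (yp * ym * w * (t1 * (K * f)))) - C * C1 * (q1 * (g * (yp * ym * w * (t2 * (K * f)))))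
    = yp * w * (C * K * (g * ym * (t1 - q1 * C1 * t2))) * f" for C C1 g yp ym w t1 t2 K f q1 :: rfun
    by (simp add: algebra_simps)
  have "Ev ((\<Sum>m\<le>M. Cpow (z - 1) * 1 * vp 2 ^ m * gn (GB i (p + 1 + int m)) * Theta_coeff i (s - z + 1 - int m)
        - Cpow z * vp 1 * vp 2 ^ m * gn (GB i (p + 1 + int m)) * Theta_coeff i (s - z - 1 - int m)) * gn (GK k)) F c
    = (\<Sum>m\<le>M. \<Sum>a\<in>R. cC powi (z - 1) * ((qF powi 2) ^ m * (yv (int i) a powi (p + 1 + int m) * wt (int i) a c
          * (zcoeff (th (int i) (mv c a)) (s - z + 1 - int m) * (Kf (int k) (mv c a) * F (mv c a)))))
        - cC powi z * (qF * ((qF powi 2) ^ m * (yv (int i) a powi (p + 1 + int m) * wt (int i) a c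
          * (zcoeff (th (int i) (mv c a)) (s - z - 1 - int m) * (Kf (int k) (mv c a) * F (mv c a)))))))"
    using c by (simp add: Ev_simps Bop_def sum_distrib_left sum_subtractf mult.assoc)
  also have "\<dots> = (\<Sum>m\<le>M. \<Sum>a\<in>R. yv (int i) a powi (p + 1) * wt (int i) a c * (cC powi (z - 1) * Kf (int k) (mv c a)
      * ((qF ^ 2 * yv (int i) a) ^ m * (zcoeff (th (int i) (mv c a)) (s - z + 1 - int m)
          - qF * cC * zcoeff (th (int i) (mv c a)) (s - z - 1 - int m)))) * F (mv c a))"
  proof (intro sum.cong refl)
    fix m a assume a: "a \<in> R"
    have e: "(qF ^ 2 * yv (int i) a) ^ m = (qF powi 2) ^ m * yv (int i) a ^ m"
      unfolding v by (simp add: power_mult_distrib[symmetric])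
    show "cC powi (z - 1) * ((qF powi 2) ^ m * (yv (int i) a powi (p + 1 + int m) * wt (int i) a c
          * (zcoeff (th (int i) (mv c a)) (s - z + 1 - int m) * (Kf (int k) (mv c a) * F (mv c a)))))
        - cC powi z * (qF * ((qF powi 2) ^ m * (yv (int i) a powi (p + 1 + int m) * wt (int i) a c
          * (zcoeff (th (int i) (mv c a)) (s - z - 1 - int m) * (Kf (int k) (mv c a) * F (mv c a))))))
      = yv (int i) a powi (p + 1) * wt (int i) a c * (cC powi (z - 1) * Kf (int k) (mv c a)
      * ((qF ^ 2 * yv (int i) a) ^ m * (zcoeff (th (int i) (mv c a)) (s - z + 1 - int m)
          - qF * cC * zcoeff (th (int i) (mv c a)) (s - z - 1 - int m)))) * F (mv c a)"
      unfolding path_powers(2)[OF a] path_powers(5)[OF a, of z] e by (rule alg)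
  qed
  also have "\<dots> = (\<Sum>a\<in>R. yv (int i) a powi (p + 1) * wt (int i) a c * (cC powi (z - 1) * Kf (int k) (mv c a)
         * zcoeff (sq (qF ^ 2 * yv (int i) a) (th (int i) (mv c a))) (s - z + 1)) * F (mv c a))"
    unfolding zcoeff_sq[OF M] sz by (subst sum.swap) (simp only: sum_distrib_left sum_distrib_right)
  finally show ?thesis .
qed

lemma path_term4:
  assumes c: "c \<in> Col" and M: "nat (s - z + 1) \<le> M"
  shows "Ev (\<Sum>m\<le>M. (Cpow z * vp 1 * vp (-2) ^ m * Theta_coeff i (s - z - 1 - int m)
        - Cpow (z - 1) * 1 * vp (-2) ^ m * Theta_coeff i (s - z + 1 - int m)) * gn (GK k) * gn (GB i (p + 1 + int m))) F c
    = - (\<Sum>a\<in>R. yv (int i) a powi (p + 1) * wt (int i) a c * (cC powi (z - 1) * Kf (int k) c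
         * zcoeff (sq (inverse qF ^ 2 * yv (int i) a) (th (int i) c)) (s - z + 1)) * F (mv c a))"
proof -
  have v: "qF powi (-2) = inverse qF ^ 2" by (simp add: power_int_minus power_inverse)
  have sz: "s - z + 1 - 2 = s - z - 1" by simp
  have alg: "C * C1 * (q1 * (g * (t2 * (K * (yp * ym * w * f))))) - C * (g * (t1 * (K * (yp * ym * w * f))))
    = - (yp * w * (C * K * (g * ym * (t1 - q1 * C1 * t2))) * f)" for C C1 g yp ym w t1 t2 K f q1 :: rfun
    by (simp add: algebra_simps)
  have "Ev (\<Sum>m\<le>M. (Cpow z * vp 1 * vp (-2) ^ m * Theta_coeff i (s - z - 1 - int m)
        - Cpow (z - 1) * 1 * vp (-2) ^ m * Theta_coeff i (s - z + 1 - int m)) * gn (GK k) * gn (GB i (p + 1 + int m))) F c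
    = (\<Sum>m\<le>M. \<Sum>a\<in>R. cC powi z * (qF * ((qF powi (-2)) ^ m * (zcoeff (th (int i) c) (s - z - 1 - int m)
          * (Kf (int k) c * (yv (int i) a powi (p + 1 + int m) * wt (int i) a c * F (mv c a))))))
        - cC powi (z - 1) * ((qF powi (-2)) ^ m * (zcoeff (th (int i) c) (s - z + 1 - int m)
          * (Kf (int k) c * (yv (int i) a powi (p + 1 + int m) * wt (int i) a c * F (mv c a))))))"
    using c by (simp add: Ev_simps Bop_def sum_distrib_left sum_subtractf mult.assoc)
  also have "\<dots> = (\<Sum>m\<le>M. \<Sum>a\<in>R. - (yv (int i) a powi (p + 1) * wt (int i) a c * (cC powi (z - 1) * Kf (int k) c
      * ((inverse qF ^ 2 * yv (int i) a) ^ m * (zcoeff (th (int i) c) (s - z + 1 - int m)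
          - qF * cC * zcoeff (th (int i) c) (s - z - 1 - int m)))) * F (mv c a)))"
  proof (intro sum.cong refl)
    fix m a assume a: "a \<in> R"
    have e: "(inverse qF ^ 2 * yv (int i) a) ^ m = (qF powi (-2)) ^ m * yv (int i) a ^ m"
      unfolding v by (simp add: power_mult_distrib[symmetric])
    show "cC powi z * (qF * ((qF powi (-2)) ^ m * (zcoeff (th (int i) c) (s - z - 1 - int m)
          * (Kf (int k) c * (yv (int i) a powi (p + 1 + int m) * wt (int i) a c * F (mv c a))))))
        - cC powi (z - 1) * ((qF powi (-2)) ^ m * (zcoeff (th (int i) c) (s - z + 1 - int m)
          * (Kf (int k) c * (yv (int i) a powi (p + 1 + int m) * wt (int i) a c * F (mv c a)))))
      = - (yv (int i) a powi (p + 1) * wt (int i) a c * (cC powi (z - 1) * Kf (int k) c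
      * ((inverse qF ^ 2 * yv (int i) a) ^ m * (zcoeff (th (int i) c) (s - z + 1 - int m)
          - qF * cC * zcoeff (th (int i) c) (s - z - 1 - int m)))) * F (mv c a))"
      unfolding path_powers(2)[OF a] path_powers(5)[OF a, of z] e by (rule alg)
  qed
  also have "\<dots> = - (\<Sum>a\<in>R. yv (int i) a powi (p + 1) * wt (int i) a c * (cC powi (z - 1) * Kf (int k) c
         * zcoeff (sq (inverse qF ^ 2 * yv (int i) a) (th (int i) c)) (s - z + 1)) * F (mv c a))"
    unfolding zcoeff_sq[OF M] sz by (subst sum.swap) (simp only: sum_distrib_left sum_distrib_right sum_negf)
  finally show ?thesis .
qed

lemma rho_zero:
  assumes "symc c" "adj i k" "a \<in> R" "b \<in> R" "c a \<noteq> i"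
  shows "rho i k a b c = 0"
proof -
  have wt: "wt i a c = 0" using assms(5) by (simp add: wt_def)
  consider "b = a" | "b = br a" "b \<noteq> a" | "b \<noteq> a" "b \<noteq> br a" by blast
  then show ?thesis
  proof cases
    case 2
    then show ?thesis using S6_diag_value assms wt by (simp add: rho_def)
  next
    case 3
    then show ?thesis using S6_mirror_value[OF assms(1-4) 3] wt by (simp add: rho_def)
  qed (simp add: rho_def wt3_def wt2_def wt)
qed

text \<open>For a of colour i the inner sum is given by \<open>serre_middle_step\<close>, whose
  factor y raises the exponent of \<open>yv\<close> in the last two terms to p + 1. For other a both
  sides are 0.\<close>

lemma serre_middle_coeff:
  assumes c: "c \<in> Col" and A: "adj i k"
  shows "(qF - inverse qF) * (\<Sum>a\<in>R. yv i a powi p * cC powi z * (\<Sum>b\<in>R. yv i b powi (s - z) * rho i k a b c) * F (mv c a))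
    = - inverse qF * two * (\<Sum>a\<in>R. yv i a powi p * wt i a c * (cC powi s * Kf i (mv c a)
         * zcoeff (sq (inverse qF ^ 2 * (cC / yv i a)) (th k (mv c a))) (z - s)) * F (mv c a))
    + two * (\<Sum>a\<in>R. yv i a powi p * wt i a c * (cC powi s * Kf i c
         * zcoeff (sq (qF ^ 2 * (cC / yv i a)) (th k c)) (z - s)) * F (mv c a))
    + qF * two * (\<Sum>a\<in>R. yv i a powi (p + 1) * wt i a c * (cC powi (z - 1) * Kf k (mv c a)
         * zcoeff (sq (qF ^ 2 * yv i a) (th i (mv c a))) (s - z + 1)) * F (mv c a))
    + inverse qF ^ 2 * two * - (\<Sum>a\<in>R. yv i a powi (p + 1) * wt i a c * (cC powi (z - 1) * Kf k c
         * zcoeff (sq (inverse qF ^ 2 * yv i a) (th i c)) (s - z + 1)) * F (mv c a))"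
proof -
  have sc: "symc c" using c symc_Col by blast
  have alg: "u * (yp * (Cz * S) * f) = yp * w2 * w * (Cs * (A2 - A1) + y * C1 * (A3 - A4)) * f"
    if "u * (Cz * S) = w2 * w * (Cs * (A2 - A1) + y * C1 * (A3 - A4))" for u yp Cz S f w2 w Cs A2 A1 y C1 A3 A4 :: rfun
  proof -
    have "u * (yp * (Cz * S) * f) = yp * (u * (Cz * S)) * f" by (simp add: mult_ac)
    then show ?thesis unfolding that by (simp add: mult_ac)
  qed
  have alg2: "yp * w2 * w * (Cs * (K * Z2 - iq * K' * Z1) + y * C1 * (q * K3 * Z3 - iq ^ 2 * K4 * Z4)) * f
    = - iq * w2 * (yp * w * (Cs * K' * Z1) * f) + w2 * (yp * w * (Cs * K * Z2) * f)
      + q * w2 * (yp * y * w * (C1 * K3 * Z3) * f) + iq ^ 2 * w2 * - (yp * y * w * (C1 * K4 * Z4) * f)"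
    for yp w2 w Cs K Z2 iq K' Z1 y C1 q K3 Z3 K4 Z4 f :: rfun
    by (simp add: algebra_simps)
  have step: "(qF - inverse qF) * (yv i a powi p * cC powi z * (\<Sum>b\<in>R. yv i b powi (s - z) * rho i k a b c) * F (mv c a))
    = - inverse qF * two * (yv i a powi p * wt i a c * (cC powi s * Kf i (mv c a)
         * zcoeff (sq (inverse qF ^ 2 * (cC / yv i a)) (th k (mv c a))) (z - s)) * F (mv c a))
    + two * (yv i a powi p * wt i a c * (cC powi s * Kf i c
         * zcoeff (sq (qF ^ 2 * (cC / yv i a)) (th k c)) (z - s)) * F (mv c a))
    + qF * two * (yv i a powi (p + 1) * wt i a c * (cC powi (z - 1) * Kf k (mv c a)
         * zcoeff (sq (qF ^ 2 * yv i a) (th i (mv c a))) (s - z + 1)) * F (mv c a))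
    + inverse qF ^ 2 * two * - (yv i a powi (p + 1) * wt i a c * (cC powi (z - 1) * Kf k c
         * zcoeff (sq (inverse qF ^ 2 * yv i a) (th i c)) (s - z + 1)) * F (mv c a))" if a: "a \<in> R" for a
  proof (cases "c a = i")
    case True
    have y: "yv i a powi (p + 1) = yv i a powi p * yv i a" using yv_nz[OF a] by (simp add: power_int_add)
    note st = serre_middle_step[OF sc A a True, of z s]
    show ?thesis unfolding y alg2[symmetric] mult.assoc[of "yv i a powi p" "cC powi z"]
      by (rule alg) (rule st)
  next
    case False
    have wt0: "wt i a c = 0" using False by (simp add: wt_def)
    have "rho i k a b c = 0" if "b \<in> R" for b
      using rho_zero[OF sc A a that False] .
    then show ?thesis by (simp add: wt0)
  qed
  show ?thesis
    using sum.cong[OF refl[of R] step] by (simp only: sum_distrib_left[symmetric] sum_negf sum.distrib)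
qed

lemma relator_Serre_tau:
  assumes i: "i \<in> idx n" "cartan i (tau n i) = -1" and c: "c \<in> Col"
  shows "Ev ((cst (sc (qv - inverse qv)) \<star> Serre i (tau n i)
     - (cst (sc (- inverse qv * qtwo)) \<star> Sym (\<lambda>a b. Deltas (b + zz)
          \<star> (cst 1 - mon (vp 1) (zz - b)) \<star> geom (vp (-2)) (a - b)
          \<star> Bs i a \<star> Ths (tau n i) zz \<star> Ks i)
        + cst (sc qtwo) \<star> Sym (\<lambda>a b. Deltas (b + zz)
          \<star> (cst 1 - mon (vp 1) (zz - b)) \<star> geom (vp 2) (a - b)
          \<star> Ths (tau n i) zz \<star> Ks i \<star> Bs i a)
        + cst (sc (qv * qtwo)) \<star> Sym (\<lambda>a b. Deltas (b + zz)
          \<star> (mon 1 (zz - a) - mon (vp 1) (b - a)) \<star> geom (vp 2) (b - a)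
          \<star> Bs i a \<star> Ths i b \<star> Ks (tau n i))
        + cst (sc (qv powi (-2) * qtwo)) \<star> Sym (\<lambda>a b. Deltas (b + zz)
          \<star> (mon (vp 1) (b - a) - mon 1 (zz - a)) \<star> geom (vp (-2)) (b - a)
          \<star> Ths i b \<star> Ks (tau n i) \<star> Bs i a))) e) F c = 0"
    (is "Ev ((_ - (_ \<star> Sym ?g1 + _ \<star> Sym ?g2 + _ \<star> Sym ?g3 + _ \<star> Sym ?g4)) e) F c = 0")
proof -
  obtain z p s where e: "e = (z, p, s)" by (cases e)
  define k where "k = tau n i"
  have "cmat (int i) (N - int i) = -1" using i by (simp add: cartan_cmat int_tau)
  then have A: "adj (int i) (int k)"
    using i(2) int_tau[OF i(1)] unfolding cmat_def adj_def k_def by (smt (verit))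
  \<comment> \<open>\<open>T j p s\<close> is the value of the correction term with number j + 1
    when \<open>w1\<close> has exponent p and \<open>w2\<close> has exponent s; the exponent z is
    fixed.\<close>
  define T where "T j p s = (if j = (0 :: nat) then (\<Sum>a\<in>R. yv (int i) a powi p * wt (int i) a c * (cC powi s * Kf (int i) (mv c a)
         * zcoeff (sq (inverse qF ^ 2 * (cC / yv (int i) a)) (th (int k) (mv c a))) (z - s)) * F (mv c a))
    else if j = 1 then (\<Sum>a\<in>R. yv (int i) a powi p * wt (int i) a c * (cC powi s * Kf (int i) c
         * zcoeff (sq (qF ^ 2 * (cC / yv (int i) a)) (th (int k) c)) (z - s)) * F (mv c a))
    else if j = 2 then (\<Sum>a\<in>R. yv (int i) a powi (p + 1) * wt (int i) a c * (cC powi (z - 1) * Kf (int k) (mv c a)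
         * zcoeff (sq (qF ^ 2 * yv (int i) a) (th (int i) (mv c a))) (s - z + 1)) * F (mv c a))
    else - (\<Sum>a\<in>R. yv (int i) a powi (p + 1) * wt (int i) a c * (cC powi (z - 1) * Kf (int k) c
         * zcoeff (sq (inverse qF ^ 2 * yv (int i) a) (th (int i) c)) (s - z + 1)) * F (mv c a)))" for j p s
  have num: "((0 :: nat) = 0) = True" "((1 :: nat) = 0) = False" "((1 :: nat) = 1) = True" "((2 :: nat) = 0) = False" "((2 :: nat) = 1) = False"
    "((2 :: nat) = 2) = True" "((3 :: nat) = 0) = False" "((3 :: nat) = 1) = False" "((3 :: nat) = 2) = False"
    by simp_all
  have T0: "Theta_coeff j l = 0" if "l < 0" for j l using that by (rule Theta_coeff_neg)
  have t1: "Ev (?g1 w1 w2 (z, p, s)) F c = T 0 p s" for p s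
    unfolding Bs_def Ths_def Deltas_def k_def[symmetric]
    by (subst serre_term1[where M="nat (z - s)"]) (simp_all only: T0 order_refl path_term1[OF c order_refl] T_def num if_True if_False)
  have t2: "Ev (?g2 w1 w2 (z, p, s)) F c = T 1 p s" for p s
    unfolding Bs_def Ths_def Deltas_def k_def[symmetric]
    by (subst serre_term2[where M="nat (z - s)"]) (simp_all only: T0 order_refl path_term2[OF c order_refl] T_def num if_True if_False)
  have t3: "Ev (?g3 w1 w2 (z, p, s)) F c = T 2 p s" for p s
    unfolding Bs_def Ths_def Deltas_def k_def[symmetric]
    by (subst serre_term3[where M="nat (s - z + 1)"]) (simp_all only: T0 order_refl path_term3[OF c order_refl] T_def num if_True if_False)
  have t4: "Ev (?g4 w1 w2 (z, p, s)) F c = T 3 p s" for p s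
    unfolding Bs_def Ths_def Deltas_def k_def[symmetric]
    by (subst serre_term4[where M="nat (s - z + 1)"]) (simp_all only: T0 order_refl path_term4[OF c order_refl] T_def num if_True if_False)
  have sw: "?g1 w2 w1 = fswap (?g1 w1 w2)" "?g2 w2 w1 = fswap (?g2 w1 w2)" "?g3 w2 w1 = fswap (?g3 w1 w2)" "?g4 w2 w1 = fswap (?g4 w1 w2)"
    by (simp_all only: Bs_def Ths_def Deltas_def geom_def fswap_inward)
  have S: "Ev (Sym ?g1 (z, p, s)) F c = T 0 p s + T 0 s p" "Ev (Sym ?g2 (z, p, s)) F c = T 1 p s + T 1 s p"
    "Ev (Sym ?g3 (z, p, s)) F c = T 2 p s + T 2 s p" "Ev (Sym ?g4 (z, p, s)) F c = T 3 p s + T 3 s p"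
    unfolding Sym_coeff[of ?g1, OF sw(1)] Sym_coeff[of ?g2, OF sw(2)] Sym_coeff[of ?g3, OF sw(3)] Sym_coeff[of ?g4, OF sw(4)]
    by (simp_all only: Ev_add t1 t2 t3 t4)
  have half: "(qF - inverse qF) * (\<Sum>a\<in>R. yv (int i) a powi p * cC powi z * (\<Sum>b\<in>R. yv (int i) b powi (s - z) * rho (int i) (int k) a b c) * F (mv c a))
    = - inverse qF * two * T 0 p s + two * T 1 p s + qF * two * T 2 p s + inverse qF ^ 2 * two * T 3 p s" for p s
    unfolding T_def num if_True if_False by (rule serre_middle_coeff[OF c A])
  have cf: "coeffF (- inverse qv * qtwo) = - inverse qF * two" "coeffF (qv * qtwo) = qF * two"
    "coeffF (qv powi (-2) * qtwo) = inverse qF ^ 2 * two"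
    by (simp_all add: qtwo_def coeffF_simps coeffF_inverse power_int_minus power2_eq_square)
  have lin: "Ev ((cst (sc u0) \<star> X0 - (cst (sc u1) \<star> X1 + cst (sc u2) \<star> X2 + cst (sc u3) \<star> X3 + cst (sc u4) \<star> X4)) (z, p, s)) F c
    = coeffF u0 * Ev (X0 (z, p, s)) F c - (coeffF u1 * Ev (X1 (z, p, s)) F c + coeffF u2 * Ev (X2 (z, p, s)) F c
        + coeffF u3 * Ev (X3 (z, p, s)) F c + coeffF u4 * Ev (X4 (z, p, s)) F c)" for u0 u1 u2 u3 u4 X0 X1 X2 X3 X4
    by (simp add: Ev_simps mon_mult)
  have alg: "a1 * (u + u') + a2 * (v + v') + a3 * (w + w') + a4 * (y + y')
     = (a1 * u + a2 * v + a3 * w + a4 * y) + (a1 * u' + a2 * v' + a3 * w' + a4 * y')" for a1 a2 a3 a4 u v w y u' v' w' y' :: rfun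
    by (simp add: algebra_simps)
  show ?thesis unfolding e lin S Ev_Serre unfolding k_def[symmetric] serre_middle_sum[OF c A] coeffF_quotients cf alg half[symmetric]
    by (simp only: distrib_left[of "qF - inverse qF"] diff_self)
qed

text \<open>Every generator preserves vanishing outside \<open>Col\<close>. This settles the
  colourings on which the relations are not examined.\<close>

lemma Ev_off_Col:
  assumes F: "\<And>c. c \<notin> Col \<Longrightarrow> F c = 0" and c: "c \<notin> Col"
  shows "Ev f F c = 0"
proof -
  have "wact w F c = 0" for w
  proof -
    have "\<forall>c. c \<notin> Col \<longrightarrow> foldr cop l F c = 0" for l
    proof (induction l)
      case (Cons h l)
      then show ?case by (cases h) (simp_all add: cop_def Bop_def)
    qed (use F in simp)
    then show ?thesis using c by (simp add: wact_def)
  qed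
  then show ?thesis by (simp add: Ev_def)
qed

lemma relator_zero:
  assumes "r \<in> relators n" and c: "c \<in> Col"
  shows "Ev r F c = 0"
  using assms(1)
proof cases
  case (C_central g)
  then show ?thesis by (cases g) (simp_all add: Ev_simps Ev_gn cop_def Bop_mult)
next
  case (K_Theta i j e)
  then show ?thesis using relator_K_Theta by blast
next
  case (K_B i j e)
  then show ?thesis using relator_K_B c by blast
next
  case (Theta_Theta i j e)
  then show ?thesis using relator_Theta_Theta by blast
next
  case (B_Theta i j e)
  then show ?thesis using relator_B_Theta c by (cases e) blast
next
  case (B_B_tau0 i e)
  then show ?thesis using relator_B_B_tau0 c by blast
next
  case (B_B i j e)
  then show ?thesis using relator_B_B c by blast
next
  case (B_B_tau1 i e)
  then show ?thesis using relator_B_B_tau1 c by blast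
next
  case (B_B_comm i j e)
  then show ?thesis using relator_B_B_comm c by blast
next
  case (Serre_ordinary i j e)
  then show ?thesis using relator_Serre c by blast
next
  case (Serre_tau i e)
  then show ?thesis unfolding Serre_tau(1) by (intro relator_Serre_tau c)
qed (simp_all add: Ev_simps Kf_nz q0 mult_ac)

end

section \<open>Substitutions in Laurent polynomials\<close>

abbreviation lsingle :: "(nat \<Rightarrow>\<^sub>0 int) \<Rightarrow> Cq \<Rightarrow> laurent" where
  "lsingle \<equiv> Poly_Mapping.single"

text \<open>A substitution by monomials with scalar coefficients. Signed permutations of the
  variables, the identification of two variables, and the evaluation of a variable at 1 or -1 all
  have this form.\<close>

definition subst :: "((nat \<Rightarrow>\<^sub>0 int) \<Rightarrow> (nat \<Rightarrow>\<^sub>0 int)) \<Rightarrow> ((nat \<Rightarrow>\<^sub>0 int) \<Rightarrow> Cq) \<Rightarrow> laurent \<Rightarrow> laurent" where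
  "subst \<phi> \<chi> f = (\<Sum>e \<in> Poly_Mapping.keys f. lsingle (\<phi> e) (\<chi> e * Poly_Mapping.lookup f e))"

lemma poly_mapping_expand: "f = (\<Sum>e \<in> Poly_Mapping.keys f. Poly_Mapping.single e (Poly_Mapping.lookup f e))"
  by (rule poly_mapping_eqI) (simp add: lookup_sum lookup_single when_def sum.delta in_keys_iff)

lemma subst_superset:
  "finite A \<Longrightarrow> Poly_Mapping.keys f \<subseteq> A \<Longrightarrow> subst \<phi> \<chi> f = (\<Sum>e\<in>A. lsingle (\<phi> e) (\<chi> e * Poly_Mapping.lookup f e))"
  unfolding subst_def by (rule sum.mono_neutral_left) (auto simp: in_keys_iff)

lemma subst_add: "subst \<phi> \<chi> (f + g) = subst \<phi> \<chi> f + subst \<phi> \<chi> g"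
proof -
  let ?A = "Poly_Mapping.keys f \<union> Poly_Mapping.keys g"
  have "subst \<phi> \<chi> h = (\<Sum>e\<in>?A. lsingle (\<phi> e) (\<chi> e * Poly_Mapping.lookup h e))" if "Poly_Mapping.keys h \<subseteq> ?A" for h
    by (rule subst_superset) (use that in auto)
  then show ?thesis using Poly_Mapping.keys_add[of f g]
    by (simp add: lookup_add distrib_left single_add sum.distrib)
qed

lemma subst_single [simp]: "subst \<phi> \<chi> (lsingle e c) = lsingle (\<phi> e) (\<chi> e * c)"
  by (cases "c = 0") (simp_all add: subst_def)

lemma subst_zero [simp]: "subst \<phi> \<chi> 0 = 0"
  by (simp add: subst_def)

lemma subst_uminus: "subst \<phi> \<chi> (- f) = - subst \<phi> \<chi> f"
  by (metis add_cancel_right_left add_eq_0_iff subst_add subst_zero)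

lemma subst_diff: "subst \<phi> \<chi> (f - g) = subst \<phi> \<chi> f - subst \<phi> \<chi> g"
  using subst_add[of \<phi> \<chi> f "- g"] by (simp add: subst_uminus)

lemma subst_sum: "subst \<phi> \<chi> (sum f A) = (\<Sum>a\<in>A. subst \<phi> \<chi> (f a))"
  by (induction A rule: infinite_finite_induct) (simp_all add: subst_add)

lemma subst_subst: "subst \<phi> \<chi> (subst \<psi> \<xi> f) = subst (\<lambda>e. \<phi> (\<psi> e)) (\<lambda>e. \<chi> (\<psi> e) * \<xi> e) f"
  unfolding subst_def[of \<psi>] by (simp only: subst_sum subst_single) (simp add: subst_def mult.assoc)

lemma subst_id: "(\<And>e. \<phi> e = e) \<Longrightarrow> (\<And>e. \<chi> e = 1) \<Longrightarrow> subst \<phi> \<chi> f = f"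
  by (simp add: subst_def flip: poly_mapping_expand)

locale lhom =
  fixes \<phi> :: "(nat \<Rightarrow>\<^sub>0 int) \<Rightarrow> (nat \<Rightarrow>\<^sub>0 int)" and \<chi> :: "(nat \<Rightarrow>\<^sub>0 int) \<Rightarrow> Cq"
  assumes exp_add: "\<phi> (e + e') = \<phi> e + \<phi> e'" and char_add: "\<chi> (e + e') = \<chi> e * \<chi> e'" and char_zero: "\<chi> 0 = 1"
begin

abbreviation h :: "laurent \<Rightarrow> laurent" where "h \<equiv> subst \<phi> \<chi>"

lemma exp_zero: "\<phi> 0 = 0"
  using exp_add[of 0 0] by simp

lemma h_single_mult: "h (lsingle e c * g) = h (lsingle e c) * h g"
proof -
  have "lsingle e c * g = (\<Sum>e'\<in>Poly_Mapping.keys g. lsingle (e + e') (c * Poly_Mapping.lookup g e'))"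
    by (subst (1) poly_mapping_expand[of g]) (simp add: sum_distrib_left mult_single)
  then show ?thesis
    by (simp add: subst_sum exp_add char_add) (simp add: subst_def sum_distrib_left mult_single mult_ac)
qed

lemma h_mult: "h (f * g) = h f * h g"
proof -
  have "f * g = (\<Sum>e\<in>Poly_Mapping.keys f. lsingle e (Poly_Mapping.lookup f e) * g)"
    by (subst (1) poly_mapping_expand[of f]) (simp add: sum_distrib_right)
  then have "h (f * g) = (\<Sum>e\<in>Poly_Mapping.keys f. h (lsingle e (Poly_Mapping.lookup f e)) * h g)"
    by (simp only: subst_sum h_single_mult)
  also have "\<dots> = h f * h g" by (subst (3) subst_def) (simp add: sum_distrib_right)
  finally show ?thesis .
qed

lemma h_one: "h 1 = 1"
  using subst_single[of \<phi> \<chi> 0 1] by (simp add: exp_zero char_zero)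

lemma h_prod: "h (prod f A) = (\<Prod>a\<in>A. h (f a))"
  by (induction A rule: infinite_finite_induct) (simp_all add: h_one h_mult)

end

lemma lsingle_eq_0_iff [simp]: "lsingle e c = 0 \<longleftrightarrow> c = 0"
  by (metis lookup_single_eq lookup_zero single_zero)

lemma lsingle_diff_nz: "e \<noteq> e' \<Longrightarrow> c \<noteq> 0 \<Longrightarrow> lsingle e c - lsingle e' c' \<noteq> 0"
proof
  assume a: "e \<noteq> e'" "c \<noteq> 0" "lsingle e c - lsingle e' c' = 0"
  have "Poly_Mapping.lookup (lsingle e c - lsingle e' c') e = c" using a(1) by (simp add: lookup_minus lookup_single when_def)
  with a(2,3) show False by (metis lookup_zero)
qed

lemma two_laurent_nz: "(2 :: laurent) \<noteq> 0"
proof -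
  have "(2 :: Cq) = to_fract 2" by (metis one_add_one to_fract_1 to_fract_add)
  moreover have "to_fract (2 :: complex poly) \<noteq> 0" by simp
  ultimately have c: "(2 :: Cq) \<noteq> 0" by (simp only: not_False_eq_True)
  have "(2 :: laurent) = lsingle 0 2" by (metis one_add_one single_add single_one)
  then show ?thesis using c by (simp only: lsingle_eq_0_iff not_False_eq_True)
qed

text \<open>A substitution that alters at most the variable x_r; p is the displacement of this
  variable.\<close>

locale evaluation = lhom +
  fixes r :: nat
  assumes fixes_other: "s \<noteq> r \<Longrightarrow> \<phi> (Poly_Mapping.single s k) = Poly_Mapping.single s k"
    and char_other: "s \<noteq> r \<Longrightarrow> \<chi> (Poly_Mapping.single s k) = 1"
begin

abbreviation p :: laurent where "p \<equiv> lsingle (Poly_Mapping.single r 1) 1 - h (lsingle (Poly_Mapping.single r 1) 1)"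

lemma dvd_mult_closed: "p dvd f - h f \<Longrightarrow> p dvd g - h g \<Longrightarrow> p dvd f * g - h (f * g)"
proof -
  assume a: "p dvd f - h f" "p dvd g - h g"
  have "f * g - h (f * g) = (f - h f) * g + h f * (g - h g)" by (simp add: h_mult algebra_simps)
  then show ?thesis using a by (metis dvd_add dvd_mult dvd_mult2)
qed

lemma dvd_nat: "p dvd lsingle (Poly_Mapping.single r (int k)) 1 - h (lsingle (Poly_Mapping.single r (int k)) 1)"
proof (induction k)
  case (Suc k)
  have "lsingle (Poly_Mapping.single r (int (Suc k))) 1 = lsingle (Poly_Mapping.single r 1) 1 * lsingle (Poly_Mapping.single r (int k)) (1 :: Cq)"
    by (simp add: mult_single single_add[symmetric])
  then show ?case using dvd_mult_closed[OF dvd_refl Suc] by simp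
qed (simp add: h_one)

text \<open>Negative powers reduce to positive ones, because a - b = - a b (1/a - 1/b) for units a
  and b.\<close>

lemma dvd_int: "p dvd lsingle (Poly_Mapping.single r k) 1 - h (lsingle (Poly_Mapping.single r k) 1)"
proof (cases "0 \<le> k")
  case True
  then show ?thesis using dvd_nat[of "nat k"] by simp
next
  case False
  let ?x = "\<lambda>k. lsingle (Poly_Mapping.single r k) (1 :: Cq)"
  have u: "?x k * ?x (- k) = 1" by (simp add: mult_single single_add[symmetric])
  then have hu: "h (?x k) * h (?x (- k)) = 1" by (metis h_mult h_one)
  have "?x k - h (?x k) = - (?x k * h (?x k)) * (?x (- k) - h (?x (- k)))"
  proof -
    have "- (a * b) * (a' - b') = a - b" if "a * a' = 1" "b * b' = 1" for a b a' b' :: laurent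
    proof -
      have "- (a * b) * (a' - b') = - (b * (a * a')) + a * (b * b')" by (simp add: algebra_simps)
      then show ?thesis using that by simp
    qed
    from this[OF u hu] show ?thesis by simp
  qed
  moreover have "p dvd ?x (- k) - h (?x (- k))" using dvd_nat[of "nat (- k)"] False by simp
  ultimately show ?thesis by (metis dvd_mult)
qed

lemma dvd_monomial: "p dvd lsingle e 1 - h (lsingle e 1)"
proof -
  have "p dvd lsingle (sum (\<lambda>s. Poly_Mapping.single s (Poly_Mapping.lookup e s)) A) 1
     - h (lsingle (sum (\<lambda>s. Poly_Mapping.single s (Poly_Mapping.lookup e s)) A) 1)" for A
  proof (induction A rule: infinite_finite_induct)
    case (insert s A)
    have "p dvd lsingle (Poly_Mapping.single s (Poly_Mapping.lookup e s)) 1 - h (lsingle (Poly_Mapping.single s (Poly_Mapping.lookup e s)) 1)"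
      using dvd_int by (cases "s = r") (simp_all add: fixes_other char_other)
    from dvd_mult_closed[OF this insert.IH] show ?case using insert.hyps by (simp add: mult_single)
  qed (simp_all add: h_one)
  from this[of "Poly_Mapping.keys e"] show ?thesis
    by (simp only: poly_mapping_expand[symmetric])
qed

text \<open>The displacement f - h f is additive and obeys a twisted Leibniz rule, so divisibility
  spreads from the powers of single variables to all monomials, and among the variables only x_r is
  displaced.\<close>

lemma dvd_displacement: "p dvd f - h f"
proof -
  have "p dvd lsingle e c - h (lsingle e c)" for e c
  proof -
    have "lsingle e c - h (lsingle e c) = lsingle 0 c * (lsingle e 1 - h (lsingle e 1))"
      by (simp add: right_diff_distrib mult_single mult.commute)
    then show ?thesis using dvd_monomial by (metis dvd_mult)
  qed
  then have "p dvd (\<Sum>e\<in>Poly_Mapping.keys f. lsingle e (Poly_Mapping.lookup f e) - h (lsingle e (Poly_Mapping.lookup f e)))"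
    by (rule dvd_sum)
  then show ?thesis
    by (simp only: sum_subtractf subst_sum[symmetric] poly_mapping_expand[symmetric])
qed

text \<open>Divisibility by x_a - x_t, or by x_a - 1 and x_a + 1, is read off in this way from the
  values of a ring homomorphism.\<close>

lemma kernel: "h f = 0 \<Longrightarrow> p dvd f"
  using dvd_displacement[of f] by simp

end

lemma additive_eqI:
  fixes \<phi> \<psi> :: "(nat \<Rightarrow>\<^sub>0 int) \<Rightarrow> (nat \<Rightarrow>\<^sub>0 int)"
  assumes "\<And>e e'. \<phi> (e + e') = \<phi> e + \<phi> e'" "\<And>e e'. \<psi> (e + e') = \<psi> e + \<psi> e'"
    and s: "\<And>r k. \<phi> (Poly_Mapping.single r k) = \<psi> (Poly_Mapping.single r k)"
  shows "\<phi> e = \<psi> e"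
proof -
  have z: "\<phi> 0 = 0" "\<psi> 0 = 0" using assms(1,2)[of 0 0] by simp_all
  have "\<phi> (sum h A) = \<psi> (sum h A)" if "\<And>r. \<phi> (h r) = \<psi> (h r)" for h :: "nat \<Rightarrow> (nat \<Rightarrow>\<^sub>0 int)" and A
    by (induction A rule: infinite_finite_induct) (simp_all add: z assms(1,2) that)
  from this[of "\<lambda>r. Poly_Mapping.single r (Poly_Mapping.lookup e r)" "Poly_Mapping.keys e"] s
  show ?thesis by (simp only: poly_mapping_expand[symmetric])
qed

section \<open>Signed permutations acting on Laurent polynomials and rational functions\<close>

lemma xexp_add: "xexp d t (k + l) = xexp d t k + xexp d t l"
  by (simp add: xexp_def single_add[symmetric])

lemma xexp_bar: "t \<in> {1..2 * d} \<Longrightarrow> xexp d (bar d t) k = xexp d t (- k)"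
proof -
  assume t: "t \<in> {1..2 * d}"
  then have "bar d (bar d t) = t" "bar d t \<le> d \<longleftrightarrow> \<not> t \<le> d" by (simp_all add: bar_def) arith
  then show ?thesis by (simp add: xexp_def)
qed

lemma xexp_inj: "a \<in> {1..2 * d} \<Longrightarrow> b \<in> {1..2 * d} \<Longrightarrow> xexp d a 1 = xexp d b 1 \<Longrightarrow> a = b"
proof -
  assume a: "a \<in> {1..2 * d}" "b \<in> {1..2 * d}" "xexp d a 1 = xexp d b 1"
  have "Poly_Mapping.lookup (xexp d a 1) k = Poly_Mapping.lookup (xexp d b 1) k" for k using a(3) by simp
  from this[of "if a \<le> d then a else bar d a"] this[of "if b \<le> d then b else bar d b"] a(1,2) show ?thesis
    by (auto simp: xexp_def lookup_single when_def bar_def split: if_splits)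
qed

definition rs :: "nat \<Rightarrow> (nat \<Rightarrow>\<^sub>0 int) \<Rightarrow> (nat \<Rightarrow>\<^sub>0 int)" where
  "rs d e = (\<Sum>r = 1..d. Poly_Mapping.single r (Poly_Mapping.lookup e r))"

text \<open>The variables with index outside 1..d are kept fixed, whereas \<open>W_act\<close> drops
  them. For w in \<open>Wc d\<close> the substitution is therefore invertible on the whole ring and
  extends to its fraction field.\<close>

definition ph :: "nat \<Rightarrow> (nat \<Rightarrow> nat) \<Rightarrow> (nat \<Rightarrow>\<^sub>0 int) \<Rightarrow> (nat \<Rightarrow>\<^sub>0 int)" where
  "ph d w e = (\<Sum>r = 1..d. xexp d (w r) (Poly_Mapping.lookup e r)) + (e - rs d e)"

lemma rs_add: "rs d (e + e') = rs d e + rs d e'"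
  by (simp add: rs_def lookup_add single_add sum.distrib)

lemma ph_add: "ph d w (e + e') = ph d w e + ph d w e'"
  by (simp add: ph_def rs_add lookup_add xexp_add sum.distrib)

lemma rs_single: "rs d (Poly_Mapping.single r k) = (if r \<in> {1..d} then Poly_Mapping.single r k else 0)"
proof -
  have "rs d (Poly_Mapping.single r k) = (\<Sum>s = 1..d. if s = r then Poly_Mapping.single r k else 0)"
    unfolding rs_def by (rule sum.cong) (auto simp: lookup_single)
  then show ?thesis by simp
qed

lemma ph_single: "ph d w (Poly_Mapping.single r k) = (if r \<in> {1..d} then xexp d (w r) k else Poly_Mapping.single r k)"
proof -
  have "(\<Sum>s = 1..d. xexp d (w s) (Poly_Mapping.lookup (Poly_Mapping.single r k) s)) = (\<Sum>s = 1..d. if s = r then xexp d (w r) k else 0)"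
    by (rule sum.cong) (auto simp: lookup_single xexp_def)
  then show ?thesis by (auto simp: ph_def rs_single)
qed

definition equi :: "nat \<Rightarrow> (nat \<Rightarrow> nat) \<Rightarrow> bool" where
  "equi d w \<longleftrightarrow> (\<forall>r\<in>{1..2 * d}. w r \<in> {1..2 * d} \<and> w (bar d r) = bar d (w r))"

lemma ph_xexp: "equi d w \<Longrightarrow> t \<in> {1..2 * d} \<Longrightarrow> ph d w (xexp d t k) = xexp d (w t) k"
proof -
  assume w: "equi d w" and t: "t \<in> {1..2 * d}"
  show ?thesis
  proof (cases "t \<le> d")
    case True
    then show ?thesis using t by (simp add: xexp_def[of d t] ph_single)
  next
    case False
    then have "bar d t \<in> {1..d}" using t by (auto simp: bar_def)
    then have "ph d w (xexp d t k) = xexp d (w (bar d t)) (- k)" using False by (simp add: xexp_def[of d t] ph_single)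
    also have "\<dots> = xexp d (w t) k" using w t xexp_bar[of "w t" d "- k"] by (simp add: equi_def)
    finally show ?thesis .
  qed
qed

lemma ph_ph: "equi d w \<Longrightarrow> equi d w' \<Longrightarrow> ph d w (ph d w' e) = ph d (w \<circ> w') e"
proof (rule additive_eqI[where \<phi>="\<lambda>e. ph d w (ph d w' e)"])
  fix r k assume w: "equi d w" "equi d w'"
  have "w' r \<in> {1..2 * d}" if "r \<in> {1..d}" using w(2) that by (simp add: equi_def)
  then show "ph d w (ph d w' (Poly_Mapping.single r k)) = ph d (w \<circ> w') (Poly_Mapping.single r k)"
    using w ph_xexp by (auto simp: ph_single)
qed (simp_all add: ph_add)

lemma ph_id: "(\<And>r. r \<in> {1..d} \<Longrightarrow> w r = r) \<Longrightarrow> ph d w e = e"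
  by (rule additive_eqI) (simp_all add: ph_add ph_single xexp_def)

definition act :: "nat \<Rightarrow> (nat \<Rightarrow> nat) \<Rightarrow> laurent \<Rightarrow> laurent" where
  "act d w = subst (ph d w) (\<lambda>_. 1)"

interpretation act: lhom "ph d w" "\<lambda>_. 1" for d w
  by unfold_locales (simp_all add: ph_add)

interpretation rs: lhom "rs d" "\<lambda>_. 1" for d
  by unfold_locales (simp_all add: rs_add)

text \<open>All variables with index outside 1..d are set to 1. Being fixed by this homomorphism
  expresses that f involves only x_1, ..., x_d, in a form that passes to products and exact
  quotients.\<close>

abbreviation kill :: "nat \<Rightarrow> laurent \<Rightarrow> laurent" where
  "kill d \<equiv> subst (rs d) (\<lambda>_. 1)"

lemma kill_iff: "kill d f = f \<longleftrightarrow> (\<forall>e \<in> Poly_Mapping.keys f. Poly_Mapping.keys e \<subseteq> {1..d})"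
proof
  assume k: "kill d f = f"
  show "\<forall>e \<in> Poly_Mapping.keys f. Poly_Mapping.keys e \<subseteq> {1..d}"
  proof
    fix e assume "e \<in> Poly_Mapping.keys f"
    then have "e \<in> Poly_Mapping.keys (kill d f)" by (simp add: k)
    then obtain e' where "e \<in> Poly_Mapping.keys (lsingle (rs d e') (Poly_Mapping.lookup f e'))"
      unfolding subst_def using Poly_Mapping.keys_sum by fastforce
    then have e: "e = rs d e'" by (auto split: if_splits)
    have "s \<in> {1..d}" if s: "s \<in> Poly_Mapping.keys (rs d e')" for s
    proof -
      have "s \<in> (\<Union>r\<in>{1..d}. Poly_Mapping.keys (Poly_Mapping.single r (Poly_Mapping.lookup e' r)))"
        using s Poly_Mapping.keys_sum unfolding rs_def by fastforce
      then show ?thesis by (auto split: if_splits)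
    qed
    then show "Poly_Mapping.keys e \<subseteq> {1..d}" unfolding e by blast
  qed
next
  assume k: "\<forall>e \<in> Poly_Mapping.keys f. Poly_Mapping.keys e \<subseteq> {1..d}"
  have "rs d e = e" if "e \<in> Poly_Mapping.keys f" for e
  proof -
    have "rs d e = (\<Sum>r\<in>Poly_Mapping.keys e. Poly_Mapping.single r (Poly_Mapping.lookup e r))"
      unfolding rs_def by (rule sum.mono_neutral_right) (use k that in \<open>auto simp: in_keys_iff\<close>)
    then show ?thesis by (simp only: poly_mapping_expand[symmetric])
  qed
  then show "kill d f = f" unfolding subst_def by (simp add: poly_mapping_expand[symmetric])
qed

lemma rs_xexp: "t \<in> {1..2 * d} \<Longrightarrow> rs d (xexp d t k) = xexp d t k"
  by (auto simp: xexp_def rs_single bar_def)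

lemma kill_act: "equi d w \<Longrightarrow> kill d (act d w f) = act d w (kill d f)"
proof -
  assume w: "equi d w"
  have "rs d (ph d w e) = ph d w (rs d e)" for e
  proof (rule additive_eqI[where \<phi>="\<lambda>e. rs d (ph d w e)"])
    fix r k
    have "w r \<in> {1..2 * d}" if "r \<in> {1..d}" using w that by (simp add: equi_def)
    then show "rs d (ph d w (Poly_Mapping.single r k)) = ph d w (rs d (Poly_Mapping.single r k))"
      using rs_xexp by (auto simp: ph_single rs_single act.exp_zero)
  qed (simp_all add: ph_add rs_add)
  then show ?thesis by (simp add: act_def subst_subst)
qed

lemma W_act_eq: "kill d f = f \<Longrightarrow> W_act d w f = act d w f"
proof -
  assume "kill d f = f"
  then have k: "\<forall>e \<in> Poly_Mapping.keys f. Poly_Mapping.keys e \<subseteq> {1..d}" by (simp add: kill_iff)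
  have "rs d e = e" if "e \<in> Poly_Mapping.keys f" for e
  proof -
    have "rs d e = (\<Sum>r\<in>Poly_Mapping.keys e. Poly_Mapping.single r (Poly_Mapping.lookup e r))"
      unfolding rs_def by (rule sum.mono_neutral_right) (use k that in \<open>auto simp: in_keys_iff\<close>)
    then show ?thesis by (simp only: poly_mapping_expand[symmetric])
  qed
  then show ?thesis by (simp add: W_act_def act_def subst_def ph_def)
qed

lemma act_act: "equi d w \<Longrightarrow> equi d w' \<Longrightarrow> act d w (act d w' f) = act d (w \<circ> w') f"
  by (simp add: act_def subst_subst ph_ph)

lemma act_id: "(\<And>r. r \<in> {1..d} \<Longrightarrow> w r = r) \<Longrightarrow> act d w f = f"
  unfolding act_def by (rule subst_id) (auto intro: ph_id)

lemma Wc_equi: "w \<in> Wc d \<Longrightarrow> equi d w"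
  unfolding Wc_def equi_def using permutes_in_image by fastforce

lemma Wc_comp: "w \<in> Wc d \<Longrightarrow> w' \<in> Wc d \<Longrightarrow> w \<circ> w' \<in> Wc d"
  using Wc_equi[of w d] Wc_equi[of w' d] permutes_compose[of w' _ w] unfolding Wc_def equi_def by simp

lemma bar_in: "r \<in> {1..2 * d} \<Longrightarrow> bar d r \<in> {1..2 * d}"
  by (auto simp: bar_def)

lemma Wc_inv: "w \<in> Wc d \<Longrightarrow> inv_into UNIV w \<in> Wc d"
proof -
  assume w: "w \<in> Wc d"
  then have p: "w permutes {1..2 * d}" by (simp add: Wc_def)
  have "inv_into UNIV w (bar d r) = bar d (inv_into UNIV w r)" if r: "r \<in> {1..2 * d}" for r
  proof -
    have i: "inv_into UNIV w r \<in> {1..2 * d}" using permutes_in_image[OF permutes_inv[OF p]] r by blast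
    then have "w (bar d (inv_into UNIV w r)) = bar d (w (inv_into UNIV w r))" using w unfolding Wc_def by blast
    then have "w (bar d (inv_into UNIV w r)) = bar d r" using permutes_inverses[OF p] by simp
    then show ?thesis using permutes_inverses[OF p] by metis
  qed
  then show ?thesis using permutes_inv[OF p] by (simp add: Wc_def)
qed

lemma Wc_id: "id \<in> Wc d"
  by (simp add: Wc_def permutes_id)

lemma act_inv: "w \<in> Wc d \<Longrightarrow> act d (inv_into UNIV w) (act d w f) = f"
proof -
  assume w: "w \<in> Wc d"
  then have "inv_into UNIV w \<circ> w = id" unfolding Wc_def by (auto dest: permutes_inv_o(2))
  then show ?thesis using act_act[OF Wc_equi[OF Wc_inv[OF w]] Wc_equi[OF w], of f] by (simp add: act_id)
qed

lemma act_hom: "act d w (f + g) = act d w f + act d w g" "act d w (f * g) = act d w f * act d w g" "act d w 1 = 1" "act d w 0 = 0"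
  by (simp_all add: act_def subst_add act.h_mult act.h_one)

lemma act_eq_0_iff: "w \<in> Wc d \<Longrightarrow> act d w f = 0 \<longleftrightarrow> f = 0"
  by (metis act_hom(4) act_inv)

text \<open>The value is read off from some presentation as a fraction. As \<open>act d w\<close> is
  injective for w in \<open>Wc d\<close>, all presentations agree, which is
  \<open>actF_frac\<close>.\<close>

definition actF :: "nat \<Rightarrow> (nat \<Rightarrow> nat) \<Rightarrow> rfun \<Rightarrow> rfun" where
  "actF d w S = (SOME T. \<exists>a b. b \<noteq> 0 \<and> S = to_fract a / to_fract b \<and> T = to_fract (act d w a) / to_fract (act d w b))"

lemma rfun_cases: obtains a b :: laurent where "b \<noteq> 0" "S = to_fract a / to_fract b"
  by (cases S) (auto simp: Fract_conv_to_fract)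

lemma actF_frac:
  assumes w: "w \<in> Wc d" and b: "b \<noteq> 0"
  shows "actF d w (to_fract a / to_fract b) = to_fract (act d w a) / to_fract (act d w b)"
  unfolding actF_def
proof (rule some_equality)
  fix T assume "\<exists>a' b'. b' \<noteq> 0 \<and> to_fract a / to_fract b = to_fract a' / to_fract b' \<and> T = to_fract (act d w a') / to_fract (act d w b')"
  then obtain a' b' where 1: "b' \<noteq> 0" "to_fract a / to_fract b = to_fract a' / to_fract b'" "T = to_fract (act d w a') / to_fract (act d w b')"
    by blast
  then have "to_fract (a * b') = to_fract (a' * b)" using b by (simp add: field_simps)
  then have "act d w a * act d w b' = act d w a' * act d w b" by (metis act_hom(2) to_fract_eq_iff)
  then have "to_fract (act d w a) * to_fract (act d w b') = to_fract (act d w a') * to_fract (act d w b)"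
    by (metis to_fract_mult)
  then show "T = to_fract (act d w a) / to_fract (act d w b)"
    using 1(1) b act_eq_0_iff[OF w] unfolding 1(3) by (simp add: frac_eq_eq)
qed (use b in blast)

lemma actF_to_fract: "w \<in> Wc d \<Longrightarrow> actF d w (to_fract f) = to_fract (act d w f)"
  using actF_frac[of w d 1 f] by (simp add: act_hom)

lemma actF_add: "w \<in> Wc d \<Longrightarrow> actF d w (S + T) = actF d w S + actF d w T"
proof -
  assume w: "w \<in> Wc d"
  obtain a b where S: "b \<noteq> 0" "S = to_fract a / to_fract b" by (rule rfun_cases)
  obtain a' b' where T: "b' \<noteq> 0" "T = to_fract a' / to_fract b'" by (rule rfun_cases)
  have "S + T = to_fract (a * b' + a' * b) / to_fract (b * b')" using S T by (simp add: field_simps)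
  then show ?thesis using S T act_eq_0_iff[OF w] by (simp add: actF_frac[OF w] act_hom del: to_fract_add to_fract_mult) (simp add: field_simps)
qed

lemma actF_mult: "w \<in> Wc d \<Longrightarrow> actF d w (S * T) = actF d w S * actF d w T"
proof -
  assume w: "w \<in> Wc d"
  obtain a b where S: "b \<noteq> 0" "S = to_fract a / to_fract b" by (rule rfun_cases)
  obtain a' b' where T: "b' \<noteq> 0" "T = to_fract a' / to_fract b'" by (rule rfun_cases)
  have "S * T = to_fract (a * a') / to_fract (b * b')" using S T by simp
  then show ?thesis using S T by (simp add: actF_frac[OF w] act_hom del: to_fract_add to_fract_mult) simp
qed

lemma actF_0 [simp]: "w \<in> Wc d \<Longrightarrow> actF d w 0 = 0" and actF_1 [simp]: "w \<in> Wc d \<Longrightarrow> actF d w 1 = 1"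
  using actF_to_fract[of w d 0] actF_to_fract[of w d 1] by (simp_all add: act_hom)

lemma actF_uminus: "w \<in> Wc d \<Longrightarrow> actF d w (- S) = - actF d w S"
  using actF_add[of w d S "- S"] by (simp add: eq_neg_iff_add_eq_0 add.commute)

lemma actF_diff: "w \<in> Wc d \<Longrightarrow> actF d w (S - T) = actF d w S - actF d w T"
  using actF_add[of w d S "- T"] by (simp add: actF_uminus)

lemma actF_inverse: "w \<in> Wc d \<Longrightarrow> actF d w (inverse S) = inverse (actF d w S)"
proof (cases "S = 0")
  case False
  assume w: "w \<in> Wc d"
  have "actF d w S * actF d w (inverse S) = 1" using False w by (simp flip: actF_mult)
  then show ?thesis by (metis inverse_unique)
qed simp

lemma actF_divide: "w \<in> Wc d \<Longrightarrow> actF d w (S / T) = actF d w S / actF d w T"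
  by (simp add: divide_inverse actF_mult actF_inverse)

lemma actF_sum: "w \<in> Wc d \<Longrightarrow> actF d w (sum f A) = (\<Sum>a\<in>A. actF d w (f a))"
  by (induction A rule: infinite_finite_induct) (simp_all add: actF_add)

lemma actF_prod: "w \<in> Wc d \<Longrightarrow> actF d w (prod f A) = (\<Prod>a\<in>A. actF d w (f a))"
  by (induction A rule: infinite_finite_induct) (simp_all add: actF_mult)

lemma actF_power: "w \<in> Wc d \<Longrightarrow> actF d w (S ^ k) = actF d w S ^ k"
  by (induction k) (simp_all add: actF_mult)

lemma actF_powi: "w \<in> Wc d \<Longrightarrow> actF d w (S powi k) = actF d w S powi k"
  by (simp add: power_int_def actF_power actF_inverse)

lemma actF_coeffF: "w \<in> Wc d \<Longrightarrow> actF d w (coeffF c) = coeffF c"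
  by (simp add: coeffF_def actF_to_fract act_def act.exp_zero)

lemma actF_xvar: "w \<in> Wc d \<Longrightarrow> t \<in> {1..2 * d} \<Longrightarrow> actF d w (xvar d t) = xvar d (w t)"
  by (simp add: xvar_def actF_to_fract act_def ph_xexp Wc_equi)

lemma actF_actF: "w \<in> Wc d \<Longrightarrow> w' \<in> Wc d \<Longrightarrow> actF d w (actF d w' S) = actF d (w \<circ> w') S"
proof -
  assume w: "w \<in> Wc d" "w' \<in> Wc d"
  obtain a b where S: "b \<noteq> 0" "S = to_fract a / to_fract b" by (rule rfun_cases)
  then show ?thesis using w by (simp add: actF_frac Wc_comp act_eq_0_iff act_act Wc_equi)
qed

lemma actF_id: "actF d id S = S"
proof -
  obtain a b where S: "b \<noteq> 0" "S = to_fract a / to_fract b" by (rule rfun_cases)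
  then show ?thesis by (simp add: actF_frac Wc_id act_id)
qed

lemma xvar_nz: "xvar d t \<noteq> 0"
  by (simp add: xvar_def)

lemma xvar_bar: "t \<in> {1..2 * d} \<Longrightarrow> xvar d (bar d t) = inverse (xvar d t)"
proof -
  assume t: "t \<in> {1..2 * d}"
  have "xvar d t * xvar d (bar d t) = to_fract (lsingle (xexp d t 1 + xexp d t (- 1)) 1)"
    by (simp add: xvar_def xexp_bar[OF t] mult_single flip: to_fract_mult)
  also have "\<dots> = 1" unfolding xexp_add[symmetric] by (simp add: xexp_def)
  finally show ?thesis by (metis inverse_unique)
qed

lemma lsingle_eq_iff: "c \<noteq> 0 \<Longrightarrow> lsingle e c = lsingle e' c' \<Longrightarrow> e = e' \<and> c = c'"
  by (metis lookup_single_eq lookup_single_not_eq)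

lemma xvar_inj: "inj_on (xvar d) {1..2 * d}"
proof (rule inj_onI)
  fix a b assume ab: "a \<in> {1..2 * d}" "b \<in> {1..2 * d}" "xvar d a = xvar d b"
  then have "lsingle (xexp d a 1) 1 = lsingle (xexp d b 1) 1" by (simp add: xvar_def)
  then have "xexp d a 1 = xexp d b 1" using lsingle_eq_iff[of 1] by fastforce
  then show "a = b" by (rule xexp_inj[OF ab(1,2)])
qed

lemma qv_nz: "qv \<noteq> 0" and qv_sq: "qv ^ 2 \<noteq> 1"
proof -
  show "qv \<noteq> 0" by (simp add: qv_def)
  show "qv ^ 2 \<noteq> 1"
  proof
    assume "qv ^ 2 = 1"
    then have "to_fract ([:0, 1 :: complex:] * [:0, 1:]) = to_fract 1" by (simp add: qv_def power2_eq_square flip: to_fract_mult)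
    then have "[:0, 1 :: complex:] * [:0, 1:] = 1" by (simp only: to_fract_eq_iff)
    then have "poly ([:0, 1 :: complex:] * [:0, 1:]) 0 = poly 1 0" by (rule arg_cong)
    then show False by simp
  qed
qed

lemma xvar_scale: "qF ^ 2 * xvar d a \<noteq> xvar d b"
proof
  assume "qF ^ 2 * xvar d a = xvar d b"
  then have "to_fract (lsingle 0 (qv ^ 2) * lsingle (xexp d a 1) 1) = to_fract (lsingle (xexp d b 1) 1)"
    by (simp add: coeffF_power[symmetric]) (simp add: coeffF_def xvar_def)
  then have "lsingle 0 (qv ^ 2) * lsingle (xexp d a 1) 1 = lsingle (xexp d b 1) 1" by (simp only: to_fract_eq_iff)
  then have "lsingle (xexp d a 1) (qv ^ 2) = lsingle (xexp d b 1) 1" by (simp add: mult_single)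
  then have "qv ^ 2 = 1" using lsingle_eq_iff[of "qv ^ 2"] qv_nz by (metis power_not_zero)
  then show False using qv_sq by simp
qed

lemma rcol_xvar: "1 \<le> n \<Longrightarrow> rcol n d (xvar d)"
proof unfold_locales
  show "qF \<noteq> 0" using qv_nz by (simp add: coeffF_eq_0_iff)
  show "qF\<^sup>2 \<noteq> 1"
    using qv_sq coeffF_eq_0_iff[of "qv ^ 2 - 1"] by (auto simp: coeffF_simps coeffF_power)
  show "inj_on (xvar d) {1..2 * d}" by (rule xvar_inj)
qed (auto simp: xvar_nz xvar_bar xvar_scale)

definition Laur :: "nat \<Rightarrow> rfun set" where
  "Laur d = to_fract ` {f. kill d f = f}"

lemma LaurI: "kill d f = f \<Longrightarrow> to_fract f \<in> Laur d"
  by (simp add: Laur_def)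

lemma LaurE: assumes "S \<in> Laur d" obtains f where "S = to_fract f" "kill d f = f"
  using assms by (auto simp: Laur_def)

lemma Laur_add: "S \<in> Laur d \<Longrightarrow> T \<in> Laur d \<Longrightarrow> S + T \<in> Laur d"
  by (elim LaurE) (simp add: LaurI subst_add del: to_fract_add flip: to_fract_add)

lemma Laur_mult: "S \<in> Laur d \<Longrightarrow> T \<in> Laur d \<Longrightarrow> S * T \<in> Laur d"
  by (elim LaurE) (simp add: LaurI rs.h_mult del: to_fract_mult flip: to_fract_mult)

lemma Laur_coeffF: "coeffF c \<in> Laur d"
  unfolding coeffF_def by (rule LaurI) (simp add: rs.exp_zero)

lemma Laur_0: "0 \<in> Laur d" and Laur_1: "1 \<in> Laur d"
  using Laur_coeffF[of 0 d] Laur_coeffF[of 1 d] by (simp_all add: coeffF_simps)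

lemma Laur_uminus: "S \<in> Laur d \<Longrightarrow> - S \<in> Laur d"
  by (elim LaurE) (simp add: LaurI subst_uminus del: to_fract_uminus flip: to_fract_uminus)

lemma Laur_diff: "S \<in> Laur d \<Longrightarrow> T \<in> Laur d \<Longrightarrow> S - T \<in> Laur d"
  using Laur_add[of S d "- T"] Laur_uminus[of T d] by simp

lemma Laur_sum: "(\<And>a. a \<in> A \<Longrightarrow> f a \<in> Laur d) \<Longrightarrow> sum f A \<in> Laur d"
  by (induction A rule: infinite_finite_induct) (auto intro: Laur_0 Laur_add)

lemma Laur_prod: "(\<And>a. a \<in> A \<Longrightarrow> f a \<in> Laur d) \<Longrightarrow> prod f A \<in> Laur d"
  by (induction A rule: infinite_finite_induct) (auto intro: Laur_1 Laur_mult)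

lemma Laur_power: "S \<in> Laur d \<Longrightarrow> S ^ k \<in> Laur d"
  by (induction k) (auto intro: Laur_1 Laur_mult)

lemma Laur_xvar: "t \<in> {1..2 * d} \<Longrightarrow> xvar d t \<in> Laur d"
  unfolding xvar_def by (rule LaurI) (simp add: rs_xexp)

lemma Laur_xvar_powi: "t \<in> {1..2 * d} \<Longrightarrow> xvar d t powi k \<in> Laur d"
  using Laur_power[OF Laur_xvar, of t d] Laur_power[OF Laur_xvar[OF bar_in], of t d] by (simp add: power_int_def xvar_bar power_inverse)

lemma Laur_qF_powi: "qF powi k \<in> Laur d"
  using Laur_coeffF[of "qv powi k"] by (simp add: coeffF_power_int)

lemma Laur_actF: "w \<in> Wc d \<Longrightarrow> S \<in> Laur d \<Longrightarrow> actF d w S \<in> Laur d"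
  by (elim LaurE) (simp add: LaurI actF_to_fract kill_act Wc_equi)

text \<open>\<open>kill d\<close> fixes both D and D S, so D times the image of S is D S; cancelling
  D shows that S is fixed as well.\<close>

lemma Laur_quotient:
  assumes "D \<in> Laur d" "D \<noteq> 0" "D * S \<in> Laur d" "S \<in> range to_fract"
  shows "S \<in> Laur d"
proof -
  obtain f where f: "D = to_fract f" "kill d f = f" using assms(1) by (rule LaurE)
  obtain g where g: "D * S = to_fract g" "kill d g = g" using assms(3) by (rule LaurE)
  obtain s where s: "S = to_fract s" using assms(4) by blast
  have 1: "f * s = g" using f g s by (metis to_fract_eq_iff to_fract_mult)
  then have "f * kill d s = f * s" using f g by (metis rs.h_mult)
  then have "kill d s = s" using f assms(2) by auto
  then show ?thesis unfolding s by (rule LaurI)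
qed

section \<open>Equivariance and integrality\<close>

locale affine_rep =
  fixes n d :: nat
  assumes n_pos: "1 \<le> n"

sublocale affine_rep \<subseteq> rcol n d "xvar d"
  using n_pos by (rule rcol_xvar)

definition fpm :: "nat \<Rightarrow> (nat \<Rightarrow> nat) \<Rightarrow> rfun fps \<Rightarrow> rfun fps" where
  "fpm d w f = Abs_fps (\<lambda>m. actF d w (f $ m))"

lemma fpm_nth [simp]: "fpm d w f $ m = actF d w (f $ m)"
  by (simp add: fpm_def)

lemma fpm_mult: "w \<in> Wc d \<Longrightarrow> fpm d w (f * g) = fpm d w f * fpm d w g"
  by (rule fps_ext) (simp add: fps_mult_nth actF_sum actF_mult)

lemma fpm_1: "w \<in> Wc d \<Longrightarrow> fpm d w 1 = 1"
  by (rule fps_ext) simp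

lemma fpm_diff: "w \<in> Wc d \<Longrightarrow> fpm d w (f - g) = fpm d w f - fpm d w g"
  by (rule fps_ext) (simp add: actF_diff)

lemma fpm_prod: "w \<in> Wc d \<Longrightarrow> fpm d w (prod f A) = (\<Prod>a\<in>A. fpm d w (f a))"
  by (induction A rule: infinite_finite_induct) (simp_all add: fpm_1 fpm_mult)

lemma fpm_linfrac: "w \<in> Wc d \<Longrightarrow> fpm d w (linfrac a b) = linfrac (actF d w a) (actF d w b)"
  by (rule fps_ext) (simp add: linfrac_nth actF_diff actF_mult actF_power)

lemma fpm_const: "w \<in> Wc d \<Longrightarrow> fpm d w (fps_const a) = fps_const (actF d w a)"
  by (rule fps_ext) simp

lemma fpm_X_power: "w \<in> Wc d \<Longrightarrow> fpm d w (fps_X ^ k) = fps_X ^ k"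
  by (rule fps_ext) simp

lemma fpm_inverse: "w \<in> Wc d \<Longrightarrow> f $ 0 \<noteq> 0 \<Longrightarrow> fpm d w (inverse f) = inverse (fpm d w f)"
proof -
  assume a: "w \<in> Wc d" "f $ 0 \<noteq> 0"
  have "f * inverse f = 1" using a by (simp add: inverse_mult_eq_1')
  then have "fpm d w f * fpm d w (inverse f) = 1" using a by (metis fpm_1 fpm_mult)
  then show ?thesis by (metis fps_inverse_unique)
qed

definition Lps :: "nat \<Rightarrow> rfun fps set" where
  "Lps d = {f. \<forall>m. f $ m \<in> Laur d}"

lemma Lps_mult: "f \<in> Lps d \<Longrightarrow> g \<in> Lps d \<Longrightarrow> f * g \<in> Lps d"
  by (simp add: Lps_def fps_mult_nth Laur_sum Laur_mult)

lemma Lps_1: "1 \<in> Lps d"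
  by (simp add: Lps_def Laur_0 Laur_1)

lemma Lps_prod: "(\<And>a. a \<in> A \<Longrightarrow> f a \<in> Lps d) \<Longrightarrow> prod f A \<in> Lps d"
  by (induction A rule: infinite_finite_induct) (auto intro: Lps_1 Lps_mult)

lemma Lps_linfrac: "a \<in> Laur d \<Longrightarrow> b \<in> Laur d \<Longrightarrow> linfrac a b \<in> Lps d"
  by (auto simp: Lps_def linfrac_nth intro!: Laur_diff Laur_mult Laur_power Laur_0 Laur_1)

lemma Lps_inverse:
  assumes f: "f \<in> Lps d" and f0: "f $ 0 = 1"
  shows "inverse f \<in> Lps d"
proof -
  have "inverse f $ m \<in> Laur d" for m
  proof (induction m rule: less_induct)
    case (less m)
    show ?case
    proof (cases m)
      case 0
      then show ?thesis using f0 by (simp add: Laur_1)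
    next
      case (Suc k)
      have "(f * inverse f) $ m = 0" using f0 Suc by (simp add: inverse_mult_eq_1')
      moreover have "{0..m} = insert 0 {1..m}" by auto
      ultimately have "inverse f $ m = - (\<Sum>i\<in>{1..m}. f $ i * inverse f $ (m - i))"
        using f0 by (simp add: fps_mult_nth eq_neg_iff_add_eq_0)
      also have "\<dots> \<in> Laur d"
        using f less by (auto simp: Lps_def intro!: Laur_uminus Laur_sum Laur_mult)
      finally show ?thesis .
    qed
  qed
  then show ?thesis by (simp add: Lps_def)
qed

context affine_rep
begin

lemma R_eq: "R = {1..2 * d}"
  by (simp add: R_def)

lemma Wc_R: "w \<in> Wc d \<Longrightarrow> w r \<in> R \<longleftrightarrow> r \<in> R"
  unfolding R_eq Wc_def by (simp only: mem_Collect_eq permutes_in_image)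

lemma Wc_br: "w \<in> Wc d \<Longrightarrow> r \<in> R \<Longrightarrow> w (br r) = br (w r)"
  unfolding R_eq Wc_def by blast

lemma Wc_inj: "w \<in> Wc d \<Longrightarrow> w r = w s \<longleftrightarrow> r = s"
  unfolding Wc_def by (metis (mono_tags, lifting) mem_Collect_eq permutes_inverses(2))

lemma Wc_bij: "w \<in> Wc d \<Longrightarrow> bij_betw w R R"
  unfolding R_eq Wc_def by (simp add: permutes_imp_bij)

lemma actF_x: "w \<in> Wc d \<Longrightarrow> r \<in> R \<Longrightarrow> actF d w (xvar d r) = xvar d (w r)"
  unfolding R_eq by (rule actF_xvar)

lemma Col_act: "w \<in> Wc d \<Longrightarrow> c \<circ> w \<in> Col \<longleftrightarrow> c \<in> Col"
proof -
  have "c \<circ> w \<in> Col" if "w \<in> Wc d" "c \<in> Col" for c w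
    using that by (simp add: Col_def Wc_R Wc_br)
  moreover have "c \<circ> w \<circ> inv_into UNIV w = c" if "w \<in> Wc d"
    using that unfolding Wc_def by (auto simp: fun_eq_iff permutes_inverses)
  ultimately show "w \<in> Wc d \<Longrightarrow> c \<circ> w \<in> Col \<longleftrightarrow> c \<in> Col" by (metis Wc_inv)
qed

lemma mv_act: "w \<in> Wc d \<Longrightarrow> b \<in> R \<Longrightarrow> mv (c \<circ> w) b = mv c (w b) \<circ> w"
  by (auto simp: mv_def fun_eq_iff Wc_inj Wc_br[symmetric])

lemma actF_q: "w \<in> Wc d \<Longrightarrow> actF d w qF = qF"
  by (rule actF_coeffF)

lemma actF_g: "w \<in> Wc d \<Longrightarrow> a \<in> R \<Longrightarrow> b \<in> R \<Longrightarrow> actF d w (g a b) = g (w a) (w b)"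
  by (simp add: g_def actF_divide actF_diff actF_mult actF_inverse actF_q actF_x)

lemma actF_yv: "w \<in> Wc d \<Longrightarrow> a \<in> R \<Longrightarrow> actF d w (yv i a) = yv i (w a)"
  by (simp add: yv_def actF_mult actF_powi actF_q actF_x)

text \<open>In the full weight the mirror index is an index like any other; the separation of
  \<open>pg\<close> from \<open>mid\<close> served the computations with moves. In this form
  equivariance amounts to a reindexing of the product.\<close>

lemma wt_alt:
  assumes "symc c" "a \<in> R"
  shows "wt i a c = (if c a = i then \<Prod>t\<in>{t \<in> R. t \<noteq> a \<and> c t = i}. g a t else 0)"
proof (cases "c a = i")
  case True
  have b: "c (br a) = N + 1 - i" using symcD[OF assms] True by simp
  show ?thesis
  proof (cases "i = int n + 1")
    case i: True
    then have "{t \<in> R. t \<noteq> a \<and> c t = i} = insert (br a) {t \<in> R. t \<noteq> a \<and> t \<noteq> br a \<and> c t = i}"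
      using b assms by auto
    then show ?thesis using True i by (simp add: wt_def mid_def pg_def mult.commute)
  next
    case False
    then have "{t \<in> R. t \<noteq> a \<and> c t = i} = {t \<in> R. t \<noteq> a \<and> t \<noteq> br a \<and> c t = i}" using b by auto
    then show ?thesis using True False by (simp add: wt_def mid_def pg_def)
  qed
qed (simp add: wt_def)

lemma actF_wt:
  assumes w: "w \<in> Wc d" and c: "symc c" and a: "a \<in> R"
  shows "actF d w (wt i a (c \<circ> w)) = wt i (w a) c"
proof -
  have s: "symc (c \<circ> w)" using c w by (simp add: symc_def Wc_R Wc_br)
  have "actF d w (\<Prod>t\<in>{t \<in> R. t \<noteq> a \<and> c (w t) = i}. g a t) = (\<Prod>t\<in>{t \<in> R. t \<noteq> a \<and> c (w t) = i}. g (w a) (w t))"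
    using w a by (simp add: actF_prod actF_g)
  also have "\<dots> = (\<Prod>t\<in>{t \<in> R. t \<noteq> w a \<and> c t = i}. g (w a) t)"
  proof (rule prod.reindex_bij_betw)
    have "w ` R = R" using Wc_bij[OF w] by (simp add: bij_betw_def)
    then show "bij_betw w {t \<in> R. t \<noteq> a \<and> c (w t) = i} {t \<in> R. t \<noteq> w a \<and> c t = i}"
      unfolding bij_betw_def inj_on_def using Wc_inj[OF w] Wc_R[OF w] by auto
  qed
  finally show ?thesis using w a c s by (simp add: wt_alt Wc_R)
qed

definition equivariant :: "((nat \<Rightarrow> int) \<Rightarrow> rfun) \<Rightarrow> bool" where
  "equivariant F \<longleftrightarrow> (\<forall>w\<in>Wc d. \<forall>c. F c = actF d w (F (c \<circ> w)))"

lemma equivariantD: "equivariant F \<Longrightarrow> w \<in> Wc d \<Longrightarrow> actF d w (F (c \<circ> w)) = F c"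
  unfolding equivariant_def by metis

lemma equivariant_Bop:
  assumes F: "equivariant F"
  shows "equivariant (Bop i k F)"
  unfolding equivariant_def
proof (intro ballI allI)
  fix w c assume w: "w \<in> Wc d"
  show "Bop i k F c = actF d w (Bop i k F (c \<circ> w))"
  proof (cases "c \<in> Col")
    case True
    have "actF d w (Bop i k F (c \<circ> w)) = (\<Sum>a\<in>R. yv i (w a) powi k * wt i (w a) c * F (mv c (w a)))"
      using True w symc_Col[OF True] equivariantD[OF F w]
      by (simp add: Bop_def Col_act actF_sum actF_mult actF_powi actF_yv actF_wt mv_act)
    also have "\<dots> = Bop i k F c"
      using sum.reindex_bij_betw[OF Wc_bij[OF w], of "\<lambda>a. yv i a powi k * wt i a c * F (mv c a)"] True
      by (simp add: Bop_def)
    finally show ?thesis ..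
  qed (simp add: Bop_def Col_act w)
qed

lemma fpm_th: "w \<in> Wc d \<Longrightarrow> fpm d w (th i (c \<circ> w)) = th i c"
proof -
  assume w: "w \<in> Wc d"
  have "fpm d w (pth i (c \<circ> w)) = (\<Prod>t\<in>R. phi i (c (w t)) (yv i (w t)))"
    using w by (simp add: pth_def fpm_prod)
      (rule prod.cong, auto simp: phi_def fpm_linfrac fpm_1 actF_divide actF_mult actF_power actF_q actF_yv)
  also have "\<dots> = pth i c"
    unfolding pth_def by (rule prod.reindex_bij_betw[OF Wc_bij[OF w]])
  finally have 1: "fpm d w (pth i (c \<circ> w)) = pth i c" .
  have "fpm d w (ext i) = ext i"
    using w by (simp add: ext_def fpm_1 fpm_mult fpm_inverse fpm_diff fpm_const fpm_X_power actF_power actF_mult actF_q)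
  then show ?thesis using 1 w by (simp add: th_def fpm_mult)
qed

lemma Kf_act: "w \<in> Wc d \<Longrightarrow> Kf i (c \<circ> w) = Kf i c"
  using prod.reindex_bij_betw[OF Wc_bij, of w "\<lambda>t. kap i (c t)"] by (simp add: Kf_def kk_def)

lemma actF_Kf: "w \<in> Wc d \<Longrightarrow> actF d w (Kf i c) = Kf i c"
  by (auto simp: Kf_def kk_def kap_def actF_mult actF_inverse actF_prod actF_q intro!: prod.cong)

lemma yv_Laur: "a \<in> R \<Longrightarrow> yv i a \<in> Laur d"
  unfolding R_eq yv_def by (intro Laur_mult Laur_qF_powi Laur_xvar)

lemma yv_powi_Laur: "a \<in> R \<Longrightarrow> yv i a powi k \<in> Laur d"
  using Laur_qF_powi[of "i * k" d] Laur_xvar_powi[of a d k]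
  by (simp add: yv_def R_eq power_int_mult_distrib power_int_mult Laur_mult)

lemma th_Laur: "th i c $ m \<in> Laur d"
proof -
  have q: "qF ^ j \<in> Laur d" "inverse qF ^ j \<in> Laur d" for j
    using Laur_qF_powi[of "int j" d] Laur_qF_powi[of "- int j" d] by (simp_all add: power_int_minus power_inverse)
  have "phi i (c t) (yv i t) \<in> Lps d" if "t \<in> R" for t
    using q[of 2] yv_Laur[OF that, of i] unfolding phi_def
    by (auto simp: divide_inverse power_inverse intro!: Lps_linfrac Lps_1 Laur_mult)
  then have "pth i c \<in> Lps d" unfolding pth_def by (rule Lps_prod)
  moreover have L: "1 - fps_const (qF ^ j) * fps_X ^ 2 \<in> Lps d" for j
    using q[of j] by (auto simp: Lps_def fps_X_power_nth intro!: Laur_diff Laur_1 Laur_0 Laur_uminus)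
  have "(1 - fps_const (qF ^ (2 * n)) * fps_X ^ 2) * inverse (1 - fps_const (qF ^ (2 * n + 2)) * fps_X ^ 2) \<in> Lps d"
    by (rule Lps_mult[OF L Lps_inverse[OF L]]) simp
  then have "ext i \<in> Lps d" unfolding ext_def by (metis Lps_1)
  ultimately have "th i c \<in> Lps d" by (simp add: th_def Lps_mult)
  then show ?thesis by (simp add: Lps_def)
qed

lemma Kf_Laur: "Kf i c \<in> Laur d" "inverse (Kf i c) \<in> Laur d"
proof -
  have q: "qF \<in> Laur d" "inverse qF \<in> Laur d" using Laur_qF_powi[of 1 d] Laur_qF_powi[of "-1" d] by simp_all
  have "kk i c \<in> Laur d" unfolding kk_def by (rule Laur_prod) (use q in \<open>simp add: kap_def Laur_1\<close>)
  moreover have "inverse (kk i c) \<in> Laur d"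
    unfolding kk_def prod_inversef[symmetric] comp_def by (rule Laur_prod) (use q in \<open>simp add: kap_def Laur_1\<close>)
  ultimately show "Kf i c \<in> Laur d" "inverse (Kf i c) \<in> Laur d"
    using q unfolding Kf_def by (auto intro: Laur_mult)
qed

end

section \<open>Cancellation of the poles\<close>

abbreviation xm :: "nat \<Rightarrow> nat \<Rightarrow> laurent" where
  "xm d t \<equiv> lsingle (xexp d t 1) 1"

lemma xm_eq_iff: "a \<in> {1..2 * d} \<Longrightarrow> b \<in> {1..2 * d} \<Longrightarrow> xm d a = xm d b \<longleftrightarrow> a = b"
  using lsingle_eq_iff[of 1] xexp_inj[of a d b] by (metis zero_neq_one)

text \<open>If \<open>S\<close> is fixed by an involution \<open>s\<close> that negates \<open>p\<close>, then \<open>H = p E S\<close> satisfies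
  \<open>H \<cdot> s E = - E \<cdot> s H\<close>; evaluations that are insensitive to \<open>s\<close> and do not kill \<open>E\<close> therefore kill \<open>H\<close>.\<close>

lemma reflection_step:
  fixes V :: "(laurent \<Rightarrow> laurent) set"
  assumes s: "s \<in> Wc d" "actF d s S = S" "act d s p = - p" and p: "p \<noteq> 0"
    and H: "to_fract p * to_fract E * S \<in> range to_fract"
    and V: "\<And>h. h \<in> V \<Longrightarrow> (\<forall>f g. h (f * g) = h f * h g) \<and> (\<forall>f. h (- f) = - h f) \<and> (\<forall>f. h (act d s f) = h f) \<and> h E \<noteq> 0"
    and dvd: "\<And>f. (\<And>h. h \<in> V \<Longrightarrow> h f = 0) \<Longrightarrow> p dvd f"
  shows "to_fract E * S \<in> range to_fract"
proof -
  obtain H where H: "to_fract p * to_fract E * S = to_fract H" using H by (auto simp: image_iff)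
  have "to_fract (act d s H) = actF d s (to_fract p * to_fract E * S)" using s by (simp add: H actF_to_fract)
  also have "\<dots> = - (to_fract p * to_fract (act d s E) * S)" using s by (simp add: actF_mult actF_to_fract)
  finally have "to_fract (H * act d s E) = to_fract (- (E * act d s H))"
    by (simp flip: H add: mult_ac)
  then have eq: "H * act d s E = - (E * act d s H)" by (simp only: to_fract_eq_iff)
  have "h H = 0" if h: "h \<in> V" for h
  proof -
    have "h (H * act d s E) = h (- (E * act d s H))" by (simp only: eq)
    then have "h H * h E = - (h E * h H)" using V[OF h] by simp
    then have "2 * (h H * h E) = 0" by (simp add: mult.commute)
    then show ?thesis using V[OF h] two_laurent_nz by simp
  qed
  then have "p dvd H" by (rule dvd)
  then obtain T where "H = p * T" by (elim dvdE)
  then have "to_fract p * (to_fract E * S) = to_fract p * to_fract T" using H by (simp add: mult.assoc)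
  then have "to_fract E * S = to_fract T" using p by simp
  then show ?thesis by blast
qed

text \<open>The index map whose substitution is the evaluation at x_a = x_t. It commutes with
  \<open>bar\<close> but is not injective, so it satisfies \<open>equi\<close> without being in
  \<open>Wc d\<close>.\<close>

definition merge :: "nat \<Rightarrow> nat \<Rightarrow> nat \<Rightarrow> nat \<Rightarrow> nat" where
  "merge d a t r = (if r = a then t else if r = bar d a then bar d t else r)"

definition refl_swap :: "nat \<Rightarrow> nat \<Rightarrow> nat \<Rightarrow> nat \<Rightarrow> nat" where
  "refl_swap d a t r = (if r = a then t else if r = t then a else if r = bar d a then bar d t
     else if r = bar d t then bar d a else r)"

text \<open>The evaluation at x_a = u, needed at u = 1 and u = -1, the zeros of x_a - 1 /
  x_a.\<close>

definition signev :: "Cq \<Rightarrow> nat \<Rightarrow> laurent \<Rightarrow> laurent" where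
  "signev u a = subst (\<lambda>e. e - Poly_Mapping.single a (Poly_Mapping.lookup e a)) (\<lambda>e. u powi Poly_Mapping.lookup e a)"

lemma evaluation_sign: "u \<noteq> 0 \<Longrightarrow>
  evaluation (\<lambda>e. e - Poly_Mapping.single a (Poly_Mapping.lookup e a)) (\<lambda>e. u powi Poly_Mapping.lookup e a) a"
  by unfold_locales (simp_all add: lookup_add single_add power_int_add lookup_single)

lemma evaluation_merge:
  assumes "a \<in> {1..d}"
  shows "evaluation (ph d (merge d a t)) (\<lambda>_. 1) a"
proof unfold_locales
  fix s k assume "s \<noteq> a"
  then show "ph d (merge d a t) (Poly_Mapping.single s k) = Poly_Mapping.single s k"
    using assms by (auto simp: ph_single merge_def bar_def xexp_def)
qed simp

context affine_rep
begin

text \<open>The factors \<open>x\<^sub>a - x\<^sub>t\<close> with \<open>(a, t)\<close> in \<open>pairs c\<close> are pairwise coprime, and their product is a common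
  denominator of the weights.\<close>

definition pairs :: "(nat \<Rightarrow> int) \<Rightarrow> (nat \<times> nat) set" where
  "pairs c = {(a, t). a \<in> R \<and> t \<in> R \<and> a < t \<and> a + t \<le> 2 * d + 1 \<and> c a = c t}"

definition pf :: "nat \<times> nat \<Rightarrow> rfun" where
  "pf = (\<lambda>(a, t). xvar d a - xvar d t)"

text \<open>Every pair of indices is equivalent under \<open>bar\<close> to exactly one pair in \<open>pairs\<close>.\<close>

definition can :: "nat \<Rightarrow> nat \<Rightarrow> nat \<times> nat" where
  "can a t = (if a + t \<le> 2 * d + 1 then (min a t, max a t) else (min (br a) (br t), max (br a) (br t)))"

lemma finite_pairs: "finite (pairs c)"
  by (rule finite_subset[of _ "R \<times> R"]) (auto simp: pairs_def)

lemma br_arith: "a \<in> R \<Longrightarrow> br a + a = 2 * d + 1"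
  by (auto simp: R_eq bar_def)

lemma can_in:
  assumes "symc c" "a \<in> R" "t \<in> R" "a \<noteq> t" "c a = c t"
  shows "can a t \<in> pairs c"
proof -
  have b: "br a + a = 2 * d + 1" "br t + t = 2 * d + 1" "br a \<in> R" "br t \<in> R" "c (br a) = c (br t)"
    using assms br_arith by (simp_all add: symcD)
  show ?thesis
  proof (cases "a + t \<le> 2 * d + 1")
    case True
    then show ?thesis using assms by (auto simp: can_def pairs_def min_def max_def)
  next
    case False
    then have "br a + br t \<le> 2 * d + 1" "br a \<noteq> br t" using b(1,2) assms(4) by linarith+
    then show ?thesis using False b(3-5) by (auto simp: can_def pairs_def min_def max_def)
  qed
qed

lemma can_inj: "a \<in> R \<Longrightarrow> inj_on (can a) R"
proof (rule inj_onI)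
  fix t u assume a: "a \<in> R" "t \<in> R" "u \<in> R" "can a t = can a u"
  have b: "br a + a = 2 * d + 1" "br t + t = 2 * d + 1" "br u + u = 2 * d + 1" "br a \<noteq> a" using a br_arith by simp_all
  show "t = u" using a(4) b unfolding can_def min_def max_def by (auto split: if_splits)
qed

text \<open>According to the case and the order chosen by \<open>can\<close>, the factor is x_a -
  x_t or the difference of the inverses, up to sign. These are unit multiples of each other, so each
  of them clears the denominator of \<open>g a t\<close>.\<close>

lemma pf_can_g:
  assumes "a \<in> R" "t \<in> R" "a \<noteq> t"
  shows "pf (can a t) * g a t \<in> Laur d"
proof -
  let ?y = "qF * xvar d a - inverse qF * xvar d t"
  have xL: "xvar d a \<in> Laur d" "xvar d t \<in> Laur d" "inverse (xvar d a) \<in> Laur d" "inverse (xvar d t) \<in> Laur d"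
    using assms Laur_xvar[of _ d] Laur_xvar_powi[of _ d "-1"] by (simp_all add: R_eq)
  have "qF \<in> Laur d" "inverse qF \<in> Laur d" using Laur_qF_powi[of 1 d] Laur_qF_powi[of "-1" d] by simp_all
  then have y: "?y \<in> Laur d" using xL by (intro Laur_diff Laur_mult)
  have nz: "xvar d a - xvar d t \<noteq> 0" "xvar d a \<noteq> 0" "xvar d t \<noteq> 0" using xneq[OF assms] xvar_nz by auto
  define u where "u = inverse (xvar d a) * inverse (xvar d t)"
  have u: "inverse (xvar d a) - inverse (xvar d t) = - (xvar d a - xvar d t) * u"
    using nz by (simp add: u_def field_simps)
  have e: "(xvar d a - xvar d t) * g a t = ?y" using nz by (simp add: g_def)
  have uy: "u * ?y \<in> Laur d" using xL y by (simp add: u_def Laur_mult)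
  have e2: "(xvar d t - xvar d a) * g a t = - ?y" unfolding e[symmetric] by (simp add: algebra_simps)
  have e3: "(inverse (xvar d a) - inverse (xvar d t)) * g a t = - (u * ?y)"
    unfolding u e[symmetric] by (simp add: algebra_simps)
  have e4: "(inverse (xvar d t) - inverse (xvar d a)) * g a t = u * ?y"
    unfolding u[symmetric] using e3 by (simp add: algebra_simps)
  have b: "xvar d (br a) = inverse (xvar d a)" "xvar d (br t) = inverse (xvar d t)" using x_br assms by auto
  show ?thesis
    using y uy Laur_uminus[OF y] Laur_uminus[OF uy] unfolding can_def pf_def min_def max_def
    by (auto simp: b e e2 e3 e4 simp del: minus_diff_eq)
qed

text \<open>By \<open>can_inj\<close> different t use different factors of the common denominator,
  one for each \<open>g a t\<close> in the weight.\<close>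

lemma D_wt:
  assumes c: "symc c" and a: "a \<in> R"
  shows "(\<Prod>s\<in>pairs c. pf s) * wt i a c \<in> Laur d"
proof (cases "c a = i")
  case True
  define T where "T = {t \<in> R. t \<noteq> a \<and> c t = i}"
  have sub: "can a ` T \<subseteq> pairs c" using can_in[OF c a] True by (auto simp: T_def)
  have inj: "inj_on (can a) T" using can_inj[OF a] by (rule inj_on_subset) (auto simp: T_def)
  have w: "wt i a c = (\<Prod>t\<in>T. g a t)" using True by (simp add: wt_alt[OF c a] T_def)
  have "(\<Prod>s\<in>pairs c. pf s) * wt i a c
    = (\<Prod>s\<in>pairs c - can a ` T. pf s) * ((\<Prod>t\<in>T. pf (can a t)) * (\<Prod>t\<in>T. g a t))"
    unfolding w prod.subset_diff[OF sub finite_pairs] prod.reindex[OF inj] by (simp add: mult.assoc)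
  also have "\<dots> = (\<Prod>s\<in>pairs c - can a ` T. pf s) * (\<Prod>t\<in>T. pf (can a t) * g a t)"
    by (simp add: prod.distrib)
  also have "\<dots> \<in> Laur d"
  proof (rule Laur_mult[OF Laur_prod Laur_prod])
    show "pf (can a t) * g a t \<in> Laur d" if "t \<in> T" for t
      by (rule pf_can_g[OF a]) (use that in \<open>auto simp: T_def\<close>)
    show "pf s \<in> Laur d" if "s \<in> pairs c - can a ` T" for s
      using that by (auto simp: pf_def pairs_def R_eq intro!: Laur_diff Laur_xvar)
  qed
  finally show ?thesis .
qed (simp add: wt_def Laur_0)

lemma refl_swap_Wc:
  assumes "a \<in> R" "t \<in> R" "a \<noteq> t"
  shows "refl_swap d a t \<in> Wc d"
proof -
  let ?s = "refl_swap d a t"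
  have b: "br a \<in> R" "br t \<in> R" "br (br a) = a" "br (br t) = t" "a \<noteq> br a" "t \<noteq> br t" "br a \<noteq> br t"
    "a = br t \<longleftrightarrow> t = br a" using assms br_eq_iff by auto
  have inv: "?s (?s r) = r" for r using b assms(3) unfolding refl_swap_def by (smt (verit))
  have out: "?s r = r" if "r \<notin> R" for r using that assms b by (auto simp: refl_swap_def)
  have "?s permutes R" unfolding permutes_def using inv out by metis
  moreover have "?s (br r) = br (?s r)" if r: "r \<in> R" for r
  proof -
    have "br r = a \<longleftrightarrow> r = br a" "br r = t \<longleftrightarrow> r = br t" "br r = br a \<longleftrightarrow> r = a" "br r = br t \<longleftrightarrow> r = t"
      using r assms br_eq_iff by auto
    then show ?thesis using b assms(3) unfolding refl_swap_def by (smt (verit))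
  qed
  ultimately show ?thesis by (simp add: Wc_def R_eq)
qed

lemma refl_swap_fix:
  assumes "symc c" "a \<in> R" "t \<in> R" "c a = c t"
  shows "c \<circ> refl_swap d a t = c"
  using assms symcD[OF assms(1)] by (auto simp: fun_eq_iff refl_swap_def)

text \<open>For t other than the mirror of a the evaluation at x_a = x_t is used; for the mirror,
  where x_a - x_t has two zeros, both values 1 and -1 of x_a are. The product E of the other factors
  survives the evaluations because \<open>pairs\<close> contains one representative per class under
  \<open>bar\<close>.\<close>

lemma integral_step:
  assumes at: "(a, t) \<in> pairs c" and c: "symc c" and P: "P \<subseteq> pairs c" "(a, t) \<notin> P"
    and S: "actF d (refl_swap d a t) S = S" and H: "(\<Prod>s\<in>insert (a, t) P. pf s) * S \<in> range to_fract"
  shows "(\<Prod>s\<in>P. pf s) * S \<in> range to_fract"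
proof -
  have a: "a \<in> R" "t \<in> R" "a < t" "a + t \<le> 2 * d + 1" "a \<in> {1..d}" using at by (auto simp: pairs_def R_eq)
  let ?s = "refl_swap d a t"
  have W: "?s \<in> Wc d" by (rule refl_swap_Wc) (use a in auto)
  define E where "E = (\<Prod>(b, u)\<in>P. xm d b - xm d u)"
  have fP: "finite P" using P(1) finite_pairs by (rule finite_subset)
  have toE: "to_fract E = (\<Prod>s\<in>P. pf s)"
  proof -
    have "to_fract (\<Prod>s\<in>A. k s) = (\<Prod>s\<in>A. to_fract (k s))" for A :: "(nat \<times> nat) set" and k :: "nat \<times> nat \<Rightarrow> laurent"
      by (induction A rule: infinite_finite_induct) simp_all
    then show ?thesis by (simp add: E_def pf_def xvar_def case_prod_unfold)
  qed
  have mem: "b \<in> R" "u \<in> R" "b < u" "b + u \<le> 2 * d + 1" "(b, u) \<noteq> (a, t)" if "(b, u) \<in> P" for b u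
    using that P by (auto simp: pairs_def)
  have neg: "act d ?s (xm d a - xm d t) = - (xm d a - xm d t)"
  proof -
    have "act d ?s (xm d r) = xm d (?s r)" if "r \<in> R" for r
      using ph_xexp[OF Wc_equi[OF W]] that by (simp add: act_def R_eq)
    then show ?thesis using a by (simp add: act_def subst_diff) (simp add: refl_swap_def)
  qed
  have nz: "xm d a - xm d t \<noteq> 0" using a xm_eq_iff[of a d t] by (simp add: R_eq)
  have H': "to_fract (xm d a - xm d t) * to_fract E * S \<in> range to_fract"
    using H P(2) fP unfolding toE by (simp add: pf_def xvar_def)
  show ?thesis unfolding toE[symmetric]
  proof (cases "t = br a")
    case False
    let ?h = "act d (merge d a t)"
    interpret ev: evaluation "ph d (merge d a t)" "\<lambda>_. 1" a by (rule evaluation_merge[OF a(5)])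
    have b: "br a \<in> R" "br t \<in> R" "br (br a) = a" "br (br t) = t" "a \<noteq> br a" "t \<noteq> br t" "br a \<noteq> br t" "a \<noteq> br t" "a \<noteq> t"
      using a False br_eq_iff by auto
    have eq: "equi d (merge d a t)"
      unfolding equi_def R_eq[symmetric]
    proof (intro ballI conjI)
      fix r assume r: "r \<in> R"
      have "br r = a \<longleftrightarrow> r = br a" "br r = br a \<longleftrightarrow> r = a" using r a br_eq_iff by auto
      then show "merge d a t r \<in> R" "merge d a t (br r) = br (merge d a t r)"
        using r b a(2) unfolding merge_def by (smt (verit))+
    qed
    \<comment> \<open>Once a and t are identified, the reflection that exchanges them is no longer
      visible.\<close>
    have "merge d a t \<circ> ?s = merge d a t"
      using b False by (auto simp: fun_eq_iff merge_def refl_swap_def)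
    then have hs: "?h (act d ?s f) = ?h f" for f by (simp add: act_act[OF eq Wc_equi[OF W]])
    have "?h (xm d b - xm d u) \<noteq> 0" if bu: "(b, u) \<in> P" for b u
    proof -
      have "merge d a t b \<noteq> merge d a t u"
      proof
        assume m: "merge d a t b = merge d a t u"
        have x: "br a + a = 2 * d + 1" "br t + t = 2 * d + 1" using br_arith a by auto
        have "b \<noteq> u" using mem(3)[OF bu] by simp
        then have "b = a \<and> u = t \<or> b = t \<and> u = a \<or> b = br a \<and> u = br t \<or> b = br t \<and> u = br a"
          using m b unfolding merge_def by (smt (verit))
        then show False using mem[OF bu] a x by auto
      qed
      moreover have "?h (xm d b - xm d u) = xm d (merge d a t b) - xm d (merge d a t u)"
        using mem[OF bu] ph_xexp[OF eq] by (simp add: act_def subst_diff R_eq)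
      moreover have "merge d a t b \<in> R" "merge d a t u \<in> R" using eq mem[OF bu] unfolding equi_def R_eq by auto
      ultimately show ?thesis using xm_eq_iff[of "merge d a t b" d "merge d a t u"] by (simp add: R_eq)
    qed
    then have hE: "?h E \<noteq> 0" unfolding E_def act_def act.h_prod using fP by (auto simp: act_def)
    show "to_fract E * S \<in> range to_fract"
    proof (rule reflection_step[OF W S neg nz H', where V="{?h}"])
      fix f assume "\<And>h. h \<in> {?h} \<Longrightarrow> h f = 0"
      then have "ev.p dvd f" using ev.kernel[of f] by (simp add: act_def)
      moreover have "ev.p = xm d a - xm d t" using a by (simp add: ph_single merge_def) (simp add: xexp_def)
      ultimately show "xm d a - xm d t dvd f" by simp
    qed (use hE hs in \<open>auto simp: act_hom act_def subst_uminus act.h_mult\<close>)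
  next
    case True
    let ?V = "{signev 1 a, signev (-1) a}"
    have one: "(1 :: Cq) \<noteq> 0" "(-1 :: Cq) \<noteq> 0" by simp_all
    interpret p: evaluation "\<lambda>e. e - Poly_Mapping.single a (Poly_Mapping.lookup e a)" "\<lambda>e. (1 :: Cq) powi Poly_Mapping.lookup e a" a
      by (rule evaluation_sign[OF one(1)])
    interpret m: evaluation "\<lambda>e. e - Poly_Mapping.single a (Poly_Mapping.lookup e a)" "\<lambda>e. (-1 :: Cq) powi Poly_Mapping.lookup e a" a
      by (rule evaluation_sign[OF one(2)])
    \<comment> \<open>For t = \<open>br a\<close> the reflection inverts x_a, so it negates the
      exponent of that variable and leaves the others.\<close>
    have ps: "ph d ?s e = e - Poly_Mapping.single a (Poly_Mapping.lookup e a) - Poly_Mapping.single a (Poly_Mapping.lookup e a)" for e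
    proof (rule additive_eqI[where \<phi>="ph d ?s"
          and \<psi>="\<lambda>e. e - Poly_Mapping.single a (Poly_Mapping.lookup e a) - Poly_Mapping.single a (Poly_Mapping.lookup e a)"])
      fix r k
      show "ph d ?s (Poly_Mapping.single r k) = Poly_Mapping.single r k - Poly_Mapping.single a (Poly_Mapping.lookup (Poly_Mapping.single r k) a)
         - Poly_Mapping.single a (Poly_Mapping.lookup (Poly_Mapping.single r k) a)"
      proof (cases "r = a")
        case ra: True
        have "\<not> t \<le> d" "br t = a" using True a by (auto simp: bar_def)
        then show ?thesis using ra a(5) by (simp add: ph_single refl_swap_def xexp_def single_uminus)
      next
        case ra: False
        have "r \<in> {1..d} \<Longrightarrow> r \<noteq> t" using True a by (auto simp: bar_def)
        then show ?thesis using ra a(5) True by (auto simp: ph_single refl_swap_def xexp_def lookup_single)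
      qed
    qed (simp_all add: ph_add lookup_add single_add)
    \<comment> \<open>The values 1 and -1 are their own inverses, so these evaluations do not notice
      the inversion of x_a.\<close>
    have hs: "signev v a (act d ?s f) = signev v a f" if v: "v = 1 \<or> v = -1" for v f
    proof -
      have "v powi (- k) = v powi k" for k using v by (auto simp: power_int_minus power_int_minus_left)
      moreover have l: "Poly_Mapping.lookup (ph d ?s e) a = - Poly_Mapping.lookup e a" for e
        unfolding ps lookup_minus lookup_single_eq by simp
      moreover have "ph d ?s e - Poly_Mapping.single a (Poly_Mapping.lookup (ph d ?s e) a) = e - Poly_Mapping.single a (Poly_Mapping.lookup e a)" for e
        unfolding l single_uminus unfolding ps by (simp only: diff_minus_eq_add diff_add_cancel)
      ultimately show ?thesis
        by (simp add: signev_def act_def subst_subst)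
    qed
    have ev_xm: "signev v a (xm d b) = (if b = a then lsingle 0 v else if b = br a then lsingle 0 (inverse v) else xm d b)" if "b \<in> R" for b v
    proof -
      have "b = br a \<longleftrightarrow> \<not> b \<le> d \<and> br b = a" using that a by (auto simp: bar_def R_eq)
      then show ?thesis using a(5) by (auto simp: signev_def xexp_def lookup_single bar_def)
    qed
    have hE: "signev v a E \<noteq> 0" if v: "v = 1 \<or> v = -1" for v
    proof -
      have vn: "v \<noteq> 0" "inverse v = v" using v by auto
      interpret ev: evaluation "\<lambda>e. e - Poly_Mapping.single a (Poly_Mapping.lookup e a)" "\<lambda>e. v powi Poly_Mapping.lookup e a" a
        by (rule evaluation_sign[OF vn(1)])
      have "signev v a (xm d b - xm d u) \<noteq> 0" if bu: "(b, u) \<in> P" for b u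
      proof -
        have x0: "xexp d r 1 \<noteq> 0" for r by (simp add: xexp_def) (metis lookup_single_eq lookup_zero zero_neq_one neg_equal_0_iff_equal)
        have "\<not> (b = a \<and> u = br a)" using mem(5)[OF bu] True by auto
        moreover have "\<not> (b = br a \<and> u = a)" using mem(3)[OF bu] br_arith[OF a(1)] a by auto
        moreover have "signev v a (xm d b - xm d u) = signev v a (xm d b) - signev v a (xm d u)"
          by (simp add: signev_def subst_diff)
        ultimately show ?thesis unfolding ev_xm[OF mem(1)[OF bu]] ev_xm[OF mem(2)[OF bu]]
          using mem[OF bu] xm_eq_iff[of b d u] lsingle_diff_nz[OF x0[of b], of 1 v] lsingle_diff_nz[OF x0[of u, symmetric], of v 1] vn
          by (auto simp: R_eq)
      qed
      then show ?thesis unfolding E_def signev_def ev.h_prod using fP by (auto simp: signev_def)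
    qed
    have hm: "signev 1 a (f * f') = signev 1 a f * signev 1 a f'" "signev (-1) a (f * f') = signev (-1) a f * signev (-1) a f'"
      "signev v a (- f) = - signev v a f" for f f' v
      unfolding signev_def by (rule p.h_mult m.h_mult subst_uminus)+
    show "to_fract E * S \<in> range to_fract"
    proof (rule reflection_step[OF W S neg nz H', where V="?V"])
      fix f assume f: "\<And>h. h \<in> ?V \<Longrightarrow> h f = 0"
      let ?x = "lsingle (Poly_Mapping.single a 1) 1"
      have pp: "p.p = ?x - lsingle 0 1" "m.p = ?x - lsingle 0 (-1)" by simp_all
      have "p.p dvd f" using f p.kernel[of f] by (simp add: signev_def)
      then obtain f' where f': "f = p.p * f'" by (elim dvdE)
      \<comment> \<open>After division by x_a - 1, evaluation at -1 multiplies the quotient by -2,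
        which is not a zero divisor; hence the quotient vanishes at -1 too and x_a + 1 can be split
        off.\<close>
      have "m.h f = m.h p.p * m.h f'" unfolding f' by (rule m.h_mult)
      moreover have "m.h p.p = - 2"
      proof -
        have "m.h p.p = lsingle 0 (-1) - lsingle 0 1" unfolding pp(1) by (simp add: subst_diff m.h_one)
        then show ?thesis by (simp add: single_uminus)
      qed
      moreover have "m.h f = 0" using f[of "signev (-1) a"] by (simp add: signev_def)
      ultimately have "m.h f' = 0" using two_laurent_nz by simp
      then have "m.p dvd f'" by (rule m.kernel)
      then have "p.p * m.p dvd f" unfolding f' by (rule mult_dvd_mono[OF dvd_refl])
      \<comment> \<open>The product (x_a - 1)(x_a + 1) is x_a - x_t times x_a, since x_t is the
        inverse of x_a.\<close>
      moreover have "p.p * m.p = (xm d a - xm d t) * ?x"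
      proof -
        have t: "\<not> t \<le> d" "br t = a" using True a by (auto simp: bar_def)
        have "xm d a = ?x" "xm d t * ?x = 1" using a(5) t by (simp_all add: xexp_def mult_single single_add[symmetric])
        then show ?thesis unfolding pp by (simp add: algebra_simps single_uminus)
      qed
      ultimately have "(xm d a - xm d t) * ?x dvd f" by (simp only:)
      then show "xm d a - xm d t dvd f" by (rule dvd_mult_left)
    qed (use hE hs in \<open>auto simp: hm\<close>)
  qed
qed

text \<open>The factors of the common denominator are removed one at a time by
  \<open>integral_step\<close>; the colouring is fixed by the reflection of each pair, so
  equivariance makes the value invariant as required. \<open>Laur_quotient\<close> finally confines
  the variables to x_1, ..., x_d.\<close>

lemma Bop_Laur:
  assumes F: "equivariant F" "\<And>c. F c \<in> Laur d"
  shows "Bop i k F c \<in> Laur d"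
proof (cases "c \<in> Col")
  case True
  have c: "symc c" using True symc_Col by blast
  let ?S = "Bop i k F c" and ?D = "\<Prod>s\<in>pairs c. pf s"
  have DS: "?D * ?S \<in> Laur d"
  proof -
    have "?D * ?S = (\<Sum>a\<in>R. yv i a powi k * (?D * wt i a c) * F (mv c a))"
      using True by (simp add: Bop_def sum_distrib_left mult_ac)
    also have "\<dots> \<in> Laur d" by (intro Laur_sum Laur_mult yv_powi_Laur D_wt c F(2))
    finally show ?thesis .
  qed
  have "P \<subseteq> pairs c \<Longrightarrow> (\<Prod>s\<in>P. pf s) * ?S \<in> range to_fract \<Longrightarrow> ?S \<in> range to_fract" if "finite P" for P
    using that
  proof (induction P rule: finite_induct)
    case (insert s P)
    obtain a t where s: "s = (a, t)" by (cases s)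
    have at: "(a, t) \<in> pairs c" using insert s by auto
    have a: "a \<in> R" "t \<in> R" "a \<noteq> t" "c a = c t" using at by (auto simp: pairs_def)
    have "actF d (refl_swap d a t) ?S = ?S"
      using equivariantD[OF equivariant_Bop[OF F(1)] refl_swap_Wc[OF a(1-3)], of i k c] refl_swap_fix[OF c a(1,2,4)] by simp
    then have "(\<Prod>s\<in>P. pf s) * ?S \<in> range to_fract"
      using integral_step[OF at c, of P ?S] insert unfolding s by blast
    then show ?case using insert by blast
  qed simp
  moreover have "?D * ?S \<in> range to_fract" using DS unfolding Laur_def by blast
  ultimately have "?S \<in> range to_fract" using finite_pairs[of c] by blast
  moreover have "?D \<in> Laur d" by (intro Laur_prod) (auto simp: pf_def pairs_def R_eq intro!: Laur_diff Laur_xvar)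
  moreover have "?D \<noteq> 0" using finite_pairs xneq by (auto simp: pf_def pairs_def)
  ultimately show ?thesis using DS Laur_quotient by blast
qed (simp add: Bop_def Laur_0)

end

section \<open>The representation space\<close>

lemma fibre_bij:
  assumes "finite A" "finite B" and card: "\<And>k. card {a \<in> A. f a = k} = card {b \<in> B. g b = k}"
  shows "\<exists>h. bij_betw h A B \<and> (\<forall>a\<in>A. g (h a) = f a)"
proof -
  have "\<exists>h. bij_betw h {a \<in> A. f a = k} {b \<in> B. g b = k}" for k
    using assms by (intro finite_same_card_bij) auto
  then obtain h where h: "\<And>k. bij_betw (h k) {a \<in> A. f a = k} {b \<in> B. g b = k}" by metis
  have hm: "h (f a) a \<in> B" "g (h (f a) a) = f a" if "a \<in> A" for a
    using h[of "f a"] that unfolding bij_betw_def by auto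
  have "inj_on (\<lambda>a. h (f a) a) A"
  proof (rule inj_onI)
    fix a a' assume a: "a \<in> A" "a' \<in> A" "h (f a) a = h (f a') a'"
    then have "f a = f a'" using hm by metis
    then show "a = a'" using a h[of "f a"] unfolding bij_betw_def inj_on_def by auto
  qed
  moreover have "B \<subseteq> (\<lambda>a. h (f a) a) ` A"
  proof
    fix b assume "b \<in> B"
    then have "b \<in> h (g b) ` {a \<in> A. f a = g b}" using h[of "g b"] unfolding bij_betw_def by auto
    then obtain a where "a \<in> A" "f a = g b" "b = h (g b) a" by blast
    then show "b \<in> (\<lambda>a. h (f a) a) ` A" by (intro image_eqI[of _ _ a]) simp_all
  qed
  ultimately have "bij_betw (\<lambda>a. h (f a) a) A B" using hm unfolding bij_betw_def by blast
  then show ?thesis using hm by blast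
qed

definition psum :: "(nat \<Rightarrow> nat) \<Rightarrow> nat \<Rightarrow> nat" where
  "psum v k = (\<Sum>j = 1..k. v j)"

lemma blk_psum: "blk v i = {psum v (i - 1) + 1 .. psum v i}"
  by (simp add: blk_def psum_def)

lemma psum_mono: "i \<le> j \<Longrightarrow> psum v i \<le> psum v j"
  unfolding psum_def by (rule sum_mono2) auto

lemma psum_step: "1 \<le> k \<Longrightarrow> psum v k = psum v (k - 1) + v k"
  by (cases k) (simp_all add: psum_def)

lemma psum_sym:
  assumes v: "v \<in> Lam N d" and k: "k \<le> N"
  shows "psum v (N - k) + psum v k = 2 * d"
proof -
  have "psum v k = (\<Sum>j = 1..k. v (N + 1 - j))"
    unfolding psum_def using v k by (intro sum.cong) (auto simp: Lam_def)
  also have "\<dots> = (\<Sum>j\<in>{N - k + 1..N}. v j)"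
    by (rule sum.reindex_bij_witness[where i="\<lambda>j. N + 1 - j" and j="\<lambda>j. N + 1 - j"]) (use k in auto)
  finally have "psum v (N - k) + psum v k = sum v ({1..N - k} \<union> {N - k + 1..N})"
    unfolding psum_def by (subst sum.union_disjoint) auto
  also have "{1..N - k} \<union> {N - k + 1..N} = {1..N}" using k by auto
  also have "sum v {1..N} = 2 * d" using v unfolding Lam_def by blast
  finally show ?thesis .
qed

lemma finite_Lam: "finite (Lam N d)"
proof -
  have "Lam N d \<subseteq> {v. \<forall>i. (i \<in> {1..N} \<longrightarrow> v i \<in> {0..2 * d}) \<and> (i \<notin> {1..N} \<longrightarrow> v i = 0)}"
  proof (rule subsetI, rule CollectI, rule allI)
    fix v i assume v: "v \<in> Lam N d"
    have "v i \<le> sum v {1..N}" if "i \<in> {1..N}" using that by (intro member_le_sum) auto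
    then show "(i \<in> {1..N} \<longrightarrow> v i \<in> {0..2 * d}) \<and> (i \<notin> {1..N} \<longrightarrow> v i = 0)"
      using v by (auto simp: Lam_def)
  qed
  then show ?thesis by (rule finite_subset) (rule finite_set_of_finite_funs; simp)
qed

lemma the_inv_to_fract: "the_inv to_fract (to_fract f) = f"
  by (rule the_inv_f_f) (simp add: inj_on_def)

lemma lookup_const_mult: "Poly_Mapping.lookup (lsingle 0 c * f) e = c * Poly_Mapping.lookup f e"
proof -
  have "lsingle 0 c * f = (\<Sum>e\<in>Poly_Mapping.keys f. lsingle e (c * Poly_Mapping.lookup f e))"
    by (subst (1) poly_mapping_expand[of f]) (simp add: sum_distrib_left mult_single)
  then show ?thesis by (simp add: lookup_sum lookup_single when_def in_keys_iff)
qed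

lemma common_denominator:
  assumes "finite C"
  shows "\<exists>s::complex poly. s \<noteq> 0 \<and> (\<forall>c\<in>C. to_fract s * c \<in> range to_fract)"
  using assms
proof (induction C rule: finite_induct)
  case (insert c C)
  then obtain s :: "complex poly" where s: "s \<noteq> 0" "\<forall>c\<in>C. to_fract s * c \<in> range to_fract" by blast
  obtain a b where c: "b \<noteq> 0" "c = to_fract a / to_fract b"
    by (cases c) (auto simp: Fract_conv_to_fract)
  have "to_fract (b * s) * c = to_fract (s * a)" using c by simp
  then have "to_fract (b * s) * c \<in> range to_fract" by blast
  moreover have "to_fract (b * s) * c' \<in> range to_fract" if "c' \<in> C" for c'
  proof -
    have "to_fract s * c' \<in> range to_fract" using s(2) that by (rule bspec)
    then obtain p where "to_fract s * c' = to_fract p" by (rule rangeE)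
    then have "to_fract (b * s) * c' = to_fract (b * p)" by (simp add: mult.assoc)
    then show ?thesis by blast
  qed
  ultimately have "\<forall>c'\<in>insert c C. to_fract (b * s) * c' \<in> range to_fract" by blast
  then show ?case using s(1) c(1) by (intro exI[of _ "b * s"]) (simp only: mult_eq_0_iff not_False_eq_True simp_thms)
qed (auto intro: exI[of _ 1])

context affine_rep
begin

definition NN :: nat where "NN = 2 * n + 1"

lemma int_NN: "int NN = N"
  by (simp add: NN_def)

text \<open>The colouring of the standard partition [v]. The block of r is the first one whose
  partial sum reaches r, so empty blocks are passed over.\<close>

definition std :: "(nat \<Rightarrow> nat) \<Rightarrow> nat \<Rightarrow> int" where
  "std v r = (if r \<in> R then int (LEAST k. r \<le> psum v k) else 0)"

definition counts :: "(nat \<Rightarrow> int) \<Rightarrow> nat \<Rightarrow> nat" where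
  "counts c k = (if k \<in> {1..NN} then card {r \<in> R. c r = int k} else 0)"

lemma psum_NN: "v \<in> Lam NN d \<Longrightarrow> psum v NN = 2 * d"
  unfolding Lam_def psum_def by blast

lemma std_range:
  assumes v: "v \<in> Lam NN d" and r: "r \<in> R"
  obtains k where "std v r = int k" "1 \<le> k" "k \<le> NN" "r \<in> blk v k"
proof -
  define k where "k = (LEAST k. r \<le> psum v k)"
  have ex: "r \<le> psum v NN" using r psum_NN[OF v] by (simp add: R_eq)
  have 1: "r \<le> psum v k" unfolding k_def using ex by (rule LeastI)
  have 2: "k \<le> NN" unfolding k_def using ex by (rule Least_le)
  have 3: "1 \<le> k" using 1 r by (cases k) (auto simp: psum_def R_eq)
  have "\<not> r \<le> psum v (k - 1)" using 3 not_less_Least[of "k - 1" "\<lambda>k. r \<le> psum v k"] by (simp add: k_def)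
  then show ?thesis using that[of k] 1 2 3 r by (simp add: std_def k_def blk_psum)
qed

lemma blk_unique: "r \<in> blk v i \<Longrightarrow> r \<in> blk v j \<Longrightarrow> 1 \<le> i \<Longrightarrow> 1 \<le> j \<Longrightarrow> i = j"
proof (rule ccontr)
  assume a: "r \<in> blk v i" "r \<in> blk v j" "1 \<le> i" "1 \<le> j" "i \<noteq> j"
  then consider "i \<le> j - 1" | "j \<le> i - 1" by linarith
  then show False using a psum_mono[of i "j - 1" v] psum_mono[of j "i - 1" v] by cases (auto simp: blk_psum)
qed

lemma blk_R: "v \<in> Lam NN d \<Longrightarrow> 1 \<le> k \<Longrightarrow> k \<le> NN \<Longrightarrow> r \<in> blk v k \<Longrightarrow> r \<in> R"
  using psum_mono[of k NN v] psum_NN[of v] by (auto simp: blk_psum R_eq)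

lemma std_iff:
  assumes v: "v \<in> Lam NN d" and k: "1 \<le> k" "k \<le> NN"
  shows "std v r = int k \<longleftrightarrow> r \<in> blk v k"
proof (cases "r \<in> R")
  case True
  obtain k' where "std v r = int k'" "1 \<le> k'" "k' \<le> NN" "r \<in> blk v k'" by (rule std_range[OF v True])
  then show ?thesis using blk_unique k by auto
next
  case False
  then show ?thesis using blk_R[OF v k] k by (auto simp: std_def)
qed

lemma blk_eq: "v \<in> Lam NN d \<Longrightarrow> 1 \<le> k \<Longrightarrow> k \<le> NN \<Longrightarrow> blk v k = {r \<in> R. std v r = int k}"
  using std_iff blk_R by blast

lemma std_Col:
  assumes v: "v \<in> Lam NN d"
  shows "std v \<in> Col"
proof -
  have "1 \<le> std v r \<and> std v r \<le> N \<and> std v (br r) = N + 1 - std v r" if r: "r \<in> R" for r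
  proof -
    obtain k where k: "std v r = int k" "1 \<le> k" "k \<le> NN" "r \<in> blk v k" by (rule std_range[OF v r])
    have "psum v (NN - k) + psum v k = 2 * d" "psum v (NN - (k - 1)) + psum v (k - 1) = 2 * d"
      using psum_sym[OF v, of k] psum_sym[OF v, of "k - 1"] k by auto
    moreover have "NN - (k - 1) = NN + 1 - k" "NN + 1 - k - 1 = NN - k" using k by auto
    moreover have "br r + r = 2 * d + 1" by (rule br_arith[OF r])
    ultimately have "br r \<in> blk v (NN + 1 - k)" using k(4) unfolding blk_psum by simp
    then have "std v (br r) = int (NN + 1 - k)" using std_iff[OF v, of "NN + 1 - k"] k by simp
    then show ?thesis using k int_NN by auto
  qed
  then show ?thesis by (simp add: Col_def std_def)
qed

lemma counts_std: "v \<in> Lam NN d \<Longrightarrow> counts (std v) = v"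
proof
  fix k assume v: "v \<in> Lam NN d"
  show "counts (std v) k = v k"
  proof (cases "k \<in> {1..NN}")
    case True
    then have "counts (std v) k = card (blk v k)" using blk_eq[OF v] by (simp add: counts_def)
    also have "\<dots> = v k" using True psum_step[of k v] by (simp add: blk_psum)
    finally show ?thesis .
  next
    case False
    then have "v k = 0" using v unfolding Lam_def by blast
    then show ?thesis using False unfolding counts_def by (simp only: if_False)
  qed
qed

lemma counts_Lam:
  assumes c: "c \<in> Col"
  shows "counts c \<in> Lam NN d"
proof -
  have "counts c i = counts c (NN + 1 - i)" if i: "i \<in> {1..NN}" for i
  proof -
    have "card {r \<in> R. c r = int i} = card {r \<in> R. c r = int (NN + 1 - i)}"
    proof (rule bij_betw_same_card[of br], rule bij_betw_byWitness[where f'=br])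
      show "br ` {r \<in> R. c r = int i} \<subseteq> {r \<in> R. c r = int (NN + 1 - i)}"
        "br ` {r \<in> R. c r = int (NN + 1 - i)} \<subseteq> {r \<in> R. c r = int i}"
        using i symcD[OF symc_Col[OF c]] int_NN by (auto simp: of_nat_diff)
    qed auto
    then show ?thesis using i by (auto simp: counts_def)
  qed
  moreover have "(\<Sum>i = 1..NN. counts c i) = 2 * d"
  proof -
    have "(\<Sum>i = 1..NN. counts c i) = (\<Sum>i\<in>{1..NN}. sum (\<lambda>_. 1) {r \<in> R. nat (c r) = i})"
    proof (rule sum.cong[OF refl])
      fix i assume i: "i \<in> {1..NN}"
      have "{r \<in> R. c r = int i} = {r \<in> R. nat (c r) = i}" using i by auto
      then show "counts c i = sum (\<lambda>_. 1) {r \<in> R. nat (c r) = i}" using i by (simp add: counts_def)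
    qed
    also have "\<dots> = sum (\<lambda>_. 1) R"
    proof (rule sum.group)
      show "(\<lambda>r. nat (c r)) ` R \<subseteq> {1..NN}"
      proof
        fix k assume "k \<in> (\<lambda>r. nat (c r)) ` R"
        then obtain r where "r \<in> R" "k = nat (c r)" by blast
        moreover then have "1 \<le> c r" "c r \<le> int NN" using c unfolding int_NN by (simp_all add: Col_def)
        ultimately show "k \<in> {1..NN}" by auto
      qed
    qed auto
    finally show ?thesis by (simp add: R_eq)
  qed
  moreover have "counts c i = 0" if "i \<notin> {1..NN}" for i using that unfolding counts_def by (simp only: if_False)
  ultimately show ?thesis unfolding Lam_def by blast
qed

text \<open>One index from each pair r, r': the one of smaller colour, and in the middle block,
  where the colours agree, the one with r at most d. A bijection between two such halves extends
  uniquely to a map commuting with \<open>bar\<close>.\<close>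

definition half :: "(nat \<Rightarrow> int) \<Rightarrow> nat set" where
  "half c = {r \<in> R. c r \<le> int n \<or> (c r = int n + 1 \<and> r \<le> d)}"

lemma half_br: "c \<in> Col \<Longrightarrow> r \<in> R \<Longrightarrow> br r \<in> half c \<longleftrightarrow> r \<notin> half c"
  using symcD[OF symc_Col, of c r] br_arith[of r] by (auto simp: half_def)

text \<open>Below the middle the half contains the entire block. The middle block is a union of
  mirror pairs, one member of each lying in the half, whence the division by 2.\<close>

lemma card_half:
  assumes c: "c \<in> Col"
  shows "card {r \<in> half c. c r = k} = (if 1 \<le> k \<and> k \<le> int n then counts c (nat k)
      else if k = int n + 1 then counts c (n + 1) div 2 else 0)"
proof -
  consider "1 \<le> k" "k \<le> int n" | "k = int n + 1" | "k \<le> 0 \<or> int n + 1 < k" by linarith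
  then show ?thesis
  proof cases
    case 1
    then have "{r \<in> half c. c r = k} = {r \<in> R. c r = int (nat k)}" by (auto simp: half_def)
    moreover have "nat k \<in> {1..NN}" using 1 by (auto simp: NN_def)
    ultimately show ?thesis using 1 unfolding counts_def by simp
  next
    case 2
    let ?X = "{r \<in> half c. c r = int n + 1}"
    have X: "?X \<subseteq> R" "br ` ?X \<subseteq> R" by (auto simp: half_def)
    have "{r \<in> R. c r = int (n + 1)} = ?X \<union> br ` ?X"
    proof (intro equalityI subsetI)
      fix r assume r: "r \<in> {r \<in> R. c r = int (n + 1)}"
      then have "r \<in> half c \<or> br r \<in> half c" "c (br r) = int n + 1" "br (br r) = r"
        using half_br[OF c] symcD[OF symc_Col[OF c]] by auto
      then show "r \<in> ?X \<union> br ` ?X" using r by (auto intro: image_eqI[of r br "br r"])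
    next
      fix r assume "r \<in> ?X \<union> br ` ?X"
      then show "r \<in> {r \<in> R. c r = int (n + 1)}" using symcD[OF symc_Col[OF c]] X by (auto simp: half_def)
    qed
    moreover have "?X \<inter> br ` ?X = {}" using half_br[OF c] X by auto
    moreover have "card (br ` ?X) = card ?X" by (rule card_image) (use X in \<open>auto simp: inj_on_def br_eq_iff subset_iff\<close>)
    moreover have "finite ?X" using X(1) finite_R by (rule finite_subset)
    ultimately have "card {r \<in> R. c r = int (n + 1)} = 2 * card ?X"
      by (simp add: card_Un_disjoint)
    moreover have "n + 1 \<in> {1..NN}" by (simp add: NN_def)
    ultimately have "counts c (n + 1) = 2 * card ?X" unfolding counts_def by (simp only: if_True)
    then show ?thesis using 2 by simp
  next
    case 3
    then have "{r \<in> half c. c r = k} = {}" using c by (auto simp: half_def Col_def)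
    then show ?thesis using 3 by (auto simp: card_eq_0_iff)
  qed
qed

text \<open>Equal block sizes give the halves equal fibres, so there is a colour preserving
  bijection between them. Extended to the other indices by commutation with \<open>bar\<close>, it
  is a signed permutation that carries one colouring to the other.\<close>

lemma exists_Wc:
  assumes c: "c \<in> Col" "c' \<in> Col" "counts c = counts c'"
  shows "\<exists>w\<in>Wc d. c \<circ> w = c'"
proof -
  have "finite (half c)" for c by (rule finite_subset[OF _ finite_R]) (auto simp: half_def)
  then have "\<exists>h. bij_betw h (half c') (half c) \<and> (\<forall>r\<in>half c'. c (h r) = c' r)"
    by (intro fibre_bij) (simp_all only: card_half[OF c(1)] card_half[OF c(2)] c(3))
  then obtain h where h: "bij_betw h (half c') (half c)" "\<And>r. r \<in> half c' \<Longrightarrow> c (h r) = c' r" by blast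
  have hR: "half c \<subseteq> R" for c by (auto simp: half_def)
  have hm: "h r \<in> half c" "h r \<in> R" if "r \<in> half c'" for r
    using h(1) that hR[of c] unfolding bij_betw_def by auto
  have hi: "h r = h s \<Longrightarrow> r = s" if "r \<in> half c'" "s \<in> half c'" for r s
    using h(1) that unfolding bij_betw_def inj_on_def by auto
  define w where "w r = (if r \<in> half c' then h r else if r \<in> R then br (h (br r)) else r)" for r
  have wR: "w r \<in> R" if "r \<in> R" for r using that hm half_br[OF c(2) that] by (auto simp: w_def)
  have wh: "w r \<in> half c \<longleftrightarrow> r \<in> half c'" if "r \<in> R" for r
    using that hm half_br[OF c(2) that] half_br[OF c(1)] by (auto simp: w_def)
  have wb: "w (br r) = br (w r)" if "r \<in> R" for r
    using that half_br[OF c(2) that] hm by (auto simp: w_def)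
  have inj: "inj_on w R"
  proof (rule inj_onI)
    fix r s assume r: "r \<in> R" "s \<in> R" "w r = w s"
    then have "r \<in> half c' \<longleftrightarrow> s \<in> half c'" using wh by metis
    then show "r = s"
      using r hi[of r s] hi[of "br r" "br s"] half_br[OF c(2)] hm by (auto simp: w_def br_eq_iff)
  qed
  have "bij_betw w R R" using inj wR endo_inj_surj[OF finite_R _ inj] unfolding bij_betw_def by blast
  moreover have "w r = r" if "r \<notin> R" for r using that hR[of c'] by (auto simp: w_def)
  ultimately have "w permutes R" by (rule bij_imp_permutes)
  then have W: "w \<in> Wc d" using wb unfolding Wc_def R_eq by simp
  have "c (w r) = c' r" for r
  proof (cases "r \<in> R")
    case True
    then show ?thesis using h(2) hm half_br[OF c(2) True] symcD[OF symc_Col[OF c(1)]] symcD[OF symc_Col[OF c(2)]]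
      by (auto simp: w_def)
  next
    case False
    then show ?thesis using c hR[of c'] by (auto simp: w_def Col_def)
  qed
  then show ?thesis using W by (auto simp: fun_eq_iff intro!: bexI[of _ w])
qed

lemma Wblk_iff:
  assumes v: "v \<in> Lam NN d"
  shows "w \<in> Wblk NN d v \<longleftrightarrow> w \<in> Wc d \<and> std v \<circ> w = std v"
proof
  assume w: "w \<in> Wblk NN d v"
  then have W: "w \<in> Wc d" by (simp add: Wblk_def)
  have "std v (w r) = std v r" for r
  proof (cases "r \<in> R")
    case True
    obtain k where k: "std v r = int k" "1 \<le> k" "k \<le> NN" "r \<in> blk v k" by (rule std_range[OF v True])
    then have "w ` blk v k = blk v k" using w unfolding Wblk_def by simp
    then have "w r \<in> blk v k" using k by blast
    then have "std v (w r) = int k" using std_iff[OF v k(2,3)] by blast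
    then show ?thesis using k(1) by simp
  qed (simp add: std_def Wc_R[OF W])
  then show "w \<in> Wc d \<and> std v \<circ> w = std v" using W by auto
next
  assume w: "w \<in> Wc d \<and> std v \<circ> w = std v"
  have "w ` blk v k = blk v k" if k: "k \<in> {1..NN}" for k
  proof (rule endo_inj_surj)
    show "finite (blk v k)" by (simp add: blk_def)
    show "w ` blk v k \<subseteq> blk v k" using w k by (auto simp: blk_eq[OF v] Wc_R fun_eq_iff)
    show "inj_on w (blk v k)" using w Wc_inj by (auto simp: inj_on_def)
  qed
  then show "w \<in> Wblk NN d v" using w by (simp add: Wblk_def)
qed

definition invar :: "(nat \<Rightarrow> nat) \<Rightarrow> rfun set" where
  "invar v = {S \<in> Laur d. \<forall>w\<in>Wc d. std v \<circ> w = std v \<longrightarrow> actF d w S = S}"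

lemma Rinv_invar:
  assumes v: "v \<in> Lam NN d"
  shows "f \<in> Rinv NN d v \<longleftrightarrow> to_fract f \<in> invar v \<and> (\<forall>e. Poly_Mapping.lookup f e \<in> Claurent)"
proof -
  have k: "(\<forall>e \<in> Poly_Mapping.keys f. Poly_Mapping.keys e \<subseteq> {1..d}) \<longleftrightarrow> to_fract f \<in> Laur d"
    unfolding kill_iff[symmetric] by (auto simp: Laur_def image_iff)
  have "(\<forall>w\<in>Wblk NN d v. W_act d w f = f) \<longleftrightarrow> (\<forall>w\<in>Wc d. std v \<circ> w = std v \<longrightarrow> actF d w (to_fract f) = to_fract f)"
    if "to_fract f \<in> Laur d"
  proof -
    have "kill d f = f" using that by (auto simp: Laur_def)
    then show ?thesis by (auto simp: Wblk_iff[OF v] W_act_eq actF_to_fract)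
  qed
  then show ?thesis unfolding Rinv_def invar_def using k by blast
qed

text \<open>After extension of scalars the integrality of coefficients disappears: a vector has
  finitely many coefficients, because \<open>Lam\<close> is finite and each component is a Laurent
  polynomial, and a common denominator brings all of them into \<complex>[q].\<close>

lemma PC_iff: "m \<in> PC NN d \<longleftrightarrow> (\<forall>v. if v \<in> Lam NN d then m v \<in> invar v else m v = 0)"
proof
  assume "m \<in> PC NN d"
  then obtain s :: "complex poly" where s: "s \<noteq> 0" "pscale (to_fract s) m \<in> Pint NN d" by (auto simp: PC_def)
  have s0: "to_fract s \<noteq> (0 :: Cq)" using s by simp
  show "\<forall>v. if v \<in> Lam NN d then m v \<in> invar v else m v = 0"
  proof
    fix v
    have m: "m v = coeffF (inverse (to_fract s)) * pscale (to_fract s) m v"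
      using s0 coeffF_eq_0_iff by (simp add: pscale_def coeffF_inverse)
    have P: "if v \<in> Lam NN d then pscale (to_fract s) m v \<in> to_fract ` Rinv NN d v else pscale (to_fract s) m v = 0"
      using s(2) by (simp add: Pint_def)
    show "if v \<in> Lam NN d then m v \<in> invar v else m v = 0"
    proof (cases "v \<in> Lam NN d")
      case True
      then have "pscale (to_fract s) m v \<in> invar v" using P Rinv_invar by auto
      then have "m v \<in> invar v" unfolding m invar_def by (simp add: Laur_mult Laur_coeffF actF_mult actF_coeffF)
      then show ?thesis using True by simp
    next
      case False
      then show ?thesis using P m by simp
    qed
  qed
next
  assume m: "\<forall>v. if v \<in> Lam NN d then m v \<in> invar v else m v = 0"
  have "\<exists>f. m v = to_fract f" if "v \<in> Lam NN d" for v
  proof -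
    have "m v \<in> invar v" using m that by metis
    then show ?thesis by (auto simp: invar_def Laur_def)
  qed
  then obtain f where f: "\<And>v. v \<in> Lam NN d \<Longrightarrow> m v = to_fract (f v)" by metis
  define C where "C = (\<Union>v\<in>Lam NN d. Poly_Mapping.lookup (f v) ` Poly_Mapping.keys (f v))"
  have "finite C" unfolding C_def by (simp add: finite_Lam)
  then obtain s :: "complex poly" where s: "s \<noteq> 0" "\<forall>c\<in>C. to_fract s * c \<in> range to_fract"
    using common_denominator by blast
  have "pscale (to_fract s) m \<in> Pint NN d"
    unfolding Pint_def
  proof (rule CollectI, rule allI)
    fix v
    show "if v \<in> Lam NN d then pscale (to_fract s) m v \<in> to_fract ` Rinv NN d v else pscale (to_fract s) m v = 0"
    proof (cases "v \<in> Lam NN d")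
      case True
      have e: "pscale (to_fract s) m v = to_fract (lsingle 0 (to_fract s) * f v)"
        using f[OF True] by (simp add: pscale_def coeffF_def)
      have "m v \<in> invar v" using m True by metis
      then have "pscale (to_fract s) m v \<in> invar v"
        by (simp add: pscale_def invar_def Laur_mult Laur_coeffF actF_mult actF_coeffF)
      moreover have "to_fract s * Poly_Mapping.lookup (f v) e \<in> Claurent" for e
      proof -
        have "to_fract s * Poly_Mapping.lookup (f v) e \<in> range to_fract"
        proof (cases "e \<in> Poly_Mapping.keys (f v)")
          case e: True
          then show ?thesis using s(2) True unfolding C_def by blast
        next
          case False
          then show ?thesis using to_fract_0 by (metis in_keys_iff mult_zero_right rangeI)
        qed
        then obtain p where "to_fract s * Poly_Mapping.lookup (f v) e = to_fract p / qv ^ 0" by auto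
        then show ?thesis unfolding Claurent_def by blast
      qed
      ultimately have "lsingle 0 (to_fract s) * f v \<in> Rinv NN d v"
        unfolding Rinv_invar[OF True] e lookup_const_mult by blast
      then show ?thesis using True unfolding e by (simp only: if_True) blast
    next
      case False
      then show ?thesis using m by (simp add: pscale_def)
    qed
  qed
  then show "m \<in> PC NN d" unfolding PC_def using s by blast
qed

text \<open>The permutation chosen in \<open>at_part\<close> differs from w by one that fixes the
  colouring \<open>std v\<close>, and S is invariant under those; so the choice may be replaced by
  w.\<close>

lemma at_part_act:
  assumes v: "v \<in> Lam NN d" and c: "c \<in> Col" "counts c = v" and w: "w \<in> Wc d" "c \<circ> w = std v" and S: "S \<in> invar v"
    and I: "\<And>k. k \<in> {1..NN} \<Longrightarrow> I k = {r \<in> R. c r = int k}"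
  shows "at_part NN d I S = actF d w S"
proof -
  have u: "(\<lambda>k. if k \<in> {1..NN} then card (I k) else 0) = v"
    unfolding c(2)[symmetric] by (auto simp: fun_eq_iff counts_def I)
  let ?P = "\<lambda>\<sigma>. \<sigma> \<in> Wc d \<and> (\<forall>k \<in> {1..NN}. \<sigma> ` blk v k = I k)"
  have "?P w"
  proof (intro conjI ballI w)
    fix k assume k: "k \<in> {1..NN}"
    have wR: "w ` R = R" using Wc_bij[OF w(1)] by (simp add: bij_betw_def)
    have "c (w r) = std v r" for r using w(2) by (metis comp_apply)
    then have e: "r \<in> blk v k \<longleftrightarrow> r \<in> R \<and> c (w r) = int k" for r using k blk_eq[OF v, of k] by simp
    have "w ` blk v k = {r \<in> R. c r = int k}"
    proof (intro equalityI subsetI)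
      fix r assume "r \<in> {r \<in> R. c r = int k}"
      then have r: "r \<in> w ` R" "c r = int k" unfolding wR by simp_all
      then obtain r' where r': "r = w r'" "r' \<in> R" by (elim imageE)
      then have "r' \<in> blk v k" using e r by simp
      then show "r \<in> w ` blk v k" using r'(1) by (intro image_eqI)
    next
      fix r assume "r \<in> w ` blk v k"
      then obtain r' where "r = w r'" "r' \<in> blk v k" by (elim imageE)
      then show "r \<in> {r \<in> R. c r = int k}" using e Wc_R[OF w(1)] by simp
    qed
    then show "w ` blk v k = I k" by (simp only: I[OF k])
  qed
  then have P: "?P (SOME \<sigma>. ?P \<sigma>)" by (rule someI[of ?P w])
  define \<sigma> where "\<sigma> = (SOME \<sigma>. ?P \<sigma>)"
  have \<sigma>: "\<sigma> \<in> Wc d" "\<And>k. k \<in> {1..NN} \<Longrightarrow> \<sigma> ` blk v k = I k" using P unfolding \<sigma>_def by auto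
  have "c (\<sigma> r) = std v r" for r
  proof (cases "r \<in> R")
    case True
    obtain k where k: "std v r = int k" "1 \<le> k" "k \<le> NN" "r \<in> blk v k" by (rule std_range[OF v True])
    then have "\<sigma> r \<in> I k" using \<sigma>(2)[of k] by auto
    then show ?thesis using k by (simp add: I)
  next
    case False
    then show ?thesis using c by (simp add: std_def Col_def Wc_R[OF \<sigma>(1)])
  qed
  then have c\<sigma>: "c \<circ> \<sigma> = std v" by auto
  let ?i = "inv_into UNIV w"
  have wi: "w \<circ> ?i = id" "?i \<circ> w = id" using w(1) unfolding Wc_def by (auto dest: permutes_inv_o)
  have "std v \<circ> (?i \<circ> \<sigma>) = c \<circ> (w \<circ> ?i) \<circ> \<sigma>" unfolding w(2)[symmetric] by (simp only: comp_assoc)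
  then have "std v \<circ> (?i \<circ> \<sigma>) = std v" using wi c\<sigma> by simp
  then have inv: "actF d (?i \<circ> \<sigma>) S = S" using S Wc_comp[OF Wc_inv[OF w(1)] \<sigma>(1)] by (simp add: invar_def)
  obtain f where f: "S = to_fract f" "kill d f = f" using S by (auto simp: invar_def elim: LaurE)
  have "at_part NN d I S = to_fract (W_act d \<sigma> f)"
    unfolding at_part_def Let_def u \<sigma>_def f(1) the_inv_to_fract by (rule refl)
  also have "\<dots> = actF d \<sigma> S" using f \<sigma>(1) by (simp add: W_act_eq actF_to_fract)
  also have "\<sigma> = w \<circ> (?i \<circ> \<sigma>)" using wi by (simp add: comp_assoc[symmetric])
  also have "actF d (w \<circ> (?i \<circ> \<sigma>)) S = actF d w S"
    using actF_actF[OF w(1) Wc_comp[OF Wc_inv[OF w(1)] \<sigma>(1)], of S] by (simp only: inv)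
  finally show ?thesis .
qed

definition Qs :: "((nat \<Rightarrow> int) \<Rightarrow> rfun) set" where
  "Qs = {F. (\<forall>c. c \<notin> Col \<longrightarrow> F c = 0) \<and> (\<forall>c. F c \<in> Laur d) \<and> equivariant F}"

text \<open>\<open>cE\<close> evaluates a vector at all set partitions, \<open>cD\<close> restricts to the standard partitions \<open>[v]\<close>.\<close>

definition cE :: "pvec \<Rightarrow> (nat \<Rightarrow> int) \<Rightarrow> rfun" where
  "cE m c = (if c \<in> Col then at_part NN d (\<lambda>k. {r \<in> R. c r = int k}) (m (counts c)) else 0)"

definition cD :: "((nat \<Rightarrow> int) \<Rightarrow> rfun) \<Rightarrow> pvec" where
  "cD F v = (if v \<in> Lam NN d then F (std v) else 0)"

lemma PC_invar: "m \<in> PC NN d \<Longrightarrow> v \<in> Lam NN d \<Longrightarrow> m v \<in> invar v"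
  unfolding PC_iff by metis

lemma exists_std: "c \<in> Col \<Longrightarrow> \<exists>w\<in>Wc d. c \<circ> w = std (counts c)"
  by (rule exists_Wc) (simp_all add: std_Col counts_Lam counts_std)

lemma cE_act:
  assumes "m \<in> PC NN d" "c \<in> Col" "w \<in> Wc d" "c \<circ> w = std (counts c)"
  shows "cE m c = actF d w (m (counts c))"
  using at_part_act[OF counts_Lam[OF assms(2)] assms(2) refl assms(3,4) PC_invar[OF assms(1) counts_Lam[OF assms(2)]]] assms(2)
  by (simp add: cE_def)

lemma counts_act: "w \<in> Wc d \<Longrightarrow> counts (c \<circ> w) = counts c"
proof
  fix k assume w: "w \<in> Wc d"
  have "w ` R = R" using Wc_bij[OF w] by (simp add: bij_betw_def)
  then have "bij_betw w {r \<in> R. c (w r) = int k} {r \<in> R. c r = int k}"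
    unfolding bij_betw_def inj_on_def using Wc_inj[OF w] Wc_R[OF w] by auto
  then show "counts (c \<circ> w) k = counts c k" by (simp add: counts_def bij_betw_same_card)
qed

text \<open>If w' makes c \<circ> w standard, then w \<circ> w' makes c standard. Equivariance is
  then the composition law of the action.\<close>

lemma cE_Qs:
  assumes m: "m \<in> PC NN d"
  shows "cE m \<in> Qs"
proof -
  have "cE m c \<in> Laur d" for c
  proof (cases "c \<in> Col")
    case True
    obtain w where w: "w \<in> Wc d" "c \<circ> w = std (counts c)" using exists_std[OF True] by blast
    show ?thesis using cE_act[OF m True w] PC_invar[OF m counts_Lam[OF True]] w(1) by (simp add: invar_def Laur_actF)
  qed (simp add: cE_def Laur_0)
  moreover have "cE m c = actF d w (cE m (c \<circ> w))" if w: "w \<in> Wc d" for w c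
  proof (cases "c \<in> Col")
    case True
    have C: "c \<circ> w \<in> Col" using True w by (simp add: Col_act)
    obtain w' where w': "w' \<in> Wc d" "c \<circ> w \<circ> w' = std (counts (c \<circ> w))" using exists_std[OF C] by blast
    have "c \<circ> (w \<circ> w') = std (counts c)" using w' counts_act[OF w] by (simp add: comp_assoc)
    then have "cE m c = actF d (w \<circ> w') (m (counts c))" using cE_act[OF m True] Wc_comp[OF w w'(1)] by blast
    also have "\<dots> = actF d w (cE m (c \<circ> w))"
      unfolding cE_act[OF m C w'] counts_act[OF w] by (rule actF_actF[OF w w'(1), symmetric])
    finally show ?thesis .
  qed (simp add: cE_def Col_act w)
  moreover have "cE m c = 0" if "c \<notin> Col" for c using that by (simp add: cE_def)
  ultimately show ?thesis unfolding Qs_def equivariant_def by blast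
qed

lemma cD_PC:
  assumes F: "F \<in> Qs"
  shows "cD F \<in> PC NN d"
  unfolding PC_iff
proof
  fix v
  show "if v \<in> Lam NN d then cD F v \<in> invar v else cD F v = 0"
  proof -
    have "actF d w (F (std v)) = F (std v)" if "w \<in> Wc d" "std v \<circ> w = std v" for w
      using equivariantD[of F w "std v"] F that by (simp add: Qs_def)
    then show ?thesis using F by (auto simp: cD_def invar_def Qs_def)
  qed
qed

lemma cD_cE: "m \<in> PC NN d \<Longrightarrow> cD (cE m) = m"
proof
  fix v assume m: "m \<in> PC NN d"
  show "cD (cE m) v = m v"
  proof (cases "v \<in> Lam NN d")
    case True
    then show ?thesis using cE_act[OF m std_Col[OF True] Wc_id] by (simp add: cD_def counts_std actF_id)
  next
    case False
    then show ?thesis using m by (simp add: cD_def PC_iff)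
  qed
qed

text \<open>Every colouring in \<open>Col\<close> is carried to a standard one by a signed
  permutation, so an equivariant family is determined by its values at the standard
  colourings.\<close>

lemma cE_cD: "F \<in> Qs \<Longrightarrow> cE (cD F) = F"
proof
  fix c assume F: "F \<in> Qs"
  show "cE (cD F) c = F c"
  proof (cases "c \<in> Col")
    case True
    obtain w where w: "w \<in> Wc d" "c \<circ> w = std (counts c)" using exists_std[OF True] by blast
    have "cE (cD F) c = actF d w (F (c \<circ> w))"
      using cE_act[OF cD_PC[OF F] True w] counts_Lam[OF True] w by (simp add: cD_def)
    then show ?thesis using F w equivariantD[of F w c] by (simp add: Qs_def)
  next
    case False
    then show ?thesis using F by (simp add: cE_def Qs_def)
  qed
qed

end

section \<open>Comparison with the given operators\<close>

lemma fps_to_fls_inverse_unit: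
  fixes f :: "'a::field fps"
  assumes "f $ 0 \<noteq> 0"
  shows "fps_to_fls (inverse f) = inverse (fps_to_fls f)"
proof -
  have "fps_to_fls f * fps_to_fls (inverse f) = 1"
    unfolding fls_times_fps_to_fls[symmetric] using assms by (simp add: inverse_mult_eq_1')
  then show ?thesis by (metis inverse_unique)
qed

lemma fps_to_fls_prod: "fps_to_fls (prod f A) = (\<Prod>a\<in>A. fps_to_fls (f a))" for f :: "_ \<Rightarrow> 'a::field fps"
  by (induction A rule: infinite_finite_induct) (simp_all add: fls_times_fps_to_fls)

lemma fps_to_fls_linear: "fps_to_fls (1 - fps_const a * fps_X ^ k) = 1 - fls_const a * fls_X ^ k" for a :: "'a::field"
  by (simp add: fls_times_fps_to_fls fps_to_fls_power)

lemma fps_to_fls_linfrac: "fps_to_fls (linfrac a b) = (1 - fls_const a * fls_X) / (1 - fls_const b * fls_X)"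
  using fps_to_fls_linear[of a 1] fps_to_fls_linear[of b 1]
  by (simp add: linfrac_def fls_times_fps_to_fls fps_to_fls_inverse_unit divide_inverse)

lemma one_minus_fls_X_nz: "1 - fls_const a * fls_X \<noteq> (0 :: 'a::field fls)"
proof
  assume "1 - fls_const a * fls_X = (0 :: 'a fls)"
  moreover have "fls_nth (1 - fls_const a * fls_X :: 'a fls) 0 = 1" by simp
  ultimately show False by simp
qed

context affine_rep
begin

lemma QsI:
  assumes "\<And>c. c \<notin> Col \<Longrightarrow> F c = 0" "\<And>c. F c \<in> Laur d" "\<And>w c. w \<in> Wc d \<Longrightarrow> actF d w (F (c \<circ> w)) = F c"
  shows "F \<in> Qs"
  using assms(1,2) assms(3)[symmetric] unfolding Qs_def equivariant_def by blast

lemma QsD: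
  assumes "F \<in> Qs"
  shows "c \<notin> Col \<Longrightarrow> F c = 0" "F c \<in> Laur d" "w \<in> Wc d \<Longrightarrow> actF d w (F (c \<circ> w)) = F c" "equivariant F"
  using assms equivariantD unfolding Qs_def by blast+

lemma Qs_mult:
  assumes F: "F \<in> Qs" and u: "\<And>c. u c \<in> Laur d" "\<And>w c. w \<in> Wc d \<Longrightarrow> actF d w (u (c \<circ> w)) = u c"
  shows "(\<lambda>c. u c * F c) \<in> Qs"
  by (rule QsI) (simp_all add: QsD[OF F] u actF_mult Laur_mult)

lemma cop_Qs:
  assumes "F \<in> Qs"
  shows "cop e F \<in> Qs"
proof (cases e)
  case (GB i k)
  have "Bop (int i) k F \<in> Qs"
    by (rule QsI) (simp add: Bop_def, rule Bop_Laur[OF QsD(4,2)[OF assms]], rule equivariantD[OF equivariant_Bop[OF QsD(4)[OF assms]]])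
  then show ?thesis by (simp add: cop_def GB)
next
  case (GTheta i m)
  have "1 / (qF - inverse qF) = coeffF (1 / (qv - inverse qv))" by (simp add: coeffF_quotients)
  then have "1 / (qF - inverse qF) \<in> Laur d" "w \<in> Wc d \<Longrightarrow> actF d w (1 / (qF - inverse qF)) = 1 / (qF - inverse qF)" for w
    by (simp_all only: Laur_coeffF actF_coeffF)
  moreover have "actF d w (th (int i) (c \<circ> w) $ m) = th (int i) c $ m" if "w \<in> Wc d" for w c
    using fpm_th[OF that, of "int i" c] by (metis fpm_nth)
  ultimately have "(\<lambda>c. th (int i) c $ m * (1 / (qF - inverse qF)) * F c) \<in> Qs"
    by (intro Qs_mult[OF assms] Laur_mult th_Laur) (simp_all only: actF_mult)
  then show ?thesis by (simp add: cop_def GTheta)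
next
  case (GK i)
  then show ?thesis using Qs_mult[OF assms, of "Kf (int i)"] by (simp add: cop_def Kf_Laur actF_Kf Kf_act)
next
  case (GKinv i)
  then show ?thesis using Qs_mult[OF assms, of "\<lambda>c. inverse (Kf (int i) c)"]
    by (simp add: cop_def Kf_Laur actF_Kf Kf_act actF_inverse)
next
  case GC
  then show ?thesis using Qs_mult[OF assms, of "\<lambda>c. cC"] by (simp add: cop_def Laur_qF_powi actF_powi actF_q)
next
  case GCinv
  have "inverse cC \<in> Laur d" using Laur_qF_powi[of "- N" d] by (simp only: power_int_minus)
  then show ?thesis using GCinv Qs_mult[OF assms, of "\<lambda>c. inverse cC"] by (simp add: cop_def actF_inverse actF_powi actF_q)
qed

sublocale tr: transported_rep cop n Qs "PC NN d" cE cD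
proof
  show "(\<lambda>v. F v + F' v) \<in> Qs" if "F \<in> Qs" "F' \<in> Qs" for F F'
    by (rule QsI) (simp_all add: QsD[OF that(1)] QsD[OF that(2)] Laur_add actF_add)
  show "fscale c F \<in> Qs" if "F \<in> Qs" for F c
    unfolding fscale_def by (rule Qs_mult[OF that]) (simp_all add: Laur_coeffF actF_coeffF)
  show "(\<lambda>v. 0) \<in> Qs" by (rule QsI) (simp_all add: Laur_0)
  show "cop e F \<in> Qs" if "F \<in> Qs" for F e by (rule cop_Qs[OF that])
  show "cE m \<in> Qs" if "m \<in> PC NN d" for m by (rule cE_Qs[OF that])
  show "cD F \<in> PC NN d" if "F \<in> Qs" for F by (rule cD_PC[OF that])
  show "cD (cE m) = m" if "m \<in> PC NN d" for m by (rule cD_cE[OF that])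
  show "cE (cD F) = F" if "F \<in> Qs" for F by (rule cE_cD[OF that])
  show "cD (\<lambda>v. F v + F' v) = cD F + cD F'" for F F' by (rule ext) (simp add: cD_def)
  show "cD (fscale c F) = pscale c (cD F)" for c F by (rule ext) (simp add: cD_def pscale_def fscale_def)
  show "Ev r F = (\<lambda>v. 0)" if r: "r \<in> relators n" and F: "F \<in> Qs" for r F
  proof
    fix c show "Ev r F c = 0"
      using relator_zero[OF r, of c F] Ev_off_Col[of F c r] QsD(1)[OF F] by blast
  qed
qed

lemma cD_mult:
  assumes m: "m \<in> PC NN d"
  shows "cD (\<lambda>c. u c * cE m c) = (\<lambda>v. u (std v) * m v)"
proof
  fix v
  have "cD (cE m) v = m v" by (simp add: cD_cE[OF m])
  then show "cD (\<lambda>c. u c * cE m c) v = u (std v) * m v" by (simp add: cD_def split: if_splits)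
qed

lemma PC_0: "m \<in> PC NN d \<Longrightarrow> v \<notin> Lam NN d \<Longrightarrow> m v = 0"
  unfolding PC_iff by metis

lemma prod_colour: "(\<Prod>t\<in>R. if c t = k then u else 1) = u ^ card {t \<in> R. c t = k}"
  by (subst prod.inter_filter[symmetric]) simp_all

lemma card_colour: "v \<in> Lam NN d \<Longrightarrow> 1 \<le> k \<Longrightarrow> k \<le> NN \<Longrightarrow> card {t \<in> R. std v t = int k} = v k"
  using counts_std[of v] by (metis atLeastAtMost_iff counts_def)

lemma Kf_std:
  assumes v: "v \<in> Lam NN d" and i: "i \<in> idx n"
  shows "Kf (int i) (std v) = qF powi (- int (v i) + int (v (i + 1)) + (if i = n then 1 else 0))"
proof -
  have k: "1 \<le> i" "i \<le> NN" "1 \<le> i + 1" "i + 1 \<le> NN" using i by (auto simp: idx_def NN_def)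
  have "kk (int i) (std v) = (\<Prod>t\<in>R. (if std v t = int i then qF else 1) * (if std v t = int (i + 1) then inverse qF else 1))"
    unfolding kk_def by (rule prod.cong) (auto simp: kap_def)
  also have "\<dots> = qF ^ v i * inverse qF ^ v (i + 1)"
    by (simp only: prod.distrib prod_colour card_colour[OF v k(1,2)] card_colour[OF v k(3,4)])
  also have "\<dots> = qF powi (int (v i) - int (v (i + 1)))"
    using q0 by (simp add: power_int_diff power_inverse divide_inverse)
  finally have "inverse (kk (int i) (std v)) = qF powi (- int (v i) + int (v (i + 1)))"
    by (simp add: power_int_minus[symmetric])
  then show ?thesis using q0 by (simp add: Kf_def power_int_add)
qed

text \<open>In the field of Laurent series each value of \<open>theta1\<close> is Q times a fraction
  of linear polynomials in z with constant term 1. The powers of Q cancel against the prefactor, and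
  the fractions for the blocks i and i + 1 are those of \<open>phi\<close>.\<close>

lemma Theta_series:
  assumes v: "v \<in> Lam NN d" and i: "i \<in> idx n"
  shows "Theta_hat_series n d i v = fps_to_fls (th (int i) (std v))"
proof -
  define Q where "Q = fls_const qF"
  define z :: "rfun fls" where "z = fls_X"
  define X where "X t = fls_const (xvar d t)" for t
  have k: "1 \<le> i" "i \<le> NN" "1 \<le> i + 1" "i + 1 \<le> NN" using i by (auto simp: idx_def NN_def)
  have Q0: "Q \<noteq> 0" using q0 by (simp add: Q_def)
  have z0: "z \<noteq> 0" by (simp add: z_def)
  have X0: "X t \<noteq> 0" for t by (simp add: X_def xvar_nz)
  define Y where "Y t = Q powi int i * X t" for t
  have Y: "Y t = fls_const (yv (int i) t)" for t
    by (simp only: Y_def Q_def X_def yv_def fls_const_power_int[symmetric] fls_const_mult_const)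
  have nz: "1 - Y t * z \<noteq> 0" "1 - Q ^ 2 * Y t * z \<noteq> 0" "1 - Y t / Q ^ 2 * z \<noteq> 0" for t
    using one_minus_fls_X_nz[of "yv (int i) t"] one_minus_fls_X_nz[of "qF ^ 2 * yv (int i) t"] one_minus_fls_X_nz[of "yv (int i) t / qF ^ 2"]
    unfolding Y z_def Q_def by (simp_all add: fls_const_power[symmetric] fls_const_mult_const fls_const_divide_const del: fls_const_power)
  have p: "Q powi (1 - int i) = Q * inverse (Q powi int i)" "Q powi (- 1 - int i) = inverse Q * inverse (Q powi int i)"
    using Q0 power_int_add[of Q 1 "- int i"] power_int_add[of Q "-1" "- int i"] by (simp_all add: power_int_minus)
  have th1: "theta1 Q (Q * s * inverse z / x) = Q * ((1 - inverse s * x / Q ^ 2 * z) / (1 - inverse s * x * z))"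
    if "s \<noteq> 0" "x \<noteq> 0" "1 - inverse s * x * z \<noteq> 0" for s x
  proof -
    define y where "y = inverse s * x"
    have y: "y \<noteq> 0" "Q * s * inverse z / x = Q / (y * z)" using that z0 by (simp_all add: y_def field_simps)
    have "theta1 Q (Q / (y * z)) = ((Q * Q - y * z) / (y * z)) / (Q * (1 - y * z) / (y * z))"
      unfolding theta1_def using y z0 by (intro arg_cong2[of _ _ _ _ "(/)"]) (simp_all add: field_simps)
    also have "\<dots> = (Q * Q - y * z) / (Q * (1 - y * z))" using y z0 by simp
    also have "\<dots> = Q * ((1 - y / Q ^ 2 * z) / (1 - y * z))"
      using Q0 that(3) unfolding y_def[symmetric] by (simp add: field_simps power2_eq_square)
    finally show ?thesis unfolding y(2) by (simp add: y_def)
  qed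
  have th2: "theta1 Q (inverse Q * s * inverse z / x) = Q * ((1 - inverse s * x * z) / (1 - Q ^ 2 * (inverse s * x) * z))"
    if "s \<noteq> 0" "x \<noteq> 0" "1 - Q ^ 2 * (inverse s * x) * z \<noteq> 0" for s x
  proof -
    define y where "y = inverse s * x"
    have y: "y \<noteq> 0" "inverse Q * s * inverse z / x = 1 / (Q * y * z)" using that z0 Q0 by (simp_all add: y_def field_simps)
    have "theta1 Q (1 / (Q * y * z)) = ((1 - y * z) / (y * z)) / ((1 - Q ^ 2 * y * z) / (Q * y * z))"
      unfolding theta1_def using y z0 Q0 by (intro arg_cong2[of _ _ _ _ "(/)"]) (simp_all add: field_simps power2_eq_square)
    also have "\<dots> = Q * ((1 - y * z) / (1 - Q ^ 2 * y * z))"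
    proof -
      have "(p / u) / (e / (w * u)) = w * (p / e)" if "u \<noteq> 0" "w \<noteq> 0" for p u e w :: "rfun fls"
        using that by (cases "e = 0") (simp_all add: field_simps)
      from this[of "y * z" Q] show ?thesis using y(1) z0 Q0 by (simp only: mult.assoc mult_eq_0_iff not_False_eq_True simp_thms)
    qed
    finally show ?thesis unfolding y(2) by (simp add: y_def)
  qed
  have si: "inverse (inverse (Q powi int i)) * X t = Y t" for t by (simp add: Y_def)
  have P1: "Phi Q X (blk v i) (Q powi (1 - int i) * inverse z) = Q ^ v i * (\<Prod>t\<in>blk v i. (1 - Y t / Q ^ 2 * z) / (1 - Y t * z))"
  proof -
    have "theta1 Q (Q powi (1 - int i) * inverse z / X t) = Q * ((1 - Y t / Q ^ 2 * z) / (1 - Y t * z))" for t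
      using th1[of "inverse (Q powi int i)" "X t"] Q0 X0 nz(1)[of t] unfolding p si by simp
    moreover have "card (blk v i) = v i" using card_colour[OF v k(1,2)] blk_eq[OF v k(1,2)] by simp
    ultimately show ?thesis by (simp only: Phi_def prod.distrib prod_constant)
  qed
  have P2: "Phi Q X (blk v (i + 1)) (Q powi (- 1 - int i) * inverse z) = Q ^ v (i + 1) * (\<Prod>t\<in>blk v (i + 1). (1 - Y t * z) / (1 - Q ^ 2 * Y t * z))"
  proof -
    have "theta1 Q (Q powi (- 1 - int i) * inverse z / X t) = Q * ((1 - Y t * z) / (1 - Q ^ 2 * Y t * z))" for t
      using th2[of "inverse (Q powi int i)" "X t"] Q0 X0 nz(2)[of t] unfolding p si by simp
    moreover have "card (blk v (i + 1)) = v (i + 1)" using card_colour[OF v k(3,4)] blk_eq[OF v k(3,4)] by simp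
    ultimately show ?thesis by (simp only: Phi_def prod.distrib prod_constant)
  qed
  have ph: "fps_to_fls (phi (int i) (std v t) (yv (int i) t))
     = (if std v t = int i then (1 - Y t / Q ^ 2 * z) / (1 - Y t * z) else 1)
     * (if std v t = int (i + 1) then inverse ((1 - Y t * z) / (1 - Q ^ 2 * Y t * z)) else 1)" for t
  proof -
    have "fls_const (u / qF ^ 2) = fls_const u / Q ^ 2" "fls_const (qF ^ 2 * u) = Q ^ 2 * fls_const u" for u
      by (simp_all only: Q_def fls_const_power[symmetric] fls_const_divide_const fls_const_mult_const)
    then show ?thesis unfolding phi_def by (auto simp: fps_to_fls_linfrac Y z_def)
  qed
  have pt: "fps_to_fls (pth (int i) (std v)) = (\<Prod>t\<in>blk v i. (1 - Y t / Q ^ 2 * z) / (1 - Y t * z))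
     * inverse (\<Prod>t\<in>blk v (i + 1). (1 - Y t * z) / (1 - Q ^ 2 * Y t * z))"
    unfolding pth_def fps_to_fls_prod ph prod.distrib prod_inversef[symmetric] comp_def blk_eq[OF v k(1,2)] blk_eq[OF v k(3,4)]
    by (simp only: prod.inter_filter[OF finite_R])
  have ex: "fps_to_fls (ext (int i)) = (if i = n + 1 then (1 - Q ^ (2 * n) * z ^ 2) / (1 - Q ^ (2 * n + 2) * z ^ 2) else 1)"
  proof (cases "i = n + 1")
    case True
    then have "ext (int i) = (1 - fps_const (qF ^ (2 * n)) * fps_X ^ 2) * inverse (1 - fps_const (qF ^ (2 * n + 2)) * fps_X ^ 2)"
      by (simp add: ext_def)
    moreover have "(1 - fps_const (qF ^ (2 * n + 2)) * fps_X ^ 2) $ 0 \<noteq> 0" by simp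
    ultimately have "fps_to_fls (ext (int i)) = (1 - fls_const (qF ^ (2 * n)) * fls_X ^ 2) * inverse (1 - fls_const (qF ^ (2 * n + 2)) * fls_X ^ 2)"
      by (simp only: fls_times_fps_to_fls fps_to_fls_inverse_unit fps_to_fls_linear not_False_eq_True)
    then show ?thesis using True unfolding Q_def z_def divide_inverse by (simp only: fls_const_power if_True simp_thms)
  next
    case False
    then show ?thesis by (simp add: ext_def)
  qed
  have sc: "Q powi (int (v (i + 1)) - int (v i)) * (Q ^ v i * A) * inverse (Q ^ v (i + 1) * B) = A * inverse B" for A B
    using Q0 by (simp add: power_int_diff field_simps)
  show ?thesis
    unfolding Theta_hat_series_def Let_def th_def fls_times_fps_to_fls
    unfolding Q_def[symmetric] z_def[symmetric] X_def[symmetric, abs_def] P1 P2 sc pt ex by (rule refl)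
qed

text \<open>Both sides are sums over the block i: \<open>Phi\<close> at q x_j is the weight of j,
  and \<open>at_part\<close> is the value of \<open>cE m\<close> at the moved colouring. The guard
  of \<open>B_hat\<close> can fail only when this block is empty, and then the sum is 0 as
  well.\<close>

lemma B_hat_std:
  assumes m: "m \<in> PC NN d" and i: "i \<in> idx n"
  shows "cD (Bop (int i) r (cE m)) = B_hat_coeff n d i r m"
proof
  fix v
  show "cD (Bop (int i) r (cE m)) v = B_hat_coeff n d i r m v"
  proof (cases "v \<in> Lam NN d")
    case False
    then show ?thesis by (simp add: cD_def B_hat_coeff_def pscale_def B_hat_def Let_def NN_def)
  next
    case v: True
    define c where "c = std v"
    have c: "c \<in> Col" "symc c" "counts c = v" using std_Col[OF v] symc_Col counts_std[OF v] by (auto simp: c_def)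
    have k: "1 \<le> i" "i \<le> NN" "1 \<le> i + 1" "i + 1 \<le> NN" "ok (int i)" using i by (auto simp: idx_def NN_def)
    have b: "blk v i = {a \<in> R. c a = int i}" using blk_eq[OF v k(1,2)] by (simp add: c_def)
    let ?v' = "\<lambda>k. nat (shift n i v k)"
    have tau: "int (tau n i) = N - int i" by (rule int_tau[OF i])
    \<comment> \<open>The four corrections are kept as separate indicators, because for i = n and
      for i = n + 1 two of them fall on the middle colour and add up.\<close>
    have cnt: "shift n i v l = int (counts (mv c a) l)" if a: "a \<in> R" "c a = int i" for a l
    proof -
      have cb: "c (br a) = N + 1 - int i" using symcD[OF c(2) a(1)] a(2) by simp
      have cd: "int (card {r \<in> R. mv c a r = K}) = int (card {r \<in> R. c r = K}) - of_bool (K = int i) - of_bool (K = N + 1 - int i)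
          + of_bool (K = int i + 1) + of_bool (K = N - int i)" for K
      proof -
        have "int (card {r \<in> R. mv c a r = K}) = (\<Sum>r\<in>R. of_bool (mv c a r = K))"
          by (simp add: of_bool_def sum.If_cases Int_def)
        also have "\<dots> = (\<Sum>r\<in>R. of_bool (c r = K) + (if r = a then of_bool (K = int i + 1) - of_bool (K = int i) else 0)
            + (if r = br a then of_bool (K = N - int i) - of_bool (K = N + 1 - int i) else 0))"
          using a cb br_neq[OF a(1)] by (intro sum.cong refl) (auto simp: mv_def)
        also have "\<dots> = int (card {r \<in> R. c r = K}) - of_bool (K = int i) - of_bool (K = N + 1 - int i)
          + of_bool (K = int i + 1) + of_bool (K = N - int i)"
          using a br_mem[OF a(1)] by (simp add: sum.distrib of_bool_def sum.If_cases Int_def)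
        finally show ?thesis .
      qed
      have e: "(l = i) = (int l = int i)" "(l = i + 1) = (int l = int i + 1)" "(l = tau n i) = (int l = N - int i)"
        "(l = tau n i + 1) = (int l = N + 1 - int i)" using tau by auto
      show ?thesis
      proof (cases "l \<in> {1..NN}")
        case True
        have "int (v l) = int (card {r \<in> R. c r = int l})" using True unfolding c(3)[symmetric] counts_def by (simp only: if_True)
        then show ?thesis using True unfolding shift_def e counts_def by (simp only: if_True cd)
      next
        case False
        have "v l = 0" using v False unfolding Lam_def by blast
        moreover have "l \<noteq> i" "l \<noteq> i + 1" "l \<noteq> tau n i" "l \<noteq> tau n i + 1"
          using False k i tau unfolding NN_def idx_def by auto
        ultimately show ?thesis using False unfolding shift_def counts_def by (simp only: if_False)
      qed
    qed
    have B: "B_hat n d i r m v = (\<Sum>j \<in> blk v i. xvar d j powi r * Phi qF (xvar d) (blk v i - {j}) (qF * xvar d j)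
             * at_part NN d (tau_plus NN d i j (blk v)) (m ?v'))"
    proof (cases "blk v i = {}")
      case True
      then show ?thesis by (simp add: B_hat_def Let_def)
    next
      case False
      then obtain a where a: "a \<in> R" "c a = int i" using b by blast
      have "\<forall>l. 0 \<le> shift n i v l" using cnt[OF a] by simp
      moreover have "?v' = counts (mv c a)" using cnt[OF a] by auto
      moreover have "mv c a \<in> Col" using mv_Col[OF c(1) a] k(5) by simp
      ultimately have "v \<in> Lam NN d \<and> (\<forall>k. 0 \<le> shift n i v k) \<and> ?v' \<in> Lam NN d" using v counts_Lam by simp
      from this[unfolded NN_def] show ?thesis unfolding B_hat_def Let_def NN_def by (rule if_P)
    qed
    have summand: "qF powi (r * int i) * (xvar d j powi r * Phi qF (xvar d) (blk v i - {j}) (qF * xvar d j)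
             * at_part NN d (tau_plus NN d i j (blk v)) (m ?v')) = yv (int i) j powi r * wt (int i) j c * cE m (mv c j)"
      if "j \<in> blk v i" for j
    proof -
      have j: "j \<in> R" "c j = int i" using that b by auto
      have C: "mv c j \<in> Col" using mv_Col[OF c(1) j] k(5) by simp
      have v': "?v' = counts (mv c j)" using cnt[OF j] by auto
      have P: "Phi qF (xvar d) (blk v i - {j}) (qF * xvar d j) = wt (int i) j c"
      proof -
        have "theta1 qF (qF * xvar d j / xvar d t) = g j t" if t: "t \<in> R" "t \<noteq> j" for t
        proof -
          define X where "X = xvar d j"
          define T where "T = xvar d t"
          have nz: "T \<noteq> 0" "X - T \<noteq> 0" using xneq[OF j(1) t(1)] t(2) by (auto simp: T_def X_def xvar_nz)
          have e: "qF * (qF * X / T) - 1 = qF * (qF * X - inverse qF * T) / T" "qF * X / T - qF = qF * (X - T) / T"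
            using nz q0 by (simp_all add: field_simps)
          show ?thesis unfolding theta1_def g_def X_def[symmetric] T_def[symmetric] e using nz q0 by simp
        qed
        then have "Phi qF (xvar d) (blk v i - {j}) (qF * xvar d j) = (\<Prod>t\<in>blk v i - {j}. g j t)"
          unfolding Phi_def b by (intro prod.cong) auto
        also have "\<dots> = (\<Prod>t\<in>{t \<in> R. t \<noteq> j \<and> c t = int i}. g j t)" by (rule prod.cong) (auto simp: b)
        finally show ?thesis using wt_alt[OF c(2) j(1), of "int i"] j(2) by simp
      qed
      obtain w where w: "w \<in> Wc d" "mv c j \<circ> w = std (counts (mv c j))" using exists_std[OF C] by blast
      have cb: "c (br j) = N + 1 - int i" using symcD[OF c(2) j(1)] j(2) by simp
      have I: "tau_plus NN d i j (blk v) l = {r \<in> R. mv c j r = int l}" if l: "l \<in> {1..NN}" for l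
      proof -
        have bl: "blk v l = {r \<in> R. c r = int l}" using blk_eq[OF v, of l] l by (simp add: c_def)
        have e: "(l = i) = (int l = int i)" "(l = i + 1) = (int l = int i + 1)" "(l = NN - i) = (int l = N - int i)"
          "(l = NN + 1 - i) = (int l = N + 1 - int i)" using k by (auto simp: NN_def)
        have r: "r \<in> tau_plus NN d i j (blk v) l \<longleftrightarrow> r \<in> R \<and> mv c j r = int l" for r
          unfolding tau_plus_def bl e using j cb br_neq[OF j(1)] br_mem[OF j(1)]
          by (cases "r = j"; cases "r = br j") (auto simp: mv_def)
        show ?thesis using r by blast
      qed
      have "at_part NN d (tau_plus NN d i j (blk v)) (m ?v') = actF d w (m ?v')"
        unfolding v' by (rule at_part_act[OF counts_Lam[OF C] C refl w PC_invar[OF m counts_Lam[OF C]] I])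
      also have "\<dots> = cE m (mv c j)" unfolding v' using cE_act[OF m C w] by simp
      finally have A: "at_part NN d (tau_plus NN d i j (blk v)) (m ?v') = cE m (mv c j)" .
      have "yv (int i) j powi r = qF powi (r * int i) * xvar d j powi r"
        unfolding yv_def power_int_mult_distrib power_int_mult[symmetric] mult.commute[of r] by (rule refl)
      then show ?thesis unfolding P A by (simp only: mult_ac)
    qed
    have "cD (Bop (int i) r (cE m)) v = (\<Sum>j\<in>R. yv (int i) j powi r * wt (int i) j c * cE m (mv c j))"
      using v c(1) by (simp add: cD_def Bop_def c_def)
    also have "\<dots> = (\<Sum>j\<in>blk v i. yv (int i) j powi r * wt (int i) j c * cE m (mv c j))"
      unfolding b by (rule sum.mono_neutral_right) (auto simp: wt_def)
    also have "\<dots> = qF powi (r * int i) * B_hat n d i r m v"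
      unfolding B sum_distrib_left by (rule sum.cong[OF refl]) (rule summand[symmetric])
    finally show ?thesis by (simp add: B_hat_coeff_def pscale_def coeffF_power_int)
  qed
qed

end

theorem theorem4p3:
  fixes n d N :: nat
  assumes "n \<ge> 1" and "d \<ge> 1" and "N = 2 * n + 1"
  shows "\<exists>\<rho>. is_representation n pscale (PC N d) \<rho>
     \<and> \<rho> (Ui_class n (gn GC)) = (\<lambda>m \<in> PC N d. pscale (qv ^ N) m)
     \<and> (\<forall>i \<in> {1..2 * n}.
          \<rho> (Ui_class n (gn (GK i))) = (\<lambda>m \<in> PC N d. K_hat n i m)
        \<and> (\<forall>k. \<rho> (Ui_class n (Theta_coeff i k)) = (\<lambda>m \<in> PC N d. Theta_hat_coeff n d i k m))
        \<and> (\<forall>k. \<rho> (Ui_class n (gn (GB i k))) = (\<lambda>m \<in> PC N d. B_hat_coeff n d i k m)))"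
proof -
  interpret affine_rep n d by unfold_locales (rule assms(1))
  have N: "N = NN" by (simp add: NN_def assms(3))
  have rho: "tr.rho (Ui_class n a) = (\<lambda>m\<in>PC NN d. cD (Ev a (cE m)))" for a
    unfolding tr.rho_class tr.rho0_def ..
  show ?thesis unfolding N
  proof (intro exI[of _ tr.rho] conjI ballI allI)
    show "is_representation n pscale (PC NN d) tr.rho" by (rule tr.rep)
    show "tr.rho (Ui_class n (gn GC)) = (\<lambda>m\<in>PC NN d. pscale (qv ^ NN) m)"
      unfolding rho Ev_simps
    proof (rule restrict_ext)
      fix m assume m: "m \<in> PC NN d"
      have "cC = coeffF (qv ^ NN)" unfolding coeffF_power int_NN[symmetric] by simp
      then show "cD (\<lambda>c. cC * cE m c) = pscale (qv ^ NN) m" unfolding cD_mult[OF m] pscale_def by simp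
    qed
    fix i assume "i \<in> {1..2 * n}"
    then have i: "i \<in> idx n" by (simp add: idx_def)
    show "tr.rho (Ui_class n (gn (GK i))) = (\<lambda>m\<in>PC NN d. K_hat n i m)"
      unfolding rho Ev_simps
    proof (rule restrict_ext, rule ext)
      fix m v assume m: "m \<in> PC NN d"
      show "cD (\<lambda>c. Kf (int i) c * cE m c) v = K_hat n i m v"
        unfolding cD_mult[OF m] K_hat_def using Kf_std[OF _ i] PC_0[OF m] by (cases "v \<in> Lam NN d") simp_all
    qed
    fix k
    show "tr.rho (Ui_class n (Theta_coeff i k)) = (\<lambda>m\<in>PC NN d. Theta_hat_coeff n d i k m)"
      unfolding rho Ev_simps
    proof (rule restrict_ext, rule ext)
      fix m v assume m: "m \<in> PC NN d"
      show "cD (\<lambda>c. zcoeff (th (int i) c) k * cE m c) v = Theta_hat_coeff n d i k m v"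
        unfolding cD_mult[OF m] Theta_hat_coeff_def using Theta_series[OF _ i] PC_0[OF m]
        by (cases "v \<in> Lam NN d") (simp_all add: zcoeff_def)
    qed
    show "tr.rho (Ui_class n (gn (GB i k))) = (\<lambda>m\<in>PC NN d. B_hat_coeff n d i k m)"
      unfolding rho Ev_simps by (rule restrict_ext) (rule B_hat_std[OF _ i])
  qed
qed

end
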